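(* Let $r\in(1,R]$. Almost surely, simultaneously for every $\alpha\in[0,1]$, the set $\Lambda_r(\alpha)$ is nonempty if and only if $\alpha\in I(r)$, and in this case $$\dim_{\mathrm H}\Lambda_r(\alpha)=\frac{\ln r-L^*(\alpha)}{\alpha}.$$ Furthermore, almost surely, $$\dim_{\mathrm H}\Lambda_r=\max_{\alpha\in I(r)}\frac{\ln r-L^*(\alpha)}{\alpha}=\max_{\alpha\in I(r)}\dim_{\mathrm H}\Lambda_r(\alpha).$$
   Context: Let $d\ge 2$ and let $\mathbb F$ be the free group of rank $d$ with identity $e$ and symmetric generating set $\mathcal A=\{a_1,\dots,a_d,a_1^{-1},\dots,a_d^{-1}\}$; $|x|$ is the word length of $x\in\mathbb F$. The boundary $\partial\mathbb F$ is the set of rays $\omega=(\omega_0=e,\omega_1,\omega_2,\dots)$ in the Cayley tree of $(\mathbb F,\mathcal A)$ (so $|\omega_m|=m$ and $\omega_m$ is a prefix of $\omega_{m+1}$), with metric $\mathrm d(\omega,\omega')=e^{-|\omega\wedge\omega'|}$ for $\omega\ne\omega'$, where $\omega\wedge\omega'$ is the longest common prefix. $\dim_{\mathrm H}$ is Hausdorff dimension for this metric. Let $\mu$ be a probability measure on $\mathcal A\cup\{e\}$ with $\mu(a)=\mu(a^{-1})>0$ for all $a\in\mathcal A$. Let $(Z_n)_{n\ge0}$ be the $\mu$-random walk on $\mathbb F$ ($Z_0=e$, i.i.d. right multiplications with law $\mu$), and let $R^{-1}=\limsup_n\mathbf P(Z_n=e)^{1/n}<1$ be its spectral radius. $L^*:\mathbb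 R\to[0,\infty]$ is the (lower semicontinuous) large-deviation rate function of $|Z_n|/n$: for every Borel $B\subset\mathbb R$, $-\inf_{B^\circ}L^*\le\liminf_n\frac1n\ln\mathbf P(|Z_n|/n\in B)\le\limsup_n\frac1n\ln\mathbf P(|Z_n|/n\in B)\le-\inf_{\overline B}L^*$. It is known that $L^*$ is convex, finite precisely on $[0,1]$, $L^*(0)=\ln R$, and $(L^* )'(0)$ (the right derivative) is finite. For $r>1$ set $I(r)=\{q\in[0,1]:L^*(q)\le\ln r\}$. If $0\in I(r)$ with $r\le R$ (which forces $r=R$), the expression $\frac{\ln r-L^*(\alpha)}{\alpha}$ at $\alpha=0$ is interpreted as $\lim_{q\downarrow0}\frac{L^*(0)-L^*(q)}{q}=-(L^* )'(0)$. Branching random walk: $\mathcal T$ is a Galton–Watson tree with root $\emptyset$ and offspring distribution $(p_k)_{k\ge0}$ with $p_0=0$, $\sum_k e^{sk}p_k<\infty$ for some $s>0$, and mean $r=\sum_k kp_k$. Given $\mathcal T$, let $(Y_u)_{u\in\mathcal T\setminus\{\emptyset\}}$ be i.i.d. with law $\mu$; put $V(\emptyset)=e$ and $V(u)=Y_{u_1}\cdots Y_{u_n}$ where $(\emptyset,u_1,\dots,u_n=u)$ is the geodesic from $\emptyset$ to $u$. $\partial\mathcal T$ is the set of rays $t=(t_n)_{n\ge0}$ in $\mathcal T$ from the root. For $t\in\partial\mathcal T$ and $\omega\in\partial\mathbb F$, $V(t)=\omega$ means $V(t_n)\to\omega$, i.e. for every $m$, $\omega_m$ is a prefix of $V(t_n)$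 for all large $n$. (For $1<r\le R$, almost surely $V(t)$ exists for all $t\in\partial\mathcal T$ and $t\mapsto V(t)$ is injective.) Define the limit set $\Lambda_r=\{V(t):t\in\partial\mathcal T\}$ and $$\Lambda_r(\alpha)=\Bigl\{\omega\in\partial\mathbb F:\exists\,t\in\partial\mathcal T,\ V(t)=\omega,\ \lim_{n\to\infty}\tfrac{|V(t_n)|}{n}=\alpha\Bigr\}.$$ *)

theory Defs
  imports "HOL-Probability.Probability" "HOL-Algebra.Group" "HOL-Library.Sublist"
begin

subsection \<open>The free group and its boundary\<close>

text \<open>
  The free group on the type \<open>'g\<close> is the group of reduced words; the letter \<open>(g, True)\<close> is the
  generator \<open>g\<close> and \<open>(g, False)\<close> its inverse. Word length is list length.
\<close>

type_synonym 'g letter = "'g \<times> bool"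
type_synonym 'g word = "'g letter list"

definition letter_inv :: "'g letter \<Rightarrow> 'g letter" where
  "letter_inv a = (fst a, \<not> snd a)"

definition reduced :: "'g word \<Rightarrow> bool" where
  "reduced w \<longleftrightarrow> successively (\<lambda>a b. b \<noteq> letter_inv a) w"

fun push_letter :: "'g letter \<Rightarrow> 'g word \<Rightarrow> 'g word" where
  "push_letter a [] = [a]"
| "push_letter a (b # w) = (if b = letter_inv a then w else a # b # w)"

definition free_group :: "'g word monoid" where
  "free_group = \<lparr>carrier = {w. reduced w}, monoid.mult = foldr push_letter, one = []\<rparr>"

definition sym_gens :: "'g word set" where
  "sym_gens = range (\<lambda>a. [a])"

lemma letter_inv_inv [simp]: "letter_inv (letter_inv a) = a"
  by (simp add: letter_inv_def)

lemma letter_inv_neq [simp]: "letter_inv a \<noteq> a" "a \<noteq> letter_inv a"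
  by (auto simp: letter_inv_def prod_eq_iff)

lemma reduced_Nil: "reduced []"
  by (simp add: reduced_def)

lemma reduced_push: "reduced w \<Longrightarrow> reduced (push_letter a w)"
  by (cases w) (auto simp: reduced_def successively_Cons)

lemma reduced_foldr_push: "reduced w \<Longrightarrow> reduced (foldr push_letter u w)"
  by (induction u) (auto intro: reduced_push)

lemma push_push_inv: "reduced w \<Longrightarrow> push_letter a (push_letter (letter_inv a) w) = w"
  by (cases w; cases "tl w") (auto simp: reduced_def successively_Cons)

lemma foldr_push_push:
  assumes "reduced w"
  shows "foldr push_letter (push_letter a x) w = push_letter a (foldr push_letter x w)"
  by (cases x) (auto simp: push_push_inv reduced_foldr_push assms)

lemma foldr_push_assoc:
  "reduced w \<Longrightarrow>
     foldr push_letter (foldr push_letter u v) w = foldr push_letter u (foldr push_letter v w)"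
  by (induction u) (auto simp: foldr_push_push)

lemma foldr_push_Nil: "reduced w \<Longrightarrow> foldr push_letter w [] = w"
proof (induction w)
  case (Cons a w)
  then show ?case by (cases w) (auto simp: reduced_def successively_Cons)
qed simp

lemma foldr_push_left_inv:
  "reduced w \<Longrightarrow> foldr push_letter (foldr push_letter (rev (map letter_inv w)) []) w = []"
proof -
  have "foldr push_letter (rev (map letter_inv w)) w = []"
  proof (induction w)
    case (Cons a w)
    have "push_letter (letter_inv a) (a # w) = w" by simp
    then show ?case using Cons by simp
  qed simp
  then show "reduced w \<Longrightarrow> ?thesis" by (simp add: foldr_push_assoc)
qed

lemma group_free_group: "group free_group"
proof (rule groupI)
  fix x :: "'a word"
  assume "x \<in> carrier free_group"
  then show "\<exists>y\<in>carrier free_group. y \<otimes>\<^bsub>free_group\<^esub> x = \<one>\<^bsub>free_group\<^esub>"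
    by (intro bexI[of _ "foldr push_letter (rev (map letter_inv x)) []"])
       (auto simp: free_group_def foldr_push_left_inv reduced_Nil intro: reduced_foldr_push)
qed (auto simp: free_group_def foldr_push_assoc reduced_Nil intro: reduced_foldr_push)

definition boundary :: "(nat \<Rightarrow> 'g word) set" where
  "boundary = {w. w 0 = \<one>\<^bsub>free_group\<^esub> \<and>
     (\<forall>m. w m \<in> carrier free_group \<and> length (w m) = m \<and> prefix (w m) (w (Suc m)))}"

text \<open>
  For two distinct rays the longest common prefix is \<open>w m = w' m\<close> for the greatest such \<open>m\<close>, and
  its length is \<open>m\<close>.
\<close>

definition boundary_dist :: "(nat \<Rightarrow> 'g word) \<Rightarrow> (nat \<Rightarrow> 'g word) \<Rightarrow> real" where
  "boundary_dist w w' = (if w = w' then 0 else exp (- real (GREATEST m. w m = w' m)))"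

definition boundary_metric :: "(nat \<Rightarrow> 'g word) metric" where
  "boundary_metric = metric (boundary, boundary_dist)"

lemma boundary_take:
  assumes "w \<in> boundary" "k \<le> m"
  shows "w k = take k (w m)"
  using assms(2)
proof (induction rule: dec_induct)
  case base
  then show ?case using assms(1) by (auto simp: boundary_def)
next
  case (step m)
  have "prefix (w m) (w (Suc m))" "length (w m) = m"
    using assms(1) by (auto simp: boundary_def)
  then have "w m = take m (w (Suc m))" by (metis append_eq_conv_conj prefix_def)
  with step show ?case by (simp add: min_def)
qed

lemma boundary_agree_le:
  assumes "w \<in> boundary" "w' \<in> boundary" "w \<noteq> w'"
  shows "w m = w' m \<longleftrightarrow> m \<le> (GREATEST m. w m = w' m)"
proof -
  obtain j where j: "w j \<noteq> w' j" using assms(3) by auto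
  have mono: "w k = w' k" if "w m = w' m" "k \<le> m" for k m
    using that assms by (metis boundary_take)
  have bd: "\<And>m. w m = w' m \<Longrightarrow> m \<le> j" using mono j by (meson linear)
  have "w 0 = w' 0" using assms by (auto simp: boundary_def)
  then have "w (GREATEST m. w m = w' m) = w' (GREATEST m. w m = w' m)"
    using bd by (rule GreatestI_nat)
  then show ?thesis using mono bd by (meson Greatest_le_nat)
qed

lemma Metric_space_boundary: "Metric_space boundary boundary_dist"
proof
  fix x y z :: "nat \<Rightarrow> 'a word"
  show "0 \<le> boundary_dist x y" by (simp add: boundary_dist_def)
  show "boundary_dist x y = boundary_dist y x" by (simp add: boundary_dist_def eq_commute)
  show "boundary_dist x y = 0 \<longleftrightarrow> x = y" by (simp add: boundary_dist_def)
  assume b: "x \<in> boundary" "y \<in> boundary" "z \<in> boundary"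
  show "boundary_dist x z \<le> boundary_dist x y + boundary_dist y z"
  proof (cases "x = y \<or> y = z \<or> x = z")
    case True
    then show ?thesis by (auto simp: boundary_dist_def)
  next
    case False
    define p where "p = (GREATEST m. x m = y m)"
    define q where "q = (GREATEST m. y m = z m)"
    define r where "r = (GREATEST m. x m = z m)"
    have "x (min p q) = z (min p q)"
      using False boundary_agree_le[of x y "min p q"] boundary_agree_le[of y z "min p q"] b
      unfolding p_def q_def by auto
    then have "min p q \<le> r"
      using False boundary_agree_le[of x z "min p q"] b unfolding r_def by auto
    then have "exp (- real r) \<le> exp (- real p) \<or> exp (- real r) \<le> exp (- real q)"
      by auto
    then have "exp (- real r) \<le> exp (- real p) + exp (- real q)"
      by (auto intro: add_increasing add_increasing2)
    then show ?thesis using False by (simp add: boundary_dist_def p_def q_def r_def)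
  qed
qed

lemma mspace_boundary_metric [simp]: "mspace boundary_metric = boundary"
  and mdist_boundary_metric [simp]: "mdist boundary_metric = boundary_dist"
  by (simp_all add: boundary_metric_def Metric_space.mspace_metric Metric_space.mdist_metric
        Metric_space_boundary)

definition tends_to_ray :: "(nat \<Rightarrow> 'g word) \<Rightarrow> (nat \<Rightarrow> 'g word) \<Rightarrow> bool" where
  "tends_to_ray x w \<longleftrightarrow> (\<forall>m. \<forall>\<^sub>F n in sequentially. prefix (w m) (x n))"


subsection \<open>Hausdorff dimension\<close>

definition mdiameter :: "'a metric \<Rightarrow> 'a set \<Rightarrow> ennreal" where
  "mdiameter m U = (SUP (x, y)\<in>U \<times> U. ennreal (mdist m x y))"

text \<open>
  The cases fix the conventions that the empty set contributes \<open>0\<close> for every \<open>s\<close> and that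
  \<open>0\<close> to the power \<open>0\<close> is \<open>1\<close> (the library has \<open>0 powr 0 = 0\<close>).
\<close>

definition diameter_pow :: "'a metric \<Rightarrow> real \<Rightarrow> 'a set \<Rightarrow> ennreal" where
  "diameter_pow m s U =
     (if U = {} then 0 else if s = 0 then 1 else ennreal (enn2real (mdiameter m U) powr s))"

definition hausdorff_content :: "'a metric \<Rightarrow> real \<Rightarrow> real \<Rightarrow> 'a set \<Rightarrow> ennreal" where
  "hausdorff_content m s \<delta> A =
     (INF U\<in>{U :: nat \<Rightarrow> 'a set. A \<subseteq> (\<Union>i. U i) \<and>
                (\<forall>i. U i \<subseteq> mspace m \<and> mdiameter m (U i) \<le> ennreal \<delta>)}.
        \<Sum>i. diameter_pow m s (U i))"

definition hausdorff_measure :: "'a metric \<Rightarrow> real \<Rightarrow> 'a set \<Rightarrow> ennreal" where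
  "hausdorff_measure m s A = (SUP \<delta>\<in>{0<..}. hausdorff_content m s \<delta> A)"

definition hausdorff_dim :: "'a metric \<Rightarrow> 'a set \<Rightarrow> ereal" where
  "hausdorff_dim m A = Inf {ereal s | s. 0 \<le> s \<and> hausdorff_measure m s A = 0}"


subsection \<open>The random walk, its spectral radius and its rate function\<close>

definition step_law :: "'g word pmf \<Rightarrow> bool" where
  "step_law \<mu> \<longleftrightarrow> set_pmf \<mu> \<subseteq> insert \<one>\<^bsub>free_group\<^esub> sym_gens \<and>
     (\<forall>a\<in>sym_gens. pmf \<mu> a = pmf \<mu> (inv\<^bsub>free_group\<^esub> a) \<and> 0 < pmf \<mu> a)"

definition random_walk :: "'w measure \<Rightarrow> 'g word pmf \<Rightarrow> (nat \<Rightarrow> 'w \<Rightarrow> 'g word) \<Rightarrow> bool" where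
  "random_walk P \<mu> Z \<longleftrightarrow> prob_space P \<and>
     (\<exists>X. prob_space.indep_vars P (\<lambda>_. count_space UNIV) X (UNIV :: nat set) \<and>
          (\<forall>n. distr P (count_space UNIV) (X n) = measure_pmf \<mu>) \<and>
          (\<forall>x\<in>space P. Z 0 x = \<one>\<^bsub>free_group\<^esub> \<and>
             (\<forall>n. Z (Suc n) x = Z n x \<otimes>\<^bsub>free_group\<^esub> X n x)))"

definition spectral_radius :: "'w measure \<Rightarrow> (nat \<Rightarrow> 'w \<Rightarrow> 'g word) \<Rightarrow> ereal" where
  "spectral_radius P Z =
     limsup (\<lambda>n. ereal (root n (measure P {x \<in> space P. Z n x = \<one>\<^bsub>free_group\<^esub>})))"

definition ln_prob :: "real \<Rightarrow> ereal" where
  "ln_prob p = (if p = 0 then -\<infinity> else ereal (ln p))"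

text \<open>The conditions below determine \<open>L\<close> uniquely.\<close>

definition ldp_rate_function ::
    "'w measure \<Rightarrow> (nat \<Rightarrow> 'w \<Rightarrow> 'g word) \<Rightarrow> (real \<Rightarrow> ereal) \<Rightarrow> bool" where
  "ldp_rate_function P Z L \<longleftrightarrow>
     (\<forall>q. 0 \<le> L q) \<and> (\<forall>c. closed {q. L q \<le> c}) \<and>
     (\<forall>B\<in>sets borel.
        let a = (\<lambda>n. ereal (1 / real n) *
                  ln_prob (measure P {x \<in> space P. real (length (Z n x)) / real n \<in> B}))
        in - (INF q\<in>interior B. L q) \<le> liminf a \<and> limsup a \<le> - (INF q\<in>closure B. L q))"

definition rate_sublevel :: "(real \<Rightarrow> ereal) \<Rightarrow> real \<Rightarrow> real set" where
  "rate_sublevel L r = {q \<in> {0..1}. L q \<le> ereal (ln r)}"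

text \<open>
  The value at \<open>\<alpha> = 0\<close> is minus the right derivative of \<open>L\<close> at \<open>0\<close>; it is only used when
  \<open>L 0 = ln r\<close>.
\<close>

definition spectrum_value :: "(real \<Rightarrow> ereal) \<Rightarrow> real \<Rightarrow> real \<Rightarrow> ereal" where
  "spectrum_value L r \<alpha> =
     (if \<alpha> = 0 then Lim (at_right 0) (\<lambda>q. (L 0 - L q) / ereal q)
      else (ereal (ln r) - L \<alpha>) / ereal \<alpha>)"


subsection \<open>The branching random walk\<close>

text \<open>
  Ulam--Harris labelling: \<open>K u\<close> is the number of children of \<open>u\<close>, which are the nodes \<open>u @ [i]\<close>
  with \<open>i < K u\<close>, and \<open>Y u\<close> is the displacement from the parent of \<open>u\<close> to \<open>u\<close>. Both families
  are indexed by all potential nodes; values outside the tree, and \<open>Y []\<close>, are never used.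
\<close>

definition branching_random_walk ::
    "'x measure \<Rightarrow> nat pmf \<Rightarrow> 'g word pmf \<Rightarrow> (nat list \<Rightarrow> 'x \<Rightarrow> nat) \<Rightarrow> (nat list \<Rightarrow> 'x \<Rightarrow> 'g word) \<Rightarrow> bool"
  where
  "branching_random_walk M p \<mu> K Y \<longleftrightarrow> prob_space M \<and>
     prob_space.indep_vars M (\<lambda>_. count_space UNIV) (\<lambda>u x. (K u x, Y u x)) UNIV \<and>
     (\<forall>u. distr M (count_space UNIV) (\<lambda>x. (K u x, Y u x)) = measure_pmf (pair_pmf p \<mu>))"

definition gw_tree :: "(nat list \<Rightarrow> nat) \<Rightarrow> nat list set" where
  "gw_tree k = {u. \<forall>i<length u. u ! i < k (take i u)}"

definition tree_rays :: "(nat list \<Rightarrow> nat) \<Rightarrow> (nat \<Rightarrow> nat list) set" where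
  "tree_rays k = {t. t 0 = [] \<and> (\<forall>n. t n \<in> gw_tree k \<and> (\<exists>i. t (Suc n) = t n @ [i]))}"

definition position :: "(nat list \<Rightarrow> 'g word) \<Rightarrow> nat list \<Rightarrow> 'g word" where
  "position y u =
     foldl (\<otimes>\<^bsub>free_group\<^esub>) \<one>\<^bsub>free_group\<^esub> (map (\<lambda>i. y (take i u)) [1..<Suc (length u)])"

definition limit_set :: "(nat list \<Rightarrow> nat) \<Rightarrow> (nat list \<Rightarrow> 'g word) \<Rightarrow> (nat \<Rightarrow> 'g word) set" where
  "limit_set k y =
     {w \<in> boundary. \<exists>t\<in>tree_rays k. tends_to_ray (\<lambda>n. position y (t n)) w}"

definition limit_set_speed ::
    "(nat list \<Rightarrow> nat) \<Rightarrow> (nat list \<Rightarrow> 'g word) \<Rightarrow> real \<Rightarrow> (nat \<Rightarrow> 'g word) set" where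
  "limit_set_speed k y \<alpha> =
     {w \<in> boundary. \<exists>t\<in>tree_rays k. tends_to_ray (\<lambda>n. position y (t n)) w \<and>
        (\<lambda>n. real (length (position y (t n))) / real n) \<longlonglongrightarrow> \<alpha>}"

definition is_maximum :: "'b::order \<Rightarrow> ('a \<Rightarrow> 'b) \<Rightarrow> 'a set \<Rightarrow> bool" where
  "is_maximum m f A \<longleftrightarrow> m \<in> f ` A \<and> (\<forall>a\<in>A. f a \<le> m)"

end

theory Submission
  imports Defs "HOL-Real_Asymp.Real_Asymp"
begin

text \<open>
  Everything rests on two facts. Joining two reduced words by a letter that does not cancel makes
  the length distribution of the random walk supermultiplicative, so that the large deviation
  principle yields \<open>P(|Z\<^sub>n| = m) \<lesssim> exp (- n L(m / n))\<close> without an error term in the exponent, as well as the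
  convexity of \<open>L\<close>. And a generation \<open>n\<close> of the branching random walk visits a word \<open>x\<close> with
  probability at most \<open>r\<^sup>n P(Z\<^sub>n = x)\<close>, and, by the second moment method and \<open>r \<le> R\<close>, at least this
  quantity up to a factor that is linear in \<open>n\<close>.

  Upper bound: a ray of speed \<open>\<alpha>\<close> visits every prefix of its limit, at times \<open>n\<close> close to \<open>m / \<alpha>\<close>
  for the prefix of length \<open>m\<close>, so the expected number of visited words bounds the number of
  cylinders in a cover. For the whole limit set there is no restriction on \<open>n\<close>; here the expected
  number of words of length \<open>m\<close> that are ever visited is supermultiplicative in \<open>m\<close>, which
  removes the factor from the number of generations.

  Lower bound: words that start and end with the same letter are multiplied without cancellation.
  A block of generations in which the walk makes such a word of length \<open>M\<close> has, in the mean, more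
  than \<open>exp (s M)\<close> distinct endpoints whenever \<open>s\<close> is below the claimed dimension. Iterating blocks,
  the tree contains with positive probability an \<open>N\<close>-ary tree of blocks with \<open>N \<ge> exp (s M)\<close>.
  Splicing finite pieces of such trees, with block speeds that converge to \<open>\<alpha>\<close>, gives a homogeneous
  Cantor set inside the limit set, to which the mass distribution principle applies.
\<close>

subsection \<open>Reduced words\<close>

text \<open>The exceptional null set must not depend on \<alpha>. Every almost sure statement is
  therefore proved for countably many parameters, namely rational intervals and exponents for the
  upper bounds and quadruples of naturals (block types) for the lower ones. A single typical field
  then serves all \<alpha>, because \<open>L\<close> is lower semicontinuous and strict inequalities
  leave room for rational constants. Two speeds are delicate. If \<open>L \<alpha> = ln r\<close>,
  blocks of speed \<alpha> may be only critical; moving slightly towards a zero of \<open>L\<close>,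
  or away from 0 when \<alpha> = 0, makes them supercritical while the speed changes little. If
  \<alpha> = 0, the generations at which a ray reaches length m are not bounded by a multiple of m,
  so counting generation by generation fails; but then r = R, and the dimension of the whole limit
  set is already bounded by the value of the spectrum at 0. Block trees survive only with positive
  probability. Hence a finite piece of one type is continued only at those leaves where a tree of
  the next type survives; almost surely these are a fixed proportion of all leaves once the piece is
  deep, and this loss is paid for by an arbitrarily small part of the exponent.\<close>

abbreviation mul :: "'g word \<Rightarrow> 'g word \<Rightarrow> 'g word" where
  "mul \<equiv> foldr push_letter"

definition winv :: "'g word \<Rightarrow> 'g word" where
  "winv w = rev (map letter_inv w)"

lemma free_group_simps [simp]:
  "x \<otimes>\<^bsub>free_group\<^esub> y = mul x y" "\<one>\<^bsub>free_group\<^esub> = []" "carrier free_group = {w. reduced w}"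
  by (simp_all add: free_group_def)

lemma reduced_Nil' [simp]: "reduced []"
  by (rule reduced_Nil)

lemma reduced_single [simp]: "reduced [a]"
  by (simp add: reduced_def)

lemma reduced_Cons: "reduced (a # w) \<longleftrightarrow> reduced w \<and> (w \<noteq> [] \<longrightarrow> hd w \<noteq> letter_inv a)"
  by (cases w) (auto simp: reduced_def)

lemma reduced_append_iff:
  "reduced (u @ v) \<longleftrightarrow> reduced u \<and> reduced v \<and> (u \<noteq> [] \<longrightarrow> v \<noteq> [] \<longrightarrow> hd v \<noteq> letter_inv (last u))"
  by (auto simp: reduced_def successively_append_iff)

lemma reduced_winv [simp]: "reduced w \<Longrightarrow> reduced (winv w)"
proof (induction w)
  case (Cons a w)
  then show ?case
    by (cases w) (auto simp: winv_def reduced_append_iff reduced_Cons)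
qed (simp add: winv_def)

lemma winv_winv [simp]: "winv (winv w) = w"
  by (simp add: winv_def rev_map comp_def)

lemma winv_Nil [simp]: "winv [] = []"
  by (simp add: winv_def)

lemma mul_append: "reduced (x @ y) \<Longrightarrow> mul x y = x @ y"
proof (induction x)
  case (Cons a x)
  then show ?case by (cases "x @ y") (auto simp: reduced_Cons)
qed simp

lemma reduced_mul: "reduced y \<Longrightarrow> reduced (mul x y)"
  by (rule reduced_foldr_push)

lemma mul_Nil_right: "reduced x \<Longrightarrow> mul x [] = x"
  by (rule foldr_push_Nil)

lemma mul_assoc: "reduced z \<Longrightarrow> mul (mul x y) z = mul x (mul y z)"
  by (rule foldr_push_assoc)

lemma mul_winv_left: "reduced x \<Longrightarrow> mul (winv x) x = []"
  using foldr_push_left_inv[of x] by (simp add: winv_def[symmetric] mul_Nil_right)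

lemma mul_winv_right: "reduced x \<Longrightarrow> mul x (winv x) = []"
  using mul_winv_left[of "winv x"] by simp

lemma mul_eq_iff_left:
  assumes "reduced x" "reduced y" "reduced z"
  shows "mul x y = z \<longleftrightarrow> y = mul (winv x) z"
proof
  assume "mul x y = z"
  then have "mul (winv x) z = mul (mul (winv x) x) y"
    using assms by (simp add: mul_assoc)
  then show "y = mul (winv x) z" using assms by (simp add: mul_winv_left)
next
  assume "y = mul (winv x) z"
  then have "mul x y = mul (mul x (winv x)) z" using assms by (simp add: mul_assoc)
  then show "mul x y = z" using assms by (simp add: mul_winv_right)
qed

lemma winv_mul:
  assumes "reduced x" "reduced y"
  shows "winv (mul x y) = mul (winv y) (winv x)"
proof -
  have r: "reduced (mul x y)" using assms by (simp add: reduced_mul)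
  have "mul (mul x y) (mul (winv y) (winv x)) = mul x (mul (mul y (winv y)) (winv x))"
    using assms by (simp add: mul_assoc reduced_mul)
  also have "\<dots> = []" using assms by (simp add: mul_winv_right)
  finally have "mul (winv y) (winv x) = mul (winv (mul x y)) []"
    using mul_eq_iff_left[of "mul x y" "mul (winv y) (winv x)" "[]"] assms r
    by (simp add: reduced_mul)
  then show ?thesis using r by (simp add: mul_Nil_right)
qed

lemma inv_free_group: "reduced x \<Longrightarrow> inv\<^bsub>free_group\<^esub> x = winv x"
  using group.inv_equality[OF group_free_group, of "winv x" x]
  by (simp add: mul_winv_left)

lemma mul_single_right:
  assumes "reduced z"
  shows "mul z [a] = (if z \<noteq> [] \<and> last z = letter_inv a then butlast z else z @ [a])"
proof (cases "z \<noteq> [] \<and> last z = letter_inv a")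
  case True
  then have z: "z = butlast z @ [letter_inv a]" by (metis append_butlast_last_id)
  have "reduced (butlast z)" using assms by (subst (asm) z) (simp add: reduced_append_iff)
  moreover have "mul [letter_inv a] [a] = []" by simp
  ultimately have "mul (butlast z @ [letter_inv a]) [a] = butlast z"
    by (simp add: mul_Nil_right)
  with True z show ?thesis by metis
next
  case False
  then show ?thesis
    by (subst mul_append) (use assms in \<open>auto simp: reduced_append_iff\<close>)
qed

definition step_words :: "'g word set" where
  "step_words = insert [] (range (\<lambda>a. [a]))"

lemma step_words_reduced [simp]: "y \<in> step_words \<Longrightarrow> reduced y"
  by (auto simp: step_words_def)

text \<open>Multiplying by a letter on the right alters at most the last letter. Iterated in
  \<open>X_take\<close>, this controls how much of a position survives a given number of
  steps.\<close>

lemma mul_step: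
  assumes "reduced z" "y \<in> step_words"
  shows "length (mul z y) \<le> Suc (length z)" "length z \<le> Suc (length (mul z y))"
    "take (length z - 1) (mul z y) = take (length z - 1) z"
  using assms by (auto simp: step_words_def mul_Nil_right mul_single_right butlast_conv_take)

definition rwords :: "nat \<Rightarrow> 'g word set" where
  "rwords m = {x. reduced x \<and> length x = m}"

lemma finite_rwords [simp]: "finite (rwords m :: 'g::finite word set)"
  by (rule finite_subset[OF _ finite_lists_length_eq[of UNIV m]]) (auto simp: rwords_def)

lemma card_letters: "card (UNIV :: 'g::finite letter set) = 2 * CARD('g)"
  by (simp add: card_cartesian_product flip: UNIV_Times_UNIV)

text \<open>Only two letters are forbidden, the inverses of the last letter of \<open>x\<close> and
  of the first letter of \<open>y\<close>, whereas rank at least 2 provides four. This is where the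
  rank enters.\<close>

lemma ex_joining_letter:
  assumes "CARD('g::finite) \<ge> 2" "reduced x" "reduced (y :: 'g word)"
  shows "\<exists>c. reduced (x @ c # y)"
proof -
  define B where "B = {letter_inv (last x), letter_inv (hd y)}"
  have "card B \<le> 2" by (simp add: B_def card_insert_if)
  then have "B \<noteq> UNIV" using assms(1) card_letters[where 'g='g] by auto
  then obtain c where c: "c \<notin> B" by auto
  then have "reduced (x @ c # y)"
    using assms(2,3) by (auto simp: B_def reduced_append_iff reduced_Cons)
  then show ?thesis ..
qed

definition joiner :: "'g word \<Rightarrow> 'g word \<Rightarrow> 'g letter" where
  "joiner x y = (SOME c. reduced (x @ c # y))"

definition wjoin :: "'g word \<Rightarrow> 'g word \<Rightarrow> 'g word" where
  "wjoin x y = x @ joiner x y # y"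

lemma reduced_wjoin:
  assumes "CARD('g::finite) \<ge> 2" "reduced x" "reduced (y :: 'g word)"
  shows "reduced (wjoin x y)"
  using someI_ex[OF ex_joining_letter[OF assms]] by (simp add: wjoin_def joiner_def)

lemma length_wjoin [simp]: "length (wjoin x y) = Suc (length x + length y)"
  by (simp add: wjoin_def)

lemma wjoin_inj: "wjoin x y = wjoin x' y' \<Longrightarrow> length x = length x' \<Longrightarrow> x = x' \<and> y = y'"
  by (simp add: wjoin_def)

text \<open>Once the length of the left factor is known, a joined word reveals both factors, so
  distinct pairs give distinct words and no term on the right is counted twice. The lemma serves
  twice: for the law of the walk and for the probabilities of being visited by the branching
  walk.\<close>

lemma sum_wjoin_le:
  fixes a b d :: "'g::finite word \<Rightarrow> real"
  assumes "CARD('g) \<ge> 2" and "\<And>z. 0 \<le> d z"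
    and le: "\<And>x y c. \<lbrakk>x \<in> rwords m; y \<in> rwords m'; reduced (x @ c # y)\<rbrakk> \<Longrightarrow> e * (a x * b y) \<le> d (x @ c # y)"
  shows "e * ((\<Sum>x\<in>rwords m. a x) * (\<Sum>y\<in>rwords m'. b y)) \<le> (\<Sum>z\<in>rwords (Suc (m + m')). d z)"
proof -
  have "e * ((\<Sum>x\<in>rwords m. a x) * (\<Sum>y\<in>rwords m'. b y)) =
      (\<Sum>(x,y)\<in>rwords m \<times> rwords m'. e * (a x * b y))"
    by (subst sum_product) (simp add: sum_distrib_left sum.cartesian_product case_prod_unfold)
  also have "\<dots> \<le> (\<Sum>(x,y)\<in>rwords m \<times> rwords m'. d (wjoin x y))"
  proof (rule sum_mono, clarify)
    fix x y :: "'g word" assume xy: "x \<in> rwords m" "y \<in> rwords m'"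
    then have "reduced (wjoin x y)" by (intro reduced_wjoin assms(1)) (auto simp: rwords_def)
    then show "e * (a x * b y) \<le> d (wjoin x y)"
      unfolding wjoin_def by (intro le xy)
  qed
  also have "\<dots> = (\<Sum>z\<in>(\<lambda>(x,y). wjoin x y) ` (rwords m \<times> rwords m'). d z)"
    by (subst sum.reindex)
       (auto simp: inj_on_def rwords_def case_prod_unfold dest: wjoin_inj intro!: sum.cong)
  also have "\<dots> \<le> (\<Sum>z\<in>rwords (Suc (m + m')). d z)"
  proof (rule sum_mono2)
    show "(\<lambda>(x,y). wjoin x y) ` (rwords m \<times> rwords m') \<subseteq> (rwords (Suc (m + m')) :: 'g word set)"
      by (auto simp: rwords_def intro!: reduced_wjoin assms(1))
  qed (use assms(2) in auto)
  finally show ?thesis .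
qed

text \<open>Any two words of this form can be concatenated without cancellation.\<close>

definition block_words :: "'g letter \<Rightarrow> nat \<Rightarrow> 'g word set" where
  "block_words a M = {w. reduced w \<and> length w = M \<and> (w \<noteq> [] \<longrightarrow> hd w = a \<and> last w = a)}"

lemma block_words_append:
  "x \<in> block_words a m \<Longrightarrow> y \<in> block_words a m' \<Longrightarrow> x @ y \<in> block_words a (m + m')"
  by (cases "x = []"; cases "y = []") (auto simp: block_words_def reduced_append_iff)

lemma block_words_reduced: "x \<in> block_words a m \<Longrightarrow> reduced x"
  and block_words_length: "x \<in> block_words a m \<Longrightarrow> length x = m"
  by (simp_all add: block_words_def)

lemma block_words_mul:
  "x \<in> block_words a m \<Longrightarrow> y \<in> block_words a m' \<Longrightarrow> mul x y = x @ y"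
  by (rule mul_append[OF block_words_reduced[OF block_words_append]])

lemma finite_block_words [simp]: "finite (block_words a m :: 'g::finite word set)"
  by (rule finite_subset[OF _ finite_rwords[of m]]) (auto simp: block_words_def rwords_def)

subsection \<open>The law of the random walk\<close>

text \<open>The recursion splits off the first step, on the left, and not the last one. It thereby
  matches the decomposition of the branching walk at its root.\<close>

primrec wk :: "'g word pmf \<Rightarrow> nat \<Rightarrow> 'g word pmf" where
  "wk \<mu> 0 = return_pmf []"
| "wk \<mu> (Suc n) = bind_pmf \<mu> (\<lambda>y. map_pmf (mul y) (wk \<mu> n))"

lemma pmf_bind_ge: "pmf A x * pmf (f x) z \<le> pmf (bind_pmf A f) z"
proof -
  have "pmf A x * pmf (f x) z = (\<integral>y. pmf (f x) z * indicator {x} y \<partial>measure_pmf A)"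
    by (simp add: measure_pmf_single mult.commute)
  also have "\<dots> \<le> (\<integral>y. pmf (f y) z \<partial>measure_pmf A)"
    by (intro integral_mono measure_pmf.integrable_const_bound[where B = 1])
       (auto simp: indicator_def pmf_le_1)
  finally show ?thesis by (simp add: pmf_bind)
qed

lemma pmf_map_ge: "pmf A y \<le> pmf (map_pmf g A) (g y)"
  using pmf_bind_ge[of A y "\<lambda>y. return_pmf (g y)" "g y"] by (simp add: map_pmf_def)

lemma step_law_set: "step_law \<mu> \<Longrightarrow> set_pmf \<mu> \<subseteq> step_words"
  by (auto simp: step_law_def step_words_def sym_gens_def)

lemma step_law_pos: "step_law \<mu> \<Longrightarrow> 0 < pmf \<mu> [a]"
  unfolding step_law_def sym_gens_def by blast

lemma step_law_sym:
  assumes "step_law \<mu>"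
  shows "map_pmf winv \<mu> = \<mu>"
proof (rule pmf_eqI)
  fix x
  have e: "pmf \<mu> (winv x) = pmf \<mu> x"
  proof (cases "x \<in> step_words")
    case True
    then consider "x = []" | a where "x = [a]" by (auto simp: step_words_def)
    then show ?thesis
    proof cases
      case 2
      then have "x \<in> sym_gens" by (auto simp: sym_gens_def)
      then show ?thesis using assms inv_free_group[of x] 2 by (auto simp: step_law_def)
    qed simp
  next
    case False
    moreover have "winv x \<notin> step_words"
    proof
      assume "winv x \<in> step_words"
      then have "winv (winv x) \<in> step_words" by (auto simp: step_words_def winv_def)
      with False show False by simp
    qed
    ultimately show ?thesis using step_law_set[OF assms] by (metis set_pmf_iff subsetD)
  qed
  have "pmf (map_pmf winv \<mu>) (winv (winv x)) = pmf \<mu> (winv x)"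
    by (rule pmf_map_inj') (metis injI winv_winv)
  then show "pmf (map_pmf winv \<mu>) x = pmf \<mu> x" using e by simp
qed

lemma set_wk:
  assumes "set_pmf \<mu> \<subseteq> step_words" "x \<in> set_pmf (wk \<mu> n)"
  shows "reduced x \<and> length x \<le> n"
  using assms(2)
proof (induction n arbitrary: x)
  case (Suc n)
  then obtain y z where yz: "y \<in> set_pmf \<mu>" "z \<in> set_pmf (wk \<mu> n)" "x = mul y z"
    by auto
  have "length (mul y z) \<le> Suc (length z)"
  proof -
    have "y = [] \<or> (\<exists>a. y = [a])" using yz(1) assms(1) by (auto simp: step_words_def)
    then show ?thesis by (cases z) auto
  qed
  with Suc.IH[OF yz(2)] yz show ?case by (auto intro: reduced_mul)
qed auto

lemma wk_add:
  assumes "set_pmf \<mu> \<subseteq> step_words"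
  shows "wk \<mu> (m + n) = bind_pmf (wk \<mu> m) (\<lambda>x. map_pmf (mul x) (wk \<mu> n))"
proof (induction m)
  case 0
  have "map_pmf (mul []) (wk \<mu> n) = wk \<mu> n"
    by (intro map_pmf_idI) simp
  then show ?case by (simp add: bind_return_pmf)
next
  case (Suc m)
  have "map_pmf (\<lambda>z. mul y (mul x z)) (wk \<mu> n) = map_pmf (mul (mul y x)) (wk \<mu> n)" for x y
    using set_wk[OF assms] by (intro map_pmf_cong) (auto simp: mul_assoc)
  then show ?case
    by (simp add: Suc bind_assoc_pmf map_bind_pmf bind_map_pmf map_pmf_comp)
qed

lemma wk_1: "set_pmf \<mu> \<subseteq> step_words \<Longrightarrow> wk \<mu> 1 = \<mu>"
proof -
  assume a: "set_pmf \<mu> \<subseteq> step_words"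
  have "wk \<mu> 1 = map_pmf (\<lambda>y. mul y []) \<mu>" by (simp add: map_pmf_def bind_return_pmf)
  also have "\<dots> = map_pmf (\<lambda>y. y) \<mu>"
    using a by (intro map_pmf_cong) (auto simp: mul_Nil_right subset_iff)
  finally show ?thesis by simp
qed

lemma pmf_wk_mul_ge:
  assumes "set_pmf \<mu> \<subseteq> step_words"
  shows "pmf (wk \<mu> m) x * pmf (wk \<mu> n) y \<le> pmf (wk \<mu> (m + n)) (mul x y)"
proof -
  have "pmf (wk \<mu> m) x * pmf (wk \<mu> n) y
      \<le> pmf (wk \<mu> m) x * pmf (map_pmf (mul x) (wk \<mu> n)) (mul x y)"
    by (intro mult_left_mono pmf_map_ge) simp
  also have "\<dots> \<le> pmf (wk \<mu> (m + n)) (mul x y)"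
    unfolding wk_add[OF assms] by (rule pmf_bind_ge)
  finally show ?thesis .
qed

lemma pmf_wk_join_ge:
  assumes "set_pmf \<mu> \<subseteq> step_words" "reduced (x @ c # y)"
  shows "pmf \<mu> [c] * (pmf (wk \<mu> m) x * pmf (wk \<mu> n) y) \<le> pmf (wk \<mu> (Suc (m + n))) (x @ c # y)"
proof -
  have r: "reduced (c # y)" using assms(2) by (simp add: reduced_append_iff)
  have "pmf \<mu> [c] * (pmf (wk \<mu> m) x * pmf (wk \<mu> n) y)
      = pmf (wk \<mu> m) x * (pmf (wk \<mu> 1) [c] * pmf (wk \<mu> n) y)"
    by (simp only: wk_1[OF assms(1)]) simp
  also have "\<dots> \<le> pmf (wk \<mu> m) x * pmf (wk \<mu> (1 + n)) (mul [c] y)"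
    by (intro mult_left_mono pmf_wk_mul_ge assms) simp
  also have "\<dots> \<le> pmf (wk \<mu> (m + (1 + n))) (mul x (mul [c] y))"
    by (intro pmf_wk_mul_ge assms)
  also have "mul x (mul [c] y) = x @ c # y"
    using mul_append[of "[c]" y] mul_append[of x "c # y"] r assms(2) by simp
  finally show ?thesis by simp
qed

text \<open>Inversion reverses the order of the steps and inverts each of them; since the steps are
  independent with a symmetric law, neither operation changes the law of the product.\<close>

lemma map_winv_wk:
  assumes "step_law \<mu>"
  shows "map_pmf winv (wk \<mu> n) = wk \<mu> n"
proof (induction n)
  case (Suc n)
  note s = step_law_set[OF assms]
  have "map_pmf winv (wk \<mu> (Suc n)) =
      bind_pmf \<mu> (\<lambda>y. map_pmf (\<lambda>z. mul (winv z) (winv y)) (wk \<mu> n))"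
    using s set_wk[OF s]
    by (auto simp: map_bind_pmf map_pmf_comp winv_mul subset_iff intro!: bind_pmf_cong map_pmf_cong)
  also have "\<dots> = bind_pmf \<mu> (\<lambda>y. bind_pmf (wk \<mu> n) (\<lambda>z. return_pmf (mul (winv z) (winv y))))"
    by (simp add: map_pmf_def)
  also have "\<dots> = bind_pmf (wk \<mu> n) (\<lambda>z. bind_pmf \<mu> (\<lambda>y. return_pmf (mul (winv z) (winv y))))"
    by (rule bind_commute_pmf)
  also have "\<dots> = bind_pmf (map_pmf winv (wk \<mu> n)) (\<lambda>z. map_pmf (mul z) (map_pmf winv \<mu>))"
    by (simp add: map_pmf_def bind_return_pmf bind_assoc_pmf)
  also have "\<dots> = wk \<mu> (Suc n)"
    using wk_add[OF s, of n "Suc 0"] wk_1[OF s]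
    by (simp add: Suc step_law_sym[OF assms] del: wk.simps)
  finally show ?case .
qed simp

lemma pmf_wk_winv:
  assumes "step_law \<mu>"
  shows "pmf (wk \<mu> n) (winv x) = pmf (wk \<mu> n) x"
proof -
  have "pmf (map_pmf winv (wk \<mu> n)) (winv x) = pmf (wk \<mu> n) x"
    by (rule pmf_map_inj') (metis injI winv_winv)
  then show ?thesis by (simp add: map_winv_wk[OF assms])
qed

lemma wk_as_list:
  "wk \<mu> n = map_pmf (\<lambda>l. foldr mul l []) (replicate_pmf n \<mu>)"
proof (induction n)
  case (Suc n)
  show ?case by (simp add: Suc map_bind_pmf map_pmf_comp map_pmf_def bind_assoc_pmf bind_return_pmf)
qed simp

lemma pmf_replicate:
  "pmf (replicate_pmf n \<mu>) l = (if length l = n then \<Prod>i<n. pmf \<mu> (l ! i) else 0)"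
proof (induction n arbitrary: l)
  case 0
  then show ?case by (auto simp: pmf_return indicator_def)
next
  case (Suc n)
  show ?case
  proof (cases l)
    case Nil
    then have "l \<notin> set_pmf (replicate_pmf (Suc n) \<mu>)" by (auto simp: set_replicate_pmf simp del: replicate_pmf.simps)
    then show ?thesis using Nil by (simp add: pmf_eq_0_set_pmf del: replicate_pmf.simps)
  next
    case (Cons a l')
    have "replicate_pmf (Suc n) \<mu> = map_pmf (\<lambda>(x, xs). x # xs) (pair_pmf \<mu> (replicate_pmf n \<mu>))"
      by (simp add: pair_pmf_def map_pmf_def bind_assoc_pmf bind_return_pmf)
    then have "pmf (replicate_pmf (Suc n) \<mu>) l =
       pmf (map_pmf (\<lambda>(x, xs). x # xs) (pair_pmf \<mu> (replicate_pmf n \<mu>))) ((\<lambda>(x, xs). x # xs) (a, l'))"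
      by (simp add: Cons del: replicate_pmf.simps)
    also have "\<dots> = pmf \<mu> a * pmf (replicate_pmf n \<mu>) l'"
      by (subst pmf_map_inj') (auto intro: injI simp: pmf_pair)
    finally show ?thesis
      by (simp add: Suc Cons prod.lessThan_Suc_shift del: replicate_pmf.simps prod.lessThan_Suc)
  qed
qed

lemma foldl_mul_eq_foldr:
  assumes "\<forall>y\<in>set l. reduced y" "reduced x"
  shows "foldl mul x l = mul x (foldr mul l [])"
  using assms
proof (induction l arbitrary: x)
  case (Cons a l)
  have "reduced (foldr mul l [])"
    using Cons.prems(1) by (induction l) (auto intro: reduced_mul)
  with Cons show ?case by (simp add: mul_assoc reduced_mul)
qed (simp add: mul_Nil_right)

lemma distr_eq_pmfI:
  fixes f :: "'w \<Rightarrow> 'a::countable"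
  assumes "prob_space P" "f \<in> P \<rightarrow>\<^sub>M count_space UNIV"
    and "\<And>a. measure P {x \<in> space P. f x = a} = pmf q a"
  shows "distr P (count_space UNIV) f = measure_pmf q"
proof (rule measure_eqI_countable[where A = UNIV])
  interpret prob_space P by fact
  fix a
  have "emeasure (distr P (count_space UNIV) f) {a} = emeasure P {x \<in> space P. f x = a}"
    using assms(2) by (subst emeasure_distr) (auto intro!: arg_cong[where f = "emeasure P"])
  then show "emeasure (distr P (count_space UNIV) f) {a} = emeasure (measure_pmf q) {a}"
    using assms(3)[of a] by (simp add: emeasure_eq_measure emeasure_pmf_single)
qed auto

text \<open>The transfer from the given process to \<open>wk \<mu>\<close>, through which all later
  statements about the walk are expressed.\<close>

lemma random_walk_law:
  fixes \<mu> :: "'g::finite word pmf"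
  assumes s: "set_pmf \<mu> \<subseteq> step_words" and rw: "random_walk P \<mu> Z"
  shows "measure P {x \<in> space P. Q (Z n x)} = measure_pmf.prob (wk \<mu> n) {x. Q x}"
proof -
  interpret prob_space P using rw by (simp add: random_walk_def)
  from rw obtain X where
    X: "indep_vars (\<lambda>_. count_space UNIV) X (UNIV :: nat set)"
      "\<And>n. distr P (count_space UNIV) (X n) = measure_pmf \<mu>"
    and Z: "\<And>x. x \<in> space P \<Longrightarrow> Z 0 x = []"
      "\<And>x n. x \<in> space P \<Longrightarrow> Z (Suc n) x = mul (Z n x) (X n x)"
    by (auto simp: random_walk_def)
  have mX [measurable]: "X i \<in> P \<rightarrow>\<^sub>M count_space UNIV" for i
    using X(1) by (auto simp: indep_vars_def)
  define l where "l x = map (\<lambda>i. X i x) [0..<n]" for x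
  have pX: "measure P {x \<in> space P. X i x = a} = pmf \<mu> a" for i a
  proof -
    have "pmf \<mu> a = measure (distr P (count_space UNIV) (X i)) {a}"
      by (simp add: X(2) measure_pmf_single)
    also have "\<dots> = measure P {x \<in> space P. X i x = a}"
      by (subst measure_distr) (auto intro!: arg_cong[where f = "measure P"])
    finally show ?thesis by simp
  qed
  have ev: "{x \<in> space P. l x = a} = {x \<in> space P. length a = n \<and> (\<forall>i<n. X i x = a ! i)}" for a
    by (auto simp: l_def list_eq_iff_nth_eq)
  have ml [measurable]: "l \<in> P \<rightarrow>\<^sub>M count_space UNIV"
  proof (subst measurable_count_space_eq_countable[OF countableI_type], safe)
    fix a show "l -` {a} \<inter> space P \<in> sets P"
    proof -
      have "l -` {a} \<inter> space P = {x \<in> space P. length a = n \<and> (\<forall>i<n. X i x = a ! i)}"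
        using ev[of a] by auto
      also have "\<dots> \<in> sets P" by measurable
      finally show ?thesis .
    qed
  qed auto
  have "distr P (count_space UNIV) l = measure_pmf (replicate_pmf n \<mu>)"
  proof (rule distr_eq_pmfI[OF prob_space_axioms ml])
    fix a
    have "measure P {x \<in> space P. l x = a} = pmf (replicate_pmf n \<mu>) a" if "n > 0" "length a = n"
    proof -
      have "{x \<in> space P. l x = a} = (\<Inter>i\<in>{..<n}. X i -` {a ! i} \<inter> space P)"
        using that ev[of a] by auto
      also have "prob \<dots> = (\<Prod>i<n. prob (X i -` {a ! i} \<inter> space P))"
        using that by (intro indep_varsD[OF X(1)]) auto
      also have "\<dots> = (\<Prod>i<n. pmf \<mu> (a ! i))"
      proof (intro prod.cong refl)
        fix i
        have "X i -` {a ! i} \<inter> space P = {x \<in> space P. X i x = a ! i}" by auto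
        then show "prob (X i -` {a ! i} \<inter> space P) = pmf \<mu> (a ! i)" by (simp add: pX)
      qed
      finally show ?thesis using that by (simp add: pmf_replicate)
    qed
    moreover have "measure P {x \<in> space P. l x = a} = pmf (replicate_pmf n \<mu>) a" if "length a \<noteq> n"
      unfolding ev using that by (simp add: pmf_replicate)
    moreover have "measure P {x \<in> space P. l x = a} = pmf (replicate_pmf n \<mu>) a" if "n = 0" "length a = n"
      unfolding ev using that by (simp add: pmf_replicate prob_space)
    ultimately show "measure P {x \<in> space P. l x = a} = pmf (replicate_pmf n \<mu>) a" by blast
  qed
  \<comment> \<open>The two ways of bracketing the product agree only for reduced factors, and the
    steps are reduced only almost surely, namely on the support of \<open>\<mu>\<close>.\<close>
  moreover have "AE x in P. Z n x = foldr mul (l x) []"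
  proof -
    have "AE y in distr P (count_space UNIV) (X i). y \<in> set_pmf \<mu>" for i
      unfolding X(2) by (rule AE_measure_pmf)
    then have "AE x in P. X i x \<in> set_pmf \<mu>" for i
      by (rule AE_distrD[OF mX])
    then have "AE x in P. \<forall>i. X i x \<in> set_pmf \<mu>" by (simp add: AE_all_countable)
    then show ?thesis
    proof (rule AE_mp, intro AE_I2 impI)
      fix x assume x: "x \<in> space P" "\<forall>i. X i x \<in> set_pmf \<mu>"
      have "Z k x = foldl mul [] (map (\<lambda>i. X i x) [0..<k])" for k
        by (induction k) (simp_all add: Z x(1))
      then show "Z n x = foldr mul (l x) []"
        using s x(2) by (subst foldl_mul_eq_foldr[of _ "[]", simplified, symmetric])
          (auto simp: l_def subset_iff)
    qed
  qed
  ultimately have "measure P {x \<in> space P. Q (foldr mul (l x) [])} = measure_pmf.prob (wk \<mu> n) {x. Q x}"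
    and AE: "AE x in P. Z n x = foldr mul (l x) []"
  proof -
    assume d: "distr P (count_space UNIV) l = measure_pmf (replicate_pmf n \<mu>)"
    have "measure_pmf.prob (wk \<mu> n) {x. Q x} =
        measure (distr P (count_space UNIV) l) {a. Q (foldr mul a [])}"
      unfolding d wk_as_list by (simp add: vimage_def)
    also have "\<dots> = measure P {x \<in> space P. Q (foldr mul (l x) [])}"
      by (subst measure_distr) (auto intro!: arg_cong[where f = "measure P"])
    finally show "measure P {x \<in> space P. Q (foldr mul (l x) [])} = measure_pmf.prob (wk \<mu> n) {x. Q x}"
      by simp
  qed
  have mZ [measurable]: "Z k \<in> P \<rightarrow>\<^sub>M count_space UNIV" for k
  proof (induction k)
    case 0
    then show ?case using Z(1) by (subst measurable_cong[where g = "\<lambda>_. []"]) auto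
  next
    case (Suc k)
    note [measurable] = Suc
    have "(\<lambda>x. mul (Z k x) (X k x)) \<in> P \<rightarrow>\<^sub>M count_space UNIV"
      by (rule measurable_compose_countable[OF measurable_compose[OF mX] Suc]) simp
    then show ?case using Z(2) by (subst measurable_cong[where g = "\<lambda>x. mul (Z k x) (X k x)"]) auto
  qed
  have "measure P {x \<in> space P. Q (Z n x)} = measure P {x \<in> space P. Q (foldr mul (l x) [])}"
  proof (rule measure_eq_AE)
    show "AE x in P. (x \<in> {x \<in> space P. Q (Z n x)}) = (x \<in> {x \<in> space P. Q (foldr mul (l x) [])})"
      using AE by (rule AE_mp) (auto intro!: AE_I2)
  qed (measurable)
  with \<open>measure P {x \<in> space P. Q (foldr mul (l x) [])} = _\<close> show ?thesis by simp
qed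

subsection \<open>The rate function\<close>

text \<open>Joining costs one letter and one step. The additive quantities are therefore
  \<open>Suc n\<close> and \<open>Suc m\<close>, and the condition on \<open>N\<close> and
  \<open>M\<close> is what \<open>k\<close> joined copies amount to.\<close>

lemma supermultiplicative_power:
  fixes h :: "nat \<Rightarrow> nat \<Rightarrow> real"
  assumes super: "\<And>n m n' m'. h n m * h n' m' \<le> h (Suc (n + n')) (Suc (m + m'))" and nonneg: "0 \<le> h n m"
  shows "Suc N = k * Suc n \<Longrightarrow> Suc M = k * Suc m \<Longrightarrow> h n m ^ k \<le> h N M"
proof (induction k arbitrary: N M)
  case (Suc k)
  show ?case
  proof (cases "k = 0")
    case True
    then show ?thesis using Suc.prems by simp
  next
    case False
    then obtain N' M' where NM: "Suc N' = k * Suc n" "Suc M' = k * Suc m"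
      by (metis mult_is_0 nat.simps(3) not0_implies_Suc)
    have "h n m ^ Suc k \<le> h n m * h N' M'"
      using Suc.IH[OF NM] nonneg by (simp add: mult_left_mono)
    also have "\<dots> \<le> h (Suc (n + N')) (Suc (m + M'))" by (rule super)
    also have "Suc (n + N') = N" using Suc.prems NM by auto
    also have "Suc (m + M') = M" using Suc.prems NM by auto
    finally show ?thesis .
  qed
qed simp

section \<open>Supermultiplicativity of the length distribution\<close>

locale free_walk =
  fixes \<mu> :: "'g::finite word pmf"
  assumes card2: "CARD('g) \<ge> 2" and step: "step_law \<mu>"
begin

lemma \<mu>_steps: "set_pmf \<mu> \<subseteq> step_words"
  using step by (rule step_law_set)

definition cmin :: real where
  "cmin = Min (range (\<lambda>a. pmf \<mu> [a]))"

lemma cmin_pos: "0 < cmin" and cmin_le: "cmin \<le> pmf \<mu> [a]" and cmin_le_1: "cmin \<le> 1"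
proof -
  show "0 < cmin" using step_law_pos[OF step] by (auto simp: cmin_def)
  show le: "cmin \<le> pmf \<mu> [a]" for a unfolding cmin_def by (intro Min_le) auto
  show "cmin \<le> 1" using le[of undefined] pmf_le_1[of \<mu> "[undefined]"] by linarith
qed

definition plen :: "nat \<Rightarrow> nat \<Rightarrow> real" where
  "plen n m = (\<Sum>x\<in>rwords m. pmf (wk \<mu> n) x)"

lemma pmf_wk_eq_0: "\<not> reduced x \<or> length x > n \<Longrightarrow> pmf (wk \<mu> n) x = 0"
  using set_wk[OF \<mu>_steps, of x n] by (metis not_le set_pmf_iff)

lemma plen_eq_prob: "plen n m = measure_pmf.prob (wk \<mu> n) {x. length x = m}"
proof -
  have "plen n m = measure_pmf.prob (wk \<mu> n) (rwords m)"
    by (simp add: plen_def measure_measure_pmf_finite)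
  also have "\<dots> = measure_pmf.prob (wk \<mu> n) {x. length x = m}"
    by (rule measure_pmf.finite_measure_eq_AE)
       (use set_wk[OF \<mu>_steps] in \<open>auto simp: rwords_def AE_measure_pmf_iff\<close>)
  finally show ?thesis .
qed

lemma plen_nonneg [simp]: "0 \<le> plen n m"
  by (simp add: plen_def sum_nonneg)

lemma plen_eq_0: "m > n \<Longrightarrow> plen n m = 0"
  unfolding plen_def by (intro sum.neutral) (auto simp: rwords_def intro!: pmf_wk_eq_0)

text \<open>The factor \<open>cmin\<close> is the least probability of a joining letter. With it
  included, supermultiplicativity holds without a constant, so powers can be taken without
  accumulating errors.\<close>

definition plen' :: "nat \<Rightarrow> nat \<Rightarrow> real" where
  "plen' n m = cmin * plen n m"

lemma plen'_nonneg [simp]: "0 \<le> plen' n m"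
  using cmin_pos by (simp add: plen'_def)

lemma plen'_le: "plen' n m \<le> plen n m"
  unfolding plen'_def using cmin_le_1 cmin_pos by (simp add: mult_left_le_one_le)

lemma plen'_supermult: "plen' n m * plen' n' m' \<le> plen' (Suc (n + n')) (Suc (m + m'))"
proof -
  have "cmin * (plen n m * plen n' m') \<le> plen (Suc (n + n')) (Suc (m + m'))"
    unfolding plen_def
  proof (rule sum_wjoin_le[OF card2])
    fix x y :: "'g word" and c
    assume r: "reduced (x @ c # y)"
    have "cmin * (pmf (wk \<mu> n) x * pmf (wk \<mu> n') y)
        \<le> pmf \<mu> [c] * (pmf (wk \<mu> n) x * pmf (wk \<mu> n') y)"
      by (intro mult_right_mono cmin_le) simp
    also have "\<dots> \<le> pmf (wk \<mu> (Suc (n + n'))) (x @ c # y)"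
      by (rule pmf_wk_join_ge[OF \<mu>_steps r])
    finally show "cmin * (pmf (wk \<mu> n) x * pmf (wk \<mu> n') y) \<le> pmf (wk \<mu> (Suc (n + n'))) (x @ c # y)" .
  qed simp
  then show ?thesis using cmin_pos by (simp add: plen'_def mult_ac)
qed

lemma plen'_power: "Suc N = k * Suc n \<Longrightarrow> Suc M = k * Suc m \<Longrightarrow> plen' n m ^ k \<le> plen' N M"
  by (rule supermultiplicative_power[where h = plen', OF plen'_supermult]) simp_all

text \<open>Mixing blocks of two different lengths in given proportions; this is the source of the
  convexity of \<open>L\<close>.\<close>

lemma plen'_power2:
  assumes "Suc N = (k1 + k2) * Suc n" "Suc M = k1 * Suc m1 + k2 * Suc m2"
  shows "plen' n m1 ^ k1 * plen' n m2 ^ k2 \<le> plen' N M"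
proof -
  consider "k1 = 0" | "k2 = 0" | "k1 > 0" "k2 > 0" by auto
  then show ?thesis
  proof cases
    case 3
    then obtain N1 M1 where 1: "Suc N1 = k1 * Suc n" "Suc M1 = k1 * Suc m1"
      by (metis mult_is_0 nat.simps(3) not0_implies_Suc not_gr_zero)
    from 3 obtain N2 M2 where 2: "Suc N2 = k2 * Suc n" "Suc M2 = k2 * Suc m2"
      by (metis mult_is_0 nat.simps(3) not0_implies_Suc not_gr_zero)
    have "plen' n m1 ^ k1 * plen' n m2 ^ k2 \<le> plen' N1 M1 * plen' N2 M2"
      using plen'_power[OF 1] plen'_power[OF 2] by (intro mult_mono) auto
    also have "\<dots> \<le> plen' (Suc (N1 + N2)) (Suc (M1 + M2))" by (rule plen'_supermult)
    also have "Suc (N1 + N2) = N" using assms 1 2 by (auto simp: algebra_simps)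
    also have "Suc (M1 + M2) = M" using assms 1 2 by (auto simp: algebra_simps)
    finally show ?thesis .
  qed (use assms plen'_power in auto)
qed

end

section \<open>Comparison of the length distribution with the rate function\<close>

locale rated_walk = free_walk \<mu> for \<mu> :: "'g::finite word pmf" +
  fixes P :: "'w measure" and Z :: "nat \<Rightarrow> 'w \<Rightarrow> 'g word" and R :: real and L :: "real \<Rightarrow> ereal"
  assumes rw: "random_walk P \<mu> Z" and spec: "spectral_radius P Z = ereal (1 / R)"
    and ldp: "ldp_rate_function P Z L" and R1: "1 < R"
begin

lemma L_nonneg: "0 \<le> L q"
  and L_closed: "closed {q. L q \<le> c}"
  using ldp by (auto simp: ldp_rate_function_def)

lemma spec': "limsup (\<lambda>n. ereal (root n (pmf (wk \<mu> n) []))) = ereal (1 / R)"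
  using spec random_walk_law[OF \<mu>_steps rw, of "\<lambda>z. z = []"]
  by (simp add: spectral_radius_def measure_pmf_single)

text \<open>Going to \<open>x\<close> and back is a return, and by symmetry both halves have the
  same probability, so the square is at most the return probability at time \<open>2 * n\<close>.
  Return probabilities are supermultiplicative, hence the root of any one of them recurs as a lower
  bound along multiples of its time and cannot exceed the limsup.\<close>

lemma pmf_wk_le: "pmf (wk \<mu> n) x \<le> (1 / R) ^ n"
proof (cases "n = 0 \<or> \<not> reduced x")
  case True
  then show ?thesis using R1 by (auto simp: pmf_le_1 pmf_wk_eq_0)
next
  case False
  then have n: "n > 0" and x: "reduced x" by auto
  have sq: "pmf (wk \<mu> n) x ^ 2 \<le> pmf (wk \<mu> (2 * n)) []"
    using pmf_wk_mul_ge[OF \<mu>_steps, of n x n "winv x"] x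
    by (simp add: pmf_wk_winv[OF step] mul_winv_right power2_eq_square mult_2)
  have pow: "pmf (wk \<mu> (2 * n)) [] ^ k \<le> pmf (wk \<mu> (k * (2 * n))) []" for k
  proof (induction k)
    case (Suc k)
    have "pmf (wk \<mu> (2 * n)) [] ^ Suc k \<le> pmf (wk \<mu> (2 * n)) [] * pmf (wk \<mu> (k * (2 * n))) []"
      using Suc by (simp add: mult_left_mono)
    also have "\<dots> \<le> pmf (wk \<mu> (2 * n + k * (2 * n))) (mul [] [])"
      by (rule pmf_wk_mul_ge[OF \<mu>_steps])
    finally show ?case by simp
  qed (simp add: pmf_return)
  have ge: "root n (pmf (wk \<mu> n) x) \<le> root (k * (2 * n)) (pmf (wk \<mu> (k * (2 * n))) [])" if "k > 0" for k
  proof -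
    have "pmf (wk \<mu> n) x ^ (2 * k) \<le> pmf (wk \<mu> (k * (2 * n))) []"
      using power_mono[OF sq, of k] pow[of k] by (simp add: power_mult)
    then have "root (k * (2 * n)) (pmf (wk \<mu> n) x ^ (2 * k)) \<le> root (k * (2 * n)) (pmf (wk \<mu> (k * (2 * n))) [])"
      using that n by simp
    moreover have "root (k * (2 * n)) (pmf (wk \<mu> n) x ^ (2 * k)) = root n (pmf (wk \<mu> n) x)"
    proof -
      have "root (n * (2 * k)) (pmf (wk \<mu> n) x ^ (2 * k)) = root n (root (2 * k) (pmf (wk \<mu> n) x ^ (2 * k)))"
        by (rule real_root_mult_exp)
      then show ?thesis using that by (simp add: real_root_power_cancel mult_ac)
    qed
    ultimately show ?thesis by simp
  qed
  have "ereal (root n (pmf (wk \<mu> n) x)) \<le> limsup (\<lambda>n. ereal (root n (pmf (wk \<mu> n) [])))"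
    unfolding limsup_INF_SUP
  proof (rule INF_greatest)
    fix N
    have "Suc N * (2 * n) \<in> {N..}" using n by (cases n) auto
    then have "ereal (root (Suc N * (2 * n)) (pmf (wk \<mu> (Suc N * (2 * n))) [])) \<le>
       (SUP m\<in>{N..}. ereal (root m (pmf (wk \<mu> m) [])))" by (rule SUP_upper)
    with ge[of "Suc N"] show "ereal (root n (pmf (wk \<mu> n) x)) \<le> (SUP m\<in>{N..}. ereal (root m (pmf (wk \<mu> m) [])))"
      by (meson ereal_less_eq(3) order_trans zero_less_Suc)
  qed
  then have "root n (pmf (wk \<mu> n) x) \<le> 1 / R" by (simp add: spec')
  then have "root n (pmf (wk \<mu> n) x) ^ n \<le> (1 / R) ^ n" using n by (intro power_mono) auto
  then show ?thesis using n by (simp add: real_root_pow_pos2)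
qed

lemma ldp':
  assumes "B \<in> sets borel"
  shows "- (INF q\<in>interior B. L q) \<le>
      liminf (\<lambda>n. ereal (1 / real n) * ln_prob (measure_pmf.prob (wk \<mu> n) {x. real (length x) / real n \<in> B}))"
    and "limsup (\<lambda>n. ereal (1 / real n) * ln_prob (measure_pmf.prob (wk \<mu> n) {x. real (length x) / real n \<in> B}))
      \<le> - (INF q\<in>closure B. L q)"
  using ldp assms random_walk_law[OF \<mu>_steps rw, of "\<lambda>z. real (length z) / real n \<in> B" n for n]
  by (auto simp: ldp_rate_function_def Let_def)

lemma ln_prob_gt:
  assumes "n > 0" "ereal (- l) < ereal (1 / real n) * ln_prob p" "0 \<le> p"
  shows "exp (- real n * l) \<le> p"
proof -
  have "p \<noteq> 0" using assms by (auto simp: ln_prob_def)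
  then have "p > 0" using assms(3) by simp
  then have "- l < ln p / real n" using assms by (simp add: ln_prob_def)
  then have "- real n * l < ln p" using assms(1) by (simp add: field_simps)
  then have "exp (- real n * l) < exp (ln p)" by (simp only: exp_less_mono)
  then show ?thesis using \<open>p > 0\<close> by simp
qed

lemma ln_prob_lt:
  assumes "n > 0" "ereal (1 / real n) * ln_prob p < ereal (- l)" "0 \<le> p"
  shows "p < exp (- real n * l)"
proof (cases "p = 0")
  case False
  then have "p > 0" using assms(3) by simp
  then have "ln p / real n < - l" using assms by (simp add: ln_prob_def)
  then have "ln p < - real n * l" using assms(1) by (simp add: field_simps)
  then have "exp (ln p) < exp (- real n * l)" by (simp only: exp_less_mono)
  then show ?thesis using \<open>p > 0\<close> by simp
qed simp

lemma ldp_lower: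
  assumes "L q < ereal l" "\<delta> > 0"
  shows "\<forall>\<^sub>F n in sequentially. exp (- real n * l) \<le>
    measure_pmf.prob (wk \<mu> n) {x. real (length x) / real n \<in> {q - \<delta><..<q + \<delta>}}"
proof -
  have "ereal (- l) < - L q" using assms(1) by (cases "L q") auto
  also have "- L q \<le> - (INF q\<in>interior {q - \<delta><..<q + \<delta>}. L q)"
    using assms(2) by (simp add: INF_lower)
  also have "\<dots> \<le> liminf (\<lambda>n. ereal (1 / real n) * ln_prob (measure_pmf.prob (wk \<mu> n)
      {x. real (length x) / real n \<in> {q - \<delta><..<q + \<delta>}}))"
    by (rule ldp'(1)) simp
  finally have "\<forall>\<^sub>F n in sequentially. ereal (- l) < ereal (1 / real n) * ln_prob (measure_pmf.prob (wk \<mu> n)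
      {x. real (length x) / real n \<in> {q - \<delta><..<q + \<delta>}})"
    by (rule less_LiminfD)
  then show ?thesis
    using eventually_gt_at_top[of 0] by eventually_elim (rule ln_prob_gt, auto)
qed

lemma ldp_upper:
  assumes "\<exists>\<^sub>F n in sequentially. exp (- real n * l) \<le>
    measure_pmf.prob (wk \<mu> n) {x. real (length x) / real n \<in> {a..b}}"
  shows "(INF q\<in>{a..b}. L q) \<le> ereal l"
proof (rule ccontr)
  assume "\<not> ?thesis"
  then have "- (INF q\<in>{a..b}. L q) < ereal (- l)"
    by (cases "INF q\<in>{a..b}. L q") auto
  with ldp'(2)[of "{a..b}"] have "limsup (\<lambda>n. ereal (1 / real n) * ln_prob (measure_pmf.prob (wk \<mu> n)
      {x. real (length x) / real n \<in> {a..b}})) < ereal (- l)"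
    by simp
  then have "\<forall>\<^sub>F n in sequentially. ereal (1 / real n) * ln_prob (measure_pmf.prob (wk \<mu> n)
      {x. real (length x) / real n \<in> {a..b}}) < ereal (- l)"
    by (rule Limsup_lessD)
  then have "\<forall>\<^sub>F n in sequentially. \<not> exp (- real n * l) \<le>
    measure_pmf.prob (wk \<mu> n) {x. real (length x) / real n \<in> {a..b}}"
    using eventually_gt_at_top[of 0]
  proof eventually_elim
    case (elim n)
    then show ?case using ln_prob_lt[of n _ l] by (simp add: not_le)
  qed
  with assms show False by (simp add: frequently_def)
qed

text \<open>Lower semicontinuity in the form in which it is applied: it suffices to bound
  \<open>L\<close> at points arbitrarily near \<open>q\<close>, with arbitrarily small
  excess.\<close>

lemma L_le:
  assumes "\<And>\<delta>. \<delta> > 0 \<Longrightarrow> \<exists>q'. \<bar>q' - q\<bar> \<le> \<delta> \<and> L q' \<le> ereal (l + \<delta>)"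
  shows "L q \<le> ereal l"
proof (rule ereal_le_epsilon2)
  fix e :: real assume e: "0 < e"
  have "q \<in> closure {q. L q \<le> ereal (l + e)}"
    unfolding closure_approachable
  proof (intro allI impI)
    fix d :: real assume d: "0 < d"
    obtain q' where "\<bar>q' - q\<bar> \<le> min e (d / 2)" "L q' \<le> ereal (l + min e (d / 2))"
      using assms[of "min e (d / 2)"] e d by auto
    moreover have "ereal (l + min e (d / 2)) \<le> ereal (l + e)" by simp
    ultimately have "q' \<in> {q. L q \<le> ereal (l + e)}" "dist q' q < d"
      using d by (auto simp: dist_real_def intro: order_trans)
    then show "\<exists>y\<in>{q. L q \<le> ereal (l + e)}. dist y q < d" by blast
  qed
  then show "L q \<le> ereal l + ereal e" using closure_closed[OF L_closed] by auto
qed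

lemma L_le_frequently:
  assumes "\<And>\<delta>. \<delta> > 0 \<Longrightarrow> \<exists>\<^sub>F n in sequentially. exp (- real n * (l + \<delta>)) \<le>
    measure_pmf.prob (wk \<mu> n) {x. real (length x) / real n \<in> {q - \<delta>..q + \<delta>}}"
  shows "L q \<le> ereal l"
proof (rule L_le)
  fix \<delta> :: real assume d: "\<delta> > 0"
  have "(INF q\<in>{q - \<delta>/2..q + \<delta>/2}. L q) \<le> ereal (l + \<delta>/2)"
    using ldp_upper[OF assms[of "\<delta>/2"]] d by simp
  also have "\<dots> < ereal (l + \<delta>)" using d by simp
  finally obtain q' where "q' \<in> {q - \<delta>/2..q + \<delta>/2}" "L q' < ereal (l + \<delta>)"
    by (auto simp: INF_less_iff)
  then show "\<exists>q'. \<bar>q' - q\<bar> \<le> \<delta> \<and> L q' \<le> ereal (l + \<delta>)"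
    using d by (intro exI[of _ q']) auto
qed

text \<open>A Fekete argument. Joining \<open>k\<close> copies of one pair \<open>(n, m)\<close>
  keeps the shifted ratio fixed and multiplies the logarithm of the probability by \<open>k\<close>;
  the upper bound of the large deviation principle along these times bounds \<open>L\<close>. So a
  single pair already gives an inequality, with no limit in \<open>n\<close>.\<close>

lemma L_le_plen':
  assumes "plen' n m > 0"
  shows "L (real (Suc m) / real (Suc n)) \<le> ereal (- ln (plen' n m) / real (Suc n))"
proof (rule L_le_frequently)
  fix \<delta> :: real assume d: "\<delta> > 0"
  define l where "l = - ln (plen' n m) / real (Suc n)"
  define q where "q = real (Suc m) / real (Suc n)"
  \<comment> \<open>Equivalently \<open>Suc (N k) = Suc k * Suc n\<close>, and likewise for
    \<open>M\<close>, so that the ratio of the successors is \<open>q\<close> for every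
    \<open>k\<close>.\<close>
  define N where "N k = n + k * Suc n" for k
  define M where "M k = m + k * Suc m" for k
  have mn: "m \<le> n" using assms plen_eq_0[of n m] by (force simp: plen'_def)
  then have MN: "M k \<le> N k" for k unfolding M_def N_def by (intro add_mono mult_mono) auto
  have Nk: "N k \<ge> k" for k by (simp add: N_def)
  have q: "q = real (Suc (M k)) / real (Suc (N k))" for k
  proof -
    have "real (Suc (M k)) = real (Suc k) * real (Suc m)" "real (Suc (N k)) = real (Suc k) * real (Suc n)"
      by (simp_all add: M_def N_def algebra_simps)
    then show ?thesis by (simp add: q_def)
  qed
  have lim: "filterlim N at_top sequentially"
    by (rule filterlim_at_top_mono[OF filterlim_ident]) (use Nk in auto)
  have bd: "exp (- (real (N k) + 1) * l) \<le> plen (N k) (M k)" for k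
  proof -
    have "plen' n m ^ Suc k \<le> plen' (N k) (M k)"
      by (rule plen'_power) (auto simp: N_def M_def)
    also have "\<dots> \<le> plen (N k) (M k)" by (rule plen'_le)
    also have "plen' n m ^ Suc k = exp (real (Suc k) * ln (plen' n m))"
      using assms by (simp only: exp_of_nat_mult exp_ln)
    also have "real (Suc k) * ln (plen' n m) = - (real (N k) + 1) * l"
      by (simp add: l_def N_def field_simps)
    finally show ?thesis .
  qed
  \<comment> \<open>The first bound absorbs the \<open>+ 1\<close> in the exponent of
    \<open>bd\<close>, the second the difference between the ratio \<open>M k / N k\<close> and the
    ratio \<open>q\<close> of the successors, which is at most \<open>1 / N k\<close>.\<close>
  obtain K where K: "real K > l / \<delta>" "real K > 1 / \<delta>" "K > 0"
  proof -
    obtain K where "real K > max (max (l / \<delta>) (1 / \<delta>)) 0" using reals_Archimedean2 by blast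
    then show ?thesis using that[of K] by simp
  qed
  have key: "exp (- real (N k) * (l + \<delta>)) \<le>
      measure_pmf.prob (wk \<mu> (N k)) {x. real (length x) / real (N k) \<in> {q - \<delta>..q + \<delta>}}" if "k \<ge> K" for k
  proof -
    have NK: "real (N k) \<ge> real K" using Nk[of k] that by linarith
    then have "real (N k) * \<delta> \<ge> real K * \<delta>" using d by simp
    moreover have "real K * \<delta> > l" using K(1) d by (simp add: field_simps)
    ultimately have "- real (N k) * (l + \<delta>) \<le> - (real (N k) + 1) * l" by (simp add: algebra_simps)
    then have "exp (- real (N k) * (l + \<delta>)) \<le> plen (N k) (M k)"
      using bd[of k] by (meson exp_le_cancel_iff order_trans)
    also have "\<dots> \<le> measure_pmf.prob (wk \<mu> (N k)) {x. real (length x) / real (N k) \<in> {q - \<delta>..q + \<delta>}}"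
      unfolding plen_eq_prob
    proof (rule measure_pmf.finite_measure_mono)
      have N0: "real (N k) > 0" using NK K(3) by linarith
      have "\<bar>real (M k) / real (N k) - q\<bar> = \<bar>real (M k) - real (N k)\<bar> / (real (N k) * real (Suc (N k)))"
      proof -
        have "real (M k) / real (N k) - q = (real (M k) - real (N k)) / (real (N k) * real (Suc (N k)))"
          unfolding q[of k] using N0 by (simp add: field_simps)
        then show ?thesis by (simp add: abs_mult)
      qed
      also have "\<dots> \<le> real (Suc (N k)) / (real (N k) * real (Suc (N k)))"
        using MN[of k] by (intro divide_right_mono) auto
      also have "\<dots> = 1 / real (N k)" by simp
      also have "\<dots> \<le> 1 / real K" using NK K(3) by (intro divide_left_mono) auto
      also have "\<dots> \<le> \<delta>" using K(2,3) d by (simp add: field_simps)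
      finally have "\<bar>real (M k) / real (N k) - q\<bar> \<le> \<delta>" .
      then show "{x. length x = M k} \<subseteq> {x. real (length x) / real (N k) \<in> {q - \<delta>..q + \<delta>}}"
        by (auto simp: abs_le_iff)
    qed simp
    finally show ?thesis .
  qed
  have "\<exists>n\<ge>n0. exp (- real n * (l + \<delta>)) \<le>
      measure_pmf.prob (wk \<mu> n) {x. real (length x) / real n \<in> {q - \<delta>..q + \<delta>}}" for n0
    using key[of "max K n0"] Nk[of "max K n0"] by (intro exI[of _ "N (max K n0)"]) auto
  then show "\<exists>\<^sub>F i in sequentially. exp (- real i * (- ln (plen' n m) / real (Suc n) + \<delta>))
        \<le> measure_pmf.prob (wk \<mu> i) {x. real (length x) / real i
              \<in> {real (Suc m) / real (Suc n) - \<delta>..real (Suc m) / real (Suc n) + \<delta>}}"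
    unfolding frequently_sequentially l_def[symmetric] q_def[symmetric] by blast
qed

lemma plen'_le_exp:
  assumes "ereal l \<le> L (real (Suc m) / real (Suc n))"
  shows "plen' n m \<le> exp (- real (Suc n) * l)"
proof (cases "plen' n m > 0")
  case True
  then have "ereal l \<le> ereal (- ln (plen' n m) / real (Suc n))"
    using assms L_le_plen' order_trans by blast
  then have "ln (plen' n m) \<le> - real (Suc n) * l" by (simp add: field_simps)
  then have "exp (ln (plen' n m)) \<le> exp (- real (Suc n) * l)" by (simp only: exp_le_cancel_iff)
  then show ?thesis using True by simp
next
  case False
  then show ?thesis by (meson exp_ge_zero not_le order_trans less_imp_le)
qed

text \<open>At time \<open>n\<close> there are only \<open>n + 1\<close> possible lengths, so one of
  those in the window carries at least that fraction of the probability; the polynomial factor is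
  absorbed by a rate \<open>l'\<close> strictly between \<open>L q\<close> and
  \<open>l\<close>.\<close>

lemma ldp_lower_plen:
  assumes "L q < ereal l" "\<delta> > 0"
  shows "\<forall>\<^sub>F n in sequentially. \<exists>m. \<bar>real m / real n - q\<bar> < \<delta> \<and> exp (- real n * l) \<le> plen n m"
proof -
  obtain l' where l': "L q < ereal l'" "l' < l" using assms(1) ereal_dense2 by force
  have lim: "((\<lambda>n. real (Suc n) * exp (- real n * (l - l'))) \<longlongrightarrow> 0) at_top"
    using l'(2) by real_asymp
  have "\<forall>\<^sub>F n in sequentially. real (Suc n) * exp (- real n * (l - l')) < 1"
    using order_tendstoD(2)[OF lim] by simp
  with ldp_lower[OF l'(1) assms(2)] show ?thesis
  proof eventually_elim
    case (elim n)
    define A where "A = {m\<in>{..n}. real m / real n \<in> {q - \<delta><..<q + \<delta>}}"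
    show ?case
    proof (rule ccontr)
      assume c: "\<not> ?thesis"
      then have le: "plen n m \<le> exp (- real n * l)" if "m \<in> A" for m
        using that by (auto simp: A_def abs_less_iff not_le less_imp_le)
      have "measure_pmf.prob (wk \<mu> n) {x. real (length x) / real n \<in> {q - \<delta><..<q + \<delta>}}
          = measure_pmf.prob (wk \<mu> n) (\<Union>m\<in>A. {x. length x = m})"
        by (rule measure_pmf.finite_measure_eq_AE)
           (use set_wk[OF \<mu>_steps] in \<open>auto simp: A_def AE_measure_pmf_iff\<close>)
      also have "\<dots> \<le> (\<Sum>m\<in>A. plen n m)"
        unfolding plen_eq_prob by (rule measure_pmf.finite_measure_subadditive_finite) (auto simp: A_def)
      also have "\<dots> \<le> (\<Sum>m\<in>A. exp (- real n * l))" by (intro sum_mono le)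
      also have "\<dots> \<le> (\<Sum>m\<in>{..n}. exp (- real n * l))" by (intro sum_mono2) (auto simp: A_def)
      also have "\<dots> = exp (- real n * l') * (real (Suc n) * exp (- real n * (l - l')))"
        by (simp add: algebra_simps flip: exp_add)
      also have "\<dots> < exp (- real n * l')" using elim(2) by simp
      finally show False using elim(1) by simp
    qed
  qed
qed

end

section \<open>Zeros, value at the origin and convexity of the rate function\<close>

context rated_walk
begin

text \<open>The walk satisfies \<open>|Z\<^sub>n| / n \<in> {0..1}\<close> with probability one, so
  the infimum of \<open>L\<close> there is 0; it is attained because sublevel sets are closed and
  the interval is compact. The zero takes the place of the speed of the walk, without a law of large
  numbers.\<close>

lemma L_zero_ex: "\<exists>q\<in>{0..1}. L q = 0"
proof -
  define C where "C k = {0..1} \<inter> {q. L q \<le> ereal (1 / real (Suc k))}" for k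
  have inf: "(INF q\<in>{0..1}. L q) \<le> ereal 0"
  proof (rule ldp_upper)
    have "measure_pmf.prob (wk \<mu> n) {x. real (length x) / real n \<in> {0..1}} = measure_pmf.prob (wk \<mu> n) UNIV" for n
      using set_wk[OF \<mu>_steps, of _ n]
      by (intro measure_pmf.finite_measure_eq_AE) (auto simp: AE_measure_pmf_iff divide_le_eq_1)
    then show "\<exists>\<^sub>F n in sequentially. exp (- real n * 0)
         \<le> measure_pmf.prob (wk \<mu> n) {x. real (length x) / real n \<in> {0..1}}"
      by simp
  qed
  have "\<Inter>(range C) \<noteq> {}"
  proof (rule compact_nest)
    show "compact (C k)" for k unfolding C_def by (intro compact_Int_closed L_closed) simp
    show "C k \<noteq> {}" for k
    proof -
      have "(INF q\<in>{0..1}. L q) < ereal (1 / real (Suc k))" using inf by (rule le_less_trans) simp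
      then show ?thesis by (auto simp: C_def INF_less_iff intro: less_imp_le)
    qed
    show "C m \<subseteq> C k" if "k \<le> m" for k m
    proof -
      have "ereal (1 / real (Suc m)) \<le> ereal (1 / real (Suc k))"
        using that by (simp add: frac_le)
      then show ?thesis by (auto simp: C_def intro: order_trans)
    qed
  qed
  then obtain q where q: "\<And>k. q \<in> C k" by auto
  have "L q \<le> ereal 0"
  proof (rule L_le)
    fix \<delta> :: real assume d: "0 < \<delta>"
    then obtain k where k: "1 / real (Suc k) < \<delta>" using nat_approx_posE by blast
    have "L q \<le> ereal (1 / real (Suc k))" using q[of k] by (simp add: C_def)
    also have "\<dots> \<le> ereal (0 + \<delta>)" using k by simp
    finally show "\<exists>q'. \<bar>q' - q\<bar> \<le> \<delta> \<and> L q' \<le> ereal (0 + \<delta>)"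
      using d by (intro exI[of _ q]) auto
  qed
  moreover have "0 \<le> L q" by (rule L_nonneg)
  ultimately have "L q = 0" by (simp add: zero_ereal_def[symmetric] order_antisym)
  moreover have "q \<in> {0..1}" using q[of 0] by (simp add: C_def)
  ultimately show ?thesis by blast
qed

text \<open>Upper bound: returning to the identity is one way of having small length. Lower bound: a
  ball of radius \<delta> n has about \<open>Q\<close> to the power \<delta> n elements, each
  reached with probability at most \<open>(1 / R) ^ n\<close>.\<close>

lemma L_0: "L 0 = ereal (ln R)"
proof (rule antisym)
  show "L 0 \<le> ereal (ln R)"
  proof (rule L_le_frequently)
    fix \<delta> :: real assume d: "0 < \<delta>"
    have "\<exists>\<^sub>F n in sequentially. ereal (exp (- (ln R + \<delta>))) < ereal (root n (pmf (wk \<mu> n) []))"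
    proof (rule ccontr)
      assume "\<not> ?thesis"
      then have "\<forall>\<^sub>F n in sequentially. ereal (root n (pmf (wk \<mu> n) [])) \<le> ereal (exp (- (ln R + \<delta>)))"
        by (simp add: not_frequently not_less)
      then have "limsup (\<lambda>n. ereal (root n (pmf (wk \<mu> n) []))) \<le> ereal (exp (- (ln R + \<delta>)))"
        by (rule Limsup_bounded)
      then have "1 / R \<le> exp (- (ln R + \<delta>))" by (simp add: spec')
      also have "\<dots> = exp (- \<delta>) / R" using R1 by (simp add: exp_diff exp_minus field_simps)
      finally show False using d R1 by (simp add: field_simps)
    qed
    moreover have "\<forall>\<^sub>F n in sequentially. n > (0::nat)" by (rule eventually_gt_at_top)
    ultimately have "\<exists>\<^sub>F n in sequentially. ereal (exp (- (ln R + \<delta>))) < ereal (root n (pmf (wk \<mu> n) [])) \<and> n > 0"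
      by (rule frequently_eventually_frequently)
    then show "\<exists>\<^sub>F n in sequentially. exp (- real n * (ln R + \<delta>))
        \<le> measure_pmf.prob (wk \<mu> n) {x. real (length x) / real n \<in> {0 - \<delta>..0 + \<delta>}}"
    proof (rule frequently_mono[rotated], intro allI impI, elim conjE)
      fix n :: nat assume n: "n > 0" and lt: "ereal (exp (- (ln R + \<delta>))) < ereal (root n (pmf (wk \<mu> n) []))"
      have "exp (- (ln R + \<delta>)) ^ n \<le> root n (pmf (wk \<mu> n) []) ^ n"
        using lt by (intro power_mono) auto
      also have "\<dots> = pmf (wk \<mu> n) []" using n by (simp add: real_root_pow_pos2)
      also have "exp (- (ln R + \<delta>)) ^ n = exp (- real n * (ln R + \<delta>))"
        by (simp add: algebra_simps flip: exp_of_nat_mult)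
      also have "pmf (wk \<mu> n) [] \<le> measure_pmf.prob (wk \<mu> n) {x. real (length x) / real n \<in> {0 - \<delta>..0 + \<delta>}}"
        unfolding measure_pmf_single[symmetric] using d by (intro measure_pmf.finite_measure_mono) auto
      finally show "exp (- real n * (ln R + \<delta>))
        \<le> measure_pmf.prob (wk \<mu> n) {x. real (length x) / real n \<in> {0 - \<delta>..0 + \<delta>}}" .
    qed
  qed
  show "ereal (ln R) \<le> L 0"
  proof (rule ccontr)
    assume "\<not> ?thesis"
    then have "L 0 < ereal (ln R)" by simp
    then obtain l where l: "L 0 < ereal l" "l < ln R" using ereal_dense2 by force
    define Q where "Q = real (card (UNIV :: 'g letter set))"
    have Q2: "Q \<ge> 2" using card2 by (simp add: Q_def card_letters)
    \<comment> \<open>With this radius the volume of the ball costs only half of the gap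
      \<open>ln R - l\<close> in the exponent.\<close>
    define \<delta> where "\<delta> = (ln R - l) / (2 * ln Q)"
    have lnQ: "ln Q > 0" using Q2 by simp
    have d: "\<delta> > 0" using l(2) lnQ by (simp add: \<delta>_def)
    have geo: "(\<Sum>i\<le>k. Q ^ i) \<le> Q ^ Suc k" for k
    proof (induction k)
      case (Suc k)
      have "(\<Sum>i\<le>Suc k. Q ^ i) \<le> 2 * Q ^ Suc k" using Suc by simp
      also have "\<dots> \<le> Q * Q ^ Suc k" using Q2 by (intro mult_right_mono) auto
      finally show ?case by simp
    qed (use Q2 in simp)
    have le: "measure_pmf.prob (wk \<mu> n) {x. real (length x) / real n \<in> {0 - \<delta><..<0 + \<delta>}}
         \<le> exp ((\<delta> * real n + 1) * ln Q - real n * ln R)" if n: "n > 0" for n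
    proof -
      define k where "k = nat \<lfloor>\<delta> * real n\<rfloor>"
      define S where "S = {x :: 'g word. set x \<subseteq> UNIV \<and> length x \<le> k}"
      have fS: "finite S" unfolding S_def by (rule finite_lists_length_le) simp
      have "{x :: 'g word. real (length x) / real n \<in> {0 - \<delta><..<0 + \<delta>}} \<subseteq> S"
        using n d by (auto simp: S_def k_def le_nat_iff le_floor_iff pos_divide_less_eq less_imp_le)
      then have "measure_pmf.prob (wk \<mu> n) {x. real (length x) / real n \<in> {0 - \<delta><..<0 + \<delta>}}
          \<le> measure_pmf.prob (wk \<mu> n) S"
        by (intro measure_pmf.finite_measure_mono) auto
      also have "\<dots> = (\<Sum>x\<in>S. pmf (wk \<mu> n) x)" using fS by (simp add: measure_measure_pmf_finite)
      also have "\<dots> \<le> (\<Sum>x\<in>S. (1 / R) ^ n)" by (intro sum_mono pmf_wk_le)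
      also have "\<dots> = real (card S) * (1 / R) ^ n" by simp
      also have "real (card S) = (\<Sum>i\<le>k. Q ^ i)"
        unfolding S_def by (subst card_lists_length_le) (auto simp: Q_def)
      also have "\<dots> \<le> Q ^ Suc k" by (rule geo)
      also have "Q ^ Suc k = Q powr real (Suc k)" using Q2 by (subst powr_realpow) auto
      also have "\<dots> \<le> Q powr (\<delta> * real n + 1)"
        using Q2 d by (intro powr_mono) (auto simp: k_def)
      also have "Q powr (\<delta> * real n + 1) * (1 / R) ^ n = exp ((\<delta> * real n + 1) * ln Q - real n * ln R)"
      proof -
        have "exp (real n * ln R) = R ^ n" using R1 by (simp add: exp_of_nat_mult)
        then show ?thesis using Q2 R1 by (simp add: powr_def exp_diff power_one_over field_simps)
      qed
      finally show ?thesis using R1 by (simp add: mult_right_mono)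
    qed
    have "\<forall>\<^sub>F n in sequentially. exp (- real n * l) \<le> exp ((\<delta> * real n + 1) * ln Q - real n * ln R)"
      using ldp_lower[OF l(1) d] eventually_gt_at_top[of 0]
    proof eventually_elim
      case (elim n)
      show ?case using order_trans[OF elim(1) le[OF elim(2)]] .
    qed
    then have "\<forall>\<^sub>F n in sequentially. real n * ((ln R - l) / 2) \<le> ln Q"
    proof eventually_elim
      case (elim n)
      then have "- real n * l \<le> \<delta> * real n * ln Q + ln Q - real n * ln R" by (simp add: algebra_simps)
      moreover have "\<delta> * real n * ln Q = real n * ((ln R - l) / 2)" using lnQ by (simp add: \<delta>_def)
      ultimately show ?case by (simp add: field_simps)
    qed
    then obtain N where N: "\<And>n. n \<ge> N \<Longrightarrow> real n * ((ln R - l) / 2) \<le> ln Q"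
      by (auto simp: eventually_sequentially)
    obtain n where n: "real n > ln Q / ((ln R - l) / 2)" using reals_Archimedean2 by blast
    have "real (max n N) * ((ln R - l) / 2) \<le> ln Q" by (rule N) simp
    moreover have "real n * ((ln R - l) / 2) > ln Q" using n l(2) by (simp add: field_simps)
    moreover have "real n * ((ln R - l) / 2) \<le> real (max n N) * ((ln R - l) / 2)"
      using l(2) by (intro mult_right_mono) auto
    ultimately show False by linarith
  qed
qed

text \<open>At one common time \<open>n\<close> there are likely lengths \<open>m1\<close> and
  \<open>m2\<close> for the two speeds. Joining \<open>k1\<close> blocks of the first kind and
  \<open>k2\<close> of the second gives a pair whose ratio and rate are nearly the two convex
  combinations, and \<open>L_le_plen'\<close> applies to that pair.\<close>

lemma L_convex_aux:
  assumes L1: "L q1 < ereal l1" and L2: "L q2 < ereal l2" and \<theta>: "0 \<le> \<theta>" "\<theta> \<le> 1"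
  shows "L ((1 - \<theta>) * q1 + \<theta> * q2) \<le> ereal ((1 - \<theta>) * l1 + \<theta> * l2)"
proof (rule L_le)
  fix \<delta> :: real assume d: "0 < \<delta>"
  have l12: "l1 > 0" "l2 > 0"
    using L1 L2 L_nonneg[of q1] L_nonneg[of q2] by (metis ereal_less(2) le_less_trans)+
  \<comment> \<open>\<open>H\<close> dominates both differences \<open>|q2 - q1|\<close> and
    \<open>|l2 - l1|\<close>, so that replacing \<theta> by a rational weight \<open>t\<close> is
    negligible for the position and for the rate at once.\<close>
  define H where "H = 1 + \<bar>q1\<bar> + \<bar>q2\<bar> + l1 + l2"
  have H: "H \<ge> 1" using l12 by (simp add: H_def)
  \<comment> \<open>The cost of passing from \<open>plen\<close> to \<open>plen'\<close>; divided by
    \<open>n\<close> it disappears.\<close>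
  define C where "C = - ln cmin"
  have C: "C \<ge> 0" using cmin_pos cmin_le_1 by (simp add: C_def)
  have "\<forall>\<^sub>F n in sequentially. real n > max (4 / \<delta>) (2 * C / \<delta>)"
    by (rule eventually_gt_at_top[THEN eventually_compose_filterlim])
       (rule filterlim_real_sequentially)
  moreover have "\<delta> / 4 > 0" using d by simp
  ultimately obtain n m1 m2 where n: "real n > max (4 / \<delta>) (2 * C / \<delta>)"
    and m1: "\<bar>real m1 / real n - q1\<bar> < \<delta> / 4" "exp (- real n * l1) \<le> plen n m1"
    and m2: "\<bar>real m2 / real n - q2\<bar> < \<delta> / 4" "exp (- real n * l2) \<le> plen n m2"
  proof -
    assume *: "\<forall>\<^sub>F n in sequentially. real n > max (4 / \<delta>) (2 * C / \<delta>)" "\<delta> / 4 > 0"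
      and **: "\<And>n m1 m2. real n > max (4 / \<delta>) (2 * C / \<delta>) \<Longrightarrow> \<bar>real m1 / real n - q1\<bar> < \<delta> / 4 \<Longrightarrow>
          exp (- real n * l1) \<le> plen n m1 \<Longrightarrow> \<bar>real m2 / real n - q2\<bar> < \<delta> / 4 \<Longrightarrow>
          exp (- real n * l2) \<le> plen n m2 \<Longrightarrow> thesis"
    from eventually_happens'[OF sequentially_bot
      eventually_conj[OF *(1) eventually_conj[OF ldp_lower_plen[OF L1 *(2)] ldp_lower_plen[OF L2 *(2)]]]]
    obtain n where "real n > max (4 / \<delta>) (2 * C / \<delta>)"
      "\<exists>m. \<bar>real m / real n - q1\<bar> < \<delta> / 4 \<and> exp (- real n * l1) \<le> plen n m"
      "\<exists>m. \<bar>real m / real n - q2\<bar> < \<delta> / 4 \<and> exp (- real n * l2) \<le> plen n m"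
      by auto
    then show thesis using ** by blast
  qed
  have n0: "real n > 0" using n d by (smt (verit) divide_pos_pos max.cobounded1)
  have pos: "plen' n m1 > 0" "plen' n m2 > 0"
    using m1(2) m2(2) cmin_pos exp_gt_zero[of "- real n * l1"] exp_gt_zero[of "- real n * l2"]
    unfolding plen'_def by (metis less_le_trans mult_pos_pos)+
  have mn: "m1 \<le> n" "m2 \<le> n"
    using pos plen_eq_0[of n m1] plen_eq_0[of n m2] by (force simp: plen'_def)+
  define x1 where "x1 = real (Suc m1) / real (Suc n)"
  define x2 where "x2 = real (Suc m2) / real (Suc n)"
  have xm: "\<bar>real (Suc m) / real (Suc n) - real m / real n\<bar> \<le> \<delta> / 4" if "m \<le> n" for m
  proof -
    have "real (Suc m) / real (Suc n) - real m / real n = (real n - real m) / (real n * real (Suc n))"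
      using n0 by (simp add: field_simps)
    then have "\<bar>real (Suc m) / real (Suc n) - real m / real n\<bar> = (real n - real m) / (real n * real (Suc n))"
      using that by simp
    also have "\<dots> \<le> real (Suc n) / (real n * real (Suc n))" by (intro divide_right_mono) auto
    also have "\<dots> = 1 / real n" by simp
    also have "\<dots> \<le> \<delta> / 4" using n n0 d by (simp add: field_simps)
    finally show ?thesis .
  qed
  have x: "\<bar>x1 - q1\<bar> \<le> \<delta> / 2" "\<bar>x2 - q2\<bar> \<le> \<delta> / 2"
    using xm[OF mn(1)] xm[OF mn(2)] m1(1) m2(1) unfolding x1_def x2_def by linarith+
  have lnp: "- ln (plen' n m) \<le> C + real (Suc n) * l"
    if "exp (- real n * l) \<le> plen n m" "l > 0" for m l
  proof -
    have "plen n m > 0" using that(1) by (meson exp_gt_zero less_le_trans)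
    then have "- real n * l \<le> ln (plen n m)" using that(1) by (simp add: ln_ge_iff)
    moreover have "ln (plen' n m) = ln cmin + ln (plen n m)"
      unfolding plen'_def using cmin_pos \<open>plen n m > 0\<close> by (rule ln_mult_pos)
    ultimately have "- ln (plen' n m) \<le> C + real n * l" by (simp add: C_def)
    then show ?thesis using that(2) by (simp add: algebra_simps)
  qed
  obtain k where k: "real k > 2 * H / \<delta>" using reals_Archimedean2 by blast
  have k0: "real k > 0" using k H d by (smt (verit) divide_pos_pos)
  define k2 where "k2 = nat \<lfloor>\<theta> * real k\<rfloor>"
  have k2: "real k2 \<le> \<theta> * real k" "real k2 > \<theta> * real k - 1"
    using \<theta> by (auto simp: k2_def)
  have k2k: "k2 \<le> k"
  proof -
    have "\<theta> * real k \<le> 1 * real k" using \<theta> by (intro mult_right_mono) auto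
    then show ?thesis using k2(1) by simp
  qed
  define k1 where "k1 = k - k2"
  define t where "t = real k2 / real k"
  have t: "0 \<le> t" "t \<le> 1" "1 - t = real k1 / real k"
    using k0 k2k by (auto simp: t_def k1_def field_simps of_nat_diff)
  have t\<theta>: "\<bar>t - \<theta>\<bar> \<le> 1 / real k"
  proof -
    have "t \<le> \<theta>" using k2(1) k0 by (simp add: t_def pos_divide_le_eq)
    moreover have "\<theta> - 1 / real k \<le> t"
    proof -
      have "\<theta> - 1 / real k = (\<theta> * real k - 1) / real k" using k0 by (simp add: diff_divide_distrib)
      also have "\<dots> \<le> t" unfolding t_def using k2(2) by (intro divide_right_mono) auto
      finally show ?thesis .
    qed
    ultimately show ?thesis by simp
  qed
  have t\<theta>H: "\<bar>t - \<theta>\<bar> * H \<le> \<delta> / 2"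
  proof -
    have "\<bar>t - \<theta>\<bar> * H \<le> 1 / real k * H" using t\<theta> H by (intro mult_right_mono) auto
    also have "\<dots> \<le> \<delta> / 2" using k k0 d by (simp add: field_simps)
    finally show ?thesis .
  qed
  define N where "N = k * Suc n - 1"
  define M where "M = k1 * Suc m1 + k2 * Suc m2 - 1"
  have kk: "k1 + k2 = k" using k2k by (simp add: k1_def)
  have N: "Suc N = (k1 + k2) * Suc n" using k0 kk by (simp add: N_def)
  have M: "Suc M = k1 * Suc m1 + k2 * Suc m2"
  proof -
    have "k1 * Suc m1 + k2 * Suc m2 \<ge> k" using kk by (metis add_mono le_add1 mult_Suc_right)
    then show ?thesis using k0 by (simp add: M_def)
  qed
  have pw: "plen' n m1 ^ k1 * plen' n m2 ^ k2 \<le> plen' N M" by (rule plen'_power2[OF N M])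
  have pwpos: "0 < plen' n m1 ^ k1 * plen' n m2 ^ k2" using pos by simp
  then have posNM: "0 < plen' N M" using pw by linarith
  have rN: "real (Suc N) = real k * real (Suc n)"
    unfolding N kk of_nat_mult ..
  have rM: "real (Suc M) = real k1 * real (Suc m1) + real k2 * real (Suc m2)"
    unfolding M of_nat_add of_nat_mult ..
  have pos_eq: "real (Suc M) / real (Suc N) = (1 - t) * x1 + t * x2"
    using k0 unfolding rN rM t(3) x1_def x2_def by (simp add: t_def add_divide_distrib del: of_nat_Suc)
  have "L (real (Suc M) / real (Suc N)) \<le> ereal (- ln (plen' N M) / real (Suc N))"
    by (rule L_le_plen'[OF posNM])
  also have "- ln (plen' N M) / real (Suc N) \<le> (1 - \<theta>) * l1 + \<theta> * l2 + \<delta>"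
  proof -
    have "ln (plen' n m1 ^ k1 * plen' n m2 ^ k2) \<le> ln (plen' N M)"
      using pw pwpos by (simp add: ln_le_cancel_iff)
    then have "- ln (plen' N M) \<le> real k1 * - ln (plen' n m1) + real k2 * - ln (plen' n m2)"
      using pos by (simp add: ln_mult_pos ln_realpow)
    also have "\<dots> \<le> real k1 * (C + real (Suc n) * l1) + real k2 * (C + real (Suc n) * l2)"
      by (intro add_mono mult_left_mono lnp m1 m2 l12) auto
    also have "\<dots> / real (Suc N) = (1 - t) * l1 + t * l2 + C / real (Suc n)"
    proof -
      have "real k1 * (C + real (Suc n) * l1) + real k2 * (C + real (Suc n) * l2)
          = (real k1 + real k2) * C + (real k1 * l1 + real k2 * l2) * real (Suc n)"
        by (simp add: algebra_simps)
      also have "real k1 + real k2 = real k" using kk by (metis of_nat_add)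
      finally show ?thesis unfolding rN t(3) using k0
        by (simp add: t_def add_divide_distrib del: of_nat_Suc)
    qed
    finally have "- ln (plen' N M) / real (Suc N) \<le> (1 - t) * l1 + t * l2 + C / real (Suc n)"
      by (simp add: divide_right_mono del: of_nat_Suc)
    moreover have "C / real (Suc n) \<le> \<delta> / 2"
    proof -
      have "C / real (Suc n) \<le> C / real n" using C n0 by (intro divide_left_mono) auto
      also have "\<dots> \<le> \<delta> / 2" using n n0 d by (simp add: field_simps)
      finally show ?thesis .
    qed
    moreover have "(1 - t) * l1 + t * l2 \<le> (1 - \<theta>) * l1 + \<theta> * l2 + \<delta> / 2"
    proof -
      have "(1 - t) * l1 + t * l2 - ((1 - \<theta>) * l1 + \<theta> * l2) = (t - \<theta>) * (l2 - l1)"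
        by (simp add: algebra_simps)
      also have "\<dots> \<le> \<bar>t - \<theta>\<bar> * H"
      proof -
        have "(t - \<theta>) * (l2 - l1) \<le> \<bar>t - \<theta>\<bar> * \<bar>l2 - l1\<bar>" by (metis abs_ge_self abs_mult)
        also have "\<dots> \<le> \<bar>t - \<theta>\<bar> * H" using l12 by (intro mult_left_mono) (auto simp: H_def)
        finally show ?thesis .
      qed
      finally show ?thesis using t\<theta>H by linarith
    qed
    ultimately show ?thesis by linarith
  qed
  finally have L: "L (real (Suc M) / real (Suc N)) \<le> ereal ((1 - \<theta>) * l1 + \<theta> * l2 + \<delta>)" by simp
  have "\<bar>real (Suc M) / real (Suc N) - ((1 - \<theta>) * q1 + \<theta> * q2)\<bar> \<le> \<delta>"
  proof -
    have "real (Suc M) / real (Suc N) - ((1 - \<theta>) * q1 + \<theta> * q2)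
       = ((1 - t) * (x1 - q1) + t * (x2 - q2)) + (t - \<theta>) * (q2 - q1)"
      unfolding pos_eq by (simp add: algebra_simps)
    moreover have "\<bar>(1 - t) * (x1 - q1) + t * (x2 - q2)\<bar> \<le> \<delta> / 2"
    proof -
      have "\<bar>(1 - t) * (x1 - q1) + t * (x2 - q2)\<bar> \<le> (1 - t) * \<bar>x1 - q1\<bar> + t * \<bar>x2 - q2\<bar>"
        using t by (intro order_trans[OF abs_triangle_ineq]) (simp add: abs_mult)
      also have "\<dots> \<le> (1 - t) * (\<delta> / 2) + t * (\<delta> / 2)"
        using t x by (intro add_mono mult_left_mono) auto
      also have "\<dots> = \<delta> / 2" by (simp add: field_simps)
      finally show ?thesis .
    qed
    moreover have "\<bar>(t - \<theta>) * (q2 - q1)\<bar> \<le> \<delta> / 2"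
    proof -
      have "\<bar>(t - \<theta>) * (q2 - q1)\<bar> \<le> \<bar>t - \<theta>\<bar> * H"
        unfolding abs_mult using l12 by (intro mult_left_mono) (auto simp: H_def)
      then show ?thesis using t\<theta>H by linarith
    qed
    ultimately show ?thesis by linarith
  qed
  with L show "\<exists>q'. \<bar>q' - ((1 - \<theta>) * q1 + \<theta> * q2)\<bar> \<le> \<delta> \<and> L q' \<le> ereal ((1 - \<theta>) * l1 + \<theta> * l2 + \<delta>)"
    by blast
qed

lemma L_convex:
  assumes "L q1 \<le> ereal l1" "L q2 \<le> ereal l2" "0 \<le> \<theta>" "\<theta> \<le> 1"
  shows "L ((1 - \<theta>) * q1 + \<theta> * q2) \<le> ereal ((1 - \<theta>) * l1 + \<theta> * l2)"
proof (rule ereal_le_epsilon2)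
  fix e :: real assume "0 < e"
  then have "L q1 < ereal (l1 + e)" "L q2 < ereal (l2 + e)"
    using assms(1,2) by (auto intro: le_less_trans)
  from L_convex_aux[OF this assms(3,4)]
  show "L ((1 - \<theta>) * q1 + \<theta> * q2) \<le> ereal ((1 - \<theta>) * l1 + \<theta> * l2) + ereal e"
    by (simp add: algebra_simps)
qed

end

section \<open>The spectrum as a function of the speed\<close>

context rated_walk
begin

lemma rate_sublevel_real:
  assumes "\<alpha> \<in> rate_sublevel L r"
  obtains l where "L \<alpha> = ereal l" "0 \<le> l" "l \<le> ln r"
  using assms L_nonneg[of \<alpha>] by (cases "L \<alpha>") (auto simp: rate_sublevel_def)

lemma L_zero: obtains q where "0 < q" "q \<le> 1" "L q = 0"
proof -
  obtain q where q: "q \<in> {0..1}" "L q = 0" using L_zero_ex by blast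
  have "q \<noteq> 0" using q(2) L_0 R1 by (auto simp: zero_ereal_def)
  with q show ?thesis by (intro that[of q]) auto
qed

lemma L_near_0:
  assumes "L q \<le> ereal l" "0 \<le> \<theta>" "\<theta> \<le> 1"
  shows "L (\<theta> * q) \<le> ereal (ln R - \<theta> * (ln R - l))"
  using L_convex[of 0 "ln R" q l \<theta>] assms by (simp add: L_0 algebra_simps)

text \<open>The negative of the slope of the chord of \<open>L\<close> from 0 to \<open>q\<close>;
  for \<open>r = R\<close> it is the spectrum at \<open>q\<close>. By convexity it can only grow as
  \<open>q\<close> decreases, so its limit at 0 is a supremum, which is how the value at \<alpha> =
  0 is handled from here on.\<close>

definition slope :: "real \<Rightarrow> ereal" where
  "slope q = (L 0 - L q) / ereal q"

lemma slope_antimono: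
  assumes "0 < q" "q \<le> q'"
  shows "slope q' \<le> slope q"
proof (cases "L q'")
  case (real l')
  have "L (q / q' * q') \<le> ereal (ln R - q / q' * (ln R - l'))"
    using assms real by (intro L_near_0) auto
  then have le: "L q \<le> ereal (ln R - q / q' * (ln R - l'))" using assms by simp
  then obtain l where l: "L q = ereal l" using L_nonneg[of q] by (cases "L q") auto
  with le have "l \<le> ln R - q / q' * (ln R - l')" by simp
  then have "(ln R - l') / q' \<le> (ln R - l) / q" using assms by (simp add: field_simps)
  then show ?thesis using assms real l by (simp add: slope_def L_0)
next
  case PInf
  then show ?thesis using assms by (simp add: slope_def L_0)
next
  case MInf
  then show ?thesis using L_nonneg[of q'] by simp
qed

lemma slope_tendsto: "(slope \<longlongrightarrow> (SUP q\<in>{0<..1}. slope q)) (at_right 0)"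
proof (rule order_tendstoI)
  fix a assume "a < (SUP q\<in>{0<..1}. slope q)"
  then obtain q where q: "0 < q" "q \<le> 1" "a < slope q" by (auto simp: less_SUP_iff)
  have "\<forall>\<^sub>F x in at_right 0. x \<in> {0<..<q}" using q(1) by (rule eventually_at_right_real)
  then show "\<forall>\<^sub>F x in at_right 0. a < slope x"
    by eventually_elim (use q slope_antimono in \<open>auto intro: less_le_trans\<close>)
next
  fix a assume a: "(SUP q\<in>{0<..1}. slope q) < a"
  have "\<forall>\<^sub>F x in at_right 0. x \<in> {0<..<(1::real)}" by (rule eventually_at_right_real) simp
  then show "\<forall>\<^sub>F x in at_right 0. slope x < a"
  proof eventually_elim
    case (elim x)
    then have "slope x \<le> (SUP q\<in>{0<..1}. slope q)" by (intro SUP_upper) auto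
    then show ?case using a by (rule le_less_trans)
  qed
qed

lemma spectrum_value_0: "spectrum_value L r 0 = (SUP q\<in>{0<..1}. slope q)"
  using tendsto_Lim[OF _ slope_tendsto] by (simp add: spectrum_value_def slope_def[abs_def])

lemma spectrum_value_pos:
  assumes "\<alpha> > 0" "L \<alpha> = ereal l"
  shows "spectrum_value L r \<alpha> = ereal ((ln r - l) / \<alpha>)"
  using assms by (simp add: spectrum_value_def)

lemma zero_rate_sublevel:
  assumes "0 \<in> rate_sublevel L r" "1 < r" "r \<le> R"
  shows "r = R"
  using assms R1 by (auto simp: rate_sublevel_def L_0)

lemma spectrum_value_nonneg:
  assumes "\<alpha> \<in> rate_sublevel L r"
  shows "0 \<le> spectrum_value L r \<alpha>"
proof (cases "\<alpha> = 0")
  case True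
  obtain q where q: "0 < q" "q \<le> 1" "L q = 0" by (rule L_zero)
  have "0 \<le> slope q" using q R1 by (simp add: slope_def L_0 zero_ereal_def)
  also have "\<dots> \<le> spectrum_value L r 0"
    unfolding spectrum_value_0 using q by (intro SUP_upper) auto
  finally show ?thesis using True by simp
next
  case False
  moreover obtain l where l: "L \<alpha> = ereal l" "0 \<le> l" "l \<le> ln r"
    by (rule rate_sublevel_real[OF assms])
  moreover have "\<alpha> \<ge> 0" using assms by (simp add: rate_sublevel_def)
  ultimately show ?thesis by (simp add: spectrum_value_pos)
qed

text \<open>Convexity towards a zero of the rate function gives approximations whose rate is strictly
  below \<open>ln r\<close>, even when \<open>\<alpha>\<close> is critical.\<close>

lemma approx_speed:
  assumes \<alpha>: "\<alpha> \<in> rate_sublevel L r" and s: "ereal s < spectrum_value L r \<alpha>" and r: "1 < r" "r \<le> R"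
    and e: "\<epsilon> > 0"
  obtains q l where "0 < q" "q \<le> 1" "\<bar>q - \<alpha>\<bar> < \<epsilon>" "L q < ereal l" "l < ln r" "s * q < ln r - l"
proof (cases "\<alpha> = 0")
  case False
  obtain la where la: "L \<alpha> = ereal la" "0 \<le> la" "la \<le> ln r"
    by (rule rate_sublevel_real[OF \<alpha>])
  have a: "0 < \<alpha>" "\<alpha> \<le> 1" using \<alpha> False by (auto simp: rate_sublevel_def)
  obtain z where z: "0 < z" "z \<le> 1" "L z = 0" by (rule L_zero)
  have "s * \<alpha> < ln r - la" using s a la by (simp add: spectrum_value_pos field_simps)
  then have "0 < ln r - (1 - 0) * la - s * ((1 - 0) * \<alpha> + 0 * z)" by simp
  moreover have "((\<lambda>\<theta>. ln r - (1 - \<theta>) * la - s * ((1 - \<theta>) * \<alpha> + \<theta> * z)) \<longlongrightarrow>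
      ln r - (1 - 0) * la - s * ((1 - 0) * \<alpha> + 0 * z)) (at_right 0)"
    by (intro tendsto_intros)
  ultimately have "\<forall>\<^sub>F \<theta> in at_right 0. 0 < ln r - (1 - \<theta>) * la - s * ((1 - \<theta>) * \<alpha> + \<theta> * z)"
    by (rule order_tendstoD(1)[rotated])
  moreover have "((\<lambda>\<theta>. (1 - \<theta>) * \<alpha> + \<theta> * z) \<longlongrightarrow> (1 - 0) * \<alpha> + 0 * z) (at_right 0)"
    by (intro tendsto_intros)
  from tendstoD[OF this e] have "\<forall>\<^sub>F \<theta> in at_right 0. dist ((1 - \<theta>) * \<alpha> + \<theta> * z) \<alpha> < \<epsilon>" by simp
  moreover have "\<forall>\<^sub>F \<theta> in at_right 0. \<theta> \<in> {0<..<(1::real)}" by (rule eventually_at_right_real) simp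
  ultimately have "\<forall>\<^sub>F \<theta> in at_right 0. 0 < ln r - (1 - \<theta>) * la - s * ((1 - \<theta>) * \<alpha> + \<theta> * z) \<and>
      dist ((1 - \<theta>) * \<alpha> + \<theta> * z) \<alpha> < \<epsilon> \<and> \<theta> \<in> {0<..<(1::real)}"
    by eventually_elim blast
  then obtain \<theta> where \<theta>: "0 < ln r - (1 - \<theta>) * la - s * ((1 - \<theta>) * \<alpha> + \<theta> * z)"
      "dist ((1 - \<theta>) * \<alpha> + \<theta> * z) \<alpha> < \<epsilon>" "0 < \<theta>" "\<theta> < 1"
    by (auto dest!: eventually_happens simp: trivial_limit_at_right_real)
  define q where "q = (1 - \<theta>) * \<alpha> + \<theta> * z"
  have "(1 - \<theta>) * la < ln r"
  proof (cases "la = 0")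
    case False
    then have "(1 - \<theta>) * la < 1 * la" using \<theta> la by (intro mult_strict_right_mono) auto
    then show ?thesis using la by simp
  qed (use r in simp)
  then obtain l where l: "(1 - \<theta>) * la < l" "l < min (ln r) (ln r - s * q)"
    using \<theta>(1) dense[of "(1 - \<theta>) * la" "min (ln r) (ln r - s * q)"] by (auto simp: q_def)
  have "L q \<le> ereal ((1 - \<theta>) * la + \<theta> * 0)"
    unfolding q_def using la z \<theta> by (intro L_convex) (auto simp: zero_ereal_def)
  also have "\<dots> < ereal l" using l(1) by simp
  finally have "L q < ereal l" .
  moreover have "0 < q" unfolding q_def using a z \<theta> by (intro add_pos_pos mult_pos_pos) auto
  moreover have "q \<le> 1"
  proof -
    have "(1 - \<theta>) * \<alpha> + \<theta> * z \<le> (1 - \<theta>) * 1 + \<theta> * 1"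
      using a z \<theta> by (intro add_mono mult_left_mono) auto
    then show ?thesis by (simp add: q_def)
  qed
  ultimately show ?thesis using l \<theta>(2) by (intro that[of q l]) (auto simp: q_def dist_real_def)
next
  case True
  then have rR: "r = R" using zero_rate_sublevel \<alpha> r by simp
  obtain z where z: "0 < z" "z \<le> 1" "L z = 0" by (rule L_zero)
  \<comment> \<open>Truncating at 0 makes \<open>l < ln R - s' * q\<close> yield both
    \<open>s * q < ln R - l\<close> and \<open>l < ln R\<close>, also for negative \<open>s\<close>.
    It is harmless since the slope at a zero of \<open>L\<close> is positive.\<close>
  define s' where "s' = max s 0"
  have "0 < slope z" using z R1 by (simp add: slope_def L_0 zero_ereal_def)
  also have "\<dots> \<le> (SUP q\<in>{0<..1}. slope q)" using z by (intro SUP_upper) auto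
  finally have "ereal s' < (SUP q\<in>{0<..1}. slope q)"
    using s True by (auto simp: s'_def spectrum_value_0 max_def zero_ereal_def)
  then obtain q0 where q0: "0 < q0" "q0 \<le> 1" "ereal s' < slope q0" by (auto simp: less_SUP_iff)
  define q where "q = min q0 (\<epsilon> / 2)"
  have q: "0 < q" "q \<le> q0" "q < \<epsilon>" using q0 e by (auto simp: q_def)
  have "ereal s' < slope q" using q0(3) slope_antimono[OF q(1,2)] by (rule less_le_trans)
  then obtain lq where lq: "L q = ereal lq" "s' < (ln R - lq) / q"
    using q L_nonneg[of q] by (cases "L q") (auto simp: slope_def L_0)
  then have "lq < ln R - s' * q" using q by (simp add: field_simps)
  then obtain l where l: "lq < l" "l < ln R - s' * q" using dense by blast
  have "s * q \<le> s' * q" "0 \<le> s' * q" using q by (auto simp: s'_def mult_right_mono)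
  then have "s * q < ln R - l" "l < ln R" using l(2) by linarith+
  then show ?thesis using l(1) lq q q0 True rR by (intro that[of q l]) auto
qed

text \<open>If \<open>r = R\<close>, monotonicity of the chord slopes makes 0 a maximiser. If
  \<open>r < R\<close>, then \<open>L 0 > ln r\<close>, so by semicontinuity the sublevel set stays
  away from 0, the quotient is bounded on it, and compactness yields a maximiser. Speeds outside the
  sublevel set have a negative quotient; including them is what the bound for the whole limit set
  requires.\<close>

lemma spectrum_value_max:
  assumes r: "1 < r" "r \<le> R"
  obtains \<alpha> where "\<alpha> \<in> rate_sublevel L r"
    "\<And>q. 0 < q \<Longrightarrow> q \<le> 1 \<Longrightarrow> (ereal (ln r) - L q) / ereal q \<le> spectrum_value L r \<alpha>"
    "\<And>\<beta>. \<beta> \<in> rate_sublevel L r \<Longrightarrow> spectrum_value L r \<beta> \<le> spectrum_value L r \<alpha>"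
proof (cases "r = R")
  case True
  have a: "(ereal (ln r) - L q) / ereal q \<le> spectrum_value L r 0" if "0 < q" "q \<le> 1" for q
    using that SUP_upper[of q "{0<..1}" slope] True by (simp add: spectrum_value_0 slope_def L_0)
  show ?thesis
  proof (rule that[OF _ a])
    show "0 \<in> rate_sublevel L r" using True by (simp add: rate_sublevel_def L_0)
    show "spectrum_value L r \<beta> \<le> spectrum_value L r 0" if "\<beta> \<in> rate_sublevel L r" for \<beta>
      using a[of \<beta>] that by (cases "\<beta> = 0") (auto simp: rate_sublevel_def spectrum_value_def)
  qed
next
  case False
  then have lr: "ln r < ln R" using r by simp
  define K where "K = rate_sublevel L r"
  define u where "u q = (ln r - real_of_ereal (L q)) / q" for q
  have Kpos: "0 < q" "q \<le> 1" if "q \<in> K" for q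
  proof -
    have "q \<noteq> 0" using that lr by (auto simp: K_def rate_sublevel_def L_0)
    then show "0 < q" "q \<le> 1" using that by (auto simp: K_def rate_sublevel_def)
  qed
  have KL: "L q = ereal (real_of_ereal (L q))" "real_of_ereal (L q) \<le> ln r" if "q \<in> K" for q
    using that by (auto simp: K_def elim!: rate_sublevel_real)
  obtain z where z: "0 < z" "z \<le> 1" "L z = 0" by (rule L_zero)
  have zK: "z \<in> K" using z r by (auto simp: K_def rate_sublevel_def)
  have "open (- {q. L q \<le> ereal (ln r)})" by (intro open_Compl L_closed)
  moreover have "0 \<in> - {q. L q \<le> ereal (ln r)}" using lr by (simp add: L_0)
  ultimately obtain e where e: "0 < e" "ball 0 e \<subseteq> - {q. L q \<le> ereal (ln r)}"
    by (meson open_contains_ball)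
  have Ke: "q \<ge> e" if "q \<in> K" for q
  proof (rule ccontr)
    assume "\<not> q \<ge> e"
    then have "q \<in> ball 0 e" using Kpos[OF that] by (simp add: dist_real_def)
    then have "q \<in> - {q. L q \<le> ereal (ln r)}" using e(2) by blast
    then show False using that by (simp add: K_def rate_sublevel_def)
  qed
  have u_bd: "u q \<le> ln r / e" if "q \<in> K" for q
  proof -
    have "real_of_ereal (L q) \<ge> 0" using L_nonneg[of q] by (simp add: real_of_ereal_pos)
    then have "u q \<le> ln r / q" unfolding u_def using Kpos[OF that] by (intro divide_right_mono) auto
    also have "\<dots> \<le> ln r / e" using Ke[OF that] e r by (intro divide_left_mono) auto
    finally show ?thesis .
  qed
  then have bdd: "bdd_above (u ` K)" by (intro bdd_aboveI2)
  define S where "S = Sup (u ` K)"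
  have Sge: "u q \<le> S" if "q \<in> K" for q unfolding S_def by (intro cSUP_upper bdd that)
  have "u z = ln r / z" by (simp add: u_def z)
  then have S0: "S > 0" using Sge[OF zK] z r by (smt (verit) divide_pos_pos ln_gt_zero)
  have "\<exists>q\<in>K. S - 1 / real (Suc k) < u q" for k
  proof -
    have "S - 1 / real (Suc k) < Sup (u ` K)" by (simp add: S_def)
    then show ?thesis using less_cSup_iff[of "u ` K"] bdd zK by auto
  qed
  then obtain f where f: "\<And>k. f k \<in> K" "\<And>k. S - 1 / real (Suc k) < u (f k)" by metis
  have "\<forall>k. f k \<in> {0..1}" using f(1) Kpos by (auto intro: less_imp_le)
  then obtain q \<phi> where q: "q \<in> {0..1}" "strict_mono \<phi>" "(f \<circ> \<phi>) \<longlonglongrightarrow> q"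
    using compact_Icc[of 0 "1::real"] unfolding compact_def by metis
  \<comment> \<open>The quotient need not be continuous. Multiplied out, its near-maximality is an
    upper bound for \<open>L\<close>, and this form passes to the limit by lower
    semicontinuity.\<close>
  have Lq: "L q \<le> ereal (ln r - S * q)"
  proof (rule L_le)
    fix \<delta> :: real assume d: "\<delta> > 0"
    have lim0: "(\<lambda>k. 1 / real (Suc (\<phi> k))) \<longlonglongrightarrow> 0"
      using LIMSEQ_subseq_LIMSEQ[OF LIMSEQ_inverse_real_of_nat q(2)]
      by (simp add: inverse_eq_divide comp_def)
    then have lim1: "(\<lambda>k. (S - 1 / real (Suc (\<phi> k))) * f (\<phi> k)) \<longlonglongrightarrow> (S - 0) * q"
      using q(3) by (intro tendsto_intros) (auto simp: comp_def)
    have "\<forall>\<^sub>F k in sequentially. S * q - \<delta> < (S - 1 / real (Suc (\<phi> k))) * f (\<phi> k)"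
      using order_tendstoD(1)[OF lim1, of "S * q - \<delta>"] d by simp
    moreover have "\<forall>\<^sub>F k in sequentially. dist (f (\<phi> k)) q < \<delta>"
      using tendstoD[OF q(3) d] by (simp add: comp_def)
    ultimately have "\<forall>\<^sub>F k in sequentially. S * q - \<delta> < (S - 1 / real (Suc (\<phi> k))) * f (\<phi> k) \<and> dist (f (\<phi> k)) q < \<delta>"
      by eventually_elim blast
    then obtain k where k: "S * q - \<delta> < (S - 1 / real (Suc (\<phi> k))) * f (\<phi> k)" "dist (f (\<phi> k)) q < \<delta>"
      using eventually_happens'[OF sequentially_bot] by blast
    define x where "x = f (\<phi> k)"
    have xK: "x \<in> K" by (simp add: x_def f)
    have "(S - 1 / real (Suc (\<phi> k))) * x \<le> u x * x"
      using f(2)[of "\<phi> k"] Kpos[OF xK] by (intro mult_right_mono) (auto simp: x_def)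
    also have "u x * x = ln r - real_of_ereal (L x)" using Kpos[OF xK] by (simp add: u_def)
    finally have "real_of_ereal (L x) \<le> ln r - S * q + \<delta>" using k(1) by (simp add: x_def)
    then have "L x \<le> ereal (ln r - S * q + \<delta>)" using KL(1)[OF xK] by (metis ereal_less_eq(3))
    then show "\<exists>q'. \<bar>q' - q\<bar> \<le> \<delta> \<and> L q' \<le> ereal (ln r - S * q + \<delta>)"
      using k(2) by (intro exI[of _ x]) (auto simp: x_def dist_real_def)
  qed
  also have "ereal (ln r - S * q) \<le> ereal (ln r)" using S0 q(1) by simp
  finally have qK: "q \<in> K" using q(1) by (simp add: K_def rate_sublevel_def)
  have "real_of_ereal (L q) \<le> ln r - S * q" using Lq KL(1)[OF qK] by (metis ereal_less_eq(3))
  then have uq: "S \<le> u q" using Kpos[OF qK] by (simp add: u_def field_simps)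
  have sv: "spectrum_value L r x = ereal (u x)" if "x \<in> K" for x
    using spectrum_value_pos[of x "real_of_ereal (L x)" r] KL[OF that] Kpos[OF that] by (simp add: u_def)
  have b: "spectrum_value L r \<beta> \<le> spectrum_value L r q" if "\<beta> \<in> rate_sublevel L r" for \<beta>
    using that sv[of \<beta>] sv[OF qK] Sge[of \<beta>] uq by (simp add: K_def)
  show ?thesis
  proof (rule that[OF _ _ b])
    show "q \<in> rate_sublevel L r" using qK by (simp add: K_def)
    fix x :: real assume x: "0 < x" "x \<le> 1"
    show "(ereal (ln r) - L x) / ereal x \<le> spectrum_value L r q"
    proof (cases "x \<in> K")
      case True
      then show ?thesis using b[of x] x by (simp add: K_def spectrum_value_def)
    next
      case False
      then have "ereal (ln r) < L x" using x by (simp add: K_def rate_sublevel_def)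
      then have "(ereal (ln r) - L x) / ereal x \<le> 0"
        using x by (cases "L x") (auto simp: zero_ereal_def divide_le_0_iff)
      also have "\<dots> \<le> spectrum_value L r q" using qK by (intro spectrum_value_nonneg) (simp add: K_def)
      finally show ?thesis .
    qed
  qed
qed

lemma L_ge_nbhd:
  assumes "ereal c < L \<alpha>"
  obtains d where "d > 0" "\<And>q. \<bar>q - \<alpha>\<bar> < d \<Longrightarrow> ereal c < L q"
proof -
  have "open (- {q. L q \<le> ereal c})" by (intro open_Compl L_closed)
  moreover have "\<alpha> \<in> - {q. L q \<le> ereal c}" using assms by simp
  ultimately obtain d where "0 < d" "ball \<alpha> d \<subseteq> - {q. L q \<le> ereal c}"
    by (meson open_contains_ball)
  then show ?thesis by (intro that[of d]) (auto simp: dist_real_def abs_minus_commute subset_iff not_le)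
qed

text \<open>Rational end points and a rational margin: only countably many triples occur, so the
  almost sure consequences hold for all \<alpha> at once.\<close>

lemma local_bound_supercritical:
  assumes "ereal (ln r) < L \<alpha>"
  obtains a b \<eta> :: rat where "of_rat a < \<alpha>" "\<alpha> < of_rat b" "\<eta> > 0"
    "\<And>q. of_rat a \<le> q \<Longrightarrow> q \<le> of_rat b \<Longrightarrow> ereal (ln r + of_rat \<eta>) \<le> L q"
proof -
  obtain c where c: "ereal (ln r) < ereal c" "ereal c < L \<alpha>" using ereal_dense2[OF assms] by auto
  then obtain \<eta> :: rat where eta: "0 < (of_rat \<eta> :: real)" "of_rat \<eta> < c - ln r"
    using of_rat_dense[of 0 "c - ln r"] by auto
  obtain d where d: "d > 0" "\<And>q. \<bar>q - \<alpha>\<bar> < d \<Longrightarrow> ereal c < L q" by (rule L_ge_nbhd[OF c(2)]) blast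
  obtain a b :: rat where "\<alpha> - d < of_rat a" "of_rat a < \<alpha>" "\<alpha> < of_rat b" "of_rat b < \<alpha> + d"
    using of_rat_dense[of "\<alpha> - d" \<alpha>] of_rat_dense[of \<alpha> "\<alpha> + d"] d(1) by auto
  moreover have "ereal (ln r + of_rat \<eta>) \<le> L q" if "of_rat a \<le> q" "q \<le> of_rat b" for q
  proof -
    have "ereal (ln r + of_rat \<eta>) \<le> ereal c" using eta by simp
    also have "\<dots> \<le> L q"
      using that calculation \<open>\<alpha> - d < of_rat a\<close> \<open>of_rat b < \<alpha> + d\<close> by (intro less_imp_le d(2)) auto
    finally show ?thesis .
  qed
  ultimately show ?thesis using eta(1) by (intro that[of a b \<eta>]) auto
qed

lemma local_bound:
  assumes "\<alpha> \<in> rate_sublevel L r" "0 < \<alpha>" "spectrum_value L r \<alpha> < ereal s"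
  obtains a b :: rat where "0 < a" "of_rat a < \<alpha>" "\<alpha> < of_rat b"
    "\<And>q. of_rat a \<le> q \<Longrightarrow> q \<le> of_rat b \<Longrightarrow> ereal (ln r - s * q) \<le> L q"
proof -
  obtain la where la: "L \<alpha> = ereal la" "0 \<le> la" "la \<le> ln r"
    by (rule rate_sublevel_real[OF assms(1)])
  have s: "ln r - s * \<alpha> < la" using assms(2,3) la by (simp add: spectrum_value_pos field_simps)
  \<comment> \<open>Half of the gap at \<alpha> is given to the semicontinuity of \<open>L\<close>,
    the other half to the variation of \<open>s * q\<close> near \<alpha>.\<close>
  define \<eta> where "\<eta> = (la - (ln r - s * \<alpha>)) / 2"
  have eta: "\<eta> > 0" using s by (simp add: \<eta>_def)
  have "ereal (la - \<eta>) < L \<alpha>" using la eta by simp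
  then obtain d where d: "d > 0" "\<And>q. \<bar>q - \<alpha>\<bar> < d \<Longrightarrow> ereal (la - \<eta>) < L q"
    by (rule L_ge_nbhd) blast
  define d' where "d' = min (min d \<alpha>) (\<eta> / (1 + \<bar>s\<bar>))"
  have d': "d' > 0" using d(1) assms(2) eta by (simp add: d'_def)
  obtain a b :: rat where ab: "\<alpha> - d' < of_rat a" "of_rat a < \<alpha>" "\<alpha> < of_rat b" "of_rat b < \<alpha> + d'"
    using of_rat_dense[of "\<alpha> - d'" \<alpha>] of_rat_dense[of \<alpha> "\<alpha> + d'"] d' by auto
  have "d' \<le> \<alpha>" by (simp add: d'_def)
  then have "0 < (of_rat a :: real)" using ab(1) by linarith
  then have "0 < a" by (simp only: zero_less_of_rat_iff)
  moreover have "ereal (ln r - s * q) \<le> L q" if q: "of_rat a \<le> q" "q \<le> of_rat b" for q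
  proof -
    have qd: "\<bar>q - \<alpha>\<bar> < d'" using q ab by (auto simp: abs_less_iff)
    have "\<bar>s * (\<alpha> - q)\<bar> \<le> (1 + \<bar>s\<bar>) * \<bar>q - \<alpha>\<bar>"
      unfolding abs_mult abs_minus_commute[of \<alpha> q] by (intro mult_right_mono) auto
    also have "\<dots> \<le> (1 + \<bar>s\<bar>) * (\<eta> / (1 + \<bar>s\<bar>))" using qd by (intro mult_left_mono) (auto simp: d'_def)
    also have "\<dots> = \<eta>" by (simp add: add_nonneg_eq_0_iff)
    finally have "s * (\<alpha> - q) \<le> \<eta>" by simp
    then have "ln r - s * q \<le> la - \<eta>" by (simp add: \<eta>_def field_simps)
    then have "ereal (ln r - s * q) \<le> ereal (la - \<eta>)" by simp
    also have "\<dots> \<le> L q" using qd by (intro less_imp_le d(2)) (simp add: d'_def)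
    finally show ?thesis .
  qed
  ultimately show ?thesis using ab by (intro that[of a b]) auto
qed

end

subsection \<open>Independent labels on the infinite tree\<close>

definition fieldM :: "'c pmf \<Rightarrow> (nat list \<Rightarrow> 'c) measure" where
  "fieldM \<nu> = PiM UNIV (\<lambda>_. measure_pmf \<nu>)"

definition sh :: "nat list \<Rightarrow> (nat list \<Rightarrow> 'c) \<Rightarrow> nat list \<Rightarrow> 'c" where
  "sh v f = (\<lambda>u. f (v @ u))"

lemma sh_Nil [simp]: "sh [] f = f" and sh_sh: "sh u (sh v f) = sh (v @ u) f"
  by (simp_all add: sh_def)

definition depends_below :: "nat \<Rightarrow> ((nat list \<Rightarrow> 'c) \<Rightarrow> 'b) \<Rightarrow> bool" where
  "depends_below n h \<longleftrightarrow> (\<forall>f f'. (\<forall>u. length u < n \<longrightarrow> f u = f' u) \<longrightarrow> h f = h f')"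

lemma depends_belowD: "depends_below n h \<Longrightarrow> (\<And>u. length u < n \<Longrightarrow> f u = f' u) \<Longrightarrow> h f = h f'"
  unfolding depends_below_def by blast

lemma depends_below_compose: "depends_below n h \<Longrightarrow> depends_below n (\<lambda>f. g (h f))"
  unfolding depends_below_def by metis

lemma space_fieldM [simp]: "space (fieldM \<nu>) = UNIV"
  by (simp add: fieldM_def space_PiM PiE_UNIV_domain)

lemma prob_space_fieldM: "prob_space (fieldM \<nu>)"
  unfolding fieldM_def by (intro prob_space_PiM measure_pmf.prob_space_axioms)

interpretation fieldM: prob_space "fieldM \<nu>" for \<nu>
  by (rule prob_space_fieldM)

lemma measurable_apply [measurable]: "(\<lambda>f. f v) \<in> fieldM \<nu> \<rightarrow>\<^sub>M count_space UNIV"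
proof -
  have "(\<lambda>f. f v) \<in> fieldM \<nu> \<rightarrow>\<^sub>M measure_pmf \<nu>"
    unfolding fieldM_def by (rule measurable_component_singleton) simp
  then show ?thesis by (simp cong: measurable_cong_sets)
qed

lemma measurable_fieldM_I:
  assumes "\<And>v. (\<lambda>x. F x v) \<in> M \<rightarrow>\<^sub>M count_space UNIV"
  shows "F \<in> M \<rightarrow>\<^sub>M fieldM \<nu>"
  unfolding fieldM_def
proof (rule measurable_PiM_single')
  fix v show "(\<lambda>x. F x v) \<in> M \<rightarrow>\<^sub>M measure_pmf \<nu>" using assms by (simp cong: measurable_cong_sets)
qed (auto simp: PiE_UNIV_domain)

lemma measurable_sh [measurable]: "sh v \<in> fieldM \<nu> \<rightarrow>\<^sub>M fieldM \<nu>"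
  by (rule measurable_fieldM_I) (simp add: sh_def)

lemma distr_sh: "distr (fieldM \<nu>) (fieldM \<nu>) (sh v) = fieldM \<nu>"
  using distr_PiM_reindex[of UNIV "\<lambda>_. measure_pmf \<nu>" "\<lambda>u. v @ u" UNIV]
  by (simp add: fieldM_def sh_def[abs_def] measure_pmf.prob_space_axioms inj_on_def restrict_def)

lemma nn_integral_sh:
  "\<phi> \<in> borel_measurable (fieldM \<nu>) \<Longrightarrow> (\<integral>\<^sup>+f. \<phi> (sh v f) \<partial>fieldM \<nu>) = (\<integral>\<^sup>+f. \<phi> f \<partial>fieldM \<nu>)"
  by (subst (2) distr_sh[of \<nu> v, symmetric]) (simp add: nn_integral_distr)

lemma indep_coordinates: "fieldM.indep_vars \<nu> (\<lambda>_. measure_pmf \<nu>) (\<lambda>v f. f v) UNIV"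
proof (subst fieldM.indep_vars_iff_distr_eq_PiM)
  show "UNIV \<noteq> ({} :: nat list set)" by simp
  show m: "(\<lambda>f. f v) \<in> fieldM \<nu> \<rightarrow>\<^sub>M measure_pmf \<nu>" for v
    unfolding fieldM_def by (rule measurable_component_singleton) simp
  have c: "distr (fieldM \<nu>) (measure_pmf \<nu>) (\<lambda>f. f v) = measure_pmf \<nu>" for v
    unfolding fieldM_def by (rule distr_PiM_component) (auto simp: measure_pmf.prob_space_axioms)
  have "distr (fieldM \<nu>) (PiM UNIV (\<lambda>_. measure_pmf \<nu>)) (\<lambda>x. \<lambda>i\<in>UNIV. x i) = fieldM \<nu>"
    by (simp add: restrict_def fieldM_def[symmetric] distr_id2)
  then show "distr (fieldM \<nu>) (PiM UNIV (\<lambda>_. measure_pmf \<nu>)) (\<lambda>x. \<lambda>i\<in>UNIV. x i) =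
      (\<Pi>\<^sub>M i\<in>UNIV. distr (fieldM \<nu>) (measure_pmf \<nu>) (\<lambda>f. f i))"
    by (simp add: c fieldM_def[symmetric])
qed

text \<open>The branching property: the labels of the first \<open>n\<close> levels and the labels
  in the subtrees at distinct vertices of level \<open>n\<close> form disjoint families of
  independent coordinates, and each subtree carries a copy of the whole field.\<close>

lemma nn_integral_branch:
  assumes h: "h \<in> borel_measurable (fieldM \<nu>)" "depends_below n h"
    and A: "finite A" "\<And>v. v \<in> A \<Longrightarrow> length v = n"
    and \<phi>: "\<And>v. v \<in> A \<Longrightarrow> \<phi> v \<in> borel_measurable (fieldM \<nu>)"
  shows "(\<integral>\<^sup>+f. h f * (\<Prod>v\<in>A. \<phi> v (sh v f)) \<partial>fieldM \<nu>) =
      (\<integral>\<^sup>+f. h f \<partial>fieldM \<nu>) * (\<Prod>v\<in>A. \<integral>\<^sup>+f. \<phi> v f \<partial>fieldM \<nu>)"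
proof -
  \<comment> \<open>\<open>None\<close> indexes the coordinates of the first \<open>n\<close>
    levels, \<open>Some v\<close> those of the subtree at \<open>v\<close>.\<close>
  define K :: "nat list option \<Rightarrow> nat list set" where "K j = (case j of None \<Rightarrow> {u. length u < n} | Some v \<Rightarrow> range ((@) v))" for j
  define I where "I = insert None (Some ` A)"
  define Y where "Y j g = (case j of None \<Rightarrow> h (\<lambda>u. if length u < n then g u else undefined)
     | Some v \<Rightarrow> \<phi> v (\<lambda>w. g (v @ w)))" for j g
  have disj: "disjoint_family_on K I"
    using A(2) by (force simp: disjoint_family_on_def I_def K_def)
  have "fieldM.indep_vars \<nu> (\<lambda>j. PiM (K j) (\<lambda>_. measure_pmf \<nu>)) (\<lambda>j f. restrict (\<lambda>i. f i) (K j)) I"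
    by (rule fieldM.indep_vars_restrict[OF indep_coordinates _ disj]) simp
  then have "fieldM.indep_vars \<nu> (\<lambda>_. borel) (\<lambda>j f. Y j (restrict f (K j))) I"
  proof (rule fieldM.indep_vars_compose2)
    fix j assume j: "j \<in> I"
    have comp: "(\<lambda>g. g u) \<in> PiM (K j) (\<lambda>_. measure_pmf \<nu>) \<rightarrow>\<^sub>M count_space UNIV" if "u \<in> K j" for u
      using measurable_component_singleton[OF that, of "\<lambda>_. measure_pmf \<nu>"]
      by (simp cong: measurable_cong_sets)
    show "Y j \<in> borel_measurable (PiM (K j) (\<lambda>_. measure_pmf \<nu>))"
    proof (cases j)
      case None
      have "(\<lambda>g u. if length u < n then g u else undefined) \<in> PiM (K j) (\<lambda>_. measure_pmf \<nu>) \<rightarrow>\<^sub>M fieldM \<nu>"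
      proof (rule measurable_fieldM_I)
        fix u show "(\<lambda>g. if length u < n then g u else undefined) \<in> PiM (K j) (\<lambda>_. measure_pmf \<nu>) \<rightarrow>\<^sub>M count_space UNIV"
          using comp[of u] None by (cases "length u < n") (auto simp: K_def)
      qed
      from measurable_compose[OF this h(1)] show ?thesis by (simp add: Y_def[abs_def] None)
    next
      case (Some v)
      have "(\<lambda>g w. g (v @ w)) \<in> PiM (K j) (\<lambda>_. measure_pmf \<nu>) \<rightarrow>\<^sub>M fieldM \<nu>"
        by (rule measurable_fieldM_I) (use comp Some in \<open>auto simp: K_def\<close>)
      from measurable_compose[OF this \<phi>[of v]] show ?thesis
        using j Some by (auto simp: Y_def[abs_def] I_def)
    qed
  qed
  then have "(\<integral>\<^sup>+f. (\<Prod>j\<in>I. Y j (restrict f (K j))) \<partial>fieldM \<nu>)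
      = (\<Prod>j\<in>I. \<integral>\<^sup>+f. Y j (restrict f (K j)) \<partial>fieldM \<nu>)"
    using A by (intro fieldM.indep_vars_nn_integral) (auto simp: I_def)
  moreover have Y: "Y None (restrict f (K None)) = h f" "Y (Some v) (restrict f (K (Some v))) = \<phi> v (sh v f)" for f v
    unfolding Y_def K_def sh_def option.case by (auto intro!: depends_belowD[OF h(2)] arg_cong[where f = "\<phi> v"])
  ultimately show ?thesis
    using A(1) \<phi> by (simp add: I_def prod.reindex nn_integral_sh)
qed

lemma nn_integral_branch1:
  assumes "h \<in> borel_measurable (fieldM \<nu>)" "depends_below n h" "length v = n"
    "\<phi> \<in> borel_measurable (fieldM \<nu>)"
  shows "(\<integral>\<^sup>+f. h f * \<phi> (sh v f) \<partial>fieldM \<nu>) = (\<integral>\<^sup>+f. h f \<partial>fieldM \<nu>) * (\<integral>\<^sup>+f. \<phi> f \<partial>fieldM \<nu>)"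
  using nn_integral_branch[of h \<nu> n "{v}" "\<lambda>_. \<phi>"] assms by simp

lemma nn_integral_branch2:
  assumes "h \<in> borel_measurable (fieldM \<nu>)" "depends_below n h" "length v = n" "length v' = n" "v \<noteq> v'"
    "\<phi> \<in> borel_measurable (fieldM \<nu>)" "\<psi> \<in> borel_measurable (fieldM \<nu>)"
  shows "(\<integral>\<^sup>+f. h f * (\<phi> (sh v f) * \<psi> (sh v' f)) \<partial>fieldM \<nu>) =
    (\<integral>\<^sup>+f. h f \<partial>fieldM \<nu>) * ((\<integral>\<^sup>+f. \<phi> f \<partial>fieldM \<nu>) * (\<integral>\<^sup>+f. \<psi> f \<partial>fieldM \<nu>))"
proof -
  have "(if w = v then \<phi> else \<psi>) \<in> borel_measurable (fieldM \<nu>)" for w using assms by simp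
  moreover have "length w = n" if "w \<in> {v, v'}" for w using that assms by auto
  ultimately show ?thesis
    using nn_integral_branch[OF assms(1,2), of "{v, v'}" "\<lambda>w. if w = v then \<phi> else \<psi>"] assms(5)
    by auto
qed

text \<open>Reduces a random choice of vertices to fixed ones: a countable-valued random variable is
  constant on each of countably many events.\<close>

lemma nn_integral_split_countable:
  fixes s :: "'a \<Rightarrow> 'c::countable"
  assumes s: "s \<in> M \<rightarrow>\<^sub>M count_space UNIV" and g: "\<And>c. g c \<in> borel_measurable M"
  shows "(\<integral>\<^sup>+x. g (s x) x \<partial>M) = (\<integral>\<^sup>+c. (\<integral>\<^sup>+x. indicator {c} (s x) * g c x \<partial>M) \<partial>count_space UNIV)"
proof -
  note [measurable] = s g
  have "(\<integral>\<^sup>+x. g (s x) x \<partial>M) = (\<integral>\<^sup>+x. (\<integral>\<^sup>+c. indicator {c} (s x) * g c x \<partial>count_space UNIV) \<partial>M)"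
  proof (rule nn_integral_cong)
    fix x
    have "(\<integral>\<^sup>+c. indicator {c} (s x) * g c x \<partial>count_space UNIV) = (\<integral>\<^sup>+c. g c x * indicator {s x} c \<partial>count_space UNIV)"
      by (intro nn_integral_cong) (auto simp: indicator_def)
    also have "\<dots> = g (s x) x"
      by (subst nn_integral_indicator_singleton) (auto simp: one_ennreal_def[symmetric])
    finally show "g (s x) x = (\<integral>\<^sup>+c. indicator {c} (s x) * g c x \<partial>count_space UNIV)" by simp
  qed
  also have "\<dots> = (\<integral>\<^sup>+c. (\<integral>\<^sup>+x. indicator {c} (s x) * g c x \<partial>M) \<partial>count_space UNIV)"
    by (rule nn_integral_count_space_nn_integral) auto
  finally show ?thesis .
qed

text \<open>In the next two lemmas \<open>h\<close> is the information from the first \<open>n\<close> levels and \<open>A (h f)\<close> a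
  set of vertices of level \<open>n\<close> chosen from it.\<close>

lemma nn_integral_level_sum:
  fixes h :: "(nat list \<Rightarrow> 'c) \<Rightarrow> 'd::countable"
  assumes h [measurable]: "h \<in> fieldM \<nu> \<rightarrow>\<^sub>M count_space UNIV" and dep: "depends_below n h"
    and A: "\<And>c. finite (A c)" "\<And>c v. v \<in> A c \<Longrightarrow> length v = n"
    and \<phi> [measurable]: "\<And>c v. \<phi> c v \<in> borel_measurable (fieldM \<nu>)"
  shows "(\<integral>\<^sup>+f. (\<Sum>v\<in>A (h f). \<phi> (h f) v (sh v f)) \<partial>fieldM \<nu>) =
     (\<integral>\<^sup>+f. (\<Sum>v\<in>A (h f). \<integral>\<^sup>+g. \<phi> (h f) v g \<partial>fieldM \<nu>) \<partial>fieldM \<nu>)"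
proof -
  have dep': "depends_below n (\<lambda>f. indicator {c} (h f) :: ennreal)" for c
    using depends_below_compose[OF dep, of "indicator {c}"] .
  have "(\<integral>\<^sup>+f. indicator {c} (h f) * (\<Sum>v\<in>A c. \<phi> c v (sh v f)) \<partial>fieldM \<nu>) =
        (\<integral>\<^sup>+f. indicator {c} (h f) * (\<Sum>v\<in>A c. \<integral>\<^sup>+g. \<phi> c v g \<partial>fieldM \<nu>) \<partial>fieldM \<nu>)" for c
  proof -
    have "(\<integral>\<^sup>+f. indicator {c} (h f) * (\<Sum>v\<in>A c. \<phi> c v (sh v f)) \<partial>fieldM \<nu>) =
       (\<Sum>v\<in>A c. \<integral>\<^sup>+f. indicator {c} (h f) * \<phi> c v (sh v f) \<partial>fieldM \<nu>)"
      by (simp add: sum_distrib_left nn_integral_sum)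
    also have "\<dots> = (\<Sum>v\<in>A c. (\<integral>\<^sup>+f. indicator {c} (h f) \<partial>fieldM \<nu>) * (\<integral>\<^sup>+g. \<phi> c v g \<partial>fieldM \<nu>))"
      by (intro sum.cong refl nn_integral_branch1 A) (simp_all add: dep' A(2))
    also have "\<dots> = (\<integral>\<^sup>+f. indicator {c} (h f) \<partial>fieldM \<nu>) * (\<Sum>v\<in>A c. \<integral>\<^sup>+g. \<phi> c v g \<partial>fieldM \<nu>)"
      by (simp add: sum_distrib_left)
    also have "\<dots> = (\<integral>\<^sup>+f. indicator {c} (h f) * (\<Sum>v\<in>A c. \<integral>\<^sup>+g. \<phi> c v g \<partial>fieldM \<nu>) \<partial>fieldM \<nu>)"
      by (rule nn_integral_multc[symmetric]) simp
    finally show ?thesis .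
  qed
  then show ?thesis
    by (subst (1 2) nn_integral_split_countable[OF h]) auto
qed

lemma nn_integral_level_sum_square:
  fixes h :: "(nat list \<Rightarrow> 'c) \<Rightarrow> 'd::countable"
  assumes h [measurable]: "h \<in> fieldM \<nu> \<rightarrow>\<^sub>M count_space UNIV" and dep: "depends_below n h"
    and A: "\<And>c. finite (A c)" "\<And>c v. v \<in> A c \<Longrightarrow> length v = n"
    and \<phi> [measurable]: "\<And>c v. \<phi> c v \<in> borel_measurable (fieldM \<nu>)"
  shows "(\<integral>\<^sup>+f. (\<Sum>v\<in>A (h f). \<phi> (h f) v (sh v f))\<^sup>2 \<partial>fieldM \<nu>) =
     (\<integral>\<^sup>+f. (\<Sum>v\<in>A (h f). (\<integral>\<^sup>+g. (\<phi> (h f) v g)\<^sup>2 \<partial>fieldM \<nu>) +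
         (\<Sum>w\<in>A (h f) - {v}. (\<integral>\<^sup>+g. \<phi> (h f) v g \<partial>fieldM \<nu>) * (\<integral>\<^sup>+g. \<phi> (h f) w g \<partial>fieldM \<nu>))) \<partial>fieldM \<nu>)"
proof -
  have sq: "(\<Sum>v\<in>B. X v)\<^sup>2 = (\<Sum>v\<in>B. (X v)\<^sup>2 + (\<Sum>w\<in>B - {v}. X v * X w))"
    if "finite B" for B :: "nat list set" and X :: "nat list \<Rightarrow> ennreal"
  proof -
    have "(\<Sum>v\<in>B. X v)\<^sup>2 = (\<Sum>v\<in>B. \<Sum>w\<in>B. X v * X w)" by (simp add: power2_eq_square sum_product)
    also have "\<dots> = (\<Sum>v\<in>B. (X v)\<^sup>2 + (\<Sum>w\<in>B - {v}. X v * X w))"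
      using that by (intro sum.cong refl) (simp add: sum.remove power2_eq_square)
    finally show ?thesis .
  qed
  have dep': "depends_below n (\<lambda>f. indicator {c} (h f) :: ennreal)" for c
    using depends_below_compose[OF dep, of "indicator {c}"] .
  define S where "S c = (\<Sum>v\<in>A c. (\<integral>\<^sup>+g. (\<phi> c v g)\<^sup>2 \<partial>fieldM \<nu>) +
         (\<Sum>w\<in>A c - {v}. (\<integral>\<^sup>+g. \<phi> c v g \<partial>fieldM \<nu>) * (\<integral>\<^sup>+g. \<phi> c w g \<partial>fieldM \<nu>)))" for c
  have "(\<integral>\<^sup>+f. indicator {c} (h f) * (\<Sum>v\<in>A c. \<phi> c v (sh v f))\<^sup>2 \<partial>fieldM \<nu>) =
        (\<integral>\<^sup>+f. indicator {c} (h f) * S c \<partial>fieldM \<nu>)" for c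
  proof -
    have "(\<integral>\<^sup>+f. indicator {c} (h f) * (\<Sum>v\<in>A c. \<phi> c v (sh v f))\<^sup>2 \<partial>fieldM \<nu>) =
       (\<Sum>v\<in>A c. (\<integral>\<^sup>+f. indicator {c} (h f) * (\<phi> c v (sh v f))\<^sup>2 \<partial>fieldM \<nu>) +
         (\<Sum>w\<in>A c - {v}. \<integral>\<^sup>+f. indicator {c} (h f) * (\<phi> c v (sh v f) * \<phi> c w (sh w f)) \<partial>fieldM \<nu>))"
      unfolding sq[OF A(1)] by (simp add: sum_distrib_left distrib_left nn_integral_sum nn_integral_add)
    also have "\<dots> = (\<Sum>v\<in>A c. (\<integral>\<^sup>+f. indicator {c} (h f) \<partial>fieldM \<nu>) * (\<integral>\<^sup>+g. (\<phi> c v g)\<^sup>2 \<partial>fieldM \<nu>) +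
         (\<Sum>w\<in>A c - {v}. (\<integral>\<^sup>+f. indicator {c} (h f) \<partial>fieldM \<nu>) *
            ((\<integral>\<^sup>+g. \<phi> c v g \<partial>fieldM \<nu>) * (\<integral>\<^sup>+g. \<phi> c w g \<partial>fieldM \<nu>))))"
      by (intro sum.cong refl arg_cong2[where f = "(+)"] nn_integral_branch2
          nn_integral_branch1[where \<phi> = "\<lambda>g. (\<phi> c v g)\<^sup>2" for v] A) (auto simp: dep' A(2))
    also have "\<dots> = (\<integral>\<^sup>+f. indicator {c} (h f) \<partial>fieldM \<nu>) * S c"
      by (simp add: S_def sum_distrib_left distrib_left)
    also have "\<dots> = (\<integral>\<^sup>+f. indicator {c} (h f) * S c \<partial>fieldM \<nu>)"
      by (rule nn_integral_multc[symmetric]) simp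
    finally show ?thesis .
  qed
  then show ?thesis
    unfolding S_def[symmetric]
    by (subst (1 2) nn_integral_split_countable[OF h]) auto
qed

subsection \<open>Moments of the branching random walk\<close>

text \<open>The label of a vertex is the list of the displacements to its children. In this encoding the
  labels of all vertices are independent and identically distributed.\<close>

type_synonym 'g field = "nat list \<Rightarrow> 'g word list"

definition brlaw :: "nat pmf \<Rightarrow> 'g word pmf \<Rightarrow> 'g word list pmf" where
  "brlaw p \<mu> = bind_pmf p (\<lambda>k. replicate_pmf k \<mu>)"

section \<open>Vertices, positions and generations read off from the labels\<close>

primrec intree :: "nat list \<Rightarrow> 'g field \<Rightarrow> bool" where
  "intree [] = (\<lambda>f. True)"
| "intree (i # v) = (\<lambda>f. i < length (f []) \<and> intree v (sh [i] f))"

primrec pos :: "nat list \<Rightarrow> 'g field \<Rightarrow> 'g word" where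
  "pos [] = (\<lambda>f. [])"
| "pos (i # v) = (\<lambda>f. mul (f [] ! i) (pos v (sh [i] f)))"

text \<open>A whole generation as one value of a countable type. Events and choices depending on the
  first \<open>n\<close> levels become functions of \<open>gens n\<close>, which disposes of their
  measurability.\<close>

primrec gens :: "nat \<Rightarrow> 'g field \<Rightarrow> (nat list \<times> 'g word) list" where
  "gens 0 = (\<lambda>f. [([], [])])"
| "gens (Suc n) = (\<lambda>f. concat (map (\<lambda>i. map (\<lambda>(v, w). (i # v, mul (f [] ! i) w)) (gens n (sh [i] f)))
     [0..<length (f [])]))"

definition step_field :: "'g field \<Rightarrow> bool" where
  "step_field f \<longleftrightarrow> (\<forall>u. set (f u) \<subseteq> step_words)"

lemma step_field_sh: "step_field f \<Longrightarrow> step_field (sh v f)"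
  by (simp add: step_field_def sh_def)

lemma intree_append: "intree (u @ v) f \<longleftrightarrow> intree u f \<and> intree v (sh u f)"
  by (induction u arbitrary: f) (auto simp: sh_sh)

lemma intree_iff: "intree v f \<longleftrightarrow> (\<forall>i<length v. v ! i < length (f (take i v)))"
proof (induction v arbitrary: f)
  case (Cons a v)
  show ?case by (simp add: Cons All_less_Suc2 sh_def)
qed simp

lemma reduced_pos: "step_field f \<Longrightarrow> intree v f \<Longrightarrow> reduced (pos v f)"
  by (induction v arbitrary: f) (auto intro!: reduced_mul step_field_sh)

lemma pos_append:
  "step_field f \<Longrightarrow> intree (u @ v) f \<Longrightarrow> pos (u @ v) f = mul (pos u f) (pos v (sh u f))"
proof (induction u arbitrary: f)
  case (Cons a u)
  then have "reduced (pos v (sh (a # u) f))"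
    by (intro reduced_pos step_field_sh) (auto simp: intree_append sh_sh)
  with Cons show ?case by (auto simp: sh_sh step_field_sh mul_assoc)
qed simp

lemma set_gens: "(v, w) \<in> set (gens n f) \<longleftrightarrow> length v = n \<and> intree v f \<and> w = pos v f"
proof (induction n arbitrary: f v w)
  case (Suc n)
  show ?case
  proof (cases v)
    case (Cons i u)
    have "(v, w) \<in> set (gens (Suc n) f) \<longleftrightarrow>
        i < length (f []) \<and> (\<exists>w'. (u, w') \<in> set (gens n (sh [i] f)) \<and> w = mul (f [] ! i) w')"
      by (auto simp: Cons image_iff) force
    then show ?thesis by (auto simp: Suc Cons)
  qed auto
qed auto

lemma measurable_count2:
  fixes F :: "'a \<Rightarrow> 'c::countable" and G :: "'a \<Rightarrow> 'd::countable"
  assumes "F \<in> M \<rightarrow>\<^sub>M count_space UNIV" "G \<in> M \<rightarrow>\<^sub>M count_space UNIV"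
  shows "(\<lambda>x. H (F x) (G x)) \<in> M \<rightarrow>\<^sub>M count_space UNIV"
  by (rule measurable_compose_countable[OF measurable_compose[OF assms(2)] assms(1)]) simp

lemma measurable_map_list:
  fixes g :: "'i \<Rightarrow> 'a \<Rightarrow> 'c::countable"
  assumes "\<And>i. g i \<in> M \<rightarrow>\<^sub>M count_space UNIV"
  shows "(\<lambda>x. map (\<lambda>i. g i x) is) \<in> M \<rightarrow>\<^sub>M count_space UNIV"
proof (induction "is")
  case (Cons a "is")
  then show ?case using measurable_count2[OF assms[of a] Cons, of "(#)"] by simp
qed simp

lemma measurable_gens [measurable]:
  fixes \<nu> :: "'g::finite word list pmf"
  shows "gens n \<in> fieldM \<nu> \<rightarrow>\<^sub>M count_space UNIV"
proof (induction n)
  case (Suc n)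
  have "(\<lambda>f. concat (map (\<lambda>i. map (\<lambda>(v, w). (i # v, mul (c ! i) w)) (gens n (sh [i] f))) [0..<length c]))
      \<in> fieldM \<nu> \<rightarrow>\<^sub>M count_space UNIV" for c
  proof -
    have "(\<lambda>f. gens n (sh [i] f)) \<in> fieldM \<nu> \<rightarrow>\<^sub>M count_space UNIV" for i
      by (rule measurable_compose[OF measurable_sh Suc])
    then have "(\<lambda>f. map (\<lambda>(v, w). (i # v, mul (c ! i) w)) (gens n (sh [i] f))) \<in> fieldM \<nu> \<rightarrow>\<^sub>M count_space UNIV" for i
      by (rule measurable_compose) simp
    then have "(\<lambda>f. map (\<lambda>i. map (\<lambda>(v, w). (i # v, mul (c ! i) w)) (gens n (sh [i] f))) [0..<length c])
        \<in> fieldM \<nu> \<rightarrow>\<^sub>M count_space UNIV"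
      by (rule measurable_map_list)
    then show ?thesis by (rule measurable_compose) simp
  qed
  from measurable_compose_countable[OF this measurable_apply[of "[]"]] show ?case by simp
qed simp

lemma depends_gens: "depends_below n (gens n)"
proof (induction n)
  case (Suc n)
  show ?case
    unfolding depends_below_def
  proof (intro allI impI)
    fix f f' :: "'a field" assume eq: "\<forall>u. length u < Suc n \<longrightarrow> f u = f' u"
    have "gens n (sh [i] f) = gens n (sh [i] f')" for i
      using eq by (intro depends_belowD[OF Suc]) (simp add: sh_def)
    moreover have "f [] = f' []" using eq by simp
    ultimately show "gens (Suc n) f = gens (Suc n) f'" by simp
  qed
qed (simp add: depends_below_def)

text \<open>The number of visits to \<open>x\<close> in generation \<open>n\<close> (see
  \<open>cnt_eq_card\<close>), counted through the first step: a vertex below the child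
  \<open>i\<close> ends at \<open>x\<close> iff its position relative to that child is
  \<open>x\<close> with the displacement of \<open>i\<close> removed. In this form moments satisfy
  recursions.\<close>

primrec cnt :: "nat \<Rightarrow> 'g word \<Rightarrow> 'g field \<Rightarrow> ennreal" where
  "cnt 0 = (\<lambda>x f. if x = [] then 1 else 0)"
| "cnt (Suc n) = (\<lambda>x f. \<Sum>i<length (f []). cnt n (mul (winv (f [] ! i)) x) (sh [i] f))"

lemma cnt_eq_card:
  assumes "step_field f" "reduced x"
  shows "cnt n x f = of_nat (card {v. length v = n \<and> intree v f \<and> pos v f = x})"
  using assms
proof (induction n arbitrary: x f)
  case 0
  have "{v. length v = 0 \<and> intree v f \<and> pos v f = x} = (if x = [] then {[]} else {})" by auto
  then show ?case by simp
next
  case (Suc n)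
  define A where "A i = {v. length v = n \<and> intree v (sh [i] f) \<and> pos v (sh [i] f) = mul (winv (f [] ! i)) x}" for i
  have fin: "finite (A i)" for i
  proof (rule finite_subset)
    show "A i \<subseteq> fst ` set (gens n (sh [i] f))"
    proof
      fix v assume "v \<in> A i"
      then have "(v, pos v (sh [i] f)) \<in> set (gens n (sh [i] f))" by (simp add: A_def set_gens)
      then show "v \<in> fst ` set (gens n (sh [i] f))" by (metis fst_conv imageI)
    qed
  qed simp
  have eq: "{v. length v = Suc n \<and> intree v f \<and> pos v f = x} = (\<Union>i\<in>{..<length (f [])}. (#) i ` A i)"
  proof -
    have red: "reduced (f [] ! i)" if "i < length (f [])" for i
    proof (rule step_words_reduced)
      have "set (f []) \<subseteq> step_words" using Suc.prems(1) by (simp add: step_field_def)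
      then show "f [] ! i \<in> step_words" using nth_mem[OF that] by blast
    qed
    have e: "mul (f [] ! i) (pos v (sh [i] f)) = x \<longleftrightarrow> pos v (sh [i] f) = mul (winv (f [] ! i)) x"
      if "i < length (f [])" "intree v (sh [i] f)" for i v
      using that Suc.prems by (intro mul_eq_iff_left red reduced_pos step_field_sh) auto
    show ?thesis
    proof (rule Set.set_eqI)
      fix v show "v \<in> {v. length v = Suc n \<and> intree v f \<and> pos v f = x} \<longleftrightarrow> v \<in> (\<Union>i\<in>{..<length (f [])}. (#) i ` A i)"
      proof (cases v)
        case (Cons i u)
        have "v \<in> (\<Union>i\<in>{..<length (f [])}. (#) i ` A i) \<longleftrightarrow> i < length (f []) \<and> u \<in> A i" by (auto simp: Cons)
        also have "\<dots> \<longleftrightarrow> v \<in> {v. length v = Suc n \<and> intree v f \<and> pos v f = x}"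
          using e[of i u] by (auto simp: A_def Cons)
        finally show ?thesis by simp
      qed auto
    qed
  qed
  have "card {v. length v = Suc n \<and> intree v f \<and> pos v f = x} = (\<Sum>i<length (f []). card ((#) i ` A i))"
    unfolding eq using fin by (intro card_UN_disjoint) auto
  also have "\<dots> = (\<Sum>i<length (f []). card (A i))"
    by (intro sum.cong refl card_image) auto
  finally show ?case
    using Suc.prems by (simp add: Suc.IH step_field_sh reduced_mul A_def)
qed

lemma measurable_cnt [measurable]:
  fixes \<nu> :: "'g::finite word list pmf"
  shows "cnt n x \<in> borel_measurable (fieldM \<nu>)"
proof (induction n arbitrary: x)
  case (Suc n)
  note [measurable] = Suc
  have "(\<lambda>f. \<Sum>i<length c. cnt n (mul (winv (c ! i)) x) (sh [i] f)) \<in> borel_measurable (fieldM \<nu>)" for c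
    by measurable
  from measurable_compose_countable[OF this measurable_apply[of "[]"]] show ?case by simp
qed simp

lemma nn_integral_apply: "(\<integral>\<^sup>+f. g (f v) \<partial>fieldM \<nu>) = (\<integral>\<^sup>+c. g c \<partial>measure_pmf \<nu>)"
proof -
  have "distr (fieldM \<nu>) (measure_pmf \<nu>) (\<lambda>f. f v) = measure_pmf \<nu>"
    unfolding fieldM_def by (rule distr_PiM_component) (auto simp: measure_pmf.prob_space_axioms)
  moreover have "(\<lambda>f. f v) \<in> fieldM \<nu> \<rightarrow>\<^sub>M measure_pmf \<nu>"
    unfolding fieldM_def by (rule measurable_component_singleton) simp
  ultimately show ?thesis
    using nn_integral_distr[of "\<lambda>f. f v" "fieldM \<nu>" "measure_pmf \<nu>" g] by simp
qed

lemma nn_integral_replicate_sum: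
  fixes g :: "'a \<Rightarrow> ennreal"
  shows "(\<integral>\<^sup>+c. (\<Sum>i<length c. g (c ! i)) \<partial>replicate_pmf k \<mu>) = of_nat k * (\<integral>\<^sup>+y. g y \<partial>measure_pmf \<mu>)"
proof (induction k)
  case (Suc k)
  have "(\<integral>\<^sup>+c. (\<Sum>i<length c. g (c ! i)) \<partial>replicate_pmf (Suc k) \<mu>) =
    (\<integral>\<^sup>+y. (\<integral>\<^sup>+c. g y + (\<Sum>i<length c. g (c ! i)) \<partial>replicate_pmf k \<mu>) \<partial>measure_pmf \<mu>)"
    by (simp add: sum.lessThan_Suc_shift del: sum.lessThan_Suc)
  also have "\<dots> = (\<integral>\<^sup>+y. g y \<partial>measure_pmf \<mu>) + of_nat k * (\<integral>\<^sup>+y. g y \<partial>measure_pmf \<mu>)"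
    by (simp add: nn_integral_add Suc measure_pmf.emeasure_space_1)
  finally show ?case by (simp add: algebra_simps)
qed simp

lemma nn_integral_replicate_cross:
  fixes g :: "'a \<Rightarrow> ennreal"
  shows "(\<integral>\<^sup>+c. (\<Sum>i<length c. \<Sum>j\<in>{..<length c} - {i}. g (c ! i) * g (c ! j)) \<partial>replicate_pmf k \<mu>)
     = of_nat (k * (k - 1)) * (\<integral>\<^sup>+y. g y \<partial>measure_pmf \<mu>)\<^sup>2"
proof (induction k)
  case (Suc k)
  let ?X = "\<lambda>c. \<Sum>i<length c. \<Sum>j\<in>{..<length c} - {i}. g (c ! i) * g (c ! j)"
  let ?m = "\<integral>\<^sup>+y. g y \<partial>measure_pmf \<mu>"
  have X: "?X (y # c) = ?X c + 2 * (g y * (\<Sum>i<length c. g (c ! i)))" for y c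
  proof -
    have s: "{..<Suc n} - {Suc i} = insert 0 (Suc ` ({..<n} - {i}))" for n i
    proof (rule Set.set_eqI)
      fix x show "x \<in> {..<Suc n} - {Suc i} \<longleftrightarrow> x \<in> insert 0 (Suc ` ({..<n} - {i}))" by (cases x) auto
    qed
    have s0: "{..<Suc n} - {0} = Suc ` {..<n}" for n
    proof (rule Set.set_eqI)
      fix x show "x \<in> {..<Suc n} - {0} \<longleftrightarrow> x \<in> Suc ` {..<n}" by (cases x) auto
    qed
    have "?X (y # c) = (\<Sum>j\<in>Suc ` {..<length c}. g y * g ((y # c) ! j)) +
        (\<Sum>i<length c. \<Sum>j\<in>insert 0 (Suc ` ({..<length c} - {i})). g (c ! i) * g ((y # c) ! j))"
      by (simp add: sum.lessThan_Suc_shift s s0 del: sum.lessThan_Suc)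
    also have "\<dots> = g y * (\<Sum>i<length c. g (c ! i)) +
        (\<Sum>i<length c. g (c ! i) * g y + (\<Sum>j\<in>{..<length c} - {i}. g (c ! i) * g (c ! j)))"
      by (simp add: sum.reindex sum_distrib_left)
    also have "\<dots> = ?X c + 2 * (g y * (\<Sum>i<length c. g (c ! i)))"
    proof -
      have e: "(\<Sum>i<length c. g (c ! i) * g y) = g y * (\<Sum>i<length c. g (c ! i))"
        by (simp add: sum_distrib_left mult.commute)
      show ?thesis unfolding sum.distrib e mult_2 by (simp only: ac_simps)
    qed
    finally show ?thesis .
  qed
  have "(\<integral>\<^sup>+c. ?X c \<partial>replicate_pmf (Suc k) \<mu>) =
    (\<integral>\<^sup>+y. (\<integral>\<^sup>+c. ?X (y # c) \<partial>replicate_pmf k \<mu>) \<partial>measure_pmf \<mu>)"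
    by simp
  also have "\<dots> = (\<integral>\<^sup>+y. of_nat (k * (k - 1)) * ?m\<^sup>2 + 2 * (g y * (of_nat k * ?m)) \<partial>measure_pmf \<mu>)"
    unfolding X by (simp add: nn_integral_add nn_integral_cmult Suc nn_integral_replicate_sum)
  also have "\<dots> = of_nat (k * (k - 1)) * ?m\<^sup>2 + 2 * (?m * (of_nat k * ?m))"
    by (simp add: nn_integral_add nn_integral_cmult nn_integral_multc measure_pmf.emeasure_space_1)
  also have "\<dots> = (of_nat (k * (k - 1)) + 2 * of_nat k) * ?m\<^sup>2"
    by (simp add: algebra_simps power2_eq_square)
  also have "of_nat (k * (k - 1)) + 2 * of_nat k = (of_nat (Suc k * (Suc k - 1)) :: ennreal)"
  proof -
    have "k * (k - 1) + 2 * k = Suc k * (Suc k - 1)" by (cases k) auto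
    then show ?thesis by (metis of_nat_add of_nat_mult of_nat_numeral)
  qed
  finally show ?case .
qed simp

section \<open>First and second moments of the number of visits\<close>

locale brw = rated_walk \<mu> P Z R L
  for \<mu> :: "'g::finite word pmf" and P :: "'w measure" and Z R and L :: "real \<Rightarrow> ereal" +
  fixes p :: "nat pmf" and r :: real
  assumes p0: "pmf p 0 = 0" and exp_mom: "\<exists>s>0. summable (\<lambda>k. exp (s * real k) * pmf p k)"
    and r_eq: "r = measure_pmf.expectation p real" and r1: "1 < r" and rR: "r \<le> R"
begin

abbreviation \<nu> :: "'g word list pmf" where "\<nu> \<equiv> brlaw p \<mu>"
abbreviation \<P> :: "'g field measure" where "\<P> \<equiv> fieldM \<nu>"

lemma mean_p: "(\<integral>\<^sup>+k. of_nat k \<partial>measure_pmf p) = ennreal r"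
proof -
  have "integrable (measure_pmf p) real"
    using r1 r_eq not_integrable_integral_eq by fastforce
  then have "(\<integral>\<^sup>+k. ennreal (real k) \<partial>measure_pmf p) = ennreal r"
    unfolding r_eq by (intro nn_integral_eq_integral) auto
  then show ?thesis by (simp add: ennreal_of_nat_eq_real_of_nat)
qed

definition m2 :: ennreal where
  "m2 = (\<integral>\<^sup>+k. of_nat (k * (k - 1)) \<partial>measure_pmf p)"

lemma m2_finite: "m2 < \<top>"
proof -
  obtain s where s: "s > 0" "summable (\<lambda>k. exp (s * real k) * pmf p k)" using exp_mom by blast
  have le: "real (k * (k - 1)) \<le> 2 / s\<^sup>2 * exp (s * real k)" for k
  proof -
    have "(s * real k)\<^sup>2 / 2 \<le> exp (s * real k)"
    proof -
      have "0 \<le> s * real k" using s(1) by simp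
      then show ?thesis using exp_lower_Taylor_quadratic[of "s * real k"] by linarith
    qed
    then have "(real k)\<^sup>2 \<le> 2 / s\<^sup>2 * exp (s * real k)" using s(1) by (simp add: field_simps)
    moreover have "real (k * (k - 1)) \<le> (real k)\<^sup>2" by (simp add: power2_eq_square mult_left_mono)
    ultimately show ?thesis by linarith
  qed
  have "m2 = (\<integral>\<^sup>+k. ennreal (pmf p k) * of_nat (k * (k - 1)) \<partial>count_space UNIV)"
    unfolding m2_def by (rule nn_integral_measure_pmf)
  also have "\<dots> = (\<Sum>k. ennreal (pmf p k) * of_nat (k * (k - 1)))" by (rule nn_integral_count_space_nat)
  also have "\<dots> \<le> (\<Sum>k. ennreal (2 / s\<^sup>2 * (exp (s * real k) * pmf p k)))"
  proof (rule suminf_le)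
    fix k
    have "ennreal (pmf p k) * of_nat (k * (k - 1)) = ennreal (pmf p k * real (k * (k - 1)))"
      by (simp only: ennreal_of_nat_eq_real_of_nat ennreal_mult[symmetric] pmf_nonneg of_nat_0_le_iff)
    also have "\<dots> \<le> ennreal (pmf p k * (2 / s\<^sup>2 * exp (s * real k)))"
      by (intro ennreal_leI mult_left_mono le) simp
    finally show "ennreal (pmf p k) * of_nat (k * (k - 1)) \<le> ennreal (2 / s\<^sup>2 * (exp (s * real k) * pmf p k))"
      by (simp add: mult_ac)
  qed auto
  also have "\<dots> = ennreal (\<Sum>k. 2 / s\<^sup>2 * (exp (s * real k) * pmf p k))"
    using s(2) by (intro suminf_ennreal2 summable_mult) auto
  also have "\<dots> < \<top>" by simp
  finally show ?thesis .
qed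

text \<open>The second factorial moment of the offspring number in units of the squared mean. It is
  the amount by which one generation increases the bound in
  \<open>expect_cnt_square\<close>.\<close>

definition kap :: real where "kap = enn2real m2 / r\<^sup>2"

lemma kap_nonneg [simp]: "0 \<le> kap"
  by (simp add: kap_def)

lemma m2_eq: "m2 = ennreal (kap * r\<^sup>2)"
  using m2_finite r1 by (simp add: kap_def)

lemma nn_integral_label_sum:
  "(\<integral>\<^sup>+f. (\<Sum>i<length (f []). g (f [] ! i)) \<partial>\<P>) = ennreal r * (\<integral>\<^sup>+y. g y \<partial>measure_pmf \<mu>)"
proof -
  have "(\<integral>\<^sup>+f. (\<Sum>i<length (f []). g (f [] ! i)) \<partial>\<P>) = (\<integral>\<^sup>+c. (\<Sum>i<length c. g (c ! i)) \<partial>measure_pmf \<nu>)"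
    by (rule nn_integral_apply)
  also have "\<dots> = (\<integral>\<^sup>+k. of_nat k * (\<integral>\<^sup>+y. g y \<partial>measure_pmf \<mu>) \<partial>measure_pmf p)"
    by (simp add: brlaw_def nn_integral_replicate_sum)
  also have "\<dots> = ennreal r * (\<integral>\<^sup>+y. g y \<partial>measure_pmf \<mu>)"
    by (simp add: nn_integral_multc mean_p)
  finally show ?thesis .
qed

lemma nn_integral_label_cross:
  "(\<integral>\<^sup>+f. (\<Sum>i<length (f []). \<Sum>j\<in>{..<length (f [])} - {i}. g (f [] ! i) * g (f [] ! j)) \<partial>\<P>)
    = m2 * (\<integral>\<^sup>+y. g y \<partial>measure_pmf \<mu>)\<^sup>2"
proof -
  have "(\<integral>\<^sup>+f. (\<Sum>i<length (f []). \<Sum>j\<in>{..<length (f [])} - {i}. g (f [] ! i) * g (f [] ! j)) \<partial>\<P>)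
     = (\<integral>\<^sup>+c. (\<Sum>i<length c. \<Sum>j\<in>{..<length c} - {i}. g (c ! i) * g (c ! j)) \<partial>measure_pmf \<nu>)"
    by (rule nn_integral_apply)
  also have "\<dots> = (\<integral>\<^sup>+k. of_nat (k * (k - 1)) * (\<integral>\<^sup>+y. g y \<partial>measure_pmf \<mu>)\<^sup>2 \<partial>measure_pmf p)"
    by (simp add: brlaw_def nn_integral_replicate_cross del: of_nat_mult)
  also have "\<dots> = m2 * (\<integral>\<^sup>+y. g y \<partial>measure_pmf \<mu>)\<^sup>2"
    by (simp add: nn_integral_multc m2_def del: of_nat_mult)
  finally show ?thesis .
qed

lemma pmf_wk_Suc:
  assumes "reduced x"
  shows "ennreal (pmf (wk \<mu> (Suc n)) x) = (\<integral>\<^sup>+y. ennreal (pmf (wk \<mu> n) (mul (winv y) x)) \<partial>measure_pmf \<mu>)"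
proof -
  have "ennreal (pmf (wk \<mu> (Suc n)) x) = (\<integral>\<^sup>+y. ennreal (pmf (map_pmf (mul y) (wk \<mu> n)) x) \<partial>measure_pmf \<mu>)"
    by (simp add: ennreal_pmf_bind)
  also have "\<dots> = (\<integral>\<^sup>+y. ennreal (pmf (wk \<mu> n) (mul (winv y) x)) \<partial>measure_pmf \<mu>)"
  proof (intro nn_integral_cong_AE AE_pmfI)
    fix y assume "y \<in> set_pmf \<mu>"
    then have y: "reduced y" using \<mu>_steps by auto
    have "pmf (map_pmf (mul y) (wk \<mu> n)) x = measure_pmf.prob (wk \<mu> n) (mul y -` {x})"
      by (simp add: pmf_map)
    also have "\<dots> = measure_pmf.prob (wk \<mu> n) {mul (winv y) x}"
      by (rule measure_pmf.finite_measure_eq_AE)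
         (use set_wk[OF \<mu>_steps] mul_eq_iff_left[OF y _ assms] in \<open>auto simp: AE_measure_pmf_iff\<close>)
    finally show "ennreal (pmf (map_pmf (mul y) (wk \<mu> n)) x) = ennreal (pmf (wk \<mu> n) (mul (winv y) x))"
      by (simp add: measure_pmf_single)
  qed
  finally show ?thesis .
qed

lemma cnt_Suc_eq:
  "cnt (Suc n) x f = (\<Sum>v\<in>(\<lambda>i. [i]) ` {..<length (f [])}. cnt n (mul (winv (f [] ! hd v)) x) (sh v f))"
  by (subst sum.reindex) (auto simp: inj_on_def)

lemma depends_root: "depends_below (Suc 0) (\<lambda>f. f [])"
  by (simp add: depends_below_def)

lemma expect_cnt:
  "reduced x \<Longrightarrow> (\<integral>\<^sup>+f. cnt n x f \<partial>\<P>) = ennreal (r ^ n * pmf (wk \<mu> n) x)"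
proof (induction n arbitrary: x)
  case 0
  then show ?case by (simp add: pmf_return indicator_def fieldM.emeasure_space_1[simplified])
next
  case (Suc n)
  have "(\<integral>\<^sup>+f. cnt (Suc n) x f \<partial>\<P>) =
      (\<integral>\<^sup>+f. (\<Sum>v\<in>(\<lambda>i. [i]) ` {..<length (f [])}. \<integral>\<^sup>+g. cnt n (mul (winv (f [] ! hd v)) x) g \<partial>\<P>) \<partial>\<P>)"
    unfolding cnt_Suc_eq
    by (rule nn_integral_level_sum[where n = "Suc 0" and h = "\<lambda>f. f []"
          and A = "\<lambda>c. (\<lambda>i. [i]) ` {..<length c}" and \<phi> = "\<lambda>c v. cnt n (mul (winv (c ! hd v)) x)"])
       (auto simp: depends_root)
  also have "\<dots> = (\<integral>\<^sup>+f. (\<Sum>i<length (f []). ennreal (r ^ n * pmf (wk \<mu> n) (mul (winv (f [] ! i)) x))) \<partial>\<P>)"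
    using Suc by (subst sum.reindex) (auto simp: inj_on_def reduced_mul)
  also have "\<dots> = ennreal r * (\<integral>\<^sup>+y. ennreal (r ^ n * pmf (wk \<mu> n) (mul (winv y) x)) \<partial>measure_pmf \<mu>)"
    by (rule nn_integral_label_sum)
  also have "\<dots> = ennreal r * (ennreal (r ^ n) * ennreal (pmf (wk \<mu> (Suc n)) x))"
    unfolding pmf_wk_Suc[OF Suc.prems] using r1
    by (simp add: ennreal_mult nn_integral_cmult)
  also have "\<dots> = ennreal (r ^ Suc n * pmf (wk \<mu> (Suc n)) x)"
    using r1 by (simp add: ennreal_mult[symmetric] mult_ac del: wk.simps)
  finally show ?case .
qed

text \<open>This is what \<open>r \<le> R\<close> contributes to the second moment method: no word
  is visited more than once per generation in expectation.\<close>

lemma expect_le_1: "r ^ n * pmf (wk \<mu> n) x \<le> 1"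
proof -
  have "r ^ n * pmf (wk \<mu> n) x \<le> R ^ n * (1 / R) ^ n"
    using r1 rR pmf_wk_le[of n x] by (intro mult_mono power_mono) auto
  also have "\<dots> = 1" using R1 by (simp add: power_one_over)
  finally show ?thesis .
qed

text \<open>Pairs of vertices at \<open>x\<close> are split by their ancestors in the first
  generation. A common ancestor leads back to generation \<open>n\<close>; distinct ancestors
  contribute \<open>kap\<close> times the squared expectation, hence at most \<open>kap\<close>
  times the expectation, which is at most 1. So each generation adds only one multiple of
  \<open>kap\<close>.\<close>

lemma expect_cnt_square:
  "reduced x \<Longrightarrow> (\<integral>\<^sup>+f. (cnt n x f)\<^sup>2 \<partial>\<P>) \<le> ennreal ((1 + kap * real n) * (r ^ n * pmf (wk \<mu> n) x))"
proof (induction n arbitrary: x)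
  case 0
  have "(\<integral>\<^sup>+f. (cnt 0 x f)\<^sup>2 \<partial>\<P>) = (\<integral>\<^sup>+f. cnt 0 x f \<partial>\<P>)" by (intro nn_integral_cong) auto
  also have "\<dots> = ennreal (r ^ 0 * pmf (wk \<mu> 0) x)" using 0 by (rule expect_cnt)
  finally show ?case by simp
next
  case (Suc n)
  define a where "a y = r ^ n * pmf (wk \<mu> n) (mul (winv y) x)" for y
  define A where "A = r ^ Suc n * pmf (wk \<mu> (Suc n)) x"
  have a0: "a y \<ge> 0" for y using r1 by (simp add: a_def)
  have A0: "A \<ge> 0" "A \<le> 1" using r1 expect_le_1[of "Suc n" x] by (auto simp: A_def simp del: wk.simps)
  have ia: "ennreal r * (\<integral>\<^sup>+y. ennreal (a y) \<partial>measure_pmf \<mu>) = ennreal A"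
    unfolding a_def A_def using r1
    by (simp add: ennreal_mult nn_integral_cmult pmf_wk_Suc[OF Suc.prems] mult.assoc del: wk.simps)
  have "(\<integral>\<^sup>+f. (cnt (Suc n) x f)\<^sup>2 \<partial>\<P>) =
      (\<integral>\<^sup>+f. (\<Sum>v\<in>(\<lambda>i. [i]) ` {..<length (f [])}. (\<integral>\<^sup>+g. (cnt n (mul (winv (f [] ! hd v)) x) g)\<^sup>2 \<partial>\<P>) +
         (\<Sum>w\<in>(\<lambda>i. [i]) ` {..<length (f [])} - {v}. (\<integral>\<^sup>+g. cnt n (mul (winv (f [] ! hd v)) x) g \<partial>\<P>) *
             (\<integral>\<^sup>+g. cnt n (mul (winv (f [] ! hd w)) x) g \<partial>\<P>))) \<partial>\<P>)"
    unfolding cnt_Suc_eq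
    by (rule nn_integral_level_sum_square[where n = "Suc 0" and h = "\<lambda>f. f []"
          and A = "\<lambda>c. (\<lambda>i. [i]) ` {..<length c}" and \<phi> = "\<lambda>c v. cnt n (mul (winv (c ! hd v)) x)"])
       (auto simp: depends_root)
  also have "\<dots> \<le> (\<integral>\<^sup>+f. (\<Sum>i<length (f []). ennreal ((1 + kap * real n) * a (f [] ! i))) +
         (\<Sum>i<length (f []). \<Sum>j\<in>{..<length (f [])} - {i}. ennreal (a (f [] ! i)) * ennreal (a (f [] ! j))) \<partial>\<P>)"
  proof (rule nn_integral_mono)
    fix f :: "'g field"
    have im: "(\<lambda>i. [i]) ` {..<length (f [])} - {[i]} = (\<lambda>i. [i]) ` ({..<length (f [])} - {i})" for i by auto
    show "(\<Sum>v\<in>(\<lambda>i. [i]) ` {..<length (f [])}. (\<integral>\<^sup>+g. (cnt n (mul (winv (f [] ! hd v)) x) g)\<^sup>2 \<partial>\<P>) +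
         (\<Sum>w\<in>(\<lambda>i. [i]) ` {..<length (f [])} - {v}. (\<integral>\<^sup>+g. cnt n (mul (winv (f [] ! hd v)) x) g \<partial>\<P>) *
             (\<integral>\<^sup>+g. cnt n (mul (winv (f [] ! hd w)) x) g \<partial>\<P>)))
       \<le> (\<Sum>i<length (f []). ennreal ((1 + kap * real n) * a (f [] ! i))) +
         (\<Sum>i<length (f []). \<Sum>j\<in>{..<length (f [])} - {i}. ennreal (a (f [] ! i)) * ennreal (a (f [] ! j)))"
      unfolding sum.distrib[symmetric]
      using Suc by (subst sum.reindex)
        (auto simp: inj_on_def im sum.reindex expect_cnt reduced_mul a_def intro!: sum_mono add_mono)
  qed
  also have "\<dots> = (\<integral>\<^sup>+f. (\<Sum>i<length (f []). ennreal ((1 + kap * real n) * a (f [] ! i))) \<partial>\<P>) +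
         (\<integral>\<^sup>+f. (\<Sum>i<length (f []). \<Sum>j\<in>{..<length (f [])} - {i}. ennreal (a (f [] ! i)) * ennreal (a (f [] ! j))) \<partial>\<P>)"
  proof (rule nn_integral_add)
    show "(\<lambda>f. \<Sum>i<length (f []). ennreal ((1 + kap * real n) * a (f [] ! i))) \<in> borel_measurable \<P>"
      by (rule measurable_compose[OF measurable_apply]) simp
    show "(\<lambda>f. \<Sum>i<length (f []). \<Sum>j\<in>{..<length (f [])} - {i}. ennreal (a (f [] ! i)) * ennreal (a (f [] ! j)))
      \<in> borel_measurable \<P>"
      by (rule measurable_compose[OF measurable_apply]) simp
  qed
  also have "\<dots> = ennreal r * (\<integral>\<^sup>+y. ennreal ((1 + kap * real n) * a y) \<partial>measure_pmf \<mu>) +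
       m2 * (\<integral>\<^sup>+y. ennreal (a y) \<partial>measure_pmf \<mu>)\<^sup>2"
    by (intro arg_cong2[where f = "(+)"] nn_integral_label_sum nn_integral_label_cross)
  also have "\<dots> = ennreal (1 + kap * real n) * ennreal A + ennreal kap * (ennreal A)\<^sup>2"
  proof -
    have "(\<integral>\<^sup>+y. ennreal ((1 + kap * real n) * a y) \<partial>measure_pmf \<mu>) =
        ennreal (1 + kap * real n) * (\<integral>\<^sup>+y. ennreal (a y) \<partial>measure_pmf \<mu>)"
      using a0 by (subst nn_integral_cmult[symmetric]) (auto simp: ennreal_mult simp del: ennreal_plus)
    moreover have "m2 = ennreal kap * (ennreal r * ennreal r)"
      using r1 by (simp add: m2_eq ennreal_mult[symmetric] power2_eq_square)
    ultimately show ?thesis unfolding ia[symmetric] by (simp only: power2_eq_square ac_simps)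
  qed
  also have "\<dots> = ennreal ((1 + kap * real n) * A + kap * A\<^sup>2)"
    using A0 by (simp add: ennreal_mult ennreal_plus ennreal_power)
  also have "\<dots> \<le> ennreal ((1 + kap * real (Suc n)) * A)"
  proof (rule ennreal_leI)
    have "A\<^sup>2 \<le> A" using A0 by (simp add: power2_eq_square mult_left_le)
    then have "kap * A\<^sup>2 \<le> kap * A" by (rule mult_left_mono) simp
    then show "(1 + kap * real n) * A + kap * A\<^sup>2 \<le> (1 + kap * real (Suc n)) * A"
      by (simp add: algebra_simps)
  qed
  finally show ?case by (simp only: A_def)
qed

lemma visit_prob_ge:
  assumes "reduced x"
  shows "r ^ n * pmf (wk \<mu> n) x / (1 + kap * real n) \<le> measure \<P> {f. cnt n x f \<noteq> 0}"
proof -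
  define t where "t = 1 + kap * real n"
  define a where "a = r ^ n * pmf (wk \<mu> n) x"
  have t: "t \<ge> 1" by (simp add: t_def)
  have a: "a \<ge> 0" using r1 by (simp add: a_def)
  define E where "E = {f. cnt n x f \<noteq> 0}"
  have E: "E \<in> sets \<P>"
  proof -
    have "{f \<in> space \<P>. cnt n x f \<noteq> 0} \<in> sets \<P>" by measurable
    then show ?thesis by (simp add: E_def)
  qed
  \<comment> \<open>Cauchy-Schwarz linearised: \<open>t\<close> is the bound for the ratio of second
    to first moment, and integrating this inequality gives the estimate without subtraction in the
    extended reals.\<close>
  have amgm: "ennreal (2 * t) * cnt n x f \<le> (cnt n x f)\<^sup>2 + ennreal (t\<^sup>2) * indicator E f" for f
  proof (cases "cnt n x f")
    case (real c)
    have "2 * t * c \<le> c\<^sup>2 + t\<^sup>2" using sum_squares_ge_zero[of "c - t" 0] by (simp add: power2_eq_square algebra_simps)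
    then show ?thesis using real t
      by (cases "c = 0") (auto simp: E_def ennreal_power ennreal_mult[symmetric] ennreal_plus[symmetric]
          intro!: ennreal_leI simp del: ennreal_plus)
  qed (use t in \<open>auto simp: power2_eq_square ennreal_top_mult\<close>)
  have "ennreal (2 * t) * ennreal a = (\<integral>\<^sup>+f. ennreal (2 * t) * cnt n x f \<partial>\<P>)"
    using assms by (simp add: nn_integral_cmult expect_cnt a_def)
  also have "\<dots> \<le> (\<integral>\<^sup>+f. (cnt n x f)\<^sup>2 + ennreal (t\<^sup>2) * indicator E f \<partial>\<P>)"
    by (intro nn_integral_mono amgm)
  also have "\<dots> = (\<integral>\<^sup>+f. (cnt n x f)\<^sup>2 \<partial>\<P>) + ennreal (t\<^sup>2) * emeasure \<P> E"
    using E by (simp add: nn_integral_add nn_integral_cmult)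
  also have "\<dots> \<le> ennreal (t * a) + ennreal (t\<^sup>2) * emeasure \<P> E"
    using expect_cnt_square[OF assms, of n] by (intro add_right_mono) (simp add: t_def a_def)
  also have "\<dots> = ennreal (t * a + t\<^sup>2 * measure \<P> E)"
    using t a by (simp add: fieldM.emeasure_eq_measure ennreal_mult ennreal_plus)
  also have "ennreal (2 * t) * ennreal a = ennreal (2 * t * a)"
    using t a by (simp add: ennreal_mult)
  finally have "2 * t * a \<le> t * a + t\<^sup>2 * measure \<P> E"
    using t a by (subst (asm) ennreal_le_iff) auto
  then have "t * a \<le> t * (t * measure \<P> E)" by (simp add: power2_eq_square algebra_simps)
  then have "a \<le> t * measure \<P> E" using t by simp
  then have "a / t \<le> measure \<P> E" using t by (simp add: pos_divide_le_eq mult.commute)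
  then show ?thesis by (simp only: a_def t_def E_def)
qed

lemma AE_label: "AE f in \<P>. f u \<in> set_pmf \<nu>"
proof -
  have "distr \<P> (measure_pmf \<nu>) (\<lambda>f. f u) = measure_pmf \<nu>"
    unfolding fieldM_def by (rule distr_PiM_component) (auto simp: measure_pmf.prob_space_axioms)
  then have "AE c in distr \<P> (measure_pmf \<nu>) (\<lambda>f. f u). c \<in> set_pmf \<nu>"
    by (simp only: AE_measure_pmf)
  moreover have "(\<lambda>f. f u) \<in> \<P> \<rightarrow>\<^sub>M measure_pmf \<nu>"
    unfolding fieldM_def by (rule measurable_component_singleton) simp
  ultimately show ?thesis by (rule AE_distrD[rotated])
qed

lemma AE_good_field: "AE f in \<P>. step_field f \<and> (\<forall>u. f u \<noteq> [])"
proof -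
  have *: "set c \<subseteq> step_words \<and> c \<noteq> []" if "c \<in> set_pmf \<nu>" for c
  proof -
    obtain k where k: "k \<in> set_pmf p" "c \<in> set_pmf (replicate_pmf k \<mu>)"
      using \<open>c \<in> set_pmf \<nu>\<close> by (auto simp: brlaw_def)
    have "k \<noteq> 0" using k(1) p0 by (metis set_pmf_iff)
    then show ?thesis using k(2) \<mu>_steps by (auto simp: set_replicate_pmf)
  qed
  have "AE f in \<P>. \<forall>u. f u \<in> set_pmf \<nu>" using AE_label by (simp add: AE_all_countable)
  then show ?thesis
  proof eventually_elim
    case (elim f)
    then show ?case using * by (simp add: step_field_def)
  qed
qed

end

subsection \<open>Selectors\<close>

text \<open>A selector of level \<open>G\<close> chooses vertices of level \<open>G\<close> from the labels of the levels below \<open>G\<close>;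
  the subtrees at the chosen vertices are then independent of the choice.\<close>

definition selector :: "'c pmf \<Rightarrow> nat \<Rightarrow> ((nat list \<Rightarrow> 'c) \<Rightarrow> nat list list) \<Rightarrow> bool" where
  "selector \<nu> G s \<longleftrightarrow> s \<in> fieldM \<nu> \<rightarrow>\<^sub>M count_space UNIV \<and> depends_below G s \<and>
     (\<forall>f. distinct (s f) \<and> (\<forall>v\<in>set (s f). length v = G))"

lemma selectorD:
  assumes "selector \<nu> G s"
  shows "s \<in> fieldM \<nu> \<rightarrow>\<^sub>M count_space UNIV" "depends_below G s" "distinct (s f)"
    "v \<in> set (s f) \<Longrightarrow> length v = G"
  using assms by (auto simp: selector_def)

definition branches ::
  "((nat list \<Rightarrow> 'c) \<Rightarrow> nat list list) \<Rightarrow> ((nat list \<Rightarrow> 'c) \<Rightarrow> nat list list) \<Rightarrow>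
   (nat list \<Rightarrow> 'c) \<Rightarrow> nat list list list" where
  "branches s1 s2 f = map (\<lambda>v. map ((@) v) (s2 (sh v f))) (s1 f)"

text \<open>The common property of \<open>concat\<close>, which keeps all descendants, and of
  \<open>pick N\<close>, which selects among them; so \<open>iterate\<close> and
  \<open>leaves\<close> share their proofs.\<close>

definition sub_concat :: "(nat list list list \<Rightarrow> nat list list) \<Rightarrow> bool" where
  "sub_concat h \<longleftrightarrow> (\<forall>Ls. set (h Ls) \<subseteq> set (concat Ls) \<and> (distinct (concat Ls) \<longrightarrow> distinct (h Ls)))"

lemma measurable_branches:
  assumes "s1 \<in> fieldM \<nu> \<rightarrow>\<^sub>M count_space UNIV" "s2 \<in> fieldM \<nu> \<rightarrow>\<^sub>M count_space UNIV"
  shows "branches s1 s2 \<in> fieldM \<nu> \<rightarrow>\<^sub>M count_space UNIV"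
proof -
  have "(\<lambda>f. map ((@) v) (s2 (sh v f))) \<in> fieldM \<nu> \<rightarrow>\<^sub>M count_space UNIV" for v
    by (rule measurable_compose[OF measurable_compose[OF measurable_sh assms(2)]]) simp
  then have "(\<lambda>f. map (\<lambda>v. map ((@) v) (s2 (sh v f))) c) \<in> fieldM \<nu> \<rightarrow>\<^sub>M count_space UNIV" for c
    by (rule measurable_map_list)
  from measurable_compose_countable[OF this assms(1)] show ?thesis by (simp add: branches_def[abs_def])
qed

lemma selector_branches:
  assumes s1: "selector \<nu> G1 s1" and s2: "selector \<nu> G2 s2" and h: "sub_concat h"
  shows "selector \<nu> (G1 + G2) (\<lambda>f. h (branches s1 s2 f))"
  unfolding selector_def
proof (intro conjI allI)
  show "(\<lambda>f. h (branches s1 s2 f)) \<in> fieldM \<nu> \<rightarrow>\<^sub>M count_space UNIV"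
    by (rule measurable_compose[OF measurable_branches]) (use s1 s2 in \<open>auto simp: selector_def\<close>)
  show "depends_below (G1 + G2) (\<lambda>f. h (branches s1 s2 f))"
  proof (rule depends_below_compose[where g = h])
    show "depends_below (G1 + G2) (branches s1 s2)"
      unfolding depends_below_def
    proof (intro allI impI)
      fix f f' :: "nat list \<Rightarrow> 'a" assume eq: "\<forall>u. length u < G1 + G2 \<longrightarrow> f u = f' u"
      have "s1 f = s1 f'" using eq by (intro depends_belowD[OF selectorD(2)[OF s1]]) simp
      moreover have "s2 (sh v f) = s2 (sh v f')" if "v \<in> set (s1 f)" for v
        using eq selectorD(4)[OF s1 that]
        by (intro depends_belowD[OF selectorD(2)[OF s2]]) (simp add: sh_def)
      ultimately show "branches s1 s2 f = branches s1 s2 f'" by (simp add: branches_def)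
    qed
  qed
  fix f
  have len: "length u = G1 + G2" if "u \<in> set (concat (branches s1 s2 f))" for u
    using that selectorD(4)[OF s1] selectorD(4)[OF s2] by (auto simp: branches_def)
  show "\<forall>v\<in>set (h (branches s1 s2 f)). length v = G1 + G2"
    using len h unfolding sub_concat_def by blast
  have "distinct (concat (map (\<lambda>v. map ((@) v) (l v)) vs))"
    if "distinct vs" "\<And>v. v \<in> set vs \<Longrightarrow> length v = G1" "\<And>v. distinct (l v)" for vs and l :: "nat list \<Rightarrow> nat list list"
    using that(1,2)
  proof (induction vs)
    case (Cons a vs)
    have "a @ x \<noteq> b @ y" if "b \<in> set vs" for b x y
      using Cons.prems that by (metis append_eq_append_conv distinct.simps(2) list.set_intros)
    then have "set (map ((@) a) (l a)) \<inter> set (concat (map (\<lambda>v. map ((@) v) (l v)) vs)) = {}" by auto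
    moreover have "distinct (map ((@) a) (l a))" using that(3) by (simp add: distinct_map inj_on_def)
    moreover have "distinct (concat (map (\<lambda>v. map ((@) v) (l v)) vs))"
      using Cons.prems by (intro Cons.IH) auto
    ultimately show ?case by (simp only: list.map concat.simps distinct_append)
  qed simp
  from this[OF selectorD(3)[OF s1, of f] selectorD(4)[OF s1, of _ f] selectorD(3)[OF s2]]
  have "distinct (concat (branches s1 s2 f))" by (simp add: branches_def)
  then show "distinct (h (branches s1 s2 f))" using h by (simp add: sub_concat_def)
qed

primrec iterate :: "((nat list \<Rightarrow> 'c) \<Rightarrow> nat list list) \<Rightarrow> nat \<Rightarrow> (nat list \<Rightarrow> 'c) \<Rightarrow> nat list list" where
  "iterate s 0 = (\<lambda>f. [[]])"
| "iterate s (Suc k) = (\<lambda>f. concat (branches s (iterate s k) f))"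

lemma sub_concat_concat: "sub_concat concat"
  by (simp add: sub_concat_def)

lemma selector_Nil: "selector \<nu> 0 (\<lambda>f. [[]])"
  by (simp add: selector_def depends_below_def)

lemma selector_iterate: "selector \<nu> G s \<Longrightarrow> selector \<nu> (k * G) (iterate s k)"
  by (induction k) (auto simp: selector_Nil intro: selector_branches sub_concat_concat)

text \<open>Exactly \<open>N\<close> nonempty branches or nothing at all: a tree that is found has
  exactly \<open>N ^ D\<close> leaves, which is what makes the later Cantor set homogeneous.\<close>

definition pick :: "nat \<Rightarrow> nat list list list \<Rightarrow> nat list list" where
  "pick N Ls = (let Gs = filter (\<lambda>l. l \<noteq> []) Ls in if N \<le> length Gs then concat (take N Gs) else [])"

lemma sub_concat_pick: "sub_concat (pick N)"
proof -
  have *: "set (concat (take N (filter (\<lambda>l. l \<noteq> []) Ls))) \<subseteq> set (concat Ls)" for Ls :: "nat list list list"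
    using set_take_subset[of N "filter (\<lambda>l. l \<noteq> []) Ls"] by auto
  have "distinct (concat (take N (filter (\<lambda>l. l \<noteq> []) Ls)))" if d: "distinct (concat Ls)" for Ls :: "nat list list list"
  proof -
    have "concat (filter (\<lambda>l. l \<noteq> []) Ls) = concat Ls" by (induction Ls) auto
    then have "concat Ls = concat (take N (filter (\<lambda>l. l \<noteq> []) Ls)) @ concat (drop N (filter (\<lambda>l. l \<noteq> []) Ls))"
      by (metis append_take_drop_id concat_append)
    then show ?thesis using d by (metis distinct_append)
  qed
  with * show ?thesis by (auto simp: sub_concat_def pick_def Let_def)
qed

text \<open>The leaves of an \<open>N\<close>-ary subtree of depth \<open>D\<close>, or \<open>[]\<close> if there is none.\<close>

primrec leaves :: "nat \<Rightarrow> ((nat list \<Rightarrow> 'c) \<Rightarrow> nat list list) \<Rightarrow> nat \<Rightarrow> (nat list \<Rightarrow> 'c) \<Rightarrow> nat list list" where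
  "leaves N s 0 = (\<lambda>f. [[]])"
| "leaves N s (Suc D) = (\<lambda>f. pick N (branches s (leaves N s D) f))"

lemma leaves_SucE:
  assumes "v \<in> set (leaves N s (Suc D) f)"
  obtains u w where "v = u @ w" "u \<in> set (s f)" "w \<in> set (leaves N s D (sh u f))"
proof -
  have "set (pick N (branches s (leaves N s D) f)) \<subseteq> set (concat (branches s (leaves N s D) f))"
    using sub_concat_pick unfolding sub_concat_def by blast
  then have "v \<in> set (concat (branches s (leaves N s D) f))" using assms by auto
  then show ?thesis using that by (auto simp: branches_def)
qed

lemma selector_leaves: "selector \<nu> G s \<Longrightarrow> selector \<nu> (D * G) (leaves N s D)"
  by (induction D) (auto simp: selector_Nil intro: selector_branches sub_concat_pick)

lemma length_leaves:
  assumes "N > 0"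
  shows "length (leaves N s D f) = (if leaves N s D f = [] then 0 else N ^ D)"
proof (induction D arbitrary: f)
  case (Suc D)
  have l: "length l = N ^ D" if "l \<in> set (filter (\<lambda>l. l \<noteq> []) (branches s (leaves N s D) f))" for l
    using that Suc by (auto simp: branches_def split: if_splits)
  define Gs where "Gs = filter (\<lambda>l. l \<noteq> []) (branches s (leaves N s D) f)"
  have "length (concat (take N Gs)) = N * N ^ D" if "N \<le> length Gs"
  proof -
    have "length (concat Ls) = length Ls * N ^ D" if "\<And>l. l \<in> set Ls \<Longrightarrow> length l = N ^ D" for Ls :: "nat list list list"
      using that by (induction Ls) auto
    moreover have "length l = N ^ D" if "l \<in> set (take N Gs)" for l
      using in_set_takeD[OF that] unfolding Gs_def by (rule l)
    ultimately have "length (concat (take N Gs)) = length (take N Gs) * N ^ D" by blast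
    then show ?thesis using that by simp
  qed
  then show ?case by (auto simp: pick_def Let_def Gs_def[symmetric])
qed simp

lemma leaves_Suc_nonempty:
  assumes "N > 0" "distinct (s f)"
  shows "leaves N s (Suc D) f \<noteq> [] \<longleftrightarrow> N \<le> card {v \<in> set (s f). leaves N s D (sh v f) \<noteq> []}"
proof -
  define Gs where "Gs = filter (\<lambda>l. l \<noteq> []) (branches s (leaves N s D) f)"
  have "length Gs = length (filter (\<lambda>v. leaves N s D (sh v f) \<noteq> []) (s f))"
    by (simp add: Gs_def branches_def filter_map comp_def)
  also have "\<dots> = card {v \<in> set (s f). leaves N s D (sh v f) \<noteq> []}"
    using assms(2) by (simp add: distinct_length_filter Int_def conj_commute)
  finally have len: "length Gs = card {v \<in> set (s f). leaves N s D (sh v f) \<noteq> []}" .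
  have "concat (take N Gs) \<noteq> []" if N: "N \<le> length Gs"
  proof -
    have "Gs \<noteq> []" using N assms(1) by auto
    then have "hd Gs \<in> set (take N Gs)" "hd Gs \<in> set Gs"
      using assms(1) by (cases N; auto simp: neq_Nil_conv)+
    moreover have "hd Gs \<noteq> []" using \<open>hd Gs \<in> set Gs\<close> by (simp add: Gs_def)
    ultimately show ?thesis by auto
  qed
  then show ?thesis by (auto simp: pick_def Let_def Gs_def[symmetric] len)
qed

lemma leaves_nonempty_mono:
  assumes "N > 0" "\<And>f. distinct (s f)"
  shows "leaves N s (Suc D) f \<noteq> [] \<Longrightarrow> leaves N s D f \<noteq> []"
proof (induction D arbitrary: f)
  case (Suc D)
  have "N \<le> card {v \<in> set (s f). leaves N s (Suc D) (sh v f) \<noteq> []}"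
    using Suc.prems leaves_Suc_nonempty[OF assms(1), of s f "Suc D"] assms(2) by blast
  also have "\<dots> \<le> card {v \<in> set (s f). leaves N s D (sh v f) \<noteq> []}"
    using Suc.IH by (intro card_mono) auto
  finally show ?case using leaves_Suc_nonempty[OF assms(1), of s f D] assms(2) by blast
qed simp

subsection \<open>Second moment estimates for selectors\<close>

lemma nn_integral_selector_sum:
  assumes s: "selector \<nu> G s" and \<phi> [measurable]: "\<phi> \<in> borel_measurable (fieldM \<nu>)"
  shows "(\<integral>\<^sup>+f. (\<Sum>v\<in>set (s f). \<phi> (sh v f)) \<partial>fieldM \<nu>) =
    (\<integral>\<^sup>+f. of_nat (length (s f)) \<partial>fieldM \<nu>) * (\<integral>\<^sup>+f. \<phi> f \<partial>fieldM \<nu>)"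
proof -
  note [measurable] = selectorD(1)[OF s]
  \<comment> \<open>\<open>nn_integral_level_sum\<close> requires vertices of level \<open>G\<close>
    for every possible value \<open>c\<close>, also for values that \<open>s\<close> never takes;
    hence the filter.\<close>
  define A where "A c = {v\<in>set c. length v = G}" for c :: "nat list list"
  have A: "A (s f) = set (s f)" for f using selectorD(4)[OF s] by (auto simp: A_def)
  have "(\<integral>\<^sup>+f. (\<Sum>v\<in>A (s f). \<phi> (sh v f)) \<partial>fieldM \<nu>) =
    (\<integral>\<^sup>+f. (\<Sum>v\<in>A (s f). \<integral>\<^sup>+f. \<phi> f \<partial>fieldM \<nu>) \<partial>fieldM \<nu>)"
    by (rule nn_integral_level_sum[where n = G and \<phi> = "\<lambda>_ _. \<phi>"])
       (auto simp: A_def selectorD[OF s])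
  also have "\<dots> = (\<integral>\<^sup>+f. of_nat (length (s f)) * (\<integral>\<^sup>+f. \<phi> f \<partial>fieldM \<nu>) \<partial>fieldM \<nu>)"
    by (simp add: A distinct_card[OF selectorD(3)[OF s]])
  also have "\<dots> = (\<integral>\<^sup>+f. of_nat (length (s f)) \<partial>fieldM \<nu>) * (\<integral>\<^sup>+f. \<phi> f \<partial>fieldM \<nu>)"
    by (rule nn_integral_multc) simp
  finally show ?thesis by (simp add: A)
qed

lemma nn_integral_selector_sum_square:
  assumes s: "selector \<nu> G s" and \<phi> [measurable]: "\<phi> \<in> borel_measurable (fieldM \<nu>)"
  shows "(\<integral>\<^sup>+f. (\<Sum>v\<in>set (s f). \<phi> (sh v f))\<^sup>2 \<partial>fieldM \<nu>) =
    (\<integral>\<^sup>+f. of_nat (length (s f)) \<partial>fieldM \<nu>) * (\<integral>\<^sup>+f. (\<phi> f)\<^sup>2 \<partial>fieldM \<nu>) +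
    (\<integral>\<^sup>+f. of_nat (length (s f) * (length (s f) - 1)) \<partial>fieldM \<nu>) * (\<integral>\<^sup>+f. \<phi> f \<partial>fieldM \<nu>)\<^sup>2"
proof -
  note [measurable] = selectorD(1)[OF s]
  define A where "A c = {v\<in>set c. length v = G}" for c :: "nat list list"
  have A: "A (s f) = set (s f)" for f using selectorD(4)[OF s] by (auto simp: A_def)
  let ?m = "\<integral>\<^sup>+f. \<phi> f \<partial>fieldM \<nu>" and ?q = "\<integral>\<^sup>+f. (\<phi> f)\<^sup>2 \<partial>fieldM \<nu>"
  have "(\<integral>\<^sup>+f. (\<Sum>v\<in>A (s f). \<phi> (sh v f))\<^sup>2 \<partial>fieldM \<nu>) =
    (\<integral>\<^sup>+f. (\<Sum>v\<in>A (s f). ?q + (\<Sum>w\<in>A (s f) - {v}. ?m * ?m)) \<partial>fieldM \<nu>)"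
    by (rule nn_integral_level_sum_square[where n = G and \<phi> = "\<lambda>_ _. \<phi>"])
       (auto simp: A_def selectorD[OF s])
  also have "\<dots> = (\<integral>\<^sup>+f. of_nat (length (s f)) * ?q + of_nat (length (s f) * (length (s f) - 1)) * ?m\<^sup>2 \<partial>fieldM \<nu>)"
    by (simp add: A distinct_card[OF selectorD(3)[OF s]] power2_eq_square distrib_left mult_ac of_nat_mult)
  also have "\<dots> = (\<integral>\<^sup>+f. of_nat (length (s f)) \<partial>fieldM \<nu>) * ?q +
    (\<integral>\<^sup>+f. of_nat (length (s f) * (length (s f) - 1)) \<partial>fieldM \<nu>) * ?m\<^sup>2"
    by (simp add: nn_integral_add nn_integral_multc del: of_nat_mult)
  finally show ?thesis by (simp add: A)
qed

text \<open>On the event that \<open>d\<close> vertices are available, the number of the first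
  \<open>d\<close> of them whose subtree lies in \<open>E\<close> is binomial with mean
  \<open>q * d\<close>, by independence of the subtrees. This is Chebyshev's inequality for a
  deviation of half the mean.\<close>

lemma selector_chebyshev:
  assumes s: "selector \<nu> G s" and E: "E \<in> sets (fieldM \<nu>)" "q = measure (fieldM \<nu>) E" "q > 0" and d: "d > 0"
  shows "measure (fieldM \<nu>) {f. d \<le> length (s f) \<and> real (card {v \<in> set (s f). sh v f \<in> E}) < q * real d / 2}
      \<le> 4 / (q * real d)"
proof -
  note [measurable] = selectorD(1)[OF s] E(1)
  define s' where "s' f = (if d \<le> length (s f) then take d (s f) else [])" for f
  have s': "selector \<nu> G s'"
    unfolding selector_def
  proof (intro conjI allI)
    show "s' \<in> fieldM \<nu> \<rightarrow>\<^sub>M count_space UNIV"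
      unfolding s'_def[abs_def] by (rule measurable_compose[OF selectorD(1)[OF s]]) simp
    show "depends_below G s'"
      unfolding s'_def[abs_def] by (rule depends_below_compose[OF selectorD(2)[OF s]])
    show "distinct (s' f)" for f using selectorD(3)[OF s] by (simp add: s'_def)
    show "\<forall>v\<in>set (s' f). length v = G" for f
      using selectorD(4)[OF s, of _ f] set_take_subset[of d "s f"] by (auto simp: s'_def subset_iff)
  qed
  note [measurable] = selectorD(1)[OF s']
  define H where "H = {f. d \<le> length (s f)}"
  have "{f \<in> space (fieldM \<nu>). d \<le> length (s f)} \<in> sets (fieldM \<nu>)" by measurable
  then have H [measurable]: "H \<in> sets (fieldM \<nu>)" by (simp add: H_def)
  define h where "h = measure (fieldM \<nu>) H"
  have h: "0 \<le> h" "h \<le> 1" by (auto simp: h_def)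
  have q1: "q \<le> 1" using E(2) by simp
  define X where "X f = (\<Sum>v\<in>set (s' f). indicator E (sh v f) :: ennreal)" for f
  have Xc: "X f = of_nat (card {v \<in> set (s' f). sh v f \<in> E})" for f
  proof -
    have "X f = (\<Sum>v\<in>set (s' f). if sh v f \<in> E then 1 else 0)"
      unfolding X_def by (intro sum.cong) (auto simp: indicator_def)
    also have "\<dots> = of_nat (card {v \<in> set (s' f). sh v f \<in> E})" by (simp add: sum.If_cases Int_def)
    finally show ?thesis .
  qed
  have Xm [measurable]: "X \<in> borel_measurable (fieldM \<nu>)"
  proof -
    have "(\<lambda>f. \<Sum>v\<in>set c. indicator E (sh v f) :: ennreal) \<in> borel_measurable (fieldM \<nu>)" for c by measurable
    from measurable_compose_countable[OF this selectorD(1)[OF s']] show ?thesis by (simp add: X_def[abs_def])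
  qed
  have len: "length (s' f) = d * indicator H f" for f by (auto simp: s'_def H_def)
  have e1: "(\<integral>\<^sup>+f. of_nat (length (s' f)) \<partial>fieldM \<nu>) = ennreal (real d * h)"
  proof -
    have "(\<integral>\<^sup>+f. of_nat (length (s' f)) \<partial>fieldM \<nu>) = (\<integral>\<^sup>+f. ennreal (real d) * indicator H f \<partial>fieldM \<nu>)"
      by (intro nn_integral_cong) (auto simp: len indicator_def ennreal_of_nat_eq_real_of_nat)
    then show ?thesis using H by (simp add: nn_integral_cmult fieldM.emeasure_eq_measure h_def ennreal_mult)
  qed
  have e2: "(\<integral>\<^sup>+f. of_nat (length (s' f) * (length (s' f) - 1)) \<partial>fieldM \<nu>) = ennreal (real (d * (d - 1)) * h)"
  proof -
    have "(\<integral>\<^sup>+f. of_nat (length (s' f) * (length (s' f) - 1)) \<partial>fieldM \<nu>) =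
        (\<integral>\<^sup>+f. ennreal (real (d * (d - 1))) * indicator H f \<partial>fieldM \<nu>)"
      by (intro nn_integral_cong) (auto simp: len indicator_def ennreal_of_nat_eq_real_of_nat simp del: of_nat_mult)
    then show ?thesis using H
      by (simp add: nn_integral_cmult fieldM.emeasure_eq_measure h_def ennreal_mult del: of_nat_mult)
  qed
  have Em: "(\<integral>\<^sup>+f. indicator E f \<partial>fieldM \<nu>) = ennreal q"
    using E(1) by (simp add: fieldM.emeasure_eq_measure E(2))
  have m1: "(\<integral>\<^sup>+f. X f \<partial>fieldM \<nu>) = ennreal (real d * h * q)"
    unfolding X_def nn_integral_selector_sum[OF s' borel_measurable_indicator[OF E(1)]] e1 Em
    using h E(3) by (simp add: ennreal_mult)
  have m2: "(\<integral>\<^sup>+f. (X f)\<^sup>2 \<partial>fieldM \<nu>) = ennreal (real d * h * q + real (d * (d - 1)) * h * q\<^sup>2)"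
  proof -
    have "(\<integral>\<^sup>+f. (indicator E f :: ennreal)\<^sup>2 \<partial>fieldM \<nu>) = ennreal q"
      unfolding Em[symmetric] by (intro nn_integral_cong) (auto simp: indicator_def)
    then show ?thesis
      unfolding X_def nn_integral_selector_sum_square[OF s' borel_measurable_indicator[OF E(1)]] e1 e2 Em
      using h E(3) by (simp add: ennreal_mult ennreal_power ennreal_plus del: of_nat_mult)
  qed
  define c where "c = real d * q"
  have c: "c > 0" using d E(3) by (simp add: c_def)
  define B where "B = {f. f \<in> H \<and> X f < ennreal (c / 2)}"
  have "{f \<in> space (fieldM \<nu>). f \<in> H \<and> X f < ennreal (c / 2)} \<in> sets (fieldM \<nu>)" by measurable
  then have Bm [measurable]: "B \<in> sets (fieldM \<nu>)" by (simp add: B_def)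
  \<comment> \<open>On \<open>H\<close>, this is
    \<open>(X - c)\<^sup>2 \<ge> (c / 2)\<^sup>2\<close> on \<open>B\<close>, with the mixed term
    moved to the left so that all terms are nonnegative.\<close>
  have pt: "ennreal (c\<^sup>2 / 4) * indicator B f + ennreal (2 * c) * X f \<le> (X f)\<^sup>2 + ennreal (c\<^sup>2) * indicator H f" for f
  proof (cases "f \<in> H")
    case True
    obtain x where x: "X f = ennreal x" "x \<ge> 0" by (metis Xc ennreal_of_nat_eq_real_of_nat of_nat_0_le_iff)
    have "c\<^sup>2 / 4 * indicator B f + 2 * c * x \<le> x\<^sup>2 + c\<^sup>2"
    proof (cases "f \<in> B")
      case True
      then have "x < c / 2" using x c by (simp add: B_def ennreal_less_iff)
      then have "(c / 2) * (c / 2) \<le> (c - x) * (c - x)" using c by (intro mult_mono) auto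
      then show ?thesis using True by (simp add: power2_eq_square algebra_simps)
    next
      case False
      then show ?thesis using sum_squares_ge_zero[of "c - x" 0] by (simp add: power2_eq_square algebra_simps)
    qed
    then have "ennreal (c\<^sup>2 / 4 * indicator B f + 2 * c * x) \<le> ennreal (x\<^sup>2 + c\<^sup>2)" by (rule ennreal_leI)
    then show ?thesis using True x c
      by (cases "f \<in> B") (simp_all add: ennreal_plus ennreal_mult ennreal_power)
  next
    case False
    then have "X f = 0" by (simp add: X_def s'_def H_def)
    then show ?thesis using False by (simp add: B_def)
  qed
  have "ennreal (c\<^sup>2 / 4 * measure (fieldM \<nu>) B + 2 * c * (real d * h * q))
      = ennreal (c\<^sup>2 / 4) * emeasure (fieldM \<nu>) B + ennreal (2 * c) * (\<integral>\<^sup>+f. X f \<partial>fieldM \<nu>)"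
    unfolding m1 fieldM.emeasure_eq_measure using c h E(3)
    by (subst ennreal_plus) (auto simp: ennreal_mult[symmetric])
  also have "\<dots> = (\<integral>\<^sup>+f. ennreal (c\<^sup>2 / 4) * indicator B f + ennreal (2 * c) * X f \<partial>fieldM \<nu>)"
    by (subst nn_integral_add) (auto simp: nn_integral_cmult)
  also have "\<dots> \<le> (\<integral>\<^sup>+f. (X f)\<^sup>2 + ennreal (c\<^sup>2) * indicator H f \<partial>fieldM \<nu>)"
    by (intro nn_integral_mono pt)
  also have "\<dots> = (\<integral>\<^sup>+f. (X f)\<^sup>2 \<partial>fieldM \<nu>) + ennreal (c\<^sup>2) * emeasure (fieldM \<nu>) H"
    by (subst nn_integral_add) (auto simp: nn_integral_cmult)
  also have "\<dots> = ennreal (real d * h * q + real (d * (d - 1)) * h * q\<^sup>2 + c\<^sup>2 * h)"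
    unfolding m2 fieldM.emeasure_eq_measure h_def[symmetric] using c h E(3)
    by (subst ennreal_mult[symmetric], simp, simp, subst ennreal_plus[symmetric]) auto
  finally have "ennreal (c\<^sup>2 / 4 * measure (fieldM \<nu>) B + 2 * c * (real d * h * q)) \<le>
      ennreal (real d * h * q + real (d * (d - 1)) * h * q\<^sup>2 + c\<^sup>2 * h)" .
  then have "c\<^sup>2 / 4 * measure (fieldM \<nu>) B + 2 * c * (real d * h * q) \<le>
      real d * h * q + real (d * (d - 1)) * h * q\<^sup>2 + c\<^sup>2 * h"
    using c h E(3) by (subst (asm) ennreal_le_iff) (auto intro!: add_nonneg_nonneg mult_nonneg_nonneg)
  moreover have "real (d * (d - 1)) * h * q\<^sup>2 \<le> c\<^sup>2 * h"
  proof -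
    have "real (d * (d - 1)) * (h * q\<^sup>2) \<le> (real d)\<^sup>2 * (h * q\<^sup>2)"
      using h by (intro mult_right_mono) (auto simp: power2_eq_square mult_left_mono)
    then show ?thesis by (simp add: c_def power_mult_distrib mult_ac)
  qed
  moreover have "2 * c * (real d * h * q) = 2 * c\<^sup>2 * h" by (simp add: c_def power2_eq_square)
  moreover have "real d * h * q \<le> c" using h d E(3) by (simp add: c_def mult_ac mult_left_le_one_le)
  ultimately have "c\<^sup>2 / 4 * measure (fieldM \<nu>) B \<le> c" by linarith
  then have "measure (fieldM \<nu>) B \<le> 4 / c" using c by (simp add: power2_eq_square field_simps)
  moreover have "{f. d \<le> length (s f) \<and> real (card {v \<in> set (s f). sh v f \<in> E}) < q * real d / 2} \<subseteq> B"
  proof safe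
    fix f assume f: "d \<le> length (s f)" "real (card {v \<in> set (s f). sh v f \<in> E}) < q * real d / 2"
    have "card {v \<in> set (s' f). sh v f \<in> E} \<le> card {v \<in> set (s f). sh v f \<in> E}"
      using set_take_subset[of d "s f"] f(1) by (intro card_mono) (auto simp: s'_def)
    then have "real (card {v \<in> set (s' f). sh v f \<in> E}) < c / 2" using f(2) by (simp add: c_def mult.commute)
    then show "f \<in> B" using f(1) c by (simp add: B_def H_def Xc ennreal_of_nat_eq_real_of_nat ennreal_less_iff)
  qed
  then have "measure (fieldM \<nu>) {f. d \<le> length (s f) \<and> real (card {v \<in> set (s f). sh v f \<in> E}) < q * real d / 2}
      \<le> measure (fieldM \<nu>) B"
    by (intro fieldM.finite_measure_mono Bm)
  ultimately show ?thesis by (simp add: c_def mult.commute)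
qed

subsection \<open>Embedded Galton--Watson trees\<close>

lemma length_branches:
  assumes "selector \<nu> G s"
  shows "length (concat (branches s t f)) = (\<Sum>v\<in>set (s f). length (t (sh v f)))"
proof -
  have "length (concat (branches s t f)) = sum_list (map (\<lambda>v. length (t (sh v f))) (s f))"
    by (simp add: branches_def length_concat comp_def)
  also have "\<dots> = (\<Sum>v\<in>set (s f). length (t (sh v f)))"
    using selectorD(3)[OF assms] by (rule sum_list_distinct_conv_sum_set)
  finally show ?thesis .
qed

lemma measurable_length:
  "selector \<nu> G s \<Longrightarrow> (\<lambda>f. g (s f)) \<in> fieldM \<nu> \<rightarrow>\<^sub>M borel"
  by (rule measurable_compose[OF selectorD(1)]) simp_all

lemma iterate_mean:
  assumes s: "selector \<nu> G s" and B: "(\<integral>\<^sup>+f. of_nat (length (s f)) \<partial>fieldM \<nu>) = ennreal B" "B \<ge> 0"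
  shows "(\<integral>\<^sup>+f. of_nat (length (iterate s k f)) \<partial>fieldM \<nu>) = ennreal (B ^ k)"
proof (induction k)
  case 0
  then show ?case by (simp add: fieldM.emeasure_space_1[simplified])
next
  case (Suc k)
  have "(\<integral>\<^sup>+f. of_nat (length (iterate s (Suc k) f)) \<partial>fieldM \<nu>) =
      (\<integral>\<^sup>+f. (\<Sum>v\<in>set (s f). of_nat (length (iterate s k (sh v f)))) \<partial>fieldM \<nu>)"
    by (simp only: iterate.simps length_branches[OF s] of_nat_sum)
  also have "\<dots> = ennreal B * ennreal (B ^ k)"
    unfolding B(1)[symmetric] Suc[symmetric]
    by (rule nn_integral_selector_sum[OF s measurable_length[OF selector_iterate[OF s]]])
  also have "\<dots> = ennreal (B ^ Suc k)" using B(2) by (simp add: ennreal_mult)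
  finally show ?case .
qed

lemma iterate_square:
  assumes s: "selector \<nu> G s" and B: "(\<integral>\<^sup>+f. of_nat (length (s f)) \<partial>fieldM \<nu>) = ennreal B" "B > 1"
    and C: "(\<integral>\<^sup>+f. of_nat (length (s f) * (length (s f) - 1)) \<partial>fieldM \<nu>) \<le> ennreal C" "C \<ge> 0"
  shows "(\<integral>\<^sup>+f. (of_nat (length (iterate s k f)))\<^sup>2 \<partial>fieldM \<nu>) \<le> ennreal ((1 + C / (B\<^sup>2 - B)) * (B ^ k)\<^sup>2)"
proof (induction k)
  case 0
  have "B\<^sup>2 - B \<ge> 0" using B(2) by (simp add: power2_eq_square)
  then have "ennreal 1 \<le> ennreal ((1 + C / (B\<^sup>2 - B)) * (B ^ 0)\<^sup>2)"
    using C(2) by (intro ennreal_leI) simp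
  then show ?case by (simp add: fieldM.emeasure_space_1[simplified])
next
  case (Suc k)
  \<comment> \<open>The constant is chosen so that \<open>B * D + C \<le> D * B\<^sup>2\<close>,
    that is, so that the bound reproduces itself from one iterate to the next.\<close>
  define D where "D = 1 + C / (B\<^sup>2 - B)"
  have BB: "B\<^sup>2 - B > 0" using B(2) by (simp add: power2_eq_square)
  have "D * (B\<^sup>2 - B) = (B\<^sup>2 - B) + C" using BB by (simp add: D_def distrib_right)
  then have D: "D \<ge> 1" "D * (B\<^sup>2 - B) \<ge> C" using C(2) BB by (auto simp: D_def)
  have "(\<integral>\<^sup>+f. (of_nat (length (iterate s (Suc k) f)))\<^sup>2 \<partial>fieldM \<nu>) =
      (\<integral>\<^sup>+f. (\<Sum>v\<in>set (s f). of_nat (length (iterate s k (sh v f))))\<^sup>2 \<partial>fieldM \<nu>)"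
    by (simp only: iterate.simps length_branches[OF s] of_nat_sum)
  also have "\<dots> = ennreal B * (\<integral>\<^sup>+f. (of_nat (length (iterate s k f)))\<^sup>2 \<partial>fieldM \<nu>) +
      (\<integral>\<^sup>+f. of_nat (length (s f) * (length (s f) - 1)) \<partial>fieldM \<nu>) * (ennreal (B ^ k))\<^sup>2"
    unfolding B(1)[symmetric] iterate_mean[OF s B(1) less_imp_le[OF less_trans[OF zero_less_one B(2)]], symmetric]
    by (rule nn_integral_selector_sum_square[OF s measurable_length[OF selector_iterate[OF s]]])
  also have "\<dots> \<le> ennreal B * ennreal (D * (B ^ k)\<^sup>2) + ennreal C * (ennreal (B ^ k))\<^sup>2"
    using Suc C(1) by (intro add_mono mult_left_mono mult_right_mono) (auto simp: D_def)
  also have "\<dots> = ennreal ((B * D + C) * (B ^ k)\<^sup>2)"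
  proof -
    have "ennreal B * ennreal (D * (B ^ k)\<^sup>2) + ennreal C * (ennreal (B ^ k))\<^sup>2 =
        ennreal (B * (D * (B ^ k)\<^sup>2)) + ennreal (C * (B ^ k)\<^sup>2)"
      using B(2) C(2) D(1) by (simp add: ennreal_mult ennreal_power)
    also have "\<dots> = ennreal (B * (D * (B ^ k)\<^sup>2) + C * (B ^ k)\<^sup>2)"
      using B(2) C(2) D(1) by (intro ennreal_plus[symmetric]) auto
    finally show ?thesis by (simp add: algebra_simps)
  qed
  also have "\<dots> \<le> ennreal (D * (B ^ Suc k)\<^sup>2)"
  proof (rule ennreal_leI)
    have "B * D + C \<le> D * B\<^sup>2" using D(2) by (simp add: algebra_simps)
    then have "(B * D + C) * (B ^ k)\<^sup>2 \<le> (D * B\<^sup>2) * (B ^ k)\<^sup>2" by (rule mult_right_mono) simp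
    then show "(B * D + C) * (B ^ k)\<^sup>2 \<le> D * (B ^ Suc k)\<^sup>2" by (simp add: power_mult_distrib mult_ac)
  qed
  finally show ?case by (simp only: D_def)
qed

lemma paley_zygmund:
  assumes "prob_space M" and X [measurable]: "X \<in> borel_measurable M"
    and m: "(\<integral>\<^sup>+x. X x \<partial>M) = ennreal m" "m > 0"
    and sq: "(\<integral>\<^sup>+x. (X x)\<^sup>2 \<partial>M) \<le> ennreal (D * m\<^sup>2)" "D > 0"
  shows "1 / (4 * D) \<le> measure M {x \<in> space M. ennreal (m / 2) \<le> X x}"
proof -
  interpret prob_space M by fact
  define E where "E = {x \<in> space M. ennreal (m / 2) \<le> X x}"
  have E [measurable]: "E \<in> sets M" unfolding E_def by measurable
  \<comment> \<open>Off \<open>E\<close> the variable is below half its mean, so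
    \<open>2 * t * X \<le> t * m\<close>; on \<open>E\<close> the square is completed. With this
    \<open>t\<close>, integration leaves \<open>D * m\<^sup>2\<close> to be covered by
    \<open>t\<^sup>2\<close> times the probability of \<open>E\<close>.\<close>
  define t where "t = 2 * D * m"
  have t: "t > 0" using m(2) sq(2) by (simp add: t_def)
  have pt: "ennreal (2 * t) * X x \<le> (ennreal (t * m) + (X x)\<^sup>2) + ennreal (t\<^sup>2) * indicator E x" if "x \<in> space M" for x
  proof (cases "X x")
    case (real c)
    have "2 * t * c \<le> t * m + c\<^sup>2 + t\<^sup>2 * indicator E x"
    proof (cases "x \<in> E")
      case True
      have "2 * t * c \<le> c\<^sup>2 + t\<^sup>2" using sum_squares_ge_zero[of "c - t" 0] by (simp add: power2_eq_square algebra_simps)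
      moreover have "0 \<le> t * m" using t m(2) by simp
      ultimately show ?thesis using True by simp
    next
      case False
      then have "2 * c < m" using that real m(2) by (simp add: E_def)
      then have "t * (2 * c) \<le> t * m" using t by simp
      then show ?thesis using False by (simp add: mult_ac add_increasing2)
    qed
    then have "ennreal (2 * t * c) \<le> ennreal (t * m + c\<^sup>2 + t\<^sup>2 * indicator E x)" by (rule ennreal_leI)
    also have "\<dots> = ennreal (t * m) + ennreal (c\<^sup>2) + ennreal (t\<^sup>2 * indicator E x)"
      using t m(2) by (subst ennreal_plus, simp, simp, subst ennreal_plus) auto
    finally show ?thesis using real t by (cases "x \<in> E") (simp_all add: ennreal_mult ennreal_power)
  qed (use t in \<open>simp add: power2_eq_square ennreal_top_mult\<close>)
  have "ennreal (2 * t * m) = (\<integral>\<^sup>+x. ennreal (2 * t) * X x \<partial>M)"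
    using t m(2) by (simp add: nn_integral_cmult m(1) ennreal_mult)
  also have "\<dots> \<le> (\<integral>\<^sup>+x. (ennreal (t * m) + (X x)\<^sup>2) + ennreal (t\<^sup>2) * indicator E x \<partial>M)"
    by (intro nn_integral_mono pt)
  also have "\<dots> = ennreal (t * m) + (\<integral>\<^sup>+x. (X x)\<^sup>2 \<partial>M) + ennreal (t\<^sup>2) * emeasure M E"
    by (simp add: nn_integral_add nn_integral_cmult emeasure_space_1)
  also have "\<dots> \<le> ennreal (t * m) + ennreal (D * m\<^sup>2) + ennreal (t\<^sup>2) * ennreal (measure M E)"
    using sq(1) by (intro add_mono) (auto simp: emeasure_eq_measure)
  also have "\<dots> = ennreal (t * m + D * m\<^sup>2 + t\<^sup>2 * measure M E)"
    using t m(2) sq(2)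
    by (subst ennreal_mult[symmetric], simp, simp, subst ennreal_plus[symmetric], simp, simp,
        subst ennreal_plus[symmetric]) auto
  finally have "2 * t * m \<le> t * m + D * m\<^sup>2 + t\<^sup>2 * measure M E"
    using t m(2) sq(2) by (subst (asm) ennreal_le_iff) auto
  then have "D * m\<^sup>2 \<le> (4 * D * measure M E) * (D * m\<^sup>2)"
    by (simp add: t_def power2_eq_square algebra_simps)
  then have "1 \<le> 4 * D * measure M E" using m(2) sq(2) by (simp add: mult_ac)
  then show ?thesis using sq(2) by (simp add: E_def[symmetric] field_simps)
qed

definition alive :: "nat \<Rightarrow> ((nat list \<Rightarrow> 'c) \<Rightarrow> nat list list) \<Rightarrow> (nat list \<Rightarrow> 'c) set" where
  "alive N s = {f. \<forall>D. leaves N s D f \<noteq> []}"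

lemma sets_leaves_nonempty: "selector \<nu> G s \<Longrightarrow> {f. leaves N s D f \<noteq> []} \<in> sets (fieldM \<nu>)"
proof -
  assume "selector \<nu> G s"
  then have [measurable]: "leaves N s D \<in> fieldM \<nu> \<rightarrow>\<^sub>M count_space UNIV"
    by (rule selectorD(1)[OF selector_leaves])
  have "{f \<in> space (fieldM \<nu>). leaves N s D f \<noteq> []} \<in> sets (fieldM \<nu>)" by measurable
  then show ?thesis by simp
qed

lemma alive_eq: "alive N s = (\<Inter>D. {f. leaves N s D f \<noteq> []})"
  by (auto simp: alive_def)

lemma sets_alive: "selector \<nu> G s \<Longrightarrow> alive N s \<in> sets (fieldM \<nu>)"
  unfolding alive_eq by (intro sets.countable_INT) (auto intro: sets_leaves_nonempty)

lemma sets_card_event: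
  assumes s: "selector \<nu> G s" and E: "E \<in> sets (fieldM \<nu>)"
  shows "{f. Q (length (s f)) (card {v \<in> set (s f). sh v f \<in> E})} \<in> sets (fieldM \<nu>)"
proof -
  note [measurable] = selectorD(1)[OF s]
  have "(\<lambda>f. card {v \<in> set l. sh v f \<in> E}) \<in> fieldM \<nu> \<rightarrow>\<^sub>M count_space UNIV" for l
  proof -
    have "card {v \<in> set l. sh v f \<in> E} = (\<Sum>v\<in>set l. if sh v f \<in> E then 1 else 0)" for f
      by (simp add: sum.If_cases Int_def)
    moreover have "(\<lambda>f. \<Sum>v\<in>set l. if sh v f \<in> E then 1 else (0::nat)) \<in> fieldM \<nu> \<rightarrow>\<^sub>M count_space UNIV"
      using E by measurable
    ultimately show ?thesis by simp
  qed
  from measurable_compose_countable[OF this selectorD(1)[OF s]]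
  have [measurable]: "(\<lambda>f. card {v \<in> set (s f). sh v f \<in> E}) \<in> fieldM \<nu> \<rightarrow>\<^sub>M count_space UNIV" .
  have "{f \<in> space (fieldM \<nu>). Q (length (s f)) (card {v \<in> set (s f). sh v f \<in> E})} \<in> sets (fieldM \<nu>)"
    by measurable
  then show ?thesis by simp
qed

text \<open>\<open>c / 2\<close> is a lower bound for the probabilities of containing an \<open>N\<close>-ary tree of finite depth that is
  preserved when the depth grows.\<close>

lemma survival:
  assumes s: "selector \<nu> G s" and c: "c > 0" "c \<le> measure (fieldM \<nu>) {f. d \<le> length (s f)}"
    and d: "16 / c\<^sup>2 \<le> real d" and N: "N > 0" "real N \<le> c / 2 * real d / 2"
  shows "c / 2 \<le> measure (fieldM \<nu>) (alive N s)"
proof -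
  note [measurable] = selectorD(1)[OF s]
  have d0: "d > 0" using d c(1) by (cases "d = 0") (auto simp: field_simps)
  have c1: "c \<le> 1" using c(2) fieldM.prob_le_1[of \<nu>] order_trans by blast
  have fin: "c / 2 \<le> measure (fieldM \<nu>) {f. leaves N s D f \<noteq> []}" for D
  proof (induction D)
    case 0
    then show ?case using c1 fieldM.prob_space[of \<nu>] by simp
  next
    case (Suc D)
    define E where "E = {f. leaves N s D f \<noteq> []}"
    define q where "q = measure (fieldM \<nu>) E"
    have E: "E \<in> sets (fieldM \<nu>)" unfolding E_def by (rule sets_leaves_nonempty[OF s])
    have q: "c / 2 \<le> q" using Suc by (simp add: q_def E_def)
    define bad where "bad = {f. d \<le> length (s f) \<and> real (card {v \<in> set (s f). sh v f \<in> E}) < q * real d / 2}"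
    have "measure (fieldM \<nu>) bad \<le> 4 / (q * real d)"
      unfolding bad_def using q c(1) d0 by (intro selector_chebyshev[OF s E q_def]) auto
    also have "\<dots> \<le> 4 / (c / 2 * real d)"
      using q c(1) d0 by (intro divide_left_mono mult_right_mono) auto
    also have "\<dots> \<le> c / 2"
    proof -
      have "16 \<le> c\<^sup>2 * real d" using d c(1) by (simp add: field_simps)
      then show ?thesis using c(1) d0 by (simp add: field_simps power2_eq_square)
    qed
    finally have bad: "measure (fieldM \<nu>) bad \<le> c / 2" .
    have sub: "{f. d \<le> length (s f)} \<subseteq> bad \<union> {f. leaves N s (Suc D) f \<noteq> []}"
    proof safe
      fix f assume f: "d \<le> length (s f)" "leaves N s (Suc D) f = []" "f \<notin> bad"
      have "real N \<le> q * real d / 2"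
      proof -
        have "c / 2 * real d \<le> q * real d" using q by (rule mult_right_mono) simp
        then show ?thesis using N(2) by simp
      qed
      also have "\<dots> \<le> real (card {v \<in> set (s f). sh v f \<in> E})" using f by (simp add: bad_def)
      finally have "leaves N s (Suc D) f \<noteq> []"
        using leaves_Suc_nonempty[where s = s and f = f and D = D, OF N(1) selectorD(3)[OF s]] by (simp add: E_def)
      then show False using f by simp
    qed
    have badm: "bad \<in> sets (fieldM \<nu>)"
      unfolding bad_def
      by (rule sets_card_event[OF s E, where Q = "\<lambda>l c. d \<le> l \<and> real c < q * real d / 2"])
    have "c \<le> measure (fieldM \<nu>) {f. d \<le> length (s f)}" by fact
    also have "\<dots> \<le> measure (fieldM \<nu>) (bad \<union> {f. leaves N s (Suc D) f \<noteq> []})"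
      using badm sets_leaves_nonempty[OF s] by (intro fieldM.finite_measure_mono sub sets.Un)
    also have "\<dots> \<le> measure (fieldM \<nu>) bad + measure (fieldM \<nu>) {f. leaves N s (Suc D) f \<noteq> []}"
      using badm sets_leaves_nonempty[OF s] by (intro measure_Un_le)
    finally show ?case using bad by simp
  qed
  have "(\<lambda>D. measure (fieldM \<nu>) {f. leaves N s D f \<noteq> []}) \<longlonglongrightarrow> measure (fieldM \<nu>) (\<Inter>D. {f. leaves N s D f \<noteq> []})"
  proof (rule fieldM.finite_Lim_measure_decseq)
    show "range (\<lambda>D. {f. leaves N s D f \<noteq> []}) \<subseteq> sets (fieldM \<nu>)" using sets_leaves_nonempty[OF s] by auto
    show "decseq (\<lambda>D. {f. leaves N s D f \<noteq> []})"
      using leaves_nonempty_mono[OF N(1), of s] selectorD(3)[OF s] by (intro decseq_SucI) blast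
  qed
  then show ?thesis unfolding alive_eq[symmetric] by (rule LIMSEQ_le_const) (use fin in auto)
qed

text \<open>A selector of mean \<open>B > 1\<close> generates a supercritical Galton-Watson process.
  The probability of at least \<open>B ^ k / 2\<close> vertices in its generation \<open>k\<close>
  is bounded below uniformly in \<open>k\<close>. For survival the degree may be a fixed fraction of
  this number, and since \<open>b < B\<close> that fraction still exceeds \<open>b ^ k\<close> for
  large \<open>k\<close>.\<close>

lemma ex_alive_iterate:
  assumes s: "selector \<nu> G s" and B: "(\<integral>\<^sup>+f. of_nat (length (s f)) \<partial>fieldM \<nu>) = ennreal B" "B > 1"
    and C: "(\<integral>\<^sup>+f. of_nat (length (s f) * (length (s f) - 1)) \<partial>fieldM \<nu>) < \<top>"
    and b: "1 \<le> b" "b < B"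
  obtains k N where "k > 0" "N \<ge> 2" "b ^ k \<le> real N" "0 < measure (fieldM \<nu>) (alive N (iterate s k))"
proof -
  obtain C' where C': "(\<integral>\<^sup>+f. of_nat (length (s f) * (length (s f) - 1)) \<partial>fieldM \<nu>) = ennreal C'" "C' \<ge> 0"
    using C by (cases "\<integral>\<^sup>+f. of_nat (length (s f) * (length (s f) - 1)) \<partial>fieldM \<nu>") auto
  define D where "D = 1 + C' / (B\<^sup>2 - B)"
  have "B\<^sup>2 - B > 0" using B(2) by (simp add: power2_eq_square)
  then have D: "D \<ge> 1" using C'(2) by (simp add: D_def)
  define c where "c = 1 / (4 * D)"
  have c: "c > 0" using D by (simp add: c_def)
  have "1 < B / b" using b by simp
  \<comment> \<open>The constant 32 leaves \<open>c / 4 * d \<ge> 4 * b ^ k\<close>, so that after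
    rounding down the degree is still at least \<open>b ^ k\<close> and at least 2.\<close>
  then obtain k0 where k0: "max (32 / c) (32 / c\<^sup>2) < (B / b) ^ k0" using real_arch_pow by blast
  define k where "k = Suc k0"
  have "(B / b) ^ k0 \<le> (B / b) ^ k" unfolding k_def using \<open>1 < B / b\<close> by (intro power_increasing) auto
  then have k: "32 / c \<le> (B / b) ^ k" "32 / c\<^sup>2 \<le> (B / b) ^ k" using k0 by linarith+
  have bk: "1 \<le> b ^ k" using b by simp
  have Bk: "(B / b) ^ k * b ^ k = B ^ k" using b by (simp add: power_divide)
  define d where "d = nat \<lceil>B ^ k / 2\<rceil>"
  have d: "B ^ k / 2 \<le> real d" unfolding d_def by linarith
  have Bk1: "32 / c\<^sup>2 \<le> B ^ k"
  proof -
    have "32 / c\<^sup>2 * 1 \<le> (B / b) ^ k * b ^ k" using k(2) bk c b by (intro mult_mono) auto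
    then show ?thesis by (simp add: Bk)
  qed
  have Bk2: "32 / c * b ^ k \<le> B ^ k"
    unfolding Bk[symmetric] using k(1) bk by (intro mult_right_mono) auto
  define N where "N = nat \<lfloor>c / 2 * real d / 2\<rfloor>"
  have cd: "4 * b ^ k \<le> c / 2 * real d / 2"
  proof -
    have "32 * b ^ k \<le> c * B ^ k" using Bk2 c by (simp add: field_simps)
    also have "\<dots> \<le> c * (2 * real d)" using d c by (intro mult_left_mono) auto
    finally show ?thesis by simp
  qed
  have N1: "real N \<le> c / 2 * real d / 2" unfolding N_def using c by (intro of_nat_floor) simp
  have N2: "c / 2 * real d / 2 - 1 < real N" unfolding N_def by linarith
  have "real N > 4 * b ^ k - 1" using cd N2 by linarith
  then have N: "b ^ k \<le> real N" "N \<ge> 2" using bk by linarith+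
  note sk = selector_iterate[OF s, of k]
  have cle: "c \<le> measure (fieldM \<nu>) {f. d \<le> length (iterate s k f)}"
  proof -
    have "1 / (4 * D) \<le> measure (fieldM \<nu>) {f \<in> space (fieldM \<nu>). ennreal (B ^ k / 2) \<le> of_nat (length (iterate s k f))}"
    proof (rule paley_zygmund[OF prob_space_fieldM])
      show "(\<lambda>f. of_nat (length (iterate s k f))) \<in> borel_measurable (fieldM \<nu>)" by (rule measurable_length[OF sk])
      show "(\<integral>\<^sup>+f. of_nat (length (iterate s k f)) \<partial>fieldM \<nu>) = ennreal (B ^ k)"
        using B by (intro iterate_mean[OF s]) auto
      show "(\<integral>\<^sup>+f. (of_nat (length (iterate s k f)))\<^sup>2 \<partial>fieldM \<nu>) \<le> ennreal (D * (B ^ k)\<^sup>2)"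
        unfolding D_def using C' by (intro iterate_square[OF s B]) auto
    qed (use B D in auto)
    also have "{f \<in> space (fieldM \<nu>). ennreal (B ^ k / 2) \<le> of_nat (length (iterate s k f))} = {f. d \<le> length (iterate s k f)}"
      by (auto simp: d_def ennreal_of_nat_eq_real_of_nat nat_le_iff ceiling_le_iff)
    finally show ?thesis by (simp add: c_def)
  qed
  have "c / 2 \<le> measure (fieldM \<nu>) (alive N (iterate s k))"
  proof (rule survival[OF sk c cle])
    show "16 / c\<^sup>2 \<le> real d" using Bk1 d by linarith
  qed (use N N1 in auto)
  then show ?thesis using c N by (intro that[of k N]) (auto simp: k_def)
qed

subsection \<open>Blocks without cancellation\<close>

definition rep :: "(nat list \<times> 'g word) list \<Rightarrow> 'g word \<Rightarrow> nat list" where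
  "rep gs w = fst (hd (filter (\<lambda>(v, w'). w' = w) gs))"

lemma rep_in: "w \<in> snd ` set gs \<Longrightarrow> (rep gs w, w) \<in> set gs"
proof -
  assume "w \<in> snd ` set gs"
  then have "filter (\<lambda>(v, w'). w' = w) gs \<noteq> []" by (auto simp: filter_empty_conv)
  then have "hd (filter (\<lambda>(v, w'). w' = w) gs) \<in> set (filter (\<lambda>(v, w'). w' = w) gs)" by (rule hd_in_set)
  then show ?thesis unfolding rep_def by (auto simp: case_prod_unfold) (metis prod.collapse)
qed

text \<open>Chosen vertices sit at distinct words that can be concatenated freely. As all of these
  have the same length, the word at the end of several blocks determines the vertex after each
  block.\<close>

definition tracks :: "'g letter \<Rightarrow> nat \<Rightarrow> ('g field \<Rightarrow> nat list list) \<Rightarrow> bool" where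
  "tracks a M s \<longleftrightarrow> (\<forall>f. step_field f \<longrightarrow>
     (\<forall>v\<in>set (s f). intree v f \<and> pos v f \<in> block_words a M) \<and> inj_on (\<lambda>v. pos v f) (set (s f)))"

lemma tracksD:
  assumes "tracks a M s" "step_field f"
  shows "v \<in> set (s f) \<Longrightarrow> intree v f" "v \<in> set (s f) \<Longrightarrow> pos v f \<in> block_words a M"
    "inj_on (\<lambda>v. pos v f) (set (s f))"
  using assms by (auto simp: tracks_def)

lemma tracks_pos_append:
  assumes t: "tracks a M1 s1" "tracks a M2 s2" and f: "step_field f"
    and v: "v \<in> set (s1 f)" "w \<in> set (s2 (sh v f))"
  shows "intree (v @ w) f" "pos (v @ w) f = pos v f @ pos w (sh v f)"
proof -
  show i: "intree (v @ w) f"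
    using tracksD(1)[OF t(1) f v(1)] tracksD(1)[OF t(2) step_field_sh[OF f] v(2)] by (simp add: intree_append)
  have "pos (v @ w) f = mul (pos v f) (pos w (sh v f))" by (rule pos_append[OF f i])
  also have "\<dots> = pos v f @ pos w (sh v f)"
    by (rule block_words_mul[OF tracksD(2)[OF t(1) f v(1)] tracksD(2)[OF t(2) step_field_sh[OF f] v(2)]])
  finally show "pos (v @ w) f = pos v f @ pos w (sh v f)" .
qed

text \<open>Positions are concatenated without cancellation, and the fixed length \<open>M1\<close>
  shows where to cut; so injectivity is inherited from the two parts.\<close>

lemma tracks_branches:
  assumes t: "tracks a M1 s1" "tracks a M2 s2" and h: "sub_concat h"
  shows "tracks a (M1 + M2) (\<lambda>f. h (branches s1 s2 f))"
  unfolding tracks_def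
proof (intro allI impI)
  fix f :: "'a field" assume f: "step_field f"
  let ?S = "set (concat (branches s1 s2 f))"
  have S: "\<exists>v w. u = v @ w \<and> v \<in> set (s1 f) \<and> w \<in> set (s2 (sh v f))" if "u \<in> ?S" for u
    using that by (auto simp: branches_def)
  have "intree u f \<and> pos u f \<in> block_words a (M1 + M2)" if uS: "u \<in> ?S" for u
  proof -
    obtain v w where u: "u = v @ w" "v \<in> set (s1 f)" "w \<in> set (s2 (sh v f))" using S[OF uS] by blast
    then show ?thesis
      using tracks_pos_append[OF t f u(2,3)] tracksD(2)[OF t(1) f u(2)]
        tracksD(2)[OF t(2) step_field_sh[OF f] u(3)] by (simp add: block_words_append)
  qed
  moreover have "inj_on (\<lambda>v. pos v f) ?S"
  proof (rule inj_onI)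
    fix u u' assume uu: "u \<in> ?S" "u' \<in> ?S" and eq: "pos u f = pos u' f"
    obtain v w where u: "u = v @ w" "v \<in> set (s1 f)" "w \<in> set (s2 (sh v f))" using S[OF uu(1)] by blast
    obtain v' w' where u': "u' = v' @ w'" "v' \<in> set (s1 f)" "w' \<in> set (s2 (sh v' f))" using S[OF uu(2)] by blast
    have e: "pos v f @ pos w (sh v f) = pos v' f @ pos w' (sh v' f)"
      using eq u u' tracks_pos_append[OF t f] by metis
    moreover have "length (pos v f) = length (pos v' f)"
      using tracksD(2)[OF t(1) f u(2)] tracksD(2)[OF t(1) f u'(2)] by (simp add: block_words_length)
    ultimately have "pos v f = pos v' f" "pos w (sh v f) = pos w' (sh v' f)" by auto
    then have "v = v'" using tracksD(3)[OF t(1) f] u u' by (auto dest: inj_onD)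
    moreover from this have "w = w'"
      using tracksD(3)[OF t(2) step_field_sh[OF f]] u u' \<open>pos w (sh v f) = pos w' (sh v' f)\<close>
      by (auto dest: inj_onD)
    ultimately show "u = u'" using u u' by simp
  qed
  moreover have "set (h (branches s1 s2 f)) \<subseteq> ?S" using h by (simp add: sub_concat_def)
  ultimately show "(\<forall>v\<in>set (h (branches s1 s2 f)). intree v f \<and> pos v f \<in> block_words a (M1 + M2)) \<and>
      inj_on (\<lambda>v. pos v f) (set (h (branches s1 s2 f)))"
    by (blast intro: inj_on_subset)
qed

lemma tracks_Nil: "tracks a 0 (\<lambda>f. [[]])"
  by (simp add: tracks_def block_words_def)

lemma tracks_iterate: "tracks a M s \<Longrightarrow> tracks a (k * M) (iterate s k)"
  by (induction k) (auto simp: tracks_Nil intro: tracks_branches sub_concat_concat)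

lemma tracks_leaves: "tracks a M s \<Longrightarrow> tracks a (D * M) (leaves N s D)"
  by (induction D) (auto simp: tracks_Nil intro: tracks_branches sub_concat_pick)

text \<open>The word \<open>y\<close> covers \<open>d\<close> full blocks and thereby fixes the
  first \<open>d\<close> chosen vertices one after the other; only the choices in the remaining
  \<open>D - d\<close> blocks are free.\<close>

lemma card_leaves_prefix:
  assumes t: "tracks a M s" and N: "N > 0"
  shows "step_field f \<Longrightarrow> d \<le> D \<Longrightarrow> length y = d * M \<Longrightarrow>
    card {v \<in> set (leaves N s D f). prefix y (pos v f)} \<le> N ^ (D - d)"
proof (induction d arbitrary: D f y)
  case 0
  have "card {v \<in> set (leaves N s D f). prefix y (pos v f)} \<le> card (set (leaves N s D f))"
    by (intro card_mono) auto
  also have "\<dots> \<le> length (leaves N s D f)" by (rule card_length)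
  also have "\<dots> \<le> N ^ D" using length_leaves[OF N, of s D f] by (auto split: if_splits)
  finally show ?case by simp
next
  case (Suc d)
  then obtain D' where D': "D = Suc D'" "d \<le> D'" by (cases D) auto
  define V where "V = {v \<in> set (leaves N s D f). prefix y (pos v f)}"
  have dec: "\<exists>u w. v = u @ w \<and> u \<in> set (s f) \<and> w \<in> set (leaves N s D' (sh u f)) \<and>
      pos u f = take M y \<and> prefix (drop M y) (pos w (sh u f))" if vV: "v \<in> V" for v
  proof -
    have "v \<in> set (leaves N s (Suc D') f)" using vV by (simp add: V_def D')
    then obtain u w where u: "v = u @ w" "u \<in> set (s f)" "w \<in> set (leaves N s D' (sh u f))"
      by (rule leaves_SucE)
    have p: "pos v f = pos u f @ pos w (sh u f)"
      using tracks_pos_append(2)[OF t tracks_leaves[OF t] Suc.prems(1) u(2,3)] u(1) by simp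
    have l: "length (pos u f) = M"
      using tracksD(2)[OF t Suc.prems(1) u(2)] by (rule block_words_length)
    have "prefix (take M y @ drop M y) (pos u f @ pos w (sh u f))" using vV p by (simp add: V_def)
    moreover have "length (take M y) = M" using Suc.prems(3) by simp
    moreover from calculation(1) obtain zs where "pos u f @ pos w (sh u f) = take M y @ (drop M y @ zs)"
      unfolding prefix_def append_assoc by blast
    ultimately have "take M y = pos u f \<and> prefix (drop M y) (pos w (sh u f))"
      using l by (simp add: append_eq_append_conv)
    then show ?thesis using u by auto
  qed
  show ?case
  proof (cases "V = {}")
    case False
    then obtain v0 where "v0 \<in> V" by blast
    then obtain u where u: "u \<in> set (s f)" "pos u f = take M y" using dec by blast
    define W where "W = {w \<in> set (leaves N s D' (sh u f)). prefix (drop M y) (pos w (sh u f))}"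
    have "V \<subseteq> (@) u ` W"
    proof
      fix v assume "v \<in> V"
      then obtain u' w where u': "v = u' @ w" "u' \<in> set (s f)" "w \<in> set (leaves N s D' (sh u' f))"
        "pos u' f = take M y" "prefix (drop M y) (pos w (sh u' f))" using dec by blast
      then have "u' = u" using u inj_onD[OF tracksD(3)[OF t Suc.prems(1)], of u' u] by simp
      then show "v \<in> (@) u ` W" using u' by (auto simp: W_def)
    qed
    then have "card V \<le> card ((@) u ` W)" by (intro card_mono) (auto simp: W_def)
    also have "\<dots> \<le> card W" by (rule card_image_le) (simp add: W_def)
    also have "\<dots> \<le> N ^ (D' - d)"
      unfolding W_def using Suc.prems(3) by (intro Suc.IH step_field_sh Suc.prems(1) D') simp
    finally show ?thesis by (simp add: V_def D')
  next
    case True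
    then show ?thesis unfolding V_def[symmetric] by simp
  qed
qed

section \<open>Blocks obtained from the words visited in one generation\<close>

context brw
begin

definition a0 :: "'g letter" where "a0 = undefined"

text \<open>One representative vertex for each block word visited, since words and not vertices
  determine the dimension and \<open>tracks\<close> requires distinct positions.\<close>

definition blk :: "nat \<Rightarrow> nat \<Rightarrow> 'g field \<Rightarrow> nat list list" where
  "blk n M f = (let gs = gens n f in
     map (rep gs) (remdups (filter (\<lambda>w. w \<in> block_words a0 M) (map snd gs))))"

lemma set_blk:
  assumes "v \<in> set (blk n M f)"
  shows "length v = n" "intree v f" "pos v f \<in> block_words a0 M" "v = rep (gens n f) (pos v f)"
proof -
  obtain w where w: "v = rep (gens n f) w" "w \<in> block_words a0 M" "w \<in> snd ` set (gens n f)"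
    using assms by (auto simp: blk_def Let_def)
  have "(v, w) \<in> set (gens n f)" using rep_in[OF w(3)] w(1) by simp
  then have "length v = n \<and> intree v f \<and> w = pos v f" by (simp add: set_gens)
  with w show "length v = n" "intree v f" "pos v f \<in> block_words a0 M" "v = rep (gens n f) (pos v f)" by auto
qed

lemma selector_blk: "selector \<nu> n (blk n M)"
  unfolding selector_def
proof (intro conjI allI ballI)
  show "blk n M \<in> \<P> \<rightarrow>\<^sub>M count_space UNIV"
    unfolding blk_def[abs_def] by (rule measurable_compose[OF measurable_gens]) simp
  show "depends_below n (blk n M)"
    unfolding blk_def[abs_def] by (rule depends_below_compose[OF depends_gens])
  fix f :: "'g field"
  have "inj_on (rep (gens n f)) (snd ` set (gens n f))"
  proof (rule inj_onI)
    fix w w' assume "w \<in> snd ` set (gens n f)" "w' \<in> snd ` set (gens n f)" "rep (gens n f) w = rep (gens n f) w'"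
    then have "(rep (gens n f) w, w) \<in> set (gens n f)" "(rep (gens n f) w, w') \<in> set (gens n f)"
      using rep_in by metis+
    then show "w = w'" by (simp add: set_gens)
  qed
  then show "distinct (blk n M f)"
    unfolding blk_def Let_def by (auto simp: distinct_map intro: inj_on_subset)
  show "length v = n" if "v \<in> set (blk n M f)" for v using set_blk[OF that] by simp
qed

lemma tracks_blk: "tracks a0 M (blk n M)"
  unfolding tracks_def using set_blk by (auto intro!: inj_onI) metis

lemma length_blk: "length (blk n M f) = card {w \<in> block_words a0 M. w \<in> snd ` set (gens n f)}"
proof -
  have "length (blk n M f) = card (set (filter (\<lambda>w. w \<in> block_words a0 M) (map snd (gens n f))))"
    by (simp add: blk_def Let_def length_remdups_card_conv)
  also have "set (filter (\<lambda>w. w \<in> block_words a0 M) (map snd (gens n f))) =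
      {w \<in> block_words a0 M. w \<in> snd ` set (gens n f)}" by auto
  finally show ?thesis .
qed

lemma length_blk_le: "length (blk n M f) \<le> card (block_words a0 M)"
  unfolding length_blk by (rule card_mono) auto

lemma visited_iff_cnt:
  assumes "step_field f" "reduced w"
  shows "w \<in> snd ` set (gens n f) \<longleftrightarrow> cnt n w f \<noteq> 0"
proof -
  have "finite {v. length v = n \<and> intree v f \<and> pos v f = w}"
  proof (rule finite_subset)
    show "{v. length v = n \<and> intree v f \<and> pos v f = w} \<subseteq> fst ` set (gens n f)"
    proof
      fix v assume "v \<in> {v. length v = n \<and> intree v f \<and> pos v f = w}"
      then have "(v, w) \<in> set (gens n f)" by (simp add: set_gens)
      then show "v \<in> fst ` set (gens n f)" by (metis fst_conv imageI)
    qed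
  qed simp
  then have "cnt n w f \<noteq> 0 \<longleftrightarrow> (\<exists>v. length v = n \<and> intree v f \<and> pos v f = w)"
    unfolding cnt_eq_card[OF assms] by auto
  also have "\<dots> \<longleftrightarrow> (\<exists>v. (v, w) \<in> set (gens n f))" by (auto simp: set_gens)
  also have "\<dots> \<longleftrightarrow> w \<in> snd ` set (gens n f)" by force
  finally show ?thesis by simp
qed

lemma mean_blk_ge:
  "ennreal (\<Sum>w\<in>block_words a0 M. r ^ n * pmf (wk \<mu> n) w / (1 + kap * real n))
     \<le> (\<integral>\<^sup>+f. of_nat (length (blk n M f)) \<partial>\<P>)"
proof -
  let ?E = "\<lambda>w. {f. cnt n w f \<noteq> 0}"
  have E: "?E w \<in> sets \<P>" for w
  proof -
    have "{f \<in> space \<P>. cnt n w f \<noteq> 0} \<in> sets \<P>" by measurable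
    then show ?thesis by simp
  qed
  have "ennreal (\<Sum>w\<in>block_words a0 M. r ^ n * pmf (wk \<mu> n) w / (1 + kap * real n))
     \<le> ennreal (\<Sum>w\<in>block_words a0 M. measure \<P> (?E w))"
    by (intro ennreal_leI sum_mono visit_prob_ge) (auto dest: block_words_reduced)
  also have "\<dots> = (\<Sum>w\<in>block_words a0 M. emeasure \<P> (?E w))"
    by (simp add: fieldM.emeasure_eq_measure)
  also have "\<dots> = (\<integral>\<^sup>+f. (\<Sum>w\<in>block_words a0 M. indicator (?E w) f) \<partial>\<P>)"
    using E by (simp add: nn_integral_sum)
  also have "\<dots> = (\<integral>\<^sup>+f. of_nat (length (blk n M f)) \<partial>\<P>)"
  proof (rule nn_integral_cong_AE)
    show "AE f in \<P>. (\<Sum>w\<in>block_words a0 M. indicator (?E w) f) = (of_nat (length (blk n M f)) :: ennreal)"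
      using AE_good_field
    proof eventually_elim
      case (elim f)
      have "(\<Sum>w\<in>block_words a0 M. indicator (?E w) f :: ennreal) =
         (\<Sum>w\<in>block_words a0 M. if w \<in> snd ` set (gens n f) then 1 else 0)"
        using elim by (intro sum.cong refl)
          (auto simp: indicator_def visited_iff_cnt block_words_reduced simp del: image_iff)
      also have "\<dots> = of_nat (length (blk n M f))"
        unfolding length_blk by (simp add: sum.If_cases Int_def)
      finally show ?case .
    qed
  qed
  finally show ?thesis .
qed

text \<open>Every reduced word becomes a block word when \<open>a0\<close> is joined to it on both
  sides: two letters \<open>a0\<close> and two joining letters, each a step of probability at least
  \<open>cmin\<close>.\<close>

lemma block_words_prob_ge:
  "cmin ^ 4 * plen n m \<le> (\<Sum>w\<in>block_words a0 (m + 4). pmf (wk \<mu> (n + 4)) w)"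
proof -
  define pad where "pad x = wjoin [a0] (wjoin x [a0])" for x
  have red: "reduced (wjoin x [a0])" "reduced (pad x)" if "reduced x" for x
    using that by (auto simp: pad_def intro!: reduced_wjoin card2)
  have w1: "pmf (wk \<mu> (Suc 0)) = pmf \<mu>" using wk_1[OF \<mu>_steps] by simp
  have step1: "cmin * (pmf (wk \<mu> k) x * pmf (wk \<mu> j) y) \<le> pmf (wk \<mu> (Suc (k + j))) (wjoin x y)"
    if "reduced (wjoin x y)" for x y k j
  proof -
    have "cmin * (pmf (wk \<mu> k) x * pmf (wk \<mu> j) y) \<le> pmf \<mu> [joiner x y] * (pmf (wk \<mu> k) x * pmf (wk \<mu> j) y)"
      by (intro mult_right_mono cmin_le) simp
    also have "\<dots> \<le> pmf (wk \<mu> (Suc (k + j))) (wjoin x y)"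
      using that pmf_wk_join_ge[OF \<mu>_steps, of x "joiner x y" y k j] by (simp add: wjoin_def)
    finally show ?thesis .
  qed
  have ge: "cmin ^ 4 * pmf (wk \<mu> n) x \<le> pmf (wk \<mu> (n + 4)) (pad x)" if "reduced x" for x
  proof -
    have "cmin * (pmf (wk \<mu> n) x * cmin) \<le> cmin * (pmf (wk \<mu> n) x * pmf (wk \<mu> (Suc 0)) [a0])"
      using cmin_le[of a0] cmin_pos by (intro mult_left_mono) (auto simp: w1 simp del: wk.simps)
    also have "\<dots> \<le> pmf (wk \<mu> (Suc (n + Suc 0))) (wjoin x [a0])" by (rule step1[OF red(1)[OF that]])
    finally have 1: "cmin\<^sup>2 * pmf (wk \<mu> n) x \<le> pmf (wk \<mu> (n + 2)) (wjoin x [a0])"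
      by (simp add: power2_eq_square mult_ac)
    have "cmin * (cmin * (cmin\<^sup>2 * pmf (wk \<mu> n) x)) \<le> cmin * (pmf (wk \<mu> (Suc 0)) [a0] * pmf (wk \<mu> (n + 2)) (wjoin x [a0]))"
      using cmin_le[of a0] cmin_pos 1 by (intro mult_left_mono mult_mono) (auto simp: w1 simp del: wk.simps)
    also have "\<dots> \<le> pmf (wk \<mu> (Suc (Suc 0 + (n + 2)))) (pad x)"
      unfolding pad_def by (rule step1) (use red(2)[OF that] in \<open>simp add: pad_def\<close>)
    also have "Suc (Suc 0 + (n + 2)) = n + 4" by simp
    finally show ?thesis by (simp add: power4_eq_xxxx power2_eq_square mult.assoc)
  qed
  have inj: "inj_on pad (rwords m)"
    by (rule inj_onI) (auto simp: pad_def rwords_def dest!: wjoin_inj)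
  have "cmin ^ 4 * plen n m = (\<Sum>x\<in>rwords m. cmin ^ 4 * pmf (wk \<mu> n) x)"
    by (simp add: plen_def sum_distrib_left)
  also have "\<dots> \<le> (\<Sum>x\<in>rwords m. pmf (wk \<mu> (n + 4)) (pad x))"
    by (intro sum_mono ge) (simp add: rwords_def)
  also have "\<dots> = (\<Sum>w\<in>pad ` rwords m. pmf (wk \<mu> (n + 4)) w)" using inj by (simp add: sum.reindex)
  also have "\<dots> \<le> (\<Sum>w\<in>block_words a0 (m + 4). pmf (wk \<mu> (n + 4)) w)"
  proof (rule sum_mono2)
    show "pad ` rwords m \<subseteq> block_words a0 (m + 4)"
      using red(2) by (auto simp: rwords_def block_words_def) (auto simp: pad_def wjoin_def)
  qed auto
  finally show ?thesis .
qed

text \<open>At a speed \<open>q\<close> near \<alpha> whose rate is below a number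
  \<open>l < ln r\<close>, the mean number of distinct block words of length \<open>m + 4\<close> in
  generation \<open>n + 4\<close> is about \<open>exp ((ln r - l) * n)\<close>. This exceeds both 1
  and \<open>exp (s * (m + 4))\<close>, so iterated blocks survive with sufficiently large
  degree.\<close>

lemma ex_block_type:
  assumes \<alpha>: "\<alpha> \<in> rate_sublevel L r" and s: "ereal s < spectrum_value L r \<alpha>" and e: "\<epsilon> > 0"
  obtains n M k N where "n > 0" "M > 0" "k > 0" "N \<ge> 2" "exp (s * real (k * M)) \<le> real N"
    "\<bar>real M / real n - \<alpha>\<bar> < \<epsilon>" "0 < measure \<P> (alive N (iterate (blk n M) k))"
proof -
  obtain q l where q: "0 < q" "q \<le> 1" "\<bar>q - \<alpha>\<bar> < \<epsilon> / 2" "L q < ereal l" "l < ln r" "s * q < ln r - l"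
    by (rule approx_speed[OF \<alpha> s r1 rR, of "\<epsilon> / 2"]) (use e in auto)
  \<comment> \<open>Half of the margin of \<open>approx_speed\<close>; the other half pays for the
    deviation of \<open>m / n\<close> from \<open>q\<close>.\<close>
  define g where "g = (ln r - l - s * q) / 2"
  have g: "g > 0" using q by (simp add: g_def)
  define \<delta> where "\<delta> = min (\<epsilon> / 4) (g / (1 + \<bar>s\<bar>))"
  have d: "\<delta> > 0" using g e by (simp add: \<delta>_def)
  have ds: "\<bar>s\<bar> * \<delta> \<le> g"
  proof -
    have "\<bar>s\<bar> * \<delta> \<le> (1 + \<bar>s\<bar>) * (g / (1 + \<bar>s\<bar>))"
      using d by (intro mult_mono) (auto simp: \<delta>_def)
    also have "\<dots> = g" by (simp add: add_nonneg_eq_0_iff)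
    finally show ?thesis .
  qed
  \<comment> \<open>All costs that do not grow with \<open>n\<close>: the four padding steps, the
    factor \<open>1 + kap\<close> of the second moment bound and the four padding letters, weighted
    by \<open>s\<close>.\<close>
  define c where "c = 4 * ln r + 4 * ln cmin - ln (1 + kap) - 4 * \<bar>s\<bar>"
  have as: "\<forall>\<^sub>F n in sequentially. 0 < g' * real n + c - ln (real n + 5)" if "g' > 0" for g' :: real
    using that by real_asymp
  have "\<forall>\<^sub>F n in sequentially. 16 / \<epsilon> < real n"
    by real_asymp
  from eventually_happens'[OF sequentially_bot eventually_conj[OF this eventually_conj[OF ldp_lower_plen[OF q(4) d]
     eventually_conj[OF as[OF g] as[of "ln r - l"]]]]] q(5)
  obtain n m where n: "16 / \<epsilon> < real n" "0 < g * real n + c - ln (real n + 5)"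
      "0 < (ln r - l) * real n + c - ln (real n + 5)"
    and m: "\<bar>real m / real n - q\<bar> < \<delta>" "exp (- real n * l) \<le> plen n m"
    by auto
  have n0: "real n > 0" using n(1) e by (smt (verit) divide_pos_pos)
  have "plen n m > 0" using m(2) by (meson exp_gt_zero less_le_trans)
  then have mn: "m \<le> n" using plen_eq_0[of n m] by force
  define B0 where "B0 = r ^ (n + 4) * (cmin ^ 4 * exp (- real n * l)) / (1 + kap * real (n + 4))"
  have lnk: "ln (1 + kap * real (n + 4)) \<le> ln (1 + kap) + ln (real n + 5)"
  proof -
    have "1 + kap * real (n + 4) \<le> (1 + kap) * (real n + 5)"
      using kap_nonneg by (simp add: algebra_simps)
    then have "ln (1 + kap * real (n + 4)) \<le> ln ((1 + kap) * (real n + 5))"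
      using kap_nonneg by (subst ln_le_cancel_iff) (auto simp: add_pos_nonneg)
    also have "\<dots> = ln (1 + kap) + ln (real n + 5)"
      using kap_nonneg by (intro ln_mult_pos) (auto simp: add_pos_nonneg)
    finally show ?thesis .
  qed
  have kpos: "1 + kap * real (n + 4) > 0" using kap_nonneg by (intro add_pos_nonneg) auto
  have B0: "B0 > 0" unfolding B0_def using kpos r1 cmin_pos by simp
  have lnB0: "ln B0 = real (n + 4) * ln r + (4 * ln cmin - real n * l) - ln (1 + kap * real (n + 4))"
    unfolding B0_def using kpos r1 cmin_pos
    by (simp add: ln_div ln_mult_pos ln_realpow del: of_nat_add)
  have lnB0': "ln B0 \<ge> (ln r - l) * real n + c - ln (real n + 5) + 4 * \<bar>s\<bar>"
    unfolding lnB0 c_def using lnk by (simp add: algebra_simps)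
  have "ln B0 > 0" using lnB0' n(3) by linarith
  moreover have "s * real (m + 4) < ln B0"
  proof -
    have "\<bar>real m - q * real n\<bar> \<le> \<delta> * real n"
    proof -
      have "real m - q * real n = (real m / real n - q) * real n" using n0 by (simp add: field_simps)
      then have "\<bar>real m - q * real n\<bar> = \<bar>real m / real n - q\<bar> * real n" using n0 by (simp add: abs_mult)
      also have "\<dots> \<le> \<delta> * real n" using m(1) by (intro mult_right_mono) auto
      finally show ?thesis .
    qed
    then have "\<bar>s\<bar> * \<bar>real m - q * real n\<bar> \<le> \<bar>s\<bar> * (\<delta> * real n)" by (rule mult_left_mono) simp
    also have "\<dots> \<le> g * real n" using mult_right_mono[OF ds, of "real n"] by (simp add: mult.assoc)
    finally have "s * (real m - q * real n) \<le> g * real n"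
      using abs_ge_self[of "s * (real m - q * real n)"] by (simp add: abs_mult)
    then have "s * real m \<le> s * q * real n + g * real n" by (simp add: algebra_simps)
    moreover have "s * 4 \<le> 4 * \<bar>s\<bar>" by simp
    moreover have "(ln r - l) * real n = s * q * real n + 2 * g * real n"
    proof -
      have e: "ln r - l = s * q + 2 * g" using g_def by (simp add: field_simps)
      show ?thesis unfolding e by (simp add: distrib_right)
    qed
    ultimately show ?thesis using lnB0' n(2) by (simp add: algebra_simps)
  qed
  ultimately have "exp 0 < exp (ln B0)" "exp (s * real (m + 4)) < exp (ln B0)"
    by (simp_all only: exp_less_cancel_iff)
  \<comment> \<open>The maximum with 1 is for negative \<open>s\<close>, where the second term alone
    would not make the blocks supercritical.\<close>
  then have b: "max 1 (exp (s * real (m + 4))) < B0" using B0 by simp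
  define s0 where "s0 = blk (n + 4) (m + 4)"
  note sel = selector_blk[of "n + 4" "m + 4", folded s0_def]
  have len: "length (s0 f) \<le> card (block_words a0 (m + 4))" for f unfolding s0_def by (rule length_blk_le)
  have fin1: "(\<integral>\<^sup>+f. of_nat (length (s0 f)) \<partial>\<P>) < \<top>"
  proof -
    have "(\<integral>\<^sup>+f. of_nat (length (s0 f)) \<partial>\<P>) \<le> (\<integral>\<^sup>+f. of_nat (card (block_words a0 (m + 4))) \<partial>\<P>)"
      using len by (intro nn_integral_mono) simp
    also have "\<dots> < \<top>" by (simp add: fieldM.emeasure_space_1[simplified] of_nat_less_top)
    finally show ?thesis .
  qed
  have fin2: "(\<integral>\<^sup>+f. of_nat (length (s0 f) * (length (s0 f) - 1)) \<partial>\<P>) < \<top>"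
  proof -
    have "(\<integral>\<^sup>+f. of_nat (length (s0 f) * (length (s0 f) - 1)) \<partial>\<P>) \<le>
        (\<integral>\<^sup>+f. of_nat (card (block_words a0 (m + 4)) * card (block_words a0 (m + 4))) \<partial>\<P>)"
    proof (rule nn_integral_mono)
      fix f
      have "length (s0 f) * (length (s0 f) - 1) \<le> card (block_words a0 (m + 4)) * card (block_words a0 (m + 4))"
        using len[of f] by (intro mult_mono) auto
      then show "of_nat (length (s0 f) * (length (s0 f) - 1)) \<le>
        (of_nat (card (block_words a0 (m + 4)) * card (block_words a0 (m + 4))) :: ennreal)"
        by (simp only: of_nat_mono)
    qed
    also have "\<dots> < \<top>"
      by (simp add: fieldM.emeasure_space_1[simplified] of_nat_less_top del: of_nat_mult)
    finally show ?thesis .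
  qed
  define B where "B = enn2real (\<integral>\<^sup>+f. of_nat (length (s0 f)) \<partial>\<P>)"
  have B: "(\<integral>\<^sup>+f. of_nat (length (s0 f)) \<partial>\<P>) = ennreal B" using fin1 by (simp add: B_def)
  have "B0 \<le> (\<Sum>w\<in>block_words a0 (m + 4). r ^ (n + 4) * pmf (wk \<mu> (n + 4)) w / (1 + kap * real (n + 4)))"
  proof -
    have "cmin ^ 4 * exp (- real n * l) \<le> cmin ^ 4 * plen n m"
      using m(2) cmin_pos by (intro mult_left_mono) auto
    also have "\<dots> \<le> (\<Sum>w\<in>block_words a0 (m + 4). pmf (wk \<mu> (n + 4)) w)" by (rule block_words_prob_ge)
    finally have "B0 \<le> r ^ (n + 4) * (\<Sum>w\<in>block_words a0 (m + 4). pmf (wk \<mu> (n + 4)) w) / (1 + kap * real (n + 4))"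
      unfolding B0_def using kpos r1 by (intro divide_right_mono mult_left_mono) auto
    then show ?thesis by (simp only: sum_distrib_left sum_divide_distrib)
  qed
  then have "ennreal B0 \<le> ennreal B"
    unfolding B[symmetric] s0_def by (intro order_trans[OF ennreal_leI mean_blk_ge])
  then have BB: "B0 \<le> B" using B0 by (cases "B \<ge> 0") (auto simp: ennreal_le_iff ennreal_neg)
  obtain k N where k: "k > 0" "N \<ge> 2" "max 1 (exp (s * real (m + 4))) ^ k \<le> real N"
      "0 < measure \<P> (alive N (iterate s0 k))"
    by (rule ex_alive_iterate[OF sel B _ fin2, of "max 1 (exp (s * real (m + 4)))"]) (use b BB in auto)
  have "exp (s * real (k * (m + 4))) \<le> real N"
  proof -
    have "exp (s * real (k * (m + 4))) = exp (s * real (m + 4)) ^ k"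
      by (simp add: exp_of_nat_mult[symmetric] mult_ac del: of_nat_add)
    also have "\<dots> \<le> max 1 (exp (s * real (m + 4))) ^ k" by (intro power_mono) auto
    finally show ?thesis using k(3) by linarith
  qed
  moreover have "\<bar>real (m + 4) / real (n + 4) - \<alpha>\<bar> < \<epsilon>"
  proof -
    have "real (m + 4) / real (n + 4) - real m / real n = 4 * (real n - real m) / (real n * real (n + 4))"
      using n0 by (simp add: field_simps)
    then have "\<bar>real (m + 4) / real (n + 4) - real m / real n\<bar> = 4 * (real n - real m) / (real n * real (n + 4))"
      using mn by simp
    also have "\<dots> \<le> 4 * real (n + 4) / (real n * real (n + 4))" by (intro divide_right_mono) auto
    also have "\<dots> = 4 / real n" by (simp del: of_nat_add)
    also have "\<dots> < \<epsilon> / 4" using n(1) n0 e by (simp add: field_simps)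
    finally have "\<bar>real (m + 4) / real (n + 4) - real m / real n\<bar> < \<epsilon> / 4" .
    moreover have "\<delta> \<le> \<epsilon> / 4" unfolding \<delta>_def by (rule min.cobounded1)
    ultimately show ?thesis using m(1) q(3) by linarith
  qed
  ultimately show ?thesis using k by (intro that[of "n + 4" "m + 4" k N]) (auto simp: s0_def)
qed

end

subsection \<open>Almost sure properties of the embedded trees\<close>

lemma AE_sh: "AE f in fieldM \<nu>. Q f \<Longrightarrow> AE f in fieldM \<nu>. Q (sh u f)"
proof -
  assume Q: "AE f in fieldM \<nu>. Q f"
  have "AE f in distr (fieldM \<nu>) (fieldM \<nu>) (sh u). Q f" unfolding distr_sh by (rule Q)
  then show "AE f in fieldM \<nu>. Q (sh u f)" by (rule AE_distrD[OF measurable_sh])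
qed

context brw
begin

text \<open>A type \<open>(n, M, k, N)\<close> stands for the \<open>k\<close>-fold iterate of
  blocks of \<open>n\<close> generations and \<open>M\<close> letters, with degree \<open>N\<close>.
  Types form a countable set, so one null set serves all of them.\<close>

definition tsel :: "nat \<times> nat \<times> nat \<times> nat \<Rightarrow> 'g field \<Rightarrow> nat list list" where
  "tsel t = (case t of (n, M, k, N) \<Rightarrow> iterate (blk n M) k)"
definition tgen :: "nat \<times> nat \<times> nat \<times> nat \<Rightarrow> nat" where
  "tgen t = (case t of (n, M, k, N) \<Rightarrow> k * n)"
definition tlen :: "nat \<times> nat \<times> nat \<times> nat \<Rightarrow> nat" where
  "tlen t = (case t of (n, M, k, N) \<Rightarrow> k * M)"
definition tdeg :: "nat \<times> nat \<times> nat \<times> nat \<Rightarrow> nat" where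
  "tdeg t = (case t of (n, M, k, N) \<Rightarrow> N)"
definition talive :: "nat \<times> nat \<times> nat \<times> nat \<Rightarrow> 'g field set" where
  "talive t = alive (tdeg t) (tsel t)"
definition tprob :: "nat \<times> nat \<times> nat \<times> nat \<Rightarrow> real" where
  "tprob t = measure \<P> (talive t)"
definition tgood :: "nat \<times> nat \<times> nat \<times> nat \<Rightarrow> bool" where
  "tgood t \<longleftrightarrow> tgen t > 0 \<and> tlen t > 0 \<and> tdeg t \<ge> 2 \<and> tprob t > 0"
definition tleaves :: "nat \<times> nat \<times> nat \<times> nat \<Rightarrow> nat \<Rightarrow> 'g field \<Rightarrow> nat list list" where
  "tleaves t = leaves (tdeg t) (tsel t)"

lemma selector_tsel: "selector \<nu> (tgen t) (tsel t)"
  by (cases t) (simp add: tsel_def tgen_def selector_iterate selector_blk)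

lemma tracks_tsel: "tracks a0 (tlen t) (tsel t)"
  by (cases t) (simp add: tsel_def tlen_def tracks_iterate tracks_blk)

lemma talive_sets [measurable]: "talive t \<in> sets \<P>"
  unfolding talive_def by (rule sets_alive[OF selector_tsel])

lemma talive_iff: "f \<in> talive t \<longleftrightarrow> (\<forall>D. tleaves t D f \<noteq> [])"
  by (simp add: talive_def alive_def tleaves_def)

lemma ex_tgood:
  assumes "\<alpha> \<in> rate_sublevel L r" "ereal s < spectrum_value L r \<alpha>" "\<epsilon> > 0"
  shows "\<exists>t. tgood t \<and> exp (s * real (tlen t)) \<le> real (tdeg t) \<and> \<bar>real (tlen t) / real (tgen t) - \<alpha>\<bar> < \<epsilon>"
proof -
  obtain n M k N where t: "n > 0" "M > 0" "k > 0" "N \<ge> 2" "exp (s * real (k * M)) \<le> real N"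
    "\<bar>real M / real n - \<alpha>\<bar> < \<epsilon>" "0 < measure \<P> (alive N (iterate (blk n M) k))"
    by (rule ex_block_type[OF assms])
  then show ?thesis
    by (intro exI[of _ "(n, M, k, N)"])
       (simp add: tgood_def tgen_def tlen_def tdeg_def tprob_def talive_def tsel_def)
qed

text \<open>The splicing step: the subtrees at the leaves of a \<open>t\<close>-tree are independent
  of the choice of these leaves, so about the fraction \<open>tprob t'\<close> of them starts a
  surviving \<open>t'\<close>-tree. The failure probabilities decay like \<open>1 / N ^ D\<close>,
  and the Borel-Cantelli lemma applies as \<open>N \<ge> 2\<close>.\<close>

lemma AE_many_alive_root:
  assumes "tgood t" "tgood t'"
  shows "AE f in \<P>. \<forall>\<^sub>F D in sequentially. tleaves t D f \<noteq> [] \<longrightarrow>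
    tprob t' * real (tdeg t ^ D) / 2 \<le> real (card {v \<in> set (tleaves t D f). sh v f \<in> talive t'})"
proof -
  define q where "q = tprob t'"
  define N where "N = tdeg t"
  have q: "q > 0" and N: "N \<ge> 2" using assms by (auto simp: tgood_def q_def N_def)
  define bad where "bad D = {f. N ^ D \<le> length (tleaves t D f) \<and>
      real (card {v \<in> set (tleaves t D f). sh v f \<in> talive t'}) < q * real (N ^ D) / 2}" for D
  have sel: "selector \<nu> (D * tgen t) (tleaves t D)" for D
    unfolding tleaves_def by (rule selector_leaves[OF selector_tsel])
  have sets: "bad D \<in> sets \<P>" for D
    unfolding bad_def
    by (rule sets_card_event[OF sel talive_sets, where Q = "\<lambda>l c. N ^ D \<le> l \<and> real c < q * real (N ^ D) / 2"])
  have "measure \<P> (bad D) \<le> 4 / (q * real (N ^ D))" for D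
    unfolding bad_def
    by (rule selector_chebyshev[OF sel talive_sets]) (use q N in \<open>auto simp: q_def tprob_def\<close>)
  then have le: "measure \<P> (bad D) \<le> 4 / q * (1 / real N) ^ D" for D
    by (simp add: power_one_over field_simps)
  have "summable (\<lambda>D. measure \<P> (bad D))"
  proof (rule summable_comparison_test')
    show "summable (\<lambda>D. 4 / q * (1 / real N) ^ D)"
      using N by (intro summable_mult summable_geometric) auto
    show "norm (measure \<P> (bad D)) \<le> 4 / q * (1 / real N) ^ D" for D using le by simp
  qed
  then have "AE f in \<P>. \<forall>\<^sub>F D in sequentially. f \<in> space \<P> - bad D"
    using sets by (intro borel_cantelli_AE1) (auto simp: fieldM.emeasure_eq_measure)
  then show ?thesis
  proof eventually_elim
    case (elim f)
    then show ?case
    proof eventually_elim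
      case (elim D)
      have "length (tleaves t D f) = N ^ D" if "tleaves t D f \<noteq> []"
        using that length_leaves[of "tdeg t" "tsel t" D f] N by (simp add: tleaves_def N_def)
      then show ?case using elim by (auto simp: bad_def N_def q_def not_less)
    qed
  qed
qed

lemma AE_many_alive:
  "AE f in \<P>. \<forall>u t t'. tgood t \<longrightarrow> tgood t' \<longrightarrow> (\<forall>\<^sub>F D in sequentially. tleaves t D (sh u f) \<noteq> [] \<longrightarrow>
    tprob t' * real (tdeg t ^ D) / 2 \<le> real (card {v \<in> set (tleaves t D (sh u f)). sh (u @ v) f \<in> talive t'}))"
proof -
  have "AE f in \<P>. tgood t \<longrightarrow> tgood t' \<longrightarrow> (\<forall>\<^sub>F D in sequentially. tleaves t D (sh u f) \<noteq> [] \<longrightarrow>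
    tprob t' * real (tdeg t ^ D) / 2 \<le> real (card {v \<in> set (tleaves t D (sh u f)). sh (u @ v) f \<in> talive t'}))" for u t t'
  proof (cases "tgood t \<and> tgood t'")
    case True
    then show ?thesis using AE_sh[OF AE_many_alive_root[of t t'], of u] by (simp add: sh_sh)
  qed auto
  then show ?thesis by (simp add: AE_all_countable)
qed

lemma prob_two_children: "0 < measure \<P> {f. 2 \<le> length (f [])}"
proof (rule ccontr)
  assume "\<not> ?thesis"
  moreover have m: "{f. 2 \<le> length (f [])} \<in> sets \<P>"
  proof -
    have "{f \<in> space \<P>. 2 \<le> length (f [])} \<in> sets \<P>" by measurable
    then show ?thesis by simp
  qed
  ultimately have "AE f in \<P>. f \<notin> {f. 2 \<le> length (f [])}"
    by (intro AE_not_in null_setsI) (auto simp: fieldM.emeasure_eq_measure zero_less_measure_iff)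
  then have "(\<integral>\<^sup>+f. of_nat (length (f [])) \<partial>\<P>) \<le> (\<integral>\<^sup>+f. 1 \<partial>\<P>)"
    by (intro nn_integral_mono_AE) (auto elim!: eventually_mono intro: of_nat_mono[where 'a=ennreal, of _ 1, simplified])
  moreover have "(\<integral>\<^sup>+f. of_nat (length (f [])) \<partial>\<P>) = ennreal r"
    using nn_integral_label_sum[of "\<lambda>_. 1"] by simp
  ultimately have "ennreal r \<le> ennreal 1" by (simp add: fieldM.emeasure_space_1[simplified])
  then show False using r1 by (subst (asm) ennreal_le_iff) auto
qed

text \<open>Let \<open>e\<close> be the probability that no subtree lies in \<open>E\<close>. This
  property passes to the children, so \<open>e\<close> is at most
  \<open>P(A) e + P(B) e\<^sup>2\<close>, where \<open>A\<close> is the event of one child and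
  \<open>B\<close> that of at least two. As \<open>B\<close> has positive probability,
  \<open>e \<le> e\<^sup>2\<close>, and \<open>e < 1\<close> leaves only
  \<open>e = 0\<close>.\<close>

lemma AE_ex_alive:
  assumes E: "E \<in> sets \<P>" "0 < measure \<P> E"
  shows "AE f in \<P>. \<exists>u. intree u f \<and> sh u f \<in> E"
proof -
  define H where "H = {f. \<forall>u. intree u f \<longrightarrow> sh u f \<notin> E}"
  have H: "H \<in> sets \<P>"
  proof -
    have [measurable]: "Measurable.pred \<P> (intree u)" for u
      unfolding intree_iff[abs_def] by measurable
    have [measurable]: "E \<in> sets \<P>" by fact
    have "{f \<in> space \<P>. \<forall>u. intree u f \<longrightarrow> sh u f \<notin> E} \<in> sets \<P>" by measurable
    then show ?thesis by (simp add: H_def)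
  qed
  define e where "e = measure \<P> H"
  define A where "A = {f :: 'g field. length (f []) = 1}"
  define B where "B = {f :: 'g field. 2 \<le> length (f [])}"
  have A: "A \<in> sets \<P>" and B: "B \<in> sets \<P>"
  proof -
    have "{f \<in> space \<P>. length (f []) = 1} \<in> sets \<P>" "{f \<in> space \<P>. 2 \<le> length (f [])} \<in> sets \<P>"
      by measurable
    then show "A \<in> sets \<P>" "B \<in> sets \<P>" by (simp_all add: A_def B_def)
  qed
  have dep: "depends_below (Suc 0) (indicator A :: 'g field \<Rightarrow> ennreal)" "depends_below (Suc 0) (indicator B :: 'g field \<Rightarrow> ennreal)"
    by (auto simp: depends_below_def indicator_def A_def B_def)
  have HE: "E \<subseteq> - H" by (auto simp: H_def dest!: HOL.spec[where x = "[]"])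
  have e1: "e < 1"
  proof -
    have "measure \<P> E \<le> measure \<P> (space \<P> - H)"
      using HE sets.compl_sets[OF H] by (intro fieldM.finite_measure_mono) auto
    also have "\<dots> = 1 - e" using fieldM.prob_compl[OF H] by (simp add: e_def)
    finally show ?thesis using E(2) by simp
  qed
  have HA: "sh [i] f \<in> H" if "f \<in> H" "i < length (f [])" for f i
  proof -
    have "sh (i # u) f \<notin> E" if "intree u (sh [i] f)" for u
      using \<open>f \<in> H\<close> \<open>i < length (f [])\<close> that unfolding H_def mem_Collect_eq
      by (metis intree.simps(2))
    then show ?thesis by (simp add: H_def sh_sh)
  qed
  have indH: "(\<lambda>f. indicator H (sh v f) :: ennreal) \<in> borel_measurable \<P>" for v
    by (rule measurable_compose[OF measurable_sh borel_measurable_indicator[OF H]])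
  have "ennreal e = (\<integral>\<^sup>+f. indicator H f \<partial>\<P>)" using H by (simp add: fieldM.emeasure_eq_measure e_def)
  also have "\<dots> \<le> (\<integral>\<^sup>+f. indicator A f * indicator H (sh [0] f) +
      indicator B f * (indicator H (sh [0] f) * indicator H (sh [1] f)) \<partial>\<P>)"
  proof (intro nn_integral_mono_AE)
    show "AE f in \<P>. (indicator H f :: ennreal) \<le> indicator A f * indicator H (sh [0] f) +
      indicator B f * (indicator H (sh [0] f) * indicator H (sh [1] f))"
      using AE_good_field
    proof eventually_elim
      case (elim f)
      then have "length (f []) \<noteq> 0" by simp
      then have "f \<in> A \<or> f \<in> B" unfolding A_def B_def mem_Collect_eq by linarith
      moreover have "length (f []) > 0" "f \<in> B \<Longrightarrow> length (f []) > 1"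
        using \<open>length (f []) \<noteq> 0\<close> unfolding B_def mem_Collect_eq by linarith+
      ultimately show ?case using HA[of f 0] HA[of f 1] by (auto simp: indicator_def)
    qed
  qed
  also have "\<dots> = (\<integral>\<^sup>+f. indicator A f * indicator H (sh [0] f) \<partial>\<P>) +
      (\<integral>\<^sup>+f. indicator B f * (indicator H (sh [0] f) * indicator H (sh [1] f)) \<partial>\<P>)"
    by (intro nn_integral_add borel_measurable_times_ennreal indH borel_measurable_indicator A B)
  also have "(\<integral>\<^sup>+f. indicator A f * indicator H (sh [0] f) \<partial>\<P>) = ennreal (measure \<P> A) * ennreal e"
    using H A dep by (subst nn_integral_branch1[where n = "Suc 0"]) (auto simp: fieldM.emeasure_eq_measure e_def)
  also have "(\<integral>\<^sup>+f. indicator B f * (indicator H (sh [0] f) * indicator H (sh [1] f)) \<partial>\<P>) =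
      ennreal (measure \<P> B) * (ennreal e * ennreal e)"
    using H B dep by (subst nn_integral_branch2[where n = "Suc 0"]) (auto simp: fieldM.emeasure_eq_measure e_def)
  also have "ennreal (measure \<P> A) * ennreal e + ennreal (measure \<P> B) * (ennreal e * ennreal e)
      = ennreal (measure \<P> A * e + measure \<P> B * (e * e))"
    by (simp add: e_def ennreal_mult ennreal_plus)
  finally have ineq: "e \<le> measure \<P> A * e + measure \<P> B * (e * e)"
    by (subst (asm) ennreal_le_iff) (auto simp: e_def)
  have "measure \<P> A \<le> 1 - measure \<P> B"
  proof -
    have "measure \<P> A + measure \<P> B = measure \<P> (A \<union> B)"
      using A B by (intro measure_Union[symmetric]) (auto simp: A_def B_def)
    also have "\<dots> \<le> 1" by simp
    finally show ?thesis by simp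
  qed
  then have "measure \<P> A * e \<le> (1 - measure \<P> B) * e" by (rule mult_right_mono) (simp add: e_def)
  with ineq have "measure \<P> B * e \<le> measure \<P> B * (e * e)" by (simp add: algebra_simps)
  then have "e \<le> e * e" using prob_two_children by (simp add: B_def)
  moreover have "e \<ge> 0" by (simp add: e_def)
  ultimately have "e = 0" using e1 by (metis mult_left_le mult_less_cancel_left2 not_le order_antisym_conv order_le_less)
  then have "AE f in \<P>. f \<notin> H"
    using H by (intro AE_not_in null_setsI) (auto simp: fieldM.emeasure_eq_measure e_def)
  then show ?thesis by (auto simp: H_def)
qed

lemma AE_ex_talive: "AE f in \<P>. \<forall>t. tgood t \<longrightarrow> (\<exists>u. intree u f \<and> sh u f \<in> talive t)"
proof -
  have "AE f in \<P>. tgood t \<longrightarrow> (\<exists>u. intree u f \<and> sh u f \<in> talive t)" for t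
  proof (cases "tgood t")
    case True
    then show ?thesis using AE_ex_alive[OF talive_sets, of t] by (simp add: tgood_def tprob_def)
  qed simp
  then show ?thesis by (simp add: AE_all_countable)
qed

end

subsection \<open>Expected numbers of visited words\<close>

text \<open>The factor \<open>k\<close> is invisible after taking \<open>k\<close>-th roots; this is
  how a bound that is lossy by a linear factor is made exact for a supermultiplicative
  quantity.\<close>

lemma power_le_linear_imp_le:
  fixes y z A :: real
  assumes le: "\<And>k. k > 0 \<Longrightarrow> y ^ k \<le> A * real k * z ^ k" and yz: "y \<ge> 0" "z > 0"
  shows "y \<le> z"
proof (rule ccontr)
  assume "\<not> y \<le> z"
  then have yz': "z < y" "0 < y" using yz by auto
  define x where "x = z / y"
  have x: "0 < x" "x < 1" using yz yz' by (auto simp: x_def)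
  have "(\<lambda>k. A * (real k * x ^ k)) \<longlonglongrightarrow> A * 0"
    using powser_times_n_limit_0[of x] x by (intro tendsto_mult tendsto_const) simp
  moreover have "1 \<le> A * (real k * x ^ k)" if "k > 0" for k
  proof -
    have "1 = y ^ k / y ^ k" using yz' by simp
    also have "\<dots> \<le> A * real k * z ^ k / y ^ k" using le[OF that] yz' by (intro divide_right_mono) auto
    finally show ?thesis by (simp add: x_def power_divide)
  qed
  ultimately have "1 \<le> A * 0"
    by (intro tendsto_lowerbound[where F = sequentially and f = "\<lambda>k. A * (real k * x ^ k)"])
       (auto simp: eventually_sequentially intro!: exI[of _ 1])
  then show False by simp
qed

context brw
begin

definition visited :: "nat \<Rightarrow> 'g field \<Rightarrow> 'g word set" where
  "visited n f = snd ` set (gens n f)"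

lemma visited_iff: "w \<in> visited n f \<longleftrightarrow> (\<exists>v. length v = n \<and> intree v f \<and> pos v f = w)"
proof -
  have "w \<in> visited n f \<longleftrightarrow> (\<exists>v. (v, w) \<in> set (gens n f))" by (force simp: visited_def)
  then show ?thesis by (auto simp: set_gens)
qed

lemma measurable_visited: "(\<lambda>f. g (visited n f)) \<in> \<P> \<rightarrow>\<^sub>M N" if "range g \<subseteq> space N"
  unfolding visited_def by (rule measurable_compose[OF measurable_gens]) (use that in auto)

lemma sets_visited [measurable]: "Measurable.pred \<P> (\<lambda>f. w \<in> visited n f)"
  unfolding visited_def by (rule measurable_compose[OF measurable_gens]) simp

lemma sets_visited': "{f. w \<in> visited n f} \<in> sets \<P>"
proof -
  have "{f \<in> space \<P>. w \<in> visited n f} \<in> sets \<P>" by measurable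
  then show ?thesis by simp
qed

lemma prob_visited_le:
  assumes "reduced w"
  shows "measure \<P> {f. w \<in> visited n f} \<le> r ^ n * pmf (wk \<mu> n) w"
proof -
  have "ennreal (measure \<P> {f. w \<in> visited n f}) = (\<integral>\<^sup>+f. indicator {f. w \<in> visited n f} f \<partial>\<P>)"
    using sets_visited' by (simp add: fieldM.emeasure_eq_measure)
  also have "\<dots> \<le> (\<integral>\<^sup>+f. cnt n w f \<partial>\<P>)"
  proof (rule nn_integral_mono_AE)
    show "AE f in \<P>. indicator {f. w \<in> visited n f} f \<le> cnt n w f"
      using AE_good_field
    proof eventually_elim
      case (elim f)
      define A where "A = {v. length v = n \<and> intree v f \<and> pos v f = w}"
      have c: "cnt n w f = of_nat (card A)"
        unfolding A_def using elim assms by (intro cnt_eq_card) auto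
      have "indicator {f. w \<in> visited n f} f \<le> (of_nat (card A) :: ennreal)"
      proof (cases "w \<in> visited n f")
        case True
        then have "cnt n w f \<noteq> 0"
          using visited_iff_cnt[of f w n] elim assms unfolding visited_def by blast
        then have "1 \<le> card A" unfolding c by (cases "card A") auto
        then have "of_nat 1 \<le> (of_nat (card A) :: ennreal)" by (rule of_nat_mono)
        then show ?thesis using True by simp
      qed simp
      then show ?case by (simp add: c)
    qed
  qed
  also have "\<dots> = ennreal (r ^ n * pmf (wk \<mu> n) w)" by (rule expect_cnt[OF assms])
  finally show ?thesis using r1 by (subst (asm) ennreal_le_iff) auto
qed

lemma expect_visited_le:
  "(\<integral>\<^sup>+f. of_nat (card (rwords m \<inter> visited n f)) \<partial>\<P>) \<le> ennreal (r ^ n * plen n m)"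
proof -
  have "(\<integral>\<^sup>+f. of_nat (card (rwords m \<inter> visited n f)) \<partial>\<P>) =
      (\<integral>\<^sup>+f. (\<Sum>w\<in>rwords m. indicator {f. w \<in> visited n f} f) \<partial>\<P>)"
  proof (intro nn_integral_cong)
    fix f :: "'g field"
    have "(\<Sum>w\<in>rwords m. indicator {f. w \<in> visited n f} f :: ennreal) = (\<Sum>w\<in>rwords m. if w \<in> visited n f then 1 else 0)"
      by (intro sum.cong refl) (auto simp: indicator_def)
    then show "of_nat (card (rwords m \<inter> visited n f)) = (\<Sum>w\<in>rwords m. indicator {f. w \<in> visited n f} f :: ennreal)"
      by (simp add: sum.If_cases)
  qed
  also have "\<dots> = (\<Sum>w\<in>rwords m. ennreal (measure \<P> {f. w \<in> visited n f}))"
    using sets_visited' by (simp add: nn_integral_sum fieldM.emeasure_eq_measure)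
  also have "\<dots> \<le> (\<Sum>w\<in>rwords m. ennreal (r ^ n * pmf (wk \<mu> n) w))"
    by (intro sum_mono ennreal_leI prob_visited_le) (simp add: rwords_def)
  also have "\<dots> = ennreal (r ^ n * plen n m)"
    using r1 by (simp add: plen_def sum_distrib_left)
  finally show ?thesis .
qed

text \<open>If \<open>L\<close> lies above the line \<open>ln r - s * q\<close> at the ratio in
  question, growth of the population and decay of the probability combine to a bound in which
  \<open>n\<close> no longer occurs.\<close>

lemma plen_bound:
  assumes "ereal (ln r - s * (real (Suc m) / real (Suc n))) \<le> L (real (Suc m) / real (Suc n))"
  shows "r ^ n * plen n m \<le> exp (s * real (Suc m)) / (cmin * r)"
proof -
  have "plen' n m \<le> exp (- real (Suc n) * (ln r - s * (real (Suc m) / real (Suc n))))"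
    by (rule plen'_le_exp[OF assms])
  also have "- real (Suc n) * (ln r - s * (real (Suc m) / real (Suc n))) = s * real (Suc m) - real (Suc n) * ln r"
    by (simp add: right_diff_distrib del: of_nat_Suc)
  also have "exp (s * real (Suc m) - real (Suc n) * ln r) = exp (s * real (Suc m)) / r ^ Suc n"
    using r1 by (simp add: exp_diff exp_of_nat_mult del: of_nat_Suc power_Suc)
  finally show ?thesis using r1 cmin_pos by (simp add: plen'_def field_simps del: of_nat_Suc)
qed

section \<open>Words visited in some generation\<close>

definition vprob :: "nat \<Rightarrow> 'g word \<Rightarrow> real" where
  "vprob T w = measure \<P> {f. \<exists>n\<le>T. w \<in> visited n f}"

lemma sets_vprob: "{f. \<exists>n\<le>T. w \<in> visited n f} \<in> sets \<P>"
proof -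
  have "{f \<in> space \<P>. \<exists>n\<le>T. w \<in> visited n f} \<in> sets \<P>" by measurable
  then show ?thesis by simp
qed

text \<open>Phrased as a selector with at most one vertex: whether generation \<open>n\<close> is
  the first to visit \<open>w\<close> depends only on the levels below \<open>n\<close>, so the
  subtree at the visiting vertex is fresh.\<close>

definition first_visit :: "'g word \<Rightarrow> nat \<Rightarrow> 'g field \<Rightarrow> nat list list" where
  "first_visit w n f =
     (if w \<in> visited n f \<and> (\<forall>k<n. w \<notin> visited k f) then [rep (gens n f) w] else [])"

lemma depends_visited: "k \<le> n \<Longrightarrow> depends_below n (\<lambda>f. visited k f)"
proof -
  assume "k \<le> n"
  then have "depends_below n (gens k)"
    using depends_gens[of k] unfolding depends_below_def by (meson less_le_trans)
  then show ?thesis unfolding visited_def by (rule depends_below_compose)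
qed

lemma selector_first_visit: "selector \<nu> n (first_visit w n)"
  unfolding selector_def
proof (intro conjI allI ballI)
  have [measurable]: "(\<lambda>f. [rep (gens n f) w]) \<in> \<P> \<rightarrow>\<^sub>M count_space UNIV"
    by (rule measurable_compose[OF measurable_gens]) simp
  show "first_visit w n \<in> \<P> \<rightarrow>\<^sub>M count_space UNIV"
    unfolding first_visit_def[abs_def] by measurable
  show "depends_below n (first_visit w n)"
    unfolding depends_below_def
  proof (intro allI impI)
    fix f f' :: "'g field" assume eq: "\<forall>u. length u < n \<longrightarrow> f u = f' u"
    have "visited k f = visited k f'" if "k \<le> n" for k
      using eq by (intro depends_belowD[OF depends_visited[OF that]]) auto
    moreover have "gens n f = gens n f'" using eq by (intro depends_belowD[OF depends_gens]) auto
    ultimately show "first_visit w n f = first_visit w n f'" by (simp add: first_visit_def)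
  qed
  fix f :: "'g field"
  show "distinct (first_visit w n f)" by (simp add: first_visit_def)
  show "length v = n" if "v \<in> set (first_visit w n f)" for v
    using that rep_in[of w "gens n f"] by (auto simp: first_visit_def visited_def set_gens split: if_splits)
qed

lemma first_visit_in:
  "v \<in> set (first_visit w n f) \<Longrightarrow> length v = n \<and> intree v f \<and> pos v f = w"
  using rep_in[of w "gens n f"] by (auto simp: first_visit_def visited_def set_gens split: if_splits)

text \<open>Decomposing at the first visit of \<open>x\<close>; the later visits are those of the subtree.\<close>

lemma vprob_mul:
  assumes "reduced x" "reduced y"
  shows "vprob T x * vprob T' y \<le> vprob (T + T') (mul x y)"
proof -
  define E where "E = {f. \<exists>n\<le>T'. y \<in> visited n f}"
  define F where "F = {f. \<exists>n\<le>T + T'. mul x y \<in> visited n f}"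
  have E: "E \<in> sets \<P>" and F: "F \<in> sets \<P>" unfolding E_def F_def by (rule sets_vprob)+
  have fv: "(\<Sum>n\<le>T. length (first_visit x n f)) = (if \<exists>n\<le>T. x \<in> visited n f then 1 else 0)" for f
  proof (cases "\<exists>n\<le>T. x \<in> visited n f")
    case True
    define n0 where "n0 = (LEAST n. x \<in> visited n f)"
    have n0: "x \<in> visited n0 f" "\<And>k. k < n0 \<Longrightarrow> x \<notin> visited k f" "n0 \<le> T"
    proof -
      show "x \<in> visited n0 f" unfolding n0_def using True by (rule LeastI_ex[where P = "\<lambda>n. x \<in> visited n f", OF ex_forward]) simp
      show "x \<notin> visited k f" if "k < n0" for k using that unfolding n0_def by (rule not_less_Least)
      obtain n where n: "n \<le> T" "x \<in> visited n f" using True by blast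
      have "n0 \<le> n" unfolding n0_def using n(2) by (rule Least_le)
      then show "n0 \<le> T" using n(1) by simp
    qed
    have "length (first_visit x n f) = (if n = n0 then 1 else 0)" for n
      using n0(1,2) by (cases n n0 rule: linorder_cases) (auto simp: first_visit_def)
    then show ?thesis using True n0(3) by simp
  qed (simp add: first_visit_def)
  have "ennreal (vprob T x) * ennreal (vprob T' y) =
      (\<integral>\<^sup>+f. (\<Sum>n\<le>T. of_nat (length (first_visit x n f))) \<partial>\<P>) * ennreal (vprob T' y)"
  proof -
    have "(\<integral>\<^sup>+f. (\<Sum>n\<le>T. of_nat (length (first_visit x n f))) \<partial>\<P>) =
        (\<integral>\<^sup>+f. indicator {f. \<exists>n\<le>T. x \<in> visited n f} f \<partial>\<P>)"
      unfolding of_nat_sum[symmetric] fv by (intro nn_integral_cong) (auto simp: indicator_def)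
    then show ?thesis using sets_vprob by (simp add: fieldM.emeasure_eq_measure vprob_def)
  qed
  also have "\<dots> = (\<Sum>n\<le>T. (\<integral>\<^sup>+f. of_nat (length (first_visit x n f)) \<partial>\<P>) * (\<integral>\<^sup>+f. indicator E f \<partial>\<P>))"
    using E by (subst nn_integral_sum)
      (auto simp: measurable_length[OF selector_first_visit, where g = "\<lambda>l. of_nat (length l)"] sum_distrib_right fieldM.emeasure_eq_measure vprob_def E_def)
  also have "\<dots> = (\<Sum>n\<le>T. \<integral>\<^sup>+f. (\<Sum>v\<in>set (first_visit x n f). indicator E (sh v f)) \<partial>\<P>)"
    using E by (intro sum.cong refl nn_integral_selector_sum[symmetric, OF selector_first_visit]) auto
  also have "\<dots> = (\<integral>\<^sup>+f. (\<Sum>n\<le>T. \<Sum>v\<in>set (first_visit x n f). indicator E (sh v f)) \<partial>\<P>)"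
  proof (rule nn_integral_sum[symmetric])
    fix n
    have "(\<lambda>f. \<Sum>v\<in>set c. indicator E (sh v f) :: ennreal) \<in> borel_measurable \<P>" for c
      using E by measurable
    from measurable_compose_countable[OF this selectorD(1)[OF selector_first_visit]]
    show "(\<lambda>f. \<Sum>v\<in>set (first_visit x n f). indicator E (sh v f) :: ennreal) \<in> borel_measurable \<P>" .
  qed
  also have "\<dots> \<le> (\<integral>\<^sup>+f. indicator F f \<partial>\<P>)"
  proof (rule nn_integral_mono_AE)
    show "AE f in \<P>. (\<Sum>n\<le>T. \<Sum>v\<in>set (first_visit x n f). indicator E (sh v f)) \<le> (indicator F f :: ennreal)"
      using AE_good_field
    proof eventually_elim
      case (elim f)
      have EF: "f \<in> F" if v: "v \<in> set (first_visit x n f)" "n \<le> T" "sh v f \<in> E" for v n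
      proof -
        obtain k w where k: "k \<le> T'" "length w = k" "intree w (sh v f)" "pos w (sh v f) = y"
          using v(3) by (auto simp: E_def visited_iff)
        note v' = first_visit_in[OF v(1)]
        have "intree (v @ w) f" using v' k by (simp add: intree_append)
        moreover from this have "pos (v @ w) f = mul x y" using v' k elim by (simp add: pos_append)
        moreover have "length (v @ w) \<le> T + T'" using v' k v(2) by simp
        ultimately show ?thesis
          unfolding F_def mem_Collect_eq visited_iff by (intro exI[of _ "length (v @ w)"] conjI exI[of _ "v @ w"]) auto
      qed
      show ?case
      proof (cases "f \<in> F")
        case False
        then have "(\<Sum>n\<le>T. \<Sum>v\<in>set (first_visit x n f). indicator E (sh v f)) = (0 :: ennreal)"
          using EF by (intro sum.neutral ballI) (auto simp: indicator_def)
        then show ?thesis by simp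
      next
        case True
        have "(\<Sum>n\<le>T. \<Sum>v\<in>set (first_visit x n f). indicator E (sh v f)) \<le>
            (\<Sum>n\<le>T. \<Sum>v\<in>set (first_visit x n f). (1 :: ennreal))"
          by (intro sum_mono) (auto simp: indicator_def)
        also have "\<dots> = (\<Sum>n\<le>T. of_nat (length (first_visit x n f)))"
          by (intro sum.cong refl) (auto simp: first_visit_def)
        also have "\<dots> \<le> 1" unfolding of_nat_sum[symmetric] fv by simp
        finally show ?thesis using True by simp
      qed
    qed
  qed
  also have "\<dots> = ennreal (vprob (T + T') (mul x y))"
    using F by (simp add: fieldM.emeasure_eq_measure vprob_def F_def)
  finally show ?thesis by (simp add: ennreal_mult[symmetric] vprob_def)
qed

text \<open>A lower bound for the probability that a given letter is visited in the first
  generation; it plays the part that \<open>cmin\<close> has for the walk.\<close>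

definition c0 :: real where "c0 = r * cmin / (1 + kap)"

lemma c0_pos: "c0 > 0"
  using r1 cmin_pos kap_nonneg by (simp add: c0_def add_pos_nonneg)

lemma vprob_letter: "c0 \<le> vprob 1 [a]"
proof -
  have "c0 \<le> r ^ 1 * pmf (wk \<mu> 1) [a] / (1 + kap * real 1)"
    unfolding c0_def wk_1[OF \<mu>_steps] using r1 cmin_le[of a] kap_nonneg
    by (intro frac_le) (auto intro!: mult_left_mono add_pos_nonneg)
  also have "\<dots> \<le> measure \<P> {f. cnt 1 [a] f \<noteq> 0}" by (rule visit_prob_ge) simp
  also have "\<dots> = measure \<P> {f. [a] \<in> visited 1 f}"
  proof (rule fieldM.finite_measure_eq_AE)
    show "AE f in \<P>. f \<in> {f. cnt 1 [a] f \<noteq> 0} \<longleftrightarrow> f \<in> {f. [a] \<in> visited 1 f}"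
      using AE_good_field by eventually_elim (simp add: visited_def visited_iff_cnt del: cnt.simps One_nat_def)
    have "{f \<in> space \<P>. cnt 1 [a] f \<noteq> 0} \<in> sets \<P>" by measurable
    then show "{f. cnt 1 [a] f \<noteq> 0} \<in> sets \<P>" by simp
  qed (rule sets_visited')
  also have "\<dots> \<le> vprob 1 [a]"
    unfolding vprob_def by (intro fieldM.finite_measure_mono sets_vprob) auto
  finally show ?thesis .
qed

definition vsum :: "nat \<Rightarrow> nat \<Rightarrow> real" where
  "vsum T m = (\<Sum>x\<in>rwords m. vprob T x)"

lemma vprob_nonneg [simp]: "0 \<le> vprob T x"
  by (simp add: vprob_def)

lemma vsum_nonneg [simp]: "0 \<le> vsum T m"
  by (simp add: vsum_def sum_nonneg)

lemma vsum_supermult: "(c0 * vsum T m) * (c0 * vsum T' m') \<le> c0 * vsum (Suc (T + T')) (Suc (m + m'))"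
proof -
  have "c0 * (vsum T m * vsum T' m') \<le> vsum (Suc (T + T')) (Suc (m + m'))"
    unfolding vsum_def
  proof (rule sum_wjoin_le[OF card2])
    fix x y :: "'g word" and c
    assume xy: "x \<in> rwords m" "y \<in> rwords m'" and red: "reduced (x @ c # y)"
    have r: "reduced x" "reduced y" "reduced (c # y)" using red by (auto simp: reduced_append_iff reduced_Cons)
    have "c0 * (vprob T x * vprob T' y) \<le> vprob T x * (vprob 1 [c] * vprob T' y)"
      using mult_right_mono[OF vprob_letter[of c], of "vprob T x * vprob T' y"] by (simp add: mult_ac)
    also have "\<dots> \<le> vprob T x * vprob (1 + T') (mul [c] y)"
      by (intro mult_left_mono vprob_mul r) auto
    also have "\<dots> \<le> vprob (T + (1 + T')) (mul x (mul [c] y))"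
      by (intro vprob_mul r reduced_mul)
    also have "mul x (mul [c] y) = x @ c # y"
      using mul_append[of "[c]" y] mul_append[of x "c # y"] r red by simp
    finally show "c0 * (vprob T x * vprob T' y) \<le> vprob (Suc (T + T')) (x @ c # y)" by simp
  qed simp
  then show ?thesis using c0_pos by (simp add: mult_ac mult_left_mono)
qed

lemma vsum_le:
  assumes s: "\<And>q. 0 < q \<Longrightarrow> q \<le> 1 \<Longrightarrow> ereal (ln r - s * q) \<le> L q"
  shows "vsum T m \<le> real (Suc T) * (exp (s * real (Suc m)) / (cmin * r))"
proof -
  have "vprob T x \<le> (\<Sum>n\<le>T. measure \<P> {f. x \<in> visited n f})" for x
  proof -
    have "vprob T x = measure \<P> (\<Union>n\<in>{..T}. {f. x \<in> visited n f})"
      unfolding vprob_def by (rule arg_cong[where f = "measure \<P>"]) auto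
    also have "\<dots> \<le> (\<Sum>n\<in>{..T}. measure \<P> {f. x \<in> visited n f})"
      by (rule fieldM.finite_measure_subadditive_finite) (auto intro: sets_visited')
    finally show ?thesis .
  qed
  then have "vsum T m \<le> (\<Sum>x\<in>rwords m. \<Sum>n\<le>T. measure \<P> {f. x \<in> visited n f})"
    unfolding vsum_def by (intro sum_mono)
  also have "\<dots> = (\<Sum>n\<le>T. \<Sum>x\<in>rwords m. measure \<P> {f. x \<in> visited n f})" by (rule sum.swap)
  also have "\<dots> \<le> (\<Sum>n\<le>T. exp (s * real (Suc m)) / (cmin * r))"
  proof (rule sum_mono)
    fix n
    have "(\<Sum>x\<in>rwords m. measure \<P> {f. x \<in> visited n f}) \<le> (\<Sum>x\<in>rwords m. r ^ n * pmf (wk \<mu> n) x)"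
      by (intro sum_mono prob_visited_le) (simp add: rwords_def)
    also have "\<dots> = r ^ n * plen n m" by (simp add: plen_def sum_distrib_left)
    also have "\<dots> \<le> exp (s * real (Suc m)) / (cmin * r)"
    proof (cases "m \<le> n")
      case True
      show ?thesis by (rule plen_bound, rule s) (use True in \<open>auto simp: divide_le_eq_1\<close>)
    next
      case False
      then show ?thesis using cmin_pos r1 by (simp add: plen_eq_0)
    qed
    finally show "(\<Sum>x\<in>rwords m. measure \<P> {f. x \<in> visited n f}) \<le> exp (s * real (Suc m)) / (cmin * r)" .
  qed
  also have "\<dots> = real (Suc T) * (exp (s * real (Suc m)) / (cmin * r))" by simp
  finally show ?thesis .
qed

text \<open>Summing over generations costs the factor \<open>Suc T\<close>. For the joined
  parameters \<open>k * Suc T\<close> and \<open>k * Suc m\<close> this factor is linear in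
  \<open>k\<close> while everything else is a \<open>k\<close>-th power, so it disappears and the
  bound is uniform in \<open>T\<close>.\<close>

lemma vsum_le_exp:
  assumes s: "\<And>q. 0 < q \<Longrightarrow> q \<le> 1 \<Longrightarrow> ereal (ln r - s * q) \<le> L q"
  shows "c0 * vsum T m \<le> exp (s * real (Suc m))"
proof (rule power_le_linear_imp_le)
  fix k :: nat assume k: "k > 0"
  define N where "N = k * Suc T - 1"
  define M where "M = k * Suc m - 1"
  have N: "Suc N = k * Suc T" and M: "Suc M = k * Suc m" using k by (auto simp: N_def M_def)
  have "(c0 * vsum T m) ^ k \<le> c0 * vsum N M" 
    by (rule supermultiplicative_power[where h = "\<lambda>T m. c0 * vsum T m", OF vsum_supermult _ N M]) (use c0_pos in simp)
  also have "\<dots> \<le> c0 * (real (Suc N) * (exp (s * real (Suc M)) / (cmin * r)))"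
    using c0_pos by (intro mult_left_mono vsum_le s) auto
  also have "\<dots> = (c0 * real (Suc T) / (cmin * r)) * real k * exp (s * real (Suc m)) ^ k"
    unfolding N M of_nat_mult by (simp add: exp_of_nat_mult[symmetric] mult_ac del: of_nat_Suc)
  finally show "(c0 * vsum T m) ^ k \<le> (c0 * real (Suc T) / (cmin * r)) * real k * exp (s * real (Suc m)) ^ k" .
qed (use c0_pos in auto)

lemma expect_ever_visited_le:
  assumes s: "\<And>q. 0 < q \<Longrightarrow> q \<le> 1 \<Longrightarrow> ereal (ln r - s * q) \<le> L q"
  shows "(\<integral>\<^sup>+f. of_nat (card (rwords m \<inter> (\<Union>n. visited n f))) \<partial>\<P>) \<le> ennreal (exp (s * real (Suc m)) / c0)"
proof -
  have lim: "(\<lambda>T. vprob T w) \<longlonglongrightarrow> measure \<P> {f. w \<in> (\<Union>n. visited n f)}" for w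
  proof -
    have "(\<lambda>T. measure \<P> {f. \<exists>n\<le>T. w \<in> visited n f}) \<longlonglongrightarrow> measure \<P> (\<Union>T. {f. \<exists>n\<le>T. w \<in> visited n f})"
      using sets_vprob by (intro fieldM.finite_Lim_measure_incseq) (auto simp: incseq_def intro: order_trans)
    moreover have "(\<Union>T. {f. \<exists>n\<le>T. w \<in> visited n f}) = {f. w \<in> (\<Union>n. visited n f)}" by auto
    ultimately show ?thesis by (simp add: vprob_def)
  qed
  have V: "{f. w \<in> (\<Union>n. visited n f)} \<in> sets \<P>" for w
  proof -
    have "{f \<in> space \<P>. \<exists>n. w \<in> visited n f} \<in> sets \<P>" by measurable
    then show ?thesis by simp
  qed
  have "(\<integral>\<^sup>+f. of_nat (card (rwords m \<inter> (\<Union>n. visited n f))) \<partial>\<P>) =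
      (\<integral>\<^sup>+f. (\<Sum>w\<in>rwords m. indicator {f. w \<in> (\<Union>n. visited n f)} f) \<partial>\<P>)"
  proof (intro nn_integral_cong)
    fix f :: "'g field"
    have "(\<Sum>w\<in>rwords m. indicator {f. w \<in> (\<Union>n. visited n f)} f :: ennreal) =
        (\<Sum>w\<in>rwords m. if w \<in> (\<Union>n. visited n f) then 1 else 0)"
      by (intro sum.cong refl) (auto simp: indicator_def)
    then show "of_nat (card (rwords m \<inter> (\<Union>n. visited n f))) =
        (\<Sum>w\<in>rwords m. indicator {f. w \<in> (\<Union>n. visited n f)} f :: ennreal)"
      by (simp add: sum.If_cases Int_def)
  qed
  also have "\<dots> = ennreal (\<Sum>w\<in>rwords m. measure \<P> {f. w \<in> (\<Union>n. visited n f)})"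
    using V by (simp add: nn_integral_sum fieldM.emeasure_eq_measure del: UN_iff)
  also have "\<dots> \<le> ennreal (exp (s * real (Suc m)) / c0)"
  proof (rule ennreal_leI)
    have "(\<lambda>T. vsum T m) \<longlonglongrightarrow> (\<Sum>w\<in>rwords m. measure \<P> {f. w \<in> (\<Union>n. visited n f)})"
      unfolding vsum_def by (intro tendsto_sum lim)
    moreover have "vsum T m \<le> exp (s * real (Suc m)) / c0" for T
      using vsum_le_exp[OF s, of T m] c0_pos by (simp add: field_simps)
    ultimately show "(\<Sum>w\<in>rwords m. measure \<P> {f. w \<in> (\<Union>n. visited n f)}) \<le> exp (s * real (Suc m)) / c0"
      by (intro LIMSEQ_le_const2) auto
  qed
  finally show ?thesis .
qed

end

subsection \<open>Almost sure upper bounds on the number of visited words\<close>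

lemma sum_ennreal_const: "0 \<le> e \<Longrightarrow> (\<Sum>x\<in>A. ennreal e) = ennreal (real (card A) * e)"
  by (simp add: ennreal_mult ennreal_of_nat_eq_real_of_nat)

context brw
begin

lemma AE_suminf_finite:
  assumes X: "\<And>m. X m \<in> borel_measurable \<P>" and le: "\<And>m. (\<integral>\<^sup>+f. X m f \<partial>\<P>) \<le> ennreal (b m)"
    and b: "summable b" "\<And>m. 0 \<le> b m"
  shows "AE f in \<P>. (\<Sum>m. X m f) < \<top>"
proof -
  have "(\<integral>\<^sup>+f. (\<Sum>m. X m f) \<partial>\<P>) = (\<Sum>m. \<integral>\<^sup>+f. X m f \<partial>\<P>)" by (rule nn_integral_suminf[OF X])
  also have "\<dots> \<le> (\<Sum>m. ennreal (b m))" by (intro suminf_le le) auto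
  also have "\<dots> = ennreal (\<Sum>m. b m)" using b by (intro suminf_ennreal2)
  finally have "(\<integral>\<^sup>+f. (\<Sum>m. X m f) \<partial>\<P>) \<noteq> \<infinity>" by (auto simp: top_unique)
  then have "AE f in \<P>. (\<Sum>m. X m f) \<noteq> \<infinity>"
    using X by (intro nn_integral_PInf_AE borel_measurable_suminf_order)
  then show ?thesis by eventually_elim (simp add: less_top)
qed

lemma summable_linear_exp:
  assumes "(\<delta>::real) > 0"
  shows "summable (\<lambda>m. C * (real m + 1) * exp (- \<delta> * real m))"
proof -
  define z where "z = exp (- \<delta> / 2)"
  have z: "0 < z" "z < 1" using assms by (auto simp: z_def)
  have le: "\<bar>C * (real m + 1) * exp (- \<delta> * real m)\<bar> \<le> (\<bar>C\<bar> * (2 / \<delta> + 1)) * z ^ m" for m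
  proof -
    have "real m * (\<delta> / 2) + 1 \<le> exp (\<delta> / 2 * real m)" using exp_ge_add_one_self[of "\<delta> / 2 * real m"] by (simp add: mult.commute add.commute)
    then have "real m * (\<delta> / 2) \<le> exp (\<delta> / 2 * real m)" by linarith
    then have "real m \<le> 2 / \<delta> * exp (\<delta> / 2 * real m)" using assms by (simp add: field_simps)
    moreover have "1 \<le> exp (\<delta> / 2 * real m)" using assms by simp
    ultimately have "real m + 1 \<le> (2 / \<delta> + 1) * exp (\<delta> / 2 * real m)"
      unfolding distrib_right mult_1 by linarith
    then have "(real m + 1) * exp (- \<delta> * real m) \<le> (2 / \<delta> + 1) * exp (\<delta> / 2 * real m) * exp (- \<delta> * real m)"
      by (rule mult_right_mono) simp
    also have "\<dots> = (2 / \<delta> + 1) * z ^ m"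
      by (simp add: z_def exp_of_nat_mult[symmetric] mult.assoc exp_add[symmetric] field_simps)
    finally have "\<bar>C\<bar> * ((real m + 1) * exp (- \<delta> * real m)) \<le> \<bar>C\<bar> * ((2 / \<delta> + 1) * z ^ m)"
      by (rule mult_left_mono) simp
    then show ?thesis by (simp add: abs_mult mult.assoc)
  qed
  show ?thesis
  proof (rule summable_comparison_test'[where g = "\<lambda>m. (\<bar>C\<bar> * (2 / \<delta> + 1)) * z ^ m"])
    show "summable (\<lambda>m. (\<bar>C\<bar> * (2 / \<delta> + 1)) * z ^ m)"
      using z by (intro summable_mult summable_geometric) simp
  qed (use le in auto)
qed

text \<open>The expected number of such visited words in generation \<open>n\<close> is at most of
  order \<open>n * exp (- \<eta> * n)\<close>. So the counts are almost surely summable, and being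
  integers they are eventually zero.\<close>

lemma AE_no_visits:
  assumes L: "\<And>q. a \<le> q \<Longrightarrow> q \<le> b \<Longrightarrow> ereal (ln r + \<eta>) \<le> L q" and eta: "\<eta> > 0"
  shows "AE f in \<P>. \<forall>\<^sub>F n in sequentially. \<forall>m\<le>n. a \<le> real (Suc m) / real (Suc n) \<longrightarrow>
    real (Suc m) / real (Suc n) \<le> b \<longrightarrow> rwords m \<inter> visited n f = {}"
proof -
  define J where "J n = {m. m \<le> n \<and> a \<le> real (Suc m) / real (Suc n) \<and> real (Suc m) / real (Suc n) \<le> b}" for n
  have J: "finite (J n)" "card (J n) \<le> Suc n" for n
  proof -
    have "J n \<subseteq> {..n}" by (auto simp: J_def)
    then show "finite (J n)" "card (J n) \<le> Suc n"
      by (auto intro: finite_subset dest: card_mono[rotated])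
  qed
  define X where "X n f = (\<Sum>m\<in>J n. of_nat (card (rwords m \<inter> visited n f)) :: ennreal)" for n f
  have Xm: "X n \<in> borel_measurable \<P>" for n
    unfolding X_def[abs_def] by (intro borel_measurable_sum measurable_visited) auto
  have bd: "r ^ n * plen n m \<le> exp (- \<eta> * real n) / (cmin * r)" if "m \<in> J n" for n m
  proof -
    have "plen' n m \<le> exp (- real (Suc n) * (ln r + \<eta>))"
      by (rule plen'_le_exp, rule L) (use that in \<open>auto simp: J_def\<close>)
    also have "\<dots> = exp (- \<eta> * real (Suc n)) / r ^ Suc n"
    proof -
      have "- real (Suc n) * (ln r + \<eta>) = - \<eta> * real (Suc n) - real (Suc n) * ln r" by (simp add: algebra_simps del: of_nat_Suc)
      then show ?thesis using r1 by (simp add: exp_diff exp_of_nat_mult del: of_nat_Suc power_Suc)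
    qed
    finally have "r ^ n * plen n m \<le> exp (- \<eta> * real (Suc n)) / (cmin * r)"
      using r1 cmin_pos by (simp add: plen'_def field_simps del: of_nat_Suc)
    also have "\<dots> \<le> exp (- \<eta> * real n) / (cmin * r)"
      using r1 cmin_pos eta by (intro divide_right_mono) auto
    finally show ?thesis .
  qed
  have "(\<integral>\<^sup>+f. X n f \<partial>\<P>) \<le> ennreal (1 / (cmin * r) * (real n + 1) * exp (- \<eta> * real n))" for n
  proof -
    have "(\<integral>\<^sup>+f. X n f \<partial>\<P>) = (\<Sum>m\<in>J n. \<integral>\<^sup>+f. of_nat (card (rwords m \<inter> visited n f)) \<partial>\<P>)"
      unfolding X_def by (intro nn_integral_sum measurable_visited) auto
    also have "\<dots> \<le> (\<Sum>m\<in>J n. ennreal (exp (- \<eta> * real n) / (cmin * r)))"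
      by (intro sum_mono order_trans[OF expect_visited_le] ennreal_leI bd)
    also have "\<dots> = ennreal (real (card (J n)) * (exp (- \<eta> * real n) / (cmin * r)))"
      using cmin_pos r1 by (intro sum_ennreal_const) simp
    also have "\<dots> \<le> ennreal (real (Suc n) * (exp (- \<eta> * real n) / (cmin * r)))"
      using J(2)[of n] cmin_pos r1 by (intro ennreal_leI mult_right_mono) auto
    finally show ?thesis by (simp add: mult_ac add.commute)
  qed
  then have "AE f in \<P>. (\<Sum>n. X n f) < \<top>"
    by (rule AE_suminf_finite[OF Xm _ summable_linear_exp[OF eta]]) (use cmin_pos r1 in auto)
  then show ?thesis
  proof eventually_elim
    case (elim f)
    define x where "x n = (\<Sum>m\<in>J n. card (rwords m \<inter> visited n f))" for n
    have Xx: "X n f = ennreal (real (x n))" for n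
      by (simp add: X_def x_def ennreal_of_nat_eq_real_of_nat[symmetric] del: of_nat_sum) (simp add: of_nat_sum)
    have "summable (\<lambda>n. real (x n))"
      using elim by (intro summable_suminf_not_top) (auto simp: Xx)
    then have "(\<lambda>n. real (x n)) \<longlonglongrightarrow> 0" by (rule summable_LIMSEQ_zero)
    then have "\<forall>\<^sub>F n in sequentially. real (x n) < 1" by (rule order_tendstoD) simp
    then show ?case
    proof eventually_elim
      case (elim n)
      then have "x n = 0" by simp
      then have "\<forall>m\<in>J n. card (rwords m \<inter> visited n f) = 0" using J(1) by (simp add: x_def)
      then show ?case by (auto simp: J_def)
    qed
  qed
qed

text \<open>The generations in which a ray with speed strictly between \<open>a\<close> and
  \<open>b\<close> can be at distance \<open>m\<close>, once \<open>m\<close> is large. For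
  \<open>a > 0\<close> they are at most linear in number; this is what fails at speed 0.\<close>

definition window :: "real \<Rightarrow> real \<Rightarrow> nat \<Rightarrow> nat set" where
  "window a b m = {n. m \<le> n \<and> a \<le> real (Suc m) / real (Suc n) \<and> real (Suc m) / real (Suc n) \<le> b}"

lemma window:
  assumes "a > 0"
  shows "finite (window a b m)" "real (card (window a b m)) \<le> (real m + 1) / a"
proof -
  have sub: "window a b m \<subseteq> {..<nat \<lfloor>(real m + 1) / a\<rfloor>}"
  proof
    fix n assume "n \<in> window a b m"
    then have "a * real (Suc n) \<le> real (Suc m)" by (simp add: window_def field_simps del: of_nat_Suc)
    then have "real (Suc n) \<le> (real m + 1) / a" using assms by (simp add: field_simps)
    then have "Suc n \<le> nat \<lfloor>(real m + 1) / a\<rfloor>" by (simp add: le_nat_floor)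
    then show "n \<in> {..<nat \<lfloor>(real m + 1) / a\<rfloor>}" by simp
  qed
  then show "finite (window a b m)" by (rule finite_subset) simp
  have "card (window a b m) \<le> nat \<lfloor>(real m + 1) / a\<rfloor>" using card_mono[OF _ sub] by simp
  then have "real (card (window a b m)) \<le> real (nat \<lfloor>(real m + 1) / a\<rfloor>)" by simp
  also have "\<dots> \<le> (real m + 1) / a" using assms by (intro of_nat_floor) simp
  finally show "real (card (window a b m)) \<le> (real m + 1) / a" .
qed

lemma AE_window_sum_finite:
  assumes a: "a > 0" and s: "s1 < s"
    and L: "\<And>q. a \<le> q \<Longrightarrow> q \<le> b \<Longrightarrow> ereal (ln r - s1 * q) \<le> L q"
  shows "AE f in \<P>. (\<Sum>m. ennreal (exp (- s * real m)) *
     of_nat (card (rwords m \<inter> (\<Union>n\<in>window a b m. visited n f)))) < \<top>"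
proof -
  define C where "C = exp s1 / (a * cmin * r)"
  have C: "C > 0" using a cmin_pos r1 by (simp add: C_def)
  define X where "X m f = ennreal (exp (- s * real m)) * (\<Sum>n\<in>window a b m. of_nat (card (rwords m \<inter> visited n f)))" for m f
  have Xm: "X m \<in> borel_measurable \<P>" for m
    unfolding X_def[abs_def]
    by (intro borel_measurable_times_ennreal borel_measurable_sum measurable_visited) auto
  have "(\<integral>\<^sup>+f. X m f \<partial>\<P>) \<le> ennreal (C * (real m + 1) * exp (- (s - s1) * real m))" for m
  proof -
    have "(\<integral>\<^sup>+f. X m f \<partial>\<P>) = ennreal (exp (- s * real m)) * (\<Sum>n\<in>window a b m. \<integral>\<^sup>+f. of_nat (card (rwords m \<inter> visited n f)) \<partial>\<P>)"
      unfolding X_def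
      by (subst nn_integral_cmult) (auto intro!: nn_integral_sum measurable_visited borel_measurable_sum arg_cong[where f = "(*) _"])
    also have "\<dots> \<le> ennreal (exp (- s * real m)) * (\<Sum>n\<in>window a b m. ennreal (exp (s1 * real (Suc m)) / (cmin * r)))"
      by (intro mult_left_mono sum_mono order_trans[OF expect_visited_le] ennreal_leI plen_bound L) (auto simp: window_def)
    also have "\<dots> = ennreal (exp (- s * real m) * (real (card (window a b m)) * (exp (s1 * real (Suc m)) / (cmin * r))))"
    proof -
      have "0 \<le> exp (s1 * real (Suc m)) / (cmin * r)" using cmin_pos r1 by simp
      then show ?thesis by (simp only: sum_ennreal_const) (intro ennreal_mult[symmetric] mult_nonneg_nonneg, auto)
    qed
    also have "\<dots> \<le> ennreal (exp (- s * real m) * ((real m + 1) / a * (exp (s1 * real (Suc m)) / (cmin * r))))"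
      using window(2)[OF a, of b m] cmin_pos r1 by (intro ennreal_leI mult_left_mono mult_right_mono) auto
    also have "exp (- s * real m) * ((real m + 1) / a * (exp (s1 * real (Suc m)) / (cmin * r))) =
        C * (real m + 1) * exp (- (s - s1) * real m)"
    proof -
      have "exp (- s * real m) * exp (s1 * real (Suc m)) = exp s1 * exp (- (s - s1) * real m)"
        by (simp add: exp_add[symmetric] algebra_simps)
      then show ?thesis by (simp add: C_def field_simps del: of_nat_Suc)
    qed
    finally show ?thesis .
  qed
  then have "AE f in \<P>. (\<Sum>m. X m f) < \<top>"
    by (rule AE_suminf_finite[OF Xm _ summable_linear_exp]) (use s C in auto)
  then show ?thesis
  proof eventually_elim
    case (elim f)
    have "(\<Sum>m. ennreal (exp (- s * real m)) * of_nat (card (rwords m \<inter> (\<Union>n\<in>window a b m. visited n f)))) \<le> (\<Sum>m. X m f)"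
    proof (intro suminf_le)
      fix m
      have "card (rwords m \<inter> (\<Union>n\<in>window a b m. visited n f)) \<le> (\<Sum>n\<in>window a b m. card (rwords m \<inter> visited n f))"
        unfolding Int_UN_distrib by (rule card_UN_le) (rule window(1)[OF a])
      then have "(of_nat (card (rwords m \<inter> (\<Union>n\<in>window a b m. visited n f))) :: ennreal) \<le>
          of_nat (\<Sum>n\<in>window a b m. card (rwords m \<inter> visited n f))" by (rule of_nat_mono)
      then show "ennreal (exp (- s * real m)) * of_nat (card (rwords m \<inter> (\<Union>n\<in>window a b m. visited n f))) \<le> X m f"
        unfolding X_def of_nat_sum by (rule mult_left_mono) simp
    qed auto
    with elim show ?case by (rule le_less_trans[rotated])
  qed
qed

lemma AE_total_sum_finite:
  assumes s: "s1 < s" and L: "\<And>q. 0 < q \<Longrightarrow> q \<le> 1 \<Longrightarrow> ereal (ln r - s1 * q) \<le> L q"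
  shows "AE f in \<P>. (\<Sum>m. ennreal (exp (- s * real m)) *
     of_nat (card (rwords m \<inter> (\<Union>n. visited n f)))) < \<top>"
proof (rule AE_suminf_finite)
  define C where "C = exp s1 / c0"
  have C: "C > 0" using c0_pos by (simp add: C_def)
  have cm: "(\<lambda>f. of_nat (card (rwords m \<inter> (\<Union>n. visited n f))) :: ennreal) \<in> borel_measurable \<P>" for m
  proof -
    have "card (rwords m \<inter> (\<Union>n. visited n f)) = (\<Sum>w\<in>rwords m. if \<exists>n. w \<in> visited n f then 1 else 0)" for f
      by (simp add: sum.If_cases Int_def)
    moreover have "(\<lambda>f. \<Sum>w\<in>rwords m. if \<exists>n. w \<in> visited n f then 1 else (0::nat)) \<in> \<P> \<rightarrow>\<^sub>M count_space UNIV"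
      by measurable
    ultimately have "(\<lambda>f. card (rwords m \<inter> (\<Union>n. visited n f))) \<in> \<P> \<rightarrow>\<^sub>M count_space UNIV" by simp
    then show ?thesis by (rule measurable_compose) simp
  qed
  then show "(\<lambda>f. ennreal (exp (- s * real m)) * of_nat (card (rwords m \<inter> (\<Union>n. visited n f)))) \<in> borel_measurable \<P>" for m
    by (intro borel_measurable_times_ennreal) auto
  show "(\<integral>\<^sup>+f. ennreal (exp (- s * real m)) * of_nat (card (rwords m \<inter> (\<Union>n. visited n f))) \<partial>\<P>)
      \<le> ennreal (C * exp (- (s - s1)) ^ m)" for m
  proof -
    have "(\<integral>\<^sup>+f. ennreal (exp (- s * real m)) * of_nat (card (rwords m \<inter> (\<Union>n. visited n f))) \<partial>\<P>)
       = ennreal (exp (- s * real m)) * (\<integral>\<^sup>+f. of_nat (card (rwords m \<inter> (\<Union>n. visited n f))) \<partial>\<P>)"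
      by (rule nn_integral_cmult[OF cm])
    also have "\<dots> \<le> ennreal (exp (- s * real m)) * ennreal (exp (s1 * real (Suc m)) / c0)"
      by (intro mult_left_mono expect_ever_visited_le L) auto
    also have "\<dots> = ennreal (exp (- s * real m) * (exp (s1 * real (Suc m)) / c0))"
      using c0_pos by (intro ennreal_mult[symmetric]) auto
    also have "exp (- s * real m) * (exp (s1 * real (Suc m)) / c0) = C * exp (- (s - s1)) ^ m"
    proof -
      have "exp (- s * real m) * exp (s1 * real (Suc m)) = exp s1 * exp (- (s - s1)) ^ m"
        by (simp add: exp_add[symmetric] exp_of_nat_mult[symmetric] algebra_simps)
      then show ?thesis by (simp add: C_def del: of_nat_Suc)
    qed
    finally show ?thesis .
  qed
  show "summable (\<lambda>m. C * exp (- (s - s1)) ^ m)"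
    using s by (intro summable_mult summable_geometric) simp
qed (use c0_pos in auto)

end

subsection \<open>Hausdorff dimension on the boundary\<close>

definition cyl :: "'g word \<Rightarrow> (nat \<Rightarrow> 'g word) set" where
  "cyl w = {\<omega>\<in>boundary. \<omega> (length w) = w}"

lemma boundary_length: "\<omega> \<in> boundary \<Longrightarrow> length (\<omega> m) = m"
  and boundary_reduced: "\<omega> \<in> boundary \<Longrightarrow> reduced (\<omega> m)"
  by (auto simp: boundary_def)

lemma boundary_dist_le:
  assumes "x \<in> boundary" "y \<in> boundary" "x k = y k"
  shows "boundary_dist x y \<le> exp (- real k)"
  using boundary_agree_le[of x y k] assms by (auto simp: boundary_dist_def)

lemma boundary_dist_leD:
  assumes "x \<in> boundary" "y \<in> boundary" "boundary_dist x y \<le> d" "d > 0" "real k < 1 - ln d"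
  shows "x k = y k"
proof (cases "x = y")
  case False
  let ?G = "GREATEST m. x m = y m"
  have "exp (- real ?G) \<le> d" using assms(3) False by (simp add: boundary_dist_def)
  then have "- real ?G \<le> ln d" using assms(4) by (simp add: ln_ge_iff)
  then have "real k < real ?G + 1" using assms(5) by linarith
  then have "k \<le> ?G" by linarith
  then show ?thesis using boundary_agree_le[of x y k] assms False by simp
qed simp

lemma mdiameter_cyl: "mdiameter boundary_metric (cyl w) \<le> ennreal (exp (- real (length w)))"
  unfolding mdiameter_def
  by (rule SUP_least) (auto simp: cyl_def intro!: ennreal_leI boundary_dist_le)

lemma boundary_dist_le_1: "boundary_dist x y \<le> 1"
  by (simp add: boundary_dist_def)

lemma mdiameter_le_1: "mdiameter boundary_metric U \<le> 1"
  unfolding mdiameter_def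
  by (rule SUP_least) (auto simp: ennreal_le_1 boundary_dist_le_1)

lemma diameter_pow_cyl:
  assumes "s > 0"
  shows "diameter_pow boundary_metric s (cyl w) \<le> ennreal (exp (- s * real (length w)))"
proof (cases "cyl w = {}")
  case False
  have "enn2real (mdiameter boundary_metric (cyl w)) \<le> exp (- real (length w))"
    using enn2real_mono[OF mdiameter_cyl] by simp
  then have "enn2real (mdiameter boundary_metric (cyl w)) powr s \<le> exp (- real (length w)) powr s"
    using assms by (intro powr_mono2) auto
  also have "\<dots> = exp (- s * real (length w))" by (simp add: powr_def)
  finally show ?thesis using False assms by (simp add: diameter_pow_def ennreal_leI)
qed (simp add: diameter_pow_def)

text \<open>Every point of \<open>A\<close> lies in infinitely many of the cylinders, so those
  beyond any length still cover \<open>A\<close>, and their total weight is a tail of a convergent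
  series.\<close>

lemma hausdorff_measure_cyl_cover:
  fixes C :: "nat \<Rightarrow> 'g::finite word set"
  assumes s: "s > 0" and C: "\<And>m. finite (C m)" "\<And>m w. w \<in> C m \<Longrightarrow> length w = m"
    and fin: "(\<Sum>m. ennreal (exp (- s * real m)) * of_nat (card (C m))) < \<top>"
    and A: "\<And>\<omega>. \<omega> \<in> A \<Longrightarrow> \<omega> \<in> boundary \<and> (\<exists>\<^sub>F m in sequentially. \<omega> m \<in> C m)"
  shows "hausdorff_measure boundary_metric s A = 0"
proof -
  define b where "b m = exp (- s * real m) * real (card (C m))" for m
  have b: "ennreal (exp (- s * real m)) * of_nat (card (C m)) = ennreal (b m)" for m
    by (simp add: b_def ennreal_mult ennreal_of_nat_eq_real_of_nat)
  have sb: "summable b"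
  proof (rule summable_suminf_not_top)
    show "(\<Sum>m. ennreal (b m)) \<noteq> \<top>" using fin unfolding b by simp
  qed (simp add: b_def)
  have "hausdorff_content boundary_metric s \<delta> A \<le> ennreal \<epsilon>" if d: "\<delta> > 0" and e: "\<epsilon> > 0" for \<delta> \<epsilon>
  proof -
    obtain N where N: "\<And>n. n \<ge> N \<Longrightarrow> norm (\<Sum>i. b (i + n)) < \<epsilon>"
      using suminf_exist_split[OF e sb] by blast
    obtain K where K: "real K > - ln \<delta>" using reals_Archimedean2 by blast
    define M where "M = max N K"
    have M: "exp (- real m) \<le> \<delta>" if "m \<ge> M" for m
    proof -
      have "- real m \<le> ln \<delta>" using K that by (auto simp: M_def)
      then show ?thesis using d by (simp add: ln_ge_iff)
    qed
    define G where "G = {w. M \<le> length w \<and> w \<in> C (length w)}"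
    define U where "U i = (if i \<in> to_nat ` G then cyl (from_nat i :: 'g word) else {})" for i
    have "hausdorff_content boundary_metric s \<delta> A \<le> (\<Sum>i. diameter_pow boundary_metric s (U i))"
      unfolding hausdorff_content_def
    proof (rule INF_lower, safe)
      fix \<omega> assume w: "\<omega> \<in> A"
      then obtain m where m: "m \<ge> M" "\<omega> m \<in> C m" using A by (auto simp: frequently_sequentially)
      then have "\<omega> m \<in> G" "length (\<omega> m) = m" using C(2) by (auto simp: G_def)
      then have "\<omega> \<in> U (to_nat (\<omega> m))" using A[OF w] by (simp add: U_def cyl_def)
      then show "\<omega> \<in> (\<Union>i. U i)" by blast
    next
      fix i x assume "x \<in> U i"
      then show "x \<in> mspace boundary_metric" by (auto simp: U_def cyl_def split: if_splits)
    next
      fix i show "mdiameter boundary_metric (U i) \<le> ennreal \<delta>"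
      proof (cases "i \<in> to_nat ` G")
        case True
        then obtain w where w: "w \<in> G" "i = to_nat w" by blast
        have "mdiameter boundary_metric (U i) \<le> ennreal (exp (- real (length w)))"
          using mdiameter_cyl[of w] True w by (simp add: U_def)
        also have "\<dots> \<le> ennreal \<delta>" using w(1) by (intro ennreal_leI M) (simp add: G_def)
        finally show ?thesis .
      qed (simp add: U_def mdiameter_def bot_ennreal)
    qed
    also have "\<dots> = (\<integral>\<^sup>+i. diameter_pow boundary_metric s (U i) \<partial>count_space UNIV)"
      by (rule nn_integral_count_space_nat[symmetric])
    also have "\<dots> = (\<integral>\<^sup>+i. diameter_pow boundary_metric s (U i) \<partial>count_space (range (to_nat :: 'g word \<Rightarrow> nat)))"
      by (rule nn_integral_count_space_eq) (auto simp: U_def diameter_pow_def)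
    also have "\<dots> = (\<integral>\<^sup>+w. diameter_pow boundary_metric s (U (to_nat (w :: 'g word))) \<partial>count_space UNIV)"
      by (rule nn_integral_bij_count_space[symmetric]) (simp add: bij_betw_def inj_on_def)
    also have "\<dots> \<le> (\<integral>\<^sup>+w. (\<Sum>i. ennreal (exp (- s * real (i + M))) * indicator (C (i + M)) w) \<partial>count_space UNIV)"
    proof (rule nn_integral_mono)
      fix w :: "'g word"
      show "diameter_pow boundary_metric s (U (to_nat w)) \<le>
          (\<Sum>i. ennreal (exp (- s * real (i + M))) * indicator (C (i + M)) w)"
      proof (cases "w \<in> G")
        case True
        define i where "i = length w - M"
        have i: "i + M = length w" using True by (simp add: i_def G_def)
        have "diameter_pow boundary_metric s (U (to_nat w)) \<le> ennreal (exp (- s * real (length w)))"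
          using diameter_pow_cyl[OF s, of w] True by (simp add: U_def)
        also have "\<dots> = ennreal (exp (- s * real (i + M))) * indicator (C (i + M)) w"
          using True by (simp add: i G_def)
        also have "\<dots> \<le> (\<Sum>i. ennreal (exp (- s * real (i + M))) * indicator (C (i + M)) w)"
        proof -
          have "h i \<le> suminf h" for h :: "nat \<Rightarrow> ennreal"
            using sum_le_suminf[of h "{i}"] by simp
          then show ?thesis .
        qed
        finally show ?thesis .
      next
        case False
        then show ?thesis by (simp add: U_def diameter_pow_def inj_image_mem_iff)
      qed
    qed
    also have "\<dots> = (\<Sum>i. \<integral>\<^sup>+w. ennreal (exp (- s * real (i + M))) * indicator (C (i + M)) w \<partial>count_space UNIV)"
      by (rule nn_integral_suminf) simp
    also have "\<dots> = (\<Sum>i. ennreal (b (i + M)))"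
      using C(1) by (intro suminf_cong) (simp add: nn_integral_cmult b[symmetric])
    also have "\<dots> = ennreal (\<Sum>i. b (i + M))"
    proof (rule suminf_ennreal2)
      show "summable (\<lambda>i. b (i + M))" using sb by (simp only: summable_iff_shift)
    qed (simp add: b_def)
    also have "\<dots> \<le> ennreal \<epsilon>" using N[of M] by (intro ennreal_leI) (simp add: M_def)
    finally show ?thesis .
  qed
  note le = this
  have "hausdorff_content boundary_metric s \<delta> A \<le> 0" if d: "\<delta> > 0" for \<delta>
  proof (rule ennreal_le_epsilon)
    fix e :: real assume "0 < e"
    from le[OF d this] show "hausdorff_content boundary_metric s \<delta> A \<le> 0 + ennreal e" by simp
  qed
  then have "hausdorff_measure boundary_metric s A \<le> 0"
    unfolding hausdorff_measure_def by (intro SUP_least) auto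
  then show ?thesis by simp
qed

lemma hausdorff_dim_le:
  "0 \<le> s \<Longrightarrow> hausdorff_measure m s A = 0 \<Longrightarrow> hausdorff_dim m A \<le> ereal s"
  unfolding hausdorff_dim_def by (rule Inf_lower) auto

lemma hausdorff_content_mono: "A \<subseteq> B \<Longrightarrow> hausdorff_content m s \<delta> A \<le> hausdorff_content m s \<delta> B"
  unfolding hausdorff_content_def by (rule INF_superset_mono) auto

lemma hausdorff_measure_mono: "A \<subseteq> B \<Longrightarrow> hausdorff_measure m s A \<le> hausdorff_measure m s B"
  unfolding hausdorff_measure_def by (intro SUP_mono) (auto intro: hausdorff_content_mono)

lemma hausdorff_dim_mono:
  assumes "A \<subseteq> B"
  shows "hausdorff_dim m A \<le> hausdorff_dim m B"
  unfolding hausdorff_dim_def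
proof (rule Inf_superset_mono, safe)
  fix s :: real assume s: "0 \<le> s" "hausdorff_measure m s B = 0"
  have "hausdorff_measure m s A = 0" using hausdorff_measure_mono[OF assms, of m s] s by simp
  then show "\<exists>s'. ereal s = ereal s' \<and> 0 \<le> s' \<and> hausdorff_measure m s' A = 0" using s(1) by blast
qed

text \<open>Only positive exponents have to be tested: a nonempty set has zero-dimensional measure
  at least 1, so 0 itself never enters the infimum.\<close>

lemma le_hausdorff_dim:
  assumes "A \<noteq> {}" "\<And>s. 0 < s \<Longrightarrow> ereal s < v \<Longrightarrow> hausdorff_measure m s A \<noteq> 0"
  shows "v \<le> hausdorff_dim m A"
  unfolding hausdorff_dim_def
proof (rule Inf_greatest, safe)
  fix s :: real assume s: "0 \<le> s" "hausdorff_measure m s A = 0"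
  have "hausdorff_measure m 0 A \<noteq> 0"
  proof -
    have "1 \<le> hausdorff_content m 0 1 A"
      unfolding hausdorff_content_def
    proof (rule INF_greatest, safe)
      fix U :: "nat \<Rightarrow> 'a set" assume U: "A \<subseteq> (\<Union>i. U i)"
      obtain x where "x \<in> A" using assms(1) by blast
      then obtain i where i: "U i \<noteq> {}" using U by blast
      have "1 = (\<Sum>j\<in>{i}. diameter_pow m 0 (U j))" using i by (simp add: diameter_pow_def)
      also have "\<dots> \<le> (\<Sum>j. diameter_pow m 0 (U j))" by (rule sum_le_suminf) auto
      finally show "1 \<le> (\<Sum>j. diameter_pow m 0 (U j))" .
    qed
    also have "\<dots> \<le> hausdorff_measure m 0 A"
      unfolding hausdorff_measure_def by (rule SUP_upper) simp
    finally show ?thesis by auto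
  qed
  then have "s > 0" using s by (cases "s = 0") auto
  then show "v \<le> ereal s" using assms(2)[of s] s(2) by (meson not_le)
qed

text \<open>A homogeneous Cantor set. The mass of a word \<open>w\<close> is the proportion of the words of \<open>S j\<close> that
  extend it, for any \<open>j\<close> with \<open>length w \<le> l j\<close>. For a cover by cylinders of total mass below
  one, some ray starting from the empty word keeps more mass than the cylinders inside it, hence
  is not covered.\<close>

locale cantor_scheme =
  fixes S :: "nat \<Rightarrow> 'g::finite word set" and l :: "nat \<Rightarrow> nat" and c :: "nat \<Rightarrow> nat"
  assumes l: "strict_mono l"
    and S_fin: "\<And>j. finite (S j)" and S0: "S 0 \<noteq> {}"
    and S_red: "\<And>j w. w \<in> S j \<Longrightarrow> reduced w" and S_len: "\<And>j w. w \<in> S j \<Longrightarrow> length w = l j"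
    and S_take: "\<And>j w. w \<in> S (Suc j) \<Longrightarrow> take (l j) w \<in> S j"
    and S_card: "\<And>j w. w \<in> S j \<Longrightarrow> card {x \<in> S (Suc j). take (l j) x = w} = c j"
    and c_pos: "\<And>j. c j > 0"
begin

lemma l_ge: "j \<le> l j"
  using l by (rule strict_mono_imp_increasing)

lemma l_mono: "i \<le> j \<Longrightarrow> l i \<le> l j"
  using l by (simp add: strict_mono_less_eq)

lemma S_take_le: "i \<le> j \<Longrightarrow> w \<in> S j \<Longrightarrow> take (l i) w \<in> S i"
proof (induction j arbitrary: w rule: dec_induct)
  case base
  then show ?case using S_len by simp
next
  case (step j)
  have "take (l i) (take (l j) w) \<in> S i" using step S_take by blast
  then show ?case using l_mono[OF step(1)] by (simp add: min_absorb1)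
qed

definition ext :: "nat \<Rightarrow> 'g word \<Rightarrow> nat" where
  "ext j w = card {x \<in> S j. prefix w x}"

lemma ext_Suc:
  assumes "length w \<le> l j"
  shows "ext (Suc j) w = c j * ext j w"
proof -
  have p: "prefix w (take (l j) x) \<longleftrightarrow> prefix w x" for x
    using assms by (metis prefix_order.trans take_is_prefix prefix_length_prefix[of w x "take (l j) x"]
        length_take min_def take_all nle_le)
  have "{x \<in> S (Suc j). prefix w x} = (\<Union>y\<in>{y \<in> S j. prefix w y}. {x \<in> S (Suc j). take (l j) x = y})"
    using S_take p by auto
  then have "ext (Suc j) w = (\<Sum>y\<in>{y \<in> S j. prefix w y}. card {x \<in> S (Suc j). take (l j) x = y})"
    unfolding ext_def using S_fin by (simp only:) (intro card_UN_disjoint, auto)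
  also have "\<dots> = (\<Sum>y\<in>{y \<in> S j. prefix w y}. c j)" using S_card by (intro sum.cong) auto
  finally show ?thesis by (simp add: ext_def)
qed

lemma ext_Nil: "ext j [] = card (S j)"
  by (simp add: ext_def)

lemma card_S_pos: "card (S j) > 0"
proof (induction j)
  case 0
  then show ?case using S0 S_fin by (simp add: card_gt_0_iff)
next
  case (Suc j)
  then show ?case using ext_Suc[of "[]" j] c_pos[of j] by (simp add: ext_Nil)
qed

text \<open>Every word of \<open>S j\<close> has the same number \<open>c j\<close> of extensions,
  so passing to the next level multiplies numerator and denominator alike.\<close>

lemma ext_ratio:
  assumes "length w \<le> l i" "i \<le> j"
  shows "real (ext j w) / real (card (S j)) = real (ext i w) / real (card (S i))"
  using assms(2)
proof (induction j rule: dec_induct)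
  case (step j)
  have "length w \<le> l j" using assms(1) l_mono[OF step(1)] by simp
  then have "ext (Suc j) w = c j * ext j w" "card (S (Suc j)) = c j * card (S j)"
    using ext_Suc[of w j] ext_Suc[of "[]" j] by (simp_all add: ext_Nil)
  then show ?case using step(3) c_pos[of j] by simp
qed simp

text \<open>The level \<open>length w\<close> is deep enough because \<open>j \<le> l j\<close>; by
  \<open>ext_ratio\<close> any other admissible level gives the same value.\<close>

definition mass :: "'g word \<Rightarrow> real" where
  "mass w = real (ext (length w) w) / real (card (S (length w)))"

lemma mass_eq:
  assumes "length w \<le> l j"
  shows "mass w = real (ext j w) / real (card (S j))"
proof -
  have "length w \<le> l (length w)" by (rule l_ge)
  then show ?thesis
    unfolding mass_def using assms ext_ratio[of w j "length w"] ext_ratio[of w "length w" j] by (cases "j \<le> length w") auto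
qed

lemma mass_nonneg [simp]: "0 \<le> mass w"
  by (simp add: mass_def)

lemma mass_Nil: "mass [] = 1"
  using card_S_pos[of 0] by (simp add: mass_def ext_Nil)

lemma mass_additive: "mass w = (\<Sum>a\<in>UNIV. mass (w @ [a]))"
proof -
  define j where "j = Suc (length w)"
  have j: "length w < l j" using l_ge[of j] by (simp add: j_def)
  have "{x \<in> S j. prefix w x} = (\<Union>a. {x \<in> S j. prefix (w @ [a]) x})"
  proof (intro equalityI subsetI)
    fix x assume x: "x \<in> {x \<in> S j. prefix w x}"
    then obtain z where z: "x = w @ z" by (auto simp: prefix_def)
    moreover have "z \<noteq> []" using x z S_len[of x j] j by auto
    ultimately have "prefix (w @ [hd z]) x" by (cases z) (auto simp: prefix_def)
    then show "x \<in> (\<Union>a. {x \<in> S j. prefix (w @ [a]) x})" using x by blast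
  qed (auto dest: append_prefixD)
  then have "ext j w = (\<Sum>a\<in>UNIV. ext j (w @ [a]))"
    unfolding ext_def using S_fin by (simp only:) (intro card_UN_disjoint, auto simp: prefix_def)
  then show ?thesis
    using j by (simp add: mass_eq[of _ j] sum_divide_distrib)
qed

definition limit :: "(nat \<Rightarrow> 'g word) set" where
  "limit = {\<omega>\<in>boundary. \<forall>j. \<omega> (l j) \<in> S j}"

lemma ex_uncovered:
  assumes x: "(\<Sum>i. ennreal (mass (x i))) < 1"
  obtains \<omega> where "\<omega> \<in> limit" "\<And>i. \<omega> \<notin> cyl (x i)"
proof -
  \<comment> \<open>The mass of all covering cylinders inside that of \<open>w\<close>. If every
    one-letter extension were exhausted by its share, summation over the letters would show that
    \<open>w\<close> is exhausted too.\<close>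
  define T where "T w = (\<Sum>i. if prefix w (x i) then ennreal (mass (x i)) else 0)" for w
  define under where "under w \<longleftrightarrow> T w < ennreal (mass w)" for w
  have u0: "under []" using x by (simp add: under_def T_def mass_Nil)
  have step: "\<exists>a. under (w @ [a])" if "under w" for w
  proof (rule ccontr)
    assume "\<not> ?thesis"
    then have le: "ennreal (mass (w @ [a])) \<le> T (w @ [a])" for a unfolding under_def by (meson not_less)
    have "ennreal (mass w) = (\<Sum>a\<in>UNIV. ennreal (mass (w @ [a])))"
      by (subst mass_additive) simp
    also have "\<dots> \<le> (\<Sum>a\<in>UNIV. T (w @ [a]))" by (intro sum_mono le)
    also have "\<dots> = (\<Sum>i. \<Sum>a\<in>UNIV. if prefix (w @ [a]) (x i) then ennreal (mass (x i)) else 0)"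
      unfolding T_def by (rule suminf_sum[symmetric]) auto
    also have "\<dots> \<le> T w"
      unfolding T_def
    proof (intro suminf_le)
      fix i
      show "(\<Sum>a\<in>UNIV. if prefix (w @ [a]) (x i) then ennreal (mass (x i)) else 0) \<le>
          (if prefix w (x i) then ennreal (mass (x i)) else 0)"
      proof (cases "\<exists>a. prefix (w @ [a]) (x i)")
        case True
        then obtain a where a: "prefix (w @ [a]) (x i)" by blast
        have "prefix (w @ [b]) (x i) \<longleftrightarrow> b = a" for b using a by (auto simp: prefix_def)
        then have "(\<Sum>b\<in>UNIV. if prefix (w @ [b]) (x i) then ennreal (mass (x i)) else 0) = ennreal (mass (x i))"
          by simp
        then show ?thesis using append_prefixD[OF a] by simp
      next
        case False
        then have "\<not> prefix (w @ [a]) (x i)" for a by blast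
        then show ?thesis by simp
      qed
    qed auto
    also have "\<dots> < ennreal (mass w)" using that by (simp add: under_def)
    finally show False by simp
  qed
  define \<omega> where "\<omega> = rec_nat [] (\<lambda>n w. w @ [SOME a. under (w @ [a])])"
  have \<omega>0: "\<omega> 0 = []" and \<omega>S: "\<omega> (Suc n) = \<omega> n @ [SOME a. under (\<omega> n @ [a])]" for n
    by (simp_all add: \<omega>_def)
  have un: "under (\<omega> n)" for n
  proof (induction n)
    case (Suc n)
    then show ?case unfolding \<omega>S by (rule someI_ex[OF step])
  qed (simp add: \<omega>0 u0)
  have len: "length (\<omega> n) = n" for n by (induction n) (simp_all add: \<omega>0 \<omega>S)
  have ex: "\<exists>y\<in>S n. prefix (\<omega> n) y" for n
  proof -
    have "T (\<omega> n) < ennreal (mass (\<omega> n))" using un[of n] by (simp only: under_def)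
    then have "0 < ennreal (mass (\<omega> n))" by (rule le_less_trans[OF zero_le])
    then have "mass (\<omega> n) \<noteq> 0" by auto
    then have "ext n (\<omega> n) \<noteq> 0" unfolding mass_def len by (metis div_0 of_nat_0)
    then have "{y \<in> S n. prefix (\<omega> n) y} \<noteq> {}" unfolding ext_def by (metis card.empty)
    then show ?thesis by blast
  qed
  have red: "reduced (\<omega> n)" for n
  proof -
    obtain y zs where y: "y \<in> S n" "y = \<omega> n @ zs" using ex[of n] unfolding prefix_def by blast
    show ?thesis using S_red[OF y(1)] by (simp add: y(2) reduced_append_iff)
  qed
  have b: "\<omega> \<in> boundary" by (auto simp: boundary_def \<omega>0 len red \<omega>S)
  moreover have "\<omega> (l j) \<in> S j" for j
  proof -
    obtain y where y: "y \<in> S (l j)" "prefix (\<omega> (l j)) y" using ex by blast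
    have "take (l j) y \<in> S j" using S_take_le[OF l_ge y(1)] .
    moreover have "take (l j) y = \<omega> (l j)" using y(2) len[of "l j"] by (auto simp: prefix_def)
    ultimately show ?thesis by simp
  qed
  ultimately have "\<omega> \<in> limit" by (simp add: limit_def)
  moreover have "\<omega> \<notin> cyl (x i)" for i
  proof
    assume "\<omega> \<in> cyl (x i)"
    then have e: "\<omega> (length (x i)) = x i" by (simp add: cyl_def)
    have "ennreal (mass (x i)) = (\<Sum>j\<in>{i}. if prefix (x i) (x j) then ennreal (mass (x j)) else 0)" by simp
    also have "\<dots> \<le> T (x i)" unfolding T_def by (rule sum_le_suminf) auto
    also have "\<dots> < ennreal (mass (x i))" using un[of "length (x i)"] by (simp add: e under_def)
    finally show False by simp
  qed
  ultimately show ?thesis by (rule that)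
qed

text \<open>Applied to a cover that consists of copies of one cylinder of mass zero; a word that is
  not reduced has no extension in any \<open>S j\<close>.\<close>

lemma limit_nonempty: "limit \<noteq> {}"
proof -
  have big: "\<exists>w. mass w \<le> 0"
  proof -
    obtain w :: "'g word" where w: "length w = 2" "\<not> reduced w"
      by (rule that[of "[(undefined, True), (undefined, False)]"]) (auto simp: reduced_def letter_inv_def)
    have "\<not> prefix w x" if "x \<in> S 2" for x
      using S_red[OF that] w(2) by (auto simp: prefix_def reduced_append_iff)
    then have "{x \<in> S 2. prefix w x} = {}" by blast
    then have "ext 2 w = 0" unfolding ext_def by (simp only: card.empty)
    then have "mass w = 0" by (simp add: mass_def w)
    then show ?thesis by (intro exI[of _ w]) simp
  qed
  then obtain w where "mass w \<le> 0" by blast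
  then have "(\<Sum>i::nat. ennreal (mass w)) < 1" by (simp add: ennreal_neg)
  then show ?thesis using ex_uncovered[of "\<lambda>_. w"] by blast
qed

text \<open>The mass distribution principle. A cover of content below \<open>1 / (2 * C)\<close>
  could be enlarged to cylinders of total mass below 1, and then a point of \<open>limit\<close>
  would remain uncovered.\<close>

lemma hausdorff_measure_pos:
  assumes A: "limit \<subseteq> A" and s: "s > 0" and C: "C > 0"
    and mass: "\<And>w. mass w \<le> C * exp (- s * real (length w))"
  shows "hausdorff_measure boundary_metric s A \<noteq> 0"
proof -
  have "ennreal (1 / (2 * C)) \<le> hausdorff_content boundary_metric s 1 A"
    unfolding hausdorff_content_def
  proof (rule INF_greatest, safe, rule ccontr)
    fix U :: "nat \<Rightarrow> (nat \<Rightarrow> 'g word) set"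
    assume cov: "A \<subseteq> (\<Union>i. U i)" and U: "\<forall>i. U i \<subseteq> mspace boundary_metric \<and> mdiameter boundary_metric (U i) \<le> ennreal 1"
    assume "\<not> ennreal (1 / (2 * C)) \<le> (\<Sum>i. diameter_pow boundary_metric s (U i))"
    then have lt: "(\<Sum>i. diameter_pow boundary_metric s (U i)) < ennreal (1 / (2 * C))" by simp
    have "\<exists>w. U i \<subseteq> cyl w \<and> ennreal (mass w) \<le> ennreal C * diameter_pow boundary_metric s (U i) + ennreal ((1 / 2) ^ (i + 2))" for i
    proof -
      \<comment> \<open>An allowance for empty sets and single points, which have weight 0 but must
        be replaced by cylinders of possibly positive mass. The allowances sum to one half, which is
        why the content is bounded by \<open>1 / (2 * C)\<close>.\<close>
      define e where "e = ((1::real) / 2) ^ (i + 2)"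
      have e: "e > 0" by (simp add: e_def)
      obtain k where k: "real k > ln (C / e) / s" using reals_Archimedean2 by blast
      have small: "mass w \<le> e" if "length w = k" for w
      proof -
        have "ln (C / e) \<le> s * real k" using k s by (simp add: field_simps)
        then have "exp (ln (C / e)) \<le> exp (s * real k)" by (simp only: exp_le_cancel_iff)
        then have "C / e \<le> exp (s * real k)" using C e by simp
        then have "C * exp (- s * real k) \<le> e" using e by (simp add: exp_minus field_simps)
        then show ?thesis using mass[of w] that by simp
      qed
      have "\<exists>w. U i \<subseteq> cyl w \<and> ennreal (mass w) \<le> ennreal C * diameter_pow boundary_metric s (U i) + ennreal e"
      proof (cases "U i = {}")
        case True
        then show ?thesis using small[of "replicate k undefined"]
          by (intro exI[of _ "replicate k undefined"]) (auto intro!: add_increasing ennreal_leI)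
      next
        case False
        then obtain \<omega> where w: "\<omega> \<in> U i" by blast
        have Ub: "\<And>y. y \<in> U i \<Longrightarrow> y \<in> boundary" using U by auto
        define d where "d = enn2real (mdiameter boundary_metric (U i))"
        have d: "mdiameter boundary_metric (U i) = ennreal d" "0 \<le> d" "d \<le> 1"
        proof -
          have "mdiameter boundary_metric (U i) < \<top>" by (rule le_less_trans[OF mdiameter_le_1]) simp
          then show "mdiameter boundary_metric (U i) = ennreal d" by (simp add: d_def)
          then show "d \<le> 1" using mdiameter_le_1[of "U i"] by simp
        qed (simp add: d_def)
        have dist: "boundary_dist \<omega> y \<le> d" if "y \<in> U i" for y
        proof -
          have "ennreal (boundary_dist \<omega> y) \<le> mdiameter boundary_metric (U i)"
            unfolding mdiameter_def by (rule SUP_upper2[of "(\<omega>, y)"]) (use w that in auto)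
          then show ?thesis using d by simp
        qed
        have pw: "diameter_pow boundary_metric s (U i) = ennreal (d powr s)"
          using False s by (simp add: diameter_pow_def d_def)
        show ?thesis
        proof (cases "d = 0")
          case True
          have "y = \<omega>" if "y \<in> U i" for y
            using dist[OF that] True by (auto simp: boundary_dist_def split: if_splits)
          then have "U i \<subseteq> cyl (\<omega> k)" using Ub[OF w] by (auto simp: cyl_def boundary_length)
          moreover have "mass (\<omega> k) \<le> e" using Ub[OF w] by (intro small boundary_length)
          ultimately show ?thesis
            by (intro exI[of _ "\<omega> k"]) (auto intro!: add_increasing ennreal_leI)
        next
          case False
          then have d0: "d > 0" using d by simp
          \<comment> \<open>Two points at distance at most \<open>d\<close> share every prefix of
            length below \<open>1 - ln d\<close>; this \<open>n\<close> is such a length and is at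
            least \<open>- ln d\<close>, so \<open>exp (- n) \<le> d\<close>.\<close>
          define n where "n = nat \<lceil>- ln d\<rceil>"
          have "ln d \<le> 0" using d d0 by simp
          then have n: "real n < 1 - ln d" "- ln d \<le> real n" unfolding n_def by linarith+
          have "U i \<subseteq> cyl (\<omega> n)"
          proof
            fix y assume y: "y \<in> U i"
            have "\<omega> n = y n"
              using dist[OF y] by (rule boundary_dist_leD[OF Ub[OF w] Ub[OF y] _ d0 n(1)])
            then show "y \<in> cyl (\<omega> n)" using Ub[OF y] by (simp add: cyl_def boundary_length)
          qed
          moreover have "mass (\<omega> n) \<le> C * d powr s"
          proof -
            have "- s * real n \<le> s * ln d" using n(2) s mult_left_mono[of "- ln d" "real n" s] by simp
            then have "C * exp (- s * real n) \<le> C * exp (s * ln d)" using C by simp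
            then show ?thesis using mass[of "\<omega> n"] d0 Ub[OF w] by (simp add: powr_def boundary_length)
          qed
          then have "ennreal (mass (\<omega> n)) \<le> ennreal C * diameter_pow boundary_metric s (U i) + ennreal e"
            using C by (simp add: pw ennreal_mult[symmetric] add_increasing2 ennreal_leI)
          ultimately show ?thesis by blast
        qed
      qed
      then show ?thesis by (simp only: e_def)
    qed
    then obtain x where x: "\<And>i. U i \<subseteq> cyl (x i)"
      "\<And>i. ennreal (mass (x i)) \<le> ennreal C * diameter_pow boundary_metric s (U i) + ennreal ((1 / 2) ^ (i + 2))"
      by metis
    have "(\<Sum>i. ennreal (mass (x i))) \<le> (\<Sum>i. ennreal C * diameter_pow boundary_metric s (U i) + ennreal ((1 / 2) ^ (i + 2)))"
      by (intro suminf_le x) auto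
    also have "\<dots> = ennreal C * (\<Sum>i. diameter_pow boundary_metric s (U i)) + (\<Sum>i. ennreal ((1 / 2) ^ (i + 2)))"
      by (simp add: suminf_add[symmetric])
    also have "(\<Sum>i. ennreal ((1 / 2) ^ (i + 2))) = ennreal (1 / 2)"
    proof -
      have "(\<lambda>i. (1 / 2 :: real) ^ (i + 2)) sums (1 / 4 * (1 / (1 - 1 / 2)))"
        using sums_mult[OF geometric_sums[of "1 / 2 :: real"], of "1 / 4"] by (simp add: power_add power2_eq_square mult.commute)
      then show ?thesis by (intro suminf_ennreal_eq) auto
    qed
    also have "ennreal C * (\<Sum>i. diameter_pow boundary_metric s (U i)) + ennreal (1 / 2) < ennreal (1 / 2) + ennreal (1 / 2)"
    proof -
      obtain z where z: "(\<Sum>i. diameter_pow boundary_metric s (U i)) = ennreal z" "z \<ge> 0"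
        using lt by (cases "\<Sum>i. diameter_pow boundary_metric s (U i)") auto
      have "z < 1 / (2 * C)" using lt z by (simp add: ennreal_less_iff)
      then have "C * z < 1 / 2" using C by (simp add: field_simps)
      then have "ennreal (C * z + 1 / 2) < ennreal (1 / 2 + 1 / 2)" using C z by (intro ennreal_lessI) auto
      moreover have "ennreal (C * z + 1 / 2) = ennreal C * ennreal z + ennreal (1 / 2)"
        using C z by (subst ennreal_plus) (auto simp: ennreal_mult)
      moreover have "ennreal (1 / 2 + 1 / 2) = ennreal (1 / 2) + ennreal (1 / 2)"
        by (rule ennreal_plus) auto
      ultimately show ?thesis unfolding z(1) by (simp only:)
    qed
    also have "ennreal (1 / 2) + ennreal (1 / 2) = ennreal (1 / 2 + 1 / 2)"
      by (rule ennreal_plus[symmetric]) auto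
    also have "\<dots> = 1" by simp
    finally obtain \<omega> where "\<omega> \<in> limit" "\<And>i. \<omega> \<notin> cyl (x i)" using ex_uncovered by blast
    then show False using A cov x(1) by blast
  qed
  moreover have "hausdorff_content boundary_metric s 1 A \<le> hausdorff_measure boundary_metric s A"
    unfolding hausdorff_measure_def by (rule SUP_upper) simp
  ultimately show ?thesis using C by (auto simp: top_unique)
qed

end

subsection \<open>Rays of the branching random walk\<close>

definition fieldof :: "(nat list \<Rightarrow> nat) \<Rightarrow> (nat list \<Rightarrow> 'g word) \<Rightarrow> 'g field" where
  "fieldof k y u = map (\<lambda>i. y (u @ [i])) [0..<k u]"

lemma length_fieldof [simp]: "length (fieldof k y u) = k u"
  and nth_fieldof: "i < k u \<Longrightarrow> fieldof k y u ! i = y (u @ [i])"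
  by (simp_all add: fieldof_def)

lemma gw_tree_iff: "u \<in> gw_tree k \<longleftrightarrow> intree u (fieldof k y)"
  by (simp add: gw_tree_def intree_iff)

lemma intree_take: "intree u f \<Longrightarrow> intree (take n u) f"
  by (metis append_take_drop_id intree_append)

lemma pos_snoc:
  assumes "step_field f" "intree (u @ [i]) f"
  shows "pos (u @ [i]) f = mul (pos u f) (f u ! i)" "f u ! i \<in> step_words"
proof -
  have i: "i < length (f u)" using assms(2) by (simp add: intree_append sh_def)
  have "set (f u) \<subseteq> step_words" using assms(1) by (simp add: step_field_def)
  then show s: "f u ! i \<in> step_words" using nth_mem[OF i] by blast
  have "pos [i] (sh u f) = f u ! i" using s by (simp add: sh_def mul_Nil_right)
  then show "pos (u @ [i]) f = mul (pos u f) (f u ! i)" using pos_append[OF assms] by simp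
qed

lemma position_eq_pos:
  assumes "step_field (fieldof k y)"
  shows "u \<in> gw_tree k \<Longrightarrow> position y u = pos u (fieldof k y)"
proof (induction u rule: rev_induct)
  case (snoc i u)
  have it: "intree (u @ [i]) (fieldof k y)" using snoc.prems by (simp add: gw_tree_iff[of _ _ y])
  then have u: "u \<in> gw_tree k" "i < k u"
    unfolding gw_tree_iff[of _ _ y] by (simp_all add: intree_append sh_def)
  have m: "map (\<lambda>j. y (take j (u @ [i]))) [1..<Suc (length u)] = map (\<lambda>j. y (take j u)) [1..<Suc (length u)]"
    by (intro map_cong refl) auto
  have "[1..<Suc (length (u @ [i]))] = [1..<Suc (length u)] @ [Suc (length u)]" by simp
  then have "position y (u @ [i]) = mul (position y u) (y (u @ [i]))"
    unfolding position_def by (simp only: map_append m foldl_append) simp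
  also have "\<dots> = pos (u @ [i]) (fieldof k y)"
    using snoc.IH[OF u(1)] pos_snoc(1)[OF assms it] u(2) by (simp add: nth_fieldof)
  finally show ?case .
qed (simp add: position_def)

locale walk_ray =
  fixes f :: "'g field" and t :: "nat \<Rightarrow> nat list"
  assumes f: "step_field f" and t0: "t 0 = []" and tS: "\<And>n. \<exists>i. t (Suc n) = t n @ [i]"
    and t_in: "\<And>n. intree (t n) f"
begin

abbreviation X :: "nat \<Rightarrow> 'g word" where "X n \<equiv> pos (t n) f"

lemma length_t: "length (t n) = n"
proof (induction n)
  case (Suc n)
  obtain i where "t (Suc n) = t n @ [i]" using tS by blast
  then show ?case using Suc by simp
qed (simp add: t0)

lemma X_0: "X 0 = []" by (simp add: t0)

lemma X_reduced: "reduced (X n)"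
  by (rule reduced_pos[OF f t_in])

lemma X_Suc: "\<exists>y\<in>step_words. X (Suc n) = mul (X n) y"
proof -
  obtain i where i: "t (Suc n) = t n @ [i]" using tS by blast
  then show ?thesis using pos_snoc[OF f, of "t n" i] t_in[of "Suc n"] by metis
qed

lemma X_length_step: "length (X (Suc n)) \<le> Suc (length (X n))" "length (X n) \<le> Suc (length (X (Suc n)))"
  using X_Suc[of n] mul_step[OF X_reduced[of n]] by metis+

lemma X_length_steps: "length (X (n + e)) \<le> length (X n) + e" "length (X n) \<le> length (X (n + e)) + e"
proof (induction e)
  case (Suc e)
  { case 1 then show ?case using Suc X_length_step(1)[of "n + e"] by simp }
  { case 2 then show ?case using Suc X_length_step(2)[of "n + e"] by simp }
qed auto

lemma X_length_le: "length (X n) \<le> n"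
  using X_length_steps(1)[of 0 n] by (simp add: X_0)

text \<open>Each step can alter only the last letter, so \<open>e\<close> steps leave all but the
  last \<open>e\<close> letters in place.\<close>

lemma X_take: "take (length (X n) - e) (X (n + e)) = take (length (X n) - e) (X n)"
proof (induction e)
  case (Suc e)
  obtain y where y: "y \<in> step_words" "X (Suc (n + e)) = mul (X (n + e)) y" using X_Suc by blast
  have eq: "take (length (X (n + e)) - 1) (X (Suc (n + e))) = take (length (X (n + e)) - 1) (X (n + e))"
    unfolding y(2) by (rule mul_step(3)[OF X_reduced y(1)])
  have le: "length (X n) - Suc e \<le> length (X (n + e)) - 1" using X_length_steps(2)[of n e] by linarith
  have "take (length (X n) - Suc e) (X (Suc (n + e))) = take (length (X n) - Suc e) (take (length (X (n + e)) - 1) (X (Suc (n + e))))"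
    using le by (simp add: min_absorb1)
  also have "\<dots> = take (length (X n) - Suc e) (X (n + e))"
    unfolding eq using le by (simp add: min_absorb1)
  also have "\<dots> = take (length (X n) - Suc e) (take (length (X n) - e) (X (n + e)))" by (simp add: min_absorb1)
  also have "\<dots> = take (length (X n) - Suc e) (X n)" unfolding Suc by (simp add: min_absorb1)
  finally show ?case by simp
qed simp

text \<open>The walk moves to neighbours, so it visits every vertex of the limit ray.\<close>

lemma visits_limit:
  assumes w: "\<omega> \<in> boundary" "tends_to_ray X \<omega>"
  obtains n where "X n = \<omega> m" "m \<le> n"
proof -
  obtain N where N: "\<And>n. n \<ge> N \<Longrightarrow> prefix (\<omega> m) (X n)"
    using w(2) by (auto simp: tends_to_ray_def eventually_sequentially)
  \<comment> \<open>The time from which \<open>\<omega> m\<close> remains a prefix. One step earlier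
    it was not, and a single step can create this prefix only by completing it, so at
    \<open>n1\<close> the position is \<open>\<omega> m\<close> itself.\<close>
  define n1 where "n1 = (LEAST N. \<forall>n\<ge>N. prefix (\<omega> m) (X n))"
  have n1: "\<forall>n\<ge>n1. prefix (\<omega> m) (X n)"
    unfolding n1_def using N by (intro LeastI[where P = "\<lambda>N. \<forall>n\<ge>N. prefix (\<omega> m) (X n)"]) blast
  have "X n1 = \<omega> m"
  proof (cases n1)
    case 0
    then have "prefix (\<omega> m) (X 0)" using n1 by blast
    then show ?thesis using 0 X_0 by simp
  next
    case (Suc n)
    have "\<not> (\<forall>k\<ge>n. prefix (\<omega> m) (X k))"
      using not_less_Least[of n "\<lambda>N. \<forall>n\<ge>N. prefix (\<omega> m) (X n)"] Suc unfolding n1_def by auto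
    then obtain k where k: "k \<ge> n" "\<not> prefix (\<omega> m) (X k)" by blast
    then have "k = n" using n1 Suc by (metis le_antisym not_less_eq_eq)
    then have np: "\<not> prefix (\<omega> m) (X n)" using k by simp
    have p: "prefix (\<omega> m) (X (Suc n))" using n1 Suc by simp
    obtain y where y: "y \<in> step_words" "X (Suc n) = mul (X n) y" using X_Suc by blast
    show ?thesis
    proof (cases "y = []")
      case True
      then show ?thesis using y np p by (simp add: mul_Nil_right X_reduced)
    next
      case False
      then obtain a where a: "y = [a]" using y(1) by (auto simp: step_words_def)
      show ?thesis
      proof (cases "X n \<noteq> [] \<and> last (X n) = letter_inv a")
        case True
        then have "X (Suc n) = butlast (X n)" by (simp add: y(2) a mul_single_right X_reduced)
        then have "prefix (\<omega> m) (X n)" using p True by (metis append_butlast_last_id prefix_prefix)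
        then show ?thesis using np by simp
      next
        case False
        then have "X (Suc n) = X n @ [a]" unfolding y(2) a mul_single_right[OF X_reduced] by argo
        then show ?thesis using p np Suc by (metis prefix_snoc)
      qed
    qed
  qed
  moreover have "m \<le> n1" using X_length_le[of n1] calculation boundary_length[OF w(1)] by simp
  ultimately show ?thesis by (rule that)
qed

lemma ratio_shift:
  assumes "(\<lambda>n. real (length (X n)) / real n) \<longlonglongrightarrow> \<alpha>"
  shows "(\<lambda>n. real (Suc (length (X n))) / real (Suc n)) \<longlonglongrightarrow> \<alpha>"
proof -
  have l1: "(\<lambda>n. real n / real (Suc n)) \<longlonglongrightarrow> 1" by (rule LIMSEQ_n_over_Suc_n)
  have l2: "(\<lambda>n. 1 / real (Suc n)) \<longlonglongrightarrow> 0" using LIMSEQ_inverse_real_of_nat by (simp add: inverse_eq_divide)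
  have "(\<lambda>n. real (length (X n)) / real n * (real n / real (Suc n)) + 1 / real (Suc n)) \<longlonglongrightarrow> \<alpha> * 1 + 0"
    by (intro tendsto_intros assms l1 l2)
  moreover have "\<forall>\<^sub>F n in sequentially. real (length (X n)) / real n * (real n / real (Suc n)) + 1 / real (Suc n) =
      real (Suc (length (X n))) / real (Suc n)"
    using eventually_gt_at_top[of 0]
  proof eventually_elim
    case (elim n)
    then have "real (length (X n)) / real n * (real n / real (Suc n)) = real (length (X n)) / real (Suc n)" by simp
    then show ?case by (simp only: of_nat_Suc[of "length (X n)"] add_divide_distrib)
  qed
  ultimately show ?thesis using Lim_transform_eventually by fastforce
qed

end

lemma tree_ray_walk_ray:
  assumes "step_field (fieldof k y)" "t \<in> tree_rays k"
  shows "walk_ray (fieldof k y) t" "position y (t n) = pos (t n) (fieldof k y)"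
proof -
  have t: "t 0 = []" "\<And>n. t n \<in> gw_tree k" "\<And>n. \<exists>i. t (Suc n) = t n @ [i]"
    using assms(2) by (auto simp: tree_rays_def)
  show "walk_ray (fieldof k y) t"
    by unfold_locales (use assms(1) t gw_tree_iff[of _ k y] in auto)
  show "position y (t n) = pos (t n) (fieldof k y)" by (rule position_eq_pos[OF assms(1) t(2)])
qed

context brw
begin

lemma limit_set_measure_0:
  assumes f: "step_field (fieldof k y)" and s: "s > 0"
    and fin: "(\<Sum>m. ennreal (exp (- s * real m)) * of_nat (card (rwords m \<inter> (\<Union>n. visited n (fieldof k y))))) < \<top>"
  shows "hausdorff_measure boundary_metric s (limit_set k y) = 0"
proof (rule hausdorff_measure_cyl_cover[OF s _ _ fin])
  fix \<omega> assume "\<omega> \<in> limit_set k y"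
  then obtain t where t: "\<omega> \<in> boundary" "t \<in> tree_rays k" "tends_to_ray (\<lambda>n. position y (t n)) \<omega>"
    by (auto simp: limit_set_def)
  interpret walk_ray "fieldof k y" t by (rule tree_ray_walk_ray(1)[OF f t(2)])
  have tr: "tends_to_ray X \<omega>" using t(3) tree_ray_walk_ray(2)[OF f t(2)] by simp
  have "\<omega> m \<in> rwords m \<inter> (\<Union>n. visited n (fieldof k y))" for m
  proof -
    obtain n where n: "X n = \<omega> m" "m \<le> n" by (rule visits_limit[OF t(1) tr])
    then have "\<omega> m \<in> visited n (fieldof k y)" using length_t[of n] t_in[of n] by (auto simp: visited_iff)
    then show ?thesis using boundary_length[OF t(1)] boundary_reduced[OF t(1)] by (auto simp: rwords_def)
  qed
  then show "\<omega> \<in> boundary \<and> (\<exists>\<^sub>F m in sequentially. \<omega> m \<in> rwords m \<inter> (\<Union>n. visited n (fieldof k y)))"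
    using t(1) by (auto simp: frequently_sequentially)
next
  fix m v assume "v \<in> rwords m \<inter> \<Union> (range (\<lambda>n. visited n (fieldof k y)))"
  then show "length v = m" by (auto simp: rwords_def)
qed (auto simp: finite_rwords)

lemma limit_set_speed_measure_0:
  assumes f: "step_field (fieldof k y)" and s: "s > 0" and ab: "a < \<alpha>" "\<alpha> < b"
    and fin: "(\<Sum>m. ennreal (exp (- s * real m)) *
       of_nat (card (rwords m \<inter> (\<Union>n\<in>window a b m. visited n (fieldof k y))))) < \<top>"
  shows "hausdorff_measure boundary_metric s (limit_set_speed k y \<alpha>) = 0"
proof (rule hausdorff_measure_cyl_cover[OF s _ _ fin])
  fix \<omega> assume "\<omega> \<in> limit_set_speed k y \<alpha>"
  then obtain t where t: "\<omega> \<in> boundary" "t \<in> tree_rays k" "tends_to_ray (\<lambda>n. position y (t n)) \<omega>"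
    "(\<lambda>n. real (length (position y (t n))) / real n) \<longlonglongrightarrow> \<alpha>"
    by (auto simp: limit_set_speed_def)
  interpret walk_ray "fieldof k y" t by (rule tree_ray_walk_ray(1)[OF f t(2)])
  have tr: "tends_to_ray X \<omega>" and sp: "(\<lambda>n. real (length (X n)) / real n) \<longlonglongrightarrow> \<alpha>"
    using t(3,4) tree_ray_walk_ray(2)[OF f t(2)] by simp_all
  have "\<forall>\<^sub>F n in sequentially. a < real (Suc (length (X n))) / real (Suc n) \<and> real (Suc (length (X n))) / real (Suc n) < b"
    using ratio_shift[OF sp] ab by (intro eventually_conj order_tendstoD) auto
  then obtain N where N: "\<And>n. n \<ge> N \<Longrightarrow> a < real (Suc (length (X n))) / real (Suc n) \<and> real (Suc (length (X n))) / real (Suc n) < b"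
    by (auto simp: eventually_sequentially)
  have "\<omega> m \<in> rwords m \<inter> (\<Union>n\<in>window a b m. visited n (fieldof k y))" if "m \<ge> N" for m
  proof -
    obtain n where n: "X n = \<omega> m" "m \<le> n" by (rule visits_limit[OF t(1) tr])
    have lm: "length (X n) = m" using n boundary_length[OF t(1)] by simp
    have "\<omega> m \<in> visited n (fieldof k y)" using length_t[of n] t_in[of n] n by (auto simp: visited_iff)
    moreover have "n \<in> window a b m" using N[of n] that n(2) lm by (auto simp: window_def)
    ultimately show ?thesis using boundary_length[OF t(1)] boundary_reduced[OF t(1)] by (auto simp: rwords_def)
  qed
  then show "\<omega> \<in> boundary \<and> (\<exists>\<^sub>F m in sequentially. \<omega> m \<in> rwords m \<inter> (\<Union>n\<in>window a b m. visited n (fieldof k y)))"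
    using t(1) unfolding frequently_sequentially by (meson max.cobounded1 max.cobounded2)
next
  fix m v assume "v \<in> rwords m \<inter> (\<Union>n\<in>window a b m. visited n (fieldof k y))"
  then show "length v = m" by (auto simp: rwords_def)
qed (auto simp: finite_rwords)

lemma limit_set_speed_empty:
  assumes f: "step_field (fieldof k y)" and ab: "a < \<alpha>" "\<alpha> < b"
    and none: "\<forall>\<^sub>F n in sequentially. \<forall>m\<le>n. a \<le> real (Suc m) / real (Suc n) \<longrightarrow>
      real (Suc m) / real (Suc n) \<le> b \<longrightarrow> rwords m \<inter> visited n (fieldof k y) = {}"
  shows "limit_set_speed k y \<alpha> = {}"
proof (rule ccontr)
  assume "limit_set_speed k y \<alpha> \<noteq> {}"
  then obtain t where t: "t \<in> tree_rays k"
    "(\<lambda>n. real (length (position y (t n))) / real n) \<longlonglongrightarrow> \<alpha>"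
    by (auto simp: limit_set_speed_def)
  interpret walk_ray "fieldof k y" t by (rule tree_ray_walk_ray(1)[OF f t(1)])
  have sp: "(\<lambda>n. real (length (X n)) / real n) \<longlonglongrightarrow> \<alpha>"
    using t(2) tree_ray_walk_ray(2)[OF f t(1)] by simp
  have "\<forall>\<^sub>F n in sequentially. a < real (Suc (length (X n))) / real (Suc n) \<and> real (Suc (length (X n))) / real (Suc n) < b"
    using ratio_shift[OF sp] ab by (intro eventually_conj order_tendstoD) auto
  with none have "\<forall>\<^sub>F n in sequentially. False"
  proof eventually_elim
    case (elim n)
    have "X n \<in> rwords (length (X n)) \<inter> visited n (fieldof k y)"
      using length_t[of n] t_in[of n] X_reduced[of n] by (auto simp: rwords_def visited_iff)
    moreover have "rwords (length (X n)) \<inter> visited n (fieldof k y) = {}"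
      using elim X_length_le[of n] by (meson less_imp_le)
    ultimately show ?case by blast
  qed
  then show False by simp
qed

end

subsection \<open>A Cantor set inside the limit set\<close>

text \<open>The position is known after each block, not only at the leaves; this is what controls
  the speed in the middle of a stage.\<close>

lemma leaves_checkpoint:
  assumes t: "tracks a M s" and G: "\<And>f v. v \<in> set (s f) \<Longrightarrow> length v = G"
  shows "step_field f \<Longrightarrow> d \<le> D \<Longrightarrow> v \<in> set (leaves N s D f) \<Longrightarrow>
    pos (take (d * G) v) f \<in> block_words a (d * M)"
proof (induction d arbitrary: D f v)
  case (Suc d)
  then obtain D' where D': "D = Suc D'" "d \<le> D'" by (cases D) auto
  obtain u w where u: "v = u @ w" "u \<in> set (s f)" "w \<in> set (leaves N s D' (sh u f))"
    using Suc.prems(3) unfolding D'(1) by (rule leaves_SucE)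
  note f' = step_field_sh[OF Suc.prems(1), of u]
  have bu: "pos u f \<in> block_words a M" "intree u f" using tracksD(1,2)[OF t Suc.prems(1) u(2)] by auto
  have bw: "pos (take (d * G) w) (sh u f) \<in> block_words a (d * M)" by (rule Suc.IH[OF f' D'(2) u(3)])
  have "intree w (sh u f)" by (rule tracksD(1)[OF tracks_leaves[OF t] f' u(3)])
  then have "intree (u @ take (d * G) w) f" using bu by (simp add: intree_append intree_take)
  then have "pos (u @ take (d * G) w) f = mul (pos u f) (pos (take (d * G) w) (sh u f))"
    by (rule pos_append[OF Suc.prems(1)])
  also have "\<dots> = pos u f @ pos (take (d * G) w) (sh u f)" by (rule block_words_mul[OF bu(1) bw])
  finally have "pos (u @ take (d * G) w) f \<in> block_words a (M + d * M)"
    using block_words_append[OF bu(1) bw] by simp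
  moreover have "take (Suc d * G) v = u @ take (d * G) w" using G[OF u(2)] u(1) by simp
  ultimately show ?case by simp
qed (simp add: block_words_def)

lemma leaves_length_node:
  assumes G: "\<And>f v. v \<in> set (s f) \<Longrightarrow> length v = G"
  shows "v \<in> set (leaves N s D f) \<Longrightarrow> length v = D * G"
proof (induction D arbitrary: f v)
  case (Suc D)
  obtain u w where "v = u @ w" "u \<in> set (s f)" "w \<in> set (leaves N s D (sh u f))"
    using Suc.prems by (rule leaves_SucE)
  then show ?case using G Suc.IH by simp
qed simp

lemma pos_append_block:
  assumes f: "step_field f" and w0: "reduced w0" "w0 \<noteq> []" "last w0 = a"
    and q: "intree q f" "pos q f = w0 @ x" "x \<in> block_words a l"
    and v: "intree v (sh q f)" "pos v (sh q f) \<in> block_words a m"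
  shows "pos (q @ v) f = pos q f @ pos v (sh q f)"
proof -
  have xy: "x @ pos v (sh q f) \<in> block_words a (l + m)" by (rule block_words_append[OF q(3) v(2)])
  then have "reduced (w0 @ (x @ pos v (sh q f)))"
    using w0 unfolding reduced_append_iff[of w0] by (auto simp: block_words_def)
  then have "mul (pos q f) (pos v (sh q f)) = pos q f @ pos v (sh q f)"
    by (intro mul_append) (simp add: q(2))
  moreover have "intree (q @ v) f" using q v by (simp add: intree_append)
  ultimately show ?thesis using pos_append[OF f] by metis
qed

text \<open>The spliced tree. Stage \<open>j\<close> continues every node of \<open>Q j\<close> by
  \<open>D j\<close> levels of blocks with \<open>G j\<close> generations and \<open>M j\<close>
  letters each, and keeps \<open>c j\<close> of the leaves. The nodes of \<open>Q j\<close> lie in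
  generation \<open>g j\<close>, at words with \<open>l j\<close> letters after the common beginning
  \<open>w0\<close>; \<open>w0\<close> ends in \<open>a\<close>, so nothing cancels there.\<close>

locale block_tree =
  fixes f :: "'g::finite field" and a :: "'g letter" and w0 :: "'g word"
    and s :: "nat \<Rightarrow> 'g field \<Rightarrow> nat list list" and G M N D g l c :: "nat \<Rightarrow> nat"
    and Q :: "nat \<Rightarrow> nat list set"
  assumes f: "step_field f" and w0: "reduced w0" "w0 \<noteq> []" "last w0 = a"
    and tracks: "\<And>j. tracks a (M j) (s j)" and s_len: "\<And>j f v. v \<in> set (s j f) \<Longrightarrow> length v = G j"
    and pos_params: "\<And>j. N j > 0" "\<And>j. G j > 0" "\<And>j. M j > 0" "\<And>j. D j > 0" "\<And>j. c j > 0"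
    and l0: "l 0 = 0" and lS: "\<And>j. l (Suc j) = l j + D j * M j" and gS: "\<And>j. g (Suc j) = g j + D j * G j"
    and Q_fin: "\<And>j. finite (Q j)" and Q0: "Q 0 \<noteq> {}"
    and Q_in: "\<And>j q. q \<in> Q j \<Longrightarrow> intree q f" and Q_len: "\<And>j q. q \<in> Q j \<Longrightarrow> length q = g j"
    and Q_pos: "\<And>j q. q \<in> Q j \<Longrightarrow> \<exists>x\<in>block_words a (l j). pos q f = w0 @ x"
    and Q_inj: "\<And>j. inj_on (\<lambda>q. pos q f) (Q j)"
    and Q_Suc: "\<And>j q'. q' \<in> Q (Suc j) \<Longrightarrow>
      \<exists>q\<in>Q j. \<exists>v\<in>set (leaves (N j) (s j) (D j) (sh q f)). q' = q @ v"
    and Q_card: "\<And>j q. q \<in> Q j \<Longrightarrow> card {q' \<in> Q (Suc j). take (g j) q' = q} = c j"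
begin

definition len :: "nat \<Rightarrow> nat" where "len j = length w0 + l j"

lemma len_Suc: "len (Suc j) = len j + D j * M j"
  by (simp add: len_def lS)

lemma Q_pos_len: "q \<in> Q j \<Longrightarrow> length (pos q f) = len j"
  using Q_pos[of q j] by (auto simp: len_def block_words_length)

lemma node_append:
  assumes "q \<in> Q j" "intree v (sh q f)" "pos v (sh q f) \<in> block_words a m"
  shows "pos (q @ v) f = pos q f @ pos v (sh q f)"
  using pos_append_block[OF f w0 Q_in[OF assms(1)] _ _ assms(2,3)] Q_pos[OF assms(1)] by blast

lemma Q_SucE:
  assumes "q' \<in> Q (Suc j)"
  obtains q v where "q \<in> Q j" "v \<in> set (leaves (N j) (s j) (D j) (sh q f))" "q' = q @ v"
    "pos q' f = pos q f @ pos v (sh q f)" "intree v (sh q f)"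
proof -
  obtain q v where q: "q \<in> Q j" "v \<in> set (leaves (N j) (s j) (D j) (sh q f))" "q' = q @ v"
    using Q_Suc[OF assms] by blast
  note t = tracksD(1,2)[OF tracks_leaves[OF tracks] step_field_sh[OF f] q(2)]
  show ?thesis by (rule that[OF q]) (use node_append[OF q(1) t(1,2)] q(3) t(1) in auto)
qed

lemma Q_Suc_take:
  assumes q': "q' \<in> Q (Suc j)"
  shows "take (g j) q' \<in> Q j" "take (len j) (pos q' f) = pos (take (g j) q') f"
proof -
  obtain q v where q: "q \<in> Q j" "q' = q @ v" "pos q' f = pos q f @ pos v (sh q f)"
    using q' by (rule Q_SucE)
  then show "take (g j) q' \<in> Q j" "take (len j) (pos q' f) = pos (take (g j) q') f"
    by (simp_all add: Q_len Q_pos_len)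
qed

lemma checkpoint:
  assumes q': "q' \<in> Q (Suc j)" and d: "d \<le> D j"
  shows "length (pos (take (g j + d * G j) q') f) = len j + d * M j"
    "prefix (pos (take (g j) q') f) (pos (take (g j + d * G j) q') f)"
proof -
  obtain q v where q: "q \<in> Q j" "v \<in> set (leaves (N j) (s j) (D j) (sh q f))" "q' = q @ v" "intree v (sh q f)"
    using q' by (rule Q_SucE)
  have b: "pos (take (d * G j) v) (sh q f) \<in> block_words a (d * M j)"
    by (rule leaves_checkpoint[OF tracks s_len step_field_sh[OF f] d q(2)])
  have "pos (q @ take (d * G j) v) f = pos q f @ pos (take (d * G j) v) (sh q f)"
    by (rule node_append[OF q(1) intree_take[OF q(4)] b])
  moreover have "take (g j + d * G j) q' = q @ take (d * G j) v" "take (g j) q' = q"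
    using Q_len[OF q(1)] q(3) by simp_all
  ultimately show "length (pos (take (g j + d * G j) q') f) = len j + d * M j"
    "prefix (pos (take (g j) q') f) (pos (take (g j + d * G j) q') f)"
    using block_words_length[OF b] Q_pos_len[OF q(1)] by simp_all
qed

sublocale cantor_scheme "\<lambda>j. (\<lambda>q. pos q f) ` Q j" len c
proof
  show "strict_mono len" unfolding strict_mono_Suc_iff by (simp add: len_Suc pos_params)
  show "finite ((\<lambda>q. pos q f) ` Q j)" "(\<lambda>q. pos q f) ` Q 0 \<noteq> {}" "c j > 0" for j
    using Q_fin Q0 pos_params by auto
  show "reduced w" "length w = len j" if "w \<in> (\<lambda>q. pos q f) ` Q j" for w j
    using that by (auto simp: Q_pos_len intro: reduced_pos f Q_in)
  show "take (len j) w \<in> (\<lambda>q. pos q f) ` Q j" if "w \<in> (\<lambda>q. pos q f) ` Q (Suc j)" for w j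
    using that Q_Suc_take by auto
  fix j w assume "w \<in> (\<lambda>q. pos q f) ` Q j"
  then obtain q where q: "q \<in> Q j" "w = pos q f" by blast
  have "take (len j) (pos q' f) = w \<longleftrightarrow> take (g j) q' = q" if "q' \<in> Q (Suc j)" for q'
    using Q_Suc_take[OF that] q inj_onD[OF Q_inj[of j]] by metis
  then have "{x \<in> (\<lambda>q. pos q f) ` Q (Suc j). take (len j) x = w} = (\<lambda>q. pos q f) ` {q' \<in> Q (Suc j). take (g j) q' = q}"
    by auto
  moreover have "card ((\<lambda>q. pos q f) ` {q' \<in> Q (Suc j). take (g j) q' = q}) = card {q' \<in> Q (Suc j). take (g j) q' = q}"
    by (intro card_image inj_on_subset[OF Q_inj[of "Suc j"]]) auto
  ultimately show "card {x \<in> (\<lambda>q. pos q f) ` Q (Suc j). take (len j) x = w} = c j"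
    using Q_card[OF q(1)] by (simp only:)
qed

lemma ext_le:
  assumes d: "d \<le> D j" and w: "length w \<ge> len j + d * M j"
  shows "ext (Suc j) w \<le> N j ^ (D j - d)"
proof -
  let ?S = "{x \<in> (\<lambda>q. pos q f) ` Q (Suc j). prefix w x}"
  show ?thesis
  proof (cases "?S = {}")
    case True
    then show ?thesis unfolding ext_def by (simp only: card.empty le0)
  next
    case False
    then obtain q0 where q0: "q0 \<in> Q (Suc j)" "prefix w (pos q0 f)" by auto
    define q where "q = take (g j) q0"
    have q: "q \<in> Q j" unfolding q_def by (rule Q_Suc_take[OF q0(1)])
    have tw: "take (len j) w = pos q f"
      using q0 Q_Suc_take(2)[OF q0(1)] w by (auto simp: q_def prefix_def)
    define y where "y = take (d * M j) (drop (len j) w)"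
    define V where "V = {v \<in> set (leaves (N j) (s j) (D j) (sh q f)). prefix y (pos v (sh q f))}"
    have "?S \<subseteq> (\<lambda>v. pos (q @ v) f) ` V"
    proof
      fix x assume "x \<in> ?S"
      then obtain q' where q': "q' \<in> Q (Suc j)" "x = pos q' f" "prefix w (pos q' f)" by auto
      obtain q1 v where q1: "q1 \<in> Q j" "v \<in> set (leaves (N j) (s j) (D j) (sh q1 f))" "q' = q1 @ v"
        "pos q' f = pos q1 f @ pos v (sh q1 f)" using q'(1) by (rule Q_SucE)
      have "take (len j) w = take (len j) (pos q' f)" using q'(3) w by (auto simp: prefix_def)
      then have "take (len j) w = pos q1 f" by (simp add: q1(4) Q_pos_len[OF q1(1)])
      then have qq: "q1 = q" using tw inj_onD[OF Q_inj[of j] _ q1(1) q] by simp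
      have "prefix (take (len j) w @ drop (len j) w) (pos q1 f @ pos v (sh q1 f))" using q'(3) by (simp add: q1(4))
      then have "prefix (pos q f @ drop (len j) w) (pos q f @ pos v (sh q f))" by (simp only: tw qq)
      then have "prefix (drop (len j) w) (pos v (sh q f))" by simp
      then have "prefix y (pos v (sh q f))" unfolding y_def using take_is_prefix prefix_order.trans by blast
      then have "v \<in> V" "x = pos (q @ v) f" using q1(2,3) q'(2) qq by (auto simp: V_def)
      then show "x \<in> (\<lambda>v. pos (q @ v) f) ` V" by blast
    qed
    then have "card ?S \<le> card ((\<lambda>v. pos (q @ v) f) ` V)" by (intro card_mono) (auto simp: V_def)
    also have "\<dots> \<le> card V" by (rule card_image_le) (simp add: V_def)
    also have "\<dots> \<le> N j ^ (D j - d)"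
      unfolding V_def using w by (intro card_leaves_prefix[OF tracks pos_params(1) step_field_sh[OF f] d]) (simp add: y_def)
    finally show ?thesis by (simp add: ext_def)
  qed
qed

end

lemma strict_mono_bracket:
  fixes h :: "nat \<Rightarrow> nat"
  assumes h: "strict_mono h" and n: "h i \<le> n"
  obtains j where "i \<le> j" "h j \<le> n" "n < h (Suc j)"
proof -
  define k where "k = (LEAST k. n < h k)"
  have "n < h (Suc n)" using strict_mono_imp_increasing[OF h, of "Suc n"] by simp
  then have k: "n < h k" unfolding k_def by (rule LeastI)
  then have "i < k" using n strict_mono_less[OF h, of i k] by linarith
  then obtain j where j: "k = Suc j" "i \<le> j" by (cases k) auto
  have "\<not> n < h j" using not_less_Least[of j "\<lambda>k. n < h k"] j unfolding k_def by simp
  then show ?thesis using that[of j] j k by simp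
qed

context block_tree
begin

abbreviation S where "S j \<equiv> (\<lambda>q. pos q f) ` Q j"

lemma card_S_Suc: "card (S (Suc j)) = c j * card (S j)"
  using ext_Suc[of "[]" j] by (simp add: ext_Nil)

context
  fixes \<sigma> :: real and p :: "nat \<Rightarrow> real"
  assumes N_ge: "\<And>j. exp (\<sigma> * real (M j)) \<le> real (N j)"
    and p: "\<And>j. 0 < p j" and c_ge: "\<And>j. p (Suc j) * real (N j ^ D j) / 2 \<le> real (c j)"
begin

text \<open>Each stage keeps at least the fraction \<open>p (Suc j) / 2\<close> of its leaves, those
  from which the next type survives; \<open>loss\<close> is the accumulated reciprocal.\<close>

definition loss :: "nat \<Rightarrow> real" where "loss j = (\<Prod>i<j. 2 / p (Suc i))"

lemma loss_pos: "loss j > 0"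
  using p by (auto simp: loss_def intro!: prod_pos)

lemma N_power_ge: "exp (\<sigma> * real (d * M j)) \<le> real (N j ^ d)"
proof -
  have "exp (\<sigma> * real (d * M j)) = exp (\<sigma> * real (M j)) ^ d"
    by (simp add: exp_of_nat_mult[symmetric] mult_ac)
  also have "\<dots> \<le> real (N j) ^ d" by (intro power_mono N_ge) simp
  finally show ?thesis by simp
qed

lemma N_power_le: "real (N j ^ D j) \<le> 2 / p (Suc j) * real (c j)"
  using c_ge[of j] p[of "Suc j"] by (simp add: field_simps)

lemma card_S_ge: "exp (\<sigma> * real (l j)) \<le> loss j * real (card (S j))"
proof (induction j)
  case 0
  then show ?case using card_S_pos[of 0] by (simp add: l0 loss_def)
next
  case (Suc j)
  have "exp (\<sigma> * real (l (Suc j))) = exp (\<sigma> * real (l j)) * exp (\<sigma> * real (D j * M j))"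
    by (simp add: lS exp_add[symmetric] distrib_left)
  also have "\<dots> \<le> loss j * real (card (S j)) * (2 / p (Suc j) * real (c j))"
    using Suc order_trans[OF N_power_ge N_power_le[of j]] loss_pos[of j]
    by (intro mult_mono) (auto intro: less_imp_le)
  finally show ?case by (simp only: loss_def card_S_Suc) (simp add: mult_ac)
qed

text \<open>If \<open>w\<close> ends in stage \<open>j\<close> after \<open>d\<close> complete
  blocks, at most \<open>N j ^ (D j - d)\<close> leaves extend it. Compared with the
  \<open>c j\<close> leaves kept, this costs the factor \<open>2 / p (Suc j)\<close>, completing
  \<open>loss (Suc j)\<close>; the incomplete block costs
  \<open>exp (\<sigma> * M j)\<close>.\<close>

lemma mass_le:
  assumes \<sigma>: "\<sigma> \<ge> 0" and w: "len j < length w" "length w \<le> len (Suc j)"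
  shows "mass w \<le> loss (Suc j) * exp (\<sigma> * real (M j)) * exp (- \<sigma> * (real (length w) - real (length w0)))"
proof -
  define d where "d = (length w - len j) div M j"
  have M: "M j > 0" by (rule pos_params)
  have "length w - len j \<le> D j * M j" using w(2) by (simp add: len_Suc)
  then have d: "d \<le> D j" unfolding d_def using M by (metis div_le_mono div_mult_self_is_m)
  have dM: "d * M j \<le> length w - len j" by (simp add: d_def)
  have dM': "length w - len j < d * M j + M j"
    unfolding d_def using dividend_less_div_times[OF M, of "length w - len j"] by simp
  have cj: "real (card (S j)) > 0" "real (c j) > 0" using card_S_pos[of j] pos_params(5)[of j] by auto
  have "real (N j ^ (D j - d)) * real (N j ^ d) = real (N j ^ D j)"
    using d by (simp add: power_add[symmetric])
  then have "real (N j ^ (D j - d)) * exp (\<sigma> * real (d * M j)) \<le> 2 / p (Suc j) * real (c j)"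
    using mult_left_mono[OF N_power_ge[of d j], of "real (N j ^ (D j - d))"] N_power_le[of j] by simp
  moreover have "real (ext (Suc j) w) \<le> real (N j ^ (D j - d))"
    using ext_le[OF d, of w] dM w(1) by (simp only: of_nat_le_iff)
  ultimately have "real (ext (Suc j) w) * exp (\<sigma> * real (d * M j)) \<le> 2 / p (Suc j) * real (c j)"
    by (meson exp_ge_zero mult_right_mono order_trans)
  then have "real (ext (Suc j) w) \<le> 2 / p (Suc j) * real (c j) / exp (\<sigma> * real (d * M j))"
    by (simp only: pos_le_divide_eq exp_gt_zero)
  then have e: "real (ext (Suc j) w) \<le> 2 / p (Suc j) * real (c j) * exp (- \<sigma> * real (d * M j))"
    by (simp only: mult_minus_left exp_minus divide_inverse)
  have "mass w = real (ext (Suc j) w) / (real (c j) * real (card (S j)))"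
    using mass_eq[OF w(2)] by (simp add: card_S_Suc)
  also have "\<dots> \<le> 2 / p (Suc j) * real (c j) * exp (- \<sigma> * real (d * M j)) / (real (c j) * real (card (S j)))"
    using e cj by (intro divide_right_mono) auto
  also have "\<dots> = 2 / p (Suc j) * exp (- \<sigma> * real (d * M j)) * (1 / real (card (S j)))"
    using cj by simp
  also have "\<dots> \<le> 2 / p (Suc j) * exp (- \<sigma> * real (d * M j)) * (loss j * exp (- \<sigma> * real (l j)))"
  proof (intro mult_left_mono)
    show "1 / real (card (S j)) \<le> loss j * exp (- \<sigma> * real (l j))"
      using card_S_ge[of j] cj by (simp add: exp_minus divide_simps mult_ac)
  qed (use p[of "Suc j"] in auto)
  also have "\<dots> = loss (Suc j) * exp (- \<sigma> * real (d * M j + l j))"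
    by (simp add: loss_def algebra_simps mult_exp_exp)
  also have "\<dots> \<le> loss (Suc j) * exp (\<sigma> * real (M j) - \<sigma> * (real (length w) - real (length w0)))"
  proof (intro mult_left_mono)
    have "real (length w) - real (length w0) \<le> real (d * M j + l j) + real (M j)"
    proof -
      have "length w \<le> (d * M j + l j) + M j + length w0" using dM' w(1) by (simp add: len_def)
      then have "real (length w) \<le> real ((d * M j + l j) + M j + length w0)" by (simp only: of_nat_le_iff)
      then show ?thesis by (simp only: of_nat_add)
    qed
    from mult_left_mono[OF this \<sigma>]
    show "exp (- \<sigma> * real (d * M j + l j)) \<le> exp (\<sigma> * real (M j) - \<sigma> * (real (length w) - real (length w0)))"
      by (simp add: algebra_simps)
  qed (use loss_pos[of "Suc j"] in simp)
  finally show ?thesis by (simp add: mult_exp_exp mult.assoc)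
qed

text \<open>The losses up to stage \<open>j + 1\<close> and one of its blocks are covered by
  lowering the exponent from \<sigma> to \<sigma>' along the \<open>D j\<close> or more letters of
  stage \<open>j\<close>.\<close>

lemma measure_pos:
  assumes \<sigma>': "0 < \<sigma>'" "\<sigma>' < \<sigma>" and A: "limit \<subseteq> A"
    and D: "\<And>j. loss (Suc (Suc j)) * exp (\<sigma> * real (M (Suc j))) \<le> exp ((\<sigma> - \<sigma>') * real (D j))"
  shows "hausdorff_measure boundary_metric \<sigma>' A \<noteq> 0"
proof (rule hausdorff_measure_pos[OF A \<sigma>'(1)])
  define K where "K j = loss (Suc j) * exp (\<sigma> * real (M j))" for j
  \<comment> \<open>Stage 0 has no earlier stage to pay for it, hence \<open>K 0\<close>; words not
    longer than \<open>w0\<close> have mass at most 1, hence the maximum and the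
    exponential.\<close>
  define C where "C = max 1 (K 0) * exp (\<sigma>' * real (length w0))"
  show "C > 0" by (simp add: C_def less_max_iff_disj)
  fix w :: "'g word"
  let ?h = "real (length w) - real (length w0)"
  have C: "C * exp (- \<sigma>' * real (length w)) = max 1 (K 0) * exp (- \<sigma>' * ?h)"
    by (simp add: C_def mult.assoc mult_exp_exp algebra_simps)
  have "mass w \<le> max 1 (K 0) * exp (- \<sigma>' * ?h)"
  proof (cases "length w \<le> length w0")
    case True
    have "card {x \<in> S (length w). prefix w x} \<le> card (S (length w))" using Q_fin by (intro card_mono) auto
    then have "mass w \<le> 1" using card_S_pos[of "length w"] unfolding mass_def ext_def by (simp add: divide_le_eq_1)
    also have "1 \<le> max 1 (K 0) * exp (- \<sigma>' * ?h)"
    proof -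
      have "\<sigma>' * ?h \<le> 0" using True \<sigma>' by (intro mult_nonneg_nonpos) auto
      then have "1 * 1 \<le> max 1 (K 0) * exp (- \<sigma>' * ?h)" by (intro mult_mono) auto
      then show ?thesis by simp
    qed
    finally show ?thesis .
  next
    case False
    then have "len 0 \<le> length w - 1" by (simp add: len_def l0)
    then obtain j where j: "len j \<le> length w - 1" "length w - 1 < len (Suc j)"
      using strict_mono_bracket[OF l] by metis
    then have m: "mass w \<le> K j * exp (- \<sigma> * ?h)"
      unfolding K_def using False \<sigma>' by (intro mass_le) auto
    show ?thesis
    proof (cases j)
      case 0
      have "K 0 * exp (- \<sigma> * ?h) \<le> max 1 (K 0) * exp (- \<sigma>' * ?h)"
        using False \<sigma>' by (intro mult_mono) (auto intro: mult_right_mono)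
      then show ?thesis using m 0 by simp
    next
      case (Suc i)
      have "real (D i) \<le> real (l (Suc i))"
        using pos_params(3)[of i] by (simp only: lS of_nat_le_iff) (simp add: trans_le_add2)
      also have "\<dots> \<le> ?h" using j(1) False Suc by (simp add: len_def)
      finally have "(\<sigma> - \<sigma>') * real (D i) \<le> (\<sigma> - \<sigma>') * ?h" using \<sigma>' by (intro mult_left_mono) auto
      then have "K j \<le> exp ((\<sigma> - \<sigma>') * ?h)"
        using D[of i] unfolding K_def Suc by (meson exp_le_cancel_iff order_trans)
      then have "K j * exp (- \<sigma> * ?h) \<le> exp ((\<sigma> - \<sigma>') * ?h) * exp (- \<sigma> * ?h)"
        by (intro mult_right_mono) auto
      also have "\<dots> = 1 * exp (- \<sigma>' * ?h)" by (simp add: mult_exp_exp algebra_simps)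
      also have "\<dots> \<le> max 1 (K 0) * exp (- \<sigma>' * ?h)" by (intro mult_right_mono) auto
      finally show ?thesis using m by simp
    qed
  qed
  then show "mass w \<le> C * exp (- \<sigma>' * real (length w))" unfolding C .
qed

end

lemma g_strict: "strict_mono g"
  unfolding strict_mono_Suc_iff by (simp add: gS pos_params)

lemma limit_rays:
  assumes "\<omega> \<in> limit"
  obtains t where "walk_ray f t" "\<And>j. pos (t (g j)) f = \<omega> (len j)"
    "\<And>j d. d \<le> D j \<Longrightarrow> length (pos (t (g j + d * G j)) f) = len j + d * M j"
    "\<And>j d. d \<le> D j \<Longrightarrow> prefix (\<omega> (len j)) (pos (t (g j + d * G j)) f)"
proof -
  have b: "\<omega> \<in> boundary" and "\<And>j. \<exists>q\<in>Q j. \<omega> (len j) = pos q f" using assms by (auto simp: limit_def)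
  then obtain q where q: "\<And>j. q j \<in> Q j" "\<And>j. \<omega> (len j) = pos (q j) f" by metis
  have qS: "take (g j) (q (Suc j)) = q j" for j
  proof (rule inj_onD[OF Q_inj[of j] _ Q_Suc_take(1)[OF q(1)] q(1)])
    have "len j \<le> len (Suc j)" by (simp add: len_Suc)
    then show "pos (take (g j) (q (Suc j))) f = pos (q j) f"
      using Q_Suc_take(2)[OF q(1)[of "Suc j"]] boundary_take[OF b] q(2) by metis
  qed
  have qle: "take (g i) (q j) = q i" if "i \<le> j" for i j
    using that
  proof (induction j rule: dec_induct)
    case base
    then show ?case using Q_len[OF q(1)] by simp
  next
    case (step j)
    have "g i \<le> g j" using step(1) g_strict by (simp add: strict_mono_less_eq)
    then show ?case using step(3) qS[of j] by (metis min.absorb1 take_take)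
  qed
  have g_ge: "j \<le> g j" for j by (rule strict_mono_imp_increasing[OF g_strict])
  \<comment> \<open>The nodes \<open>q j\<close> extend one another; \<open>q n\<close> is long
    enough since \<open>n \<le> g n\<close>.\<close>
  define t where "t n = take n (q n)" for n
  have tq: "t n = take n (q j)" if "n \<le> g j" for n j
  proof (cases "n \<le> j")
    case True
    have "take n (q n) = take n (take (g n) (q j))" using qle[OF True] by simp
    then show ?thesis using g_ge[of n] by (simp add: t_def min_absorb1)
  next
    case False
    then have "take n (q j) = take n (take (g j) (q n))" using qle[of j n] by simp
    then show ?thesis using that by (simp add: t_def min_absorb1)
  qed
  show ?thesis
  proof (rule that)
    show "walk_ray f t"
    proof
      show "step_field f" by (rule f)
      show "t 0 = []" by (simp add: t_def)
      show "intree (t n) f" for n unfolding t_def by (intro intree_take Q_in[OF q(1)])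
      fix n
      have l: "n < length (q (Suc n))" using Q_len[OF q(1)] g_ge[of "Suc n"] by simp
      then have "t (Suc n) = take n (q (Suc n)) @ [q (Suc n) ! n]" by (simp add: t_def take_Suc_conv_app_nth)
      moreover have "t n = take n (q (Suc n))" using g_ge[of "Suc n"] by (intro tq) simp
      ultimately show "\<exists>i. t (Suc n) = t n @ [i]" by simp
    qed
    show "pos (t (g j)) f = \<omega> (len j)" for j
      using tq[of "g j" j] Q_len[OF q(1)] q(2) by simp
    fix j d assume d: "d \<le> D j"
    then have "t (g j + d * G j) = take (g j + d * G j) (q (Suc j))" by (intro tq) (simp add: gS)
    then show "length (pos (t (g j + d * G j)) f) = len j + d * M j"
      "prefix (\<omega> (len j)) (pos (t (g j + d * G j)) f)"
      using checkpoint[OF q(1) d] qS[of j] q(2) by simp_all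
  qed
qed

section \<open>Speed along the rays of the spliced tree\<close>

context
  fixes \<alpha> :: real
  assumes \<alpha>: "0 \<le> \<alpha>" "\<alpha> \<le> 1"
    and speed: "\<And>j. \<bar>real (M j) - \<alpha> * real (G j)\<bar> \<le> real (G j) / real (Suc j)"
    and D1: "\<And>j. Suc j * (len j + g j) \<le> D j" and D2: "\<And>j. Suc j * Suc (G (Suc j)) \<le> D j"
begin

lemma D_le: "D j \<le> g (Suc j)" "D j \<le> len (Suc j)"
  using pos_params(2,3)[of j] by (simp_all add: gS len_Suc trans_le_add2)

text \<open>By \<open>D1\<close>, all that precedes stage \<open>j\<close> is at most the fraction
  \<open>1 / Suc j\<close> of the generations at its end; the blocks of the stage have speed
  \<alpha> up to an error of the same size.\<close>

lemma len_speed: "\<bar>real (len (Suc j)) - \<alpha> * real (g (Suc j))\<bar> \<le> 2 * real (g (Suc j)) / real (Suc j)"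
proof -
  have "\<bar>real (len j) - \<alpha> * real (g j)\<bar> \<le> real (len j) + real (g j)"
    using \<alpha> mult_right_mono[of \<alpha> 1 "real (g j)"] mult_nonneg_nonneg[of \<alpha> "real (g j)"] by linarith
  also have "\<dots> \<le> real (g (Suc j)) / real (Suc j)"
  proof -
    have "Suc j * (len j + g j) \<le> g (Suc j)" using D1[of j] D_le(1)[of j] by linarith
    then have "real (Suc j) * (real (len j) + real (g j)) \<le> real (g (Suc j))"
      by (metis of_nat_add of_nat_le_iff of_nat_mult)
    then show ?thesis by (simp add: pos_le_divide_eq mult_ac del: of_nat_Suc)
  qed
  finally have 1: "\<bar>real (len j) - \<alpha> * real (g j)\<bar> \<le> real (g (Suc j)) / real (Suc j)" .
  have "\<bar>real (D j) * (real (M j) - \<alpha> * real (G j))\<bar> \<le> real (D j) * (real (G j) / real (Suc j))"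
    unfolding abs_mult by (intro mult_mono speed) auto
  also have "\<dots> = real (D j * G j) / real (Suc j)" by simp
  also have "\<dots> \<le> real (g (Suc j)) / real (Suc j)"
    by (intro divide_right_mono) (auto simp: gS simp flip: of_nat_mult of_nat_add)
  finally have 2: "\<bar>real (D j) * (real (M j) - \<alpha> * real (G j))\<bar> \<le> real (g (Suc j)) / real (Suc j)" .
  have "real (len (Suc j)) - \<alpha> * real (g (Suc j)) =
      (real (len j) - \<alpha> * real (g j)) + real (D j) * (real (M j) - \<alpha> * real (G j))"
    by (simp add: len_Suc gS algebra_simps)
  then have "\<bar>real (len (Suc j)) - \<alpha> * real (g (Suc j))\<bar> \<le> real (g (Suc j)) / real (Suc j) + real (g (Suc j)) / real (Suc j)"
    using 1 2 by linarith
  then show ?thesis by simp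
qed

text \<open>By \<open>D2\<close>, even one block of the next stage is short compared with the past,
  so positions inside a block need no separate control.\<close>

lemma G_le: "real (G (Suc j)) \<le> real (g (Suc j)) / real (Suc j)"
proof -
  have "Suc j * G (Suc j) \<le> Suc j * Suc (G (Suc j))" by simp
  then have "Suc j * G (Suc j) \<le> g (Suc j)" using D2[of j] D_le(1)[of j] by linarith
  then have "real (Suc j) * real (G (Suc j)) \<le> real (g (Suc j))" by (metis of_nat_le_iff of_nat_mult)
  then show ?thesis by (simp add: pos_le_divide_eq mult_ac del: of_nat_Suc)
qed

lemma G_len: "G (Suc j) + j < len (Suc j)"
proof -
  have "Suc (G (Suc j)) + j \<le> Suc j * Suc (G (Suc j))" by simp
  then show ?thesis using D2[of j] D_le(2)[of j] by linarith
qed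

text \<open>A generation \<open>n\<close> is split into finished stages, \<open>d\<close> full
  blocks of the current stage and \<open>e\<close> generations of an unfinished block. In units of
  \<open>n / Suc j\<close> the deviation from \<alpha> n is at most 2 for the stages, 1 for the
  blocks and 2 for the remainder, whence the constant 5.\<close>

lemma limit_subset_speed:
  assumes fy: "f = fieldof k y"
  shows "limit \<subseteq> limit_set_speed k y \<alpha>"
proof
  fix \<omega> assume \<omega>: "\<omega> \<in> limit"
  then have b: "\<omega> \<in> boundary" by (simp add: limit_def)
  obtain t where t: "walk_ray f t" "\<And>j. pos (t (g j)) f = \<omega> (len j)"
    "\<And>j d. d \<le> D j \<Longrightarrow> length (pos (t (g j + d * G j)) f) = len j + d * M j"
    "\<And>j d. d \<le> D j \<Longrightarrow> prefix (\<omega> (len j)) (pos (t (g j + d * G j)) f)"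
    by (rule limit_rays[OF \<omega>]) (rule that)
  interpret walk_ray f t by (rule t)
  have tr: "t \<in> tree_rays k"
    unfolding tree_rays_def using t0 tS t_in by (auto simp: gw_tree_iff[of _ k y] fy)
  have pos: "position y (t n) = X n" for n
    using tree_ray_walk_ray(2)[of k y t n] f tr by (simp add: fy)
  have near: "\<exists>j\<ge>i. prefix (\<omega> j) (X n) \<and> \<bar>real (length (X n)) / real n - \<alpha>\<bar> \<le> 5 / real (Suc j)"
    if gi: "g (Suc i) \<le> n" for i n
  proof -
    obtain J where J: "Suc i \<le> J" "g J \<le> n" "n < g (Suc J)"
      using gi by (rule strict_mono_bracket[OF g_strict])
    then obtain j where j: "J = Suc j" "i \<le> j" by (cases J) auto
    define d where "d = (n - g J) div G J"
    define e where "e = (n - g J) mod G J"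
    have GJ: "G J > 0" by (rule pos_params)
    have n: "n = g J + d * G J + e" using J(2) by (simp add: d_def e_def)
    have e: "e < G J" unfolding e_def using GJ by simp
    have "n - g J < D J * G J" using J by (simp add: gS)
    then have d: "d \<le> D J" unfolding d_def using GJ by (simp add: less_mult_imp_div_less less_imp_le)
    define n0 where "n0 = g J + d * G J"
    have n0: "length (X n0) = len J + d * M J" "prefix (\<omega> (len J)) (X n0)" "n = n0 + e"
      using t(3,4)[OF d] n by (simp_all add: n0_def)
    \<comment> \<open>The unfinished block is too short to destroy the first \<open>j\<close>
      letters; this is what makes the positions converge to \<omega>.\<close>
    have le: "j \<le> length (X n0) - e" using G_len[of j] e n0(1) by (simp add: j)
    have jl: "j \<le> len J" using G_len[of j] by (simp add: j)
    have "\<omega> j = take j (\<omega> (len J))" by (rule boundary_take[OF b jl])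
    also have "\<dots> = take j (X n0)"
      using n0(2) jl boundary_length[OF b, of "len J"] by (auto simp: prefix_def)
    also have "\<dots> = take j (take (length (X n0) - e) (X n0))" using le by (simp add: min_absorb1)
    also have "\<dots> = take j (X n)" unfolding X_take[of n0 e, symmetric] n0(3)[symmetric] using le by (simp add: min_absorb1)
    finally have 1: "prefix (\<omega> j) (X n)" by (simp add: take_is_prefix)
    have n_pos: "real n > 0" using J(2) strict_mono_imp_increasing[OF g_strict, of J] by (simp add: j)
    have gn: "real (g J) / real (Suc j) \<le> real n / real (Suc j)" "real (d * G J) / real (Suc j) \<le> real n / real (Suc j)"
      using n by (auto intro!: divide_right_mono simp flip: of_nat_mult)
    have "real (length (X n)) - \<alpha> * real n = (real (length (X n)) - real (length (X n0))) +
        (real (len J) - \<alpha> * real (g J)) + real d * (real (M J) - \<alpha> * real (G J)) - \<alpha> * real e"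
      unfolding n0(1) n by (simp add: algebra_simps)
    moreover have "\<bar>real (length (X n)) - real (length (X n0))\<bar> \<le> real e"
      using X_length_steps[of n0 e] n0(3) by simp
    moreover have "\<bar>\<alpha> * real e\<bar> \<le> real e" using \<alpha> by (simp add: abs_mult mult_left_le_one_le)
    moreover have "real e \<le> real n / real (Suc j)" using G_le[of j] e gn(1) by (simp add: j del: of_nat_Suc)
    moreover have "\<bar>real d * (real (M J) - \<alpha> * real (G J))\<bar> \<le> real n / real (Suc j)"
    proof -
      have "\<bar>real d * (real (M J) - \<alpha> * real (G J))\<bar> \<le> real d * (real (G J) / real (Suc J))"
        unfolding abs_mult by (intro mult_mono speed) auto
      also have "\<dots> \<le> real d * (real (G J) / real (Suc j))"
        by (intro mult_left_mono divide_left_mono) (auto simp: j)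
      also have "\<dots> \<le> real n / real (Suc j)" using gn(2) by (simp del: of_nat_Suc)
      finally show ?thesis .
    qed
    moreover have "\<bar>real (len J) - \<alpha> * real (g J)\<bar> \<le> 2 * (real n / real (Suc j))"
      using len_speed[of j] gn(1) by (simp add: j del: of_nat_Suc)
    ultimately have "\<bar>real (length (X n)) - \<alpha> * real n\<bar> \<le> 5 * (real n / real (Suc j))"
      by linarith
    then have "\<bar>real (length (X n)) - \<alpha> * real n\<bar> / real n \<le> 5 * (real n / real (Suc j)) / real n"
      using n_pos by (intro divide_right_mono) auto
    moreover have "\<bar>real (length (X n)) - \<alpha> * real n\<bar> / real n = \<bar>real (length (X n)) / real n - \<alpha>\<bar>"
    proof -
      have "real (length (X n)) / real n - \<alpha> = (real (length (X n)) - \<alpha> * real n) / real n"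
        using n_pos by (simp add: field_simps)
      then show ?thesis using n_pos by simp
    qed
    ultimately have "\<bar>real (length (X n)) / real n - \<alpha>\<bar> \<le> 5 / real (Suc j)"
      using n_pos by (simp del: of_nat_Suc)
    with 1 j(2) show ?thesis by blast
  qed
  have "tends_to_ray X \<omega>"
    unfolding tends_to_ray_def eventually_sequentially
  proof (intro allI exI impI)
    fix m n assume "g (Suc m) \<le> n"
    then obtain j where "m \<le> j" "prefix (\<omega> j) (X n)" using near by blast
    then show "prefix (\<omega> m) (X n)" using boundary_take[OF b] take_is_prefix prefix_order.trans by metis
  qed
  moreover have "(\<lambda>n. real (length (X n)) / real n) \<longlonglongrightarrow> \<alpha>"
  proof (rule LIMSEQ_I)
    fix \<epsilon> :: real assume \<epsilon>: "\<epsilon> > 0"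
    obtain i where i: "5 / \<epsilon> < real (Suc i)" using reals_Archimedean2 less_SucI by (metis less_trans lessI of_nat_less_iff)
    show "\<exists>no. \<forall>n\<ge>no. norm (real (length (X n)) / real n - \<alpha>) < \<epsilon>"
    proof (intro exI allI impI)
      fix n assume "g (Suc i) \<le> n"
      then obtain j where j: "i \<le> j" "\<bar>real (length (X n)) / real n - \<alpha>\<bar> \<le> 5 / real (Suc j)" using near by blast
      have "5 / real (Suc j) \<le> 5 / real (Suc i)" using j(1) by (intro divide_left_mono) auto
      also have "\<dots> < \<epsilon>" using i \<epsilon> by (simp add: field_simps)
      finally show "norm (real (length (X n)) / real n - \<alpha>) < \<epsilon>" using j(2) by simp
    qed
  qed
  ultimately have "tends_to_ray (\<lambda>n. position y (t n)) \<omega>"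
    "(\<lambda>n. real (length (position y (t n))) / real n) \<longlonglongrightarrow> \<alpha>" by (simp_all only: pos)
  then show "\<omega> \<in> limit_set_speed k y \<alpha>" unfolding limit_set_speed_def using b tr by blast
qed

end

end

text \<open>Each letter of \<open>x\<close> cancels at most one letter of \<open>y\<close>, so a
  longer \<open>y\<close> keeps its last letter.\<close>

lemma last_mul:
  assumes "length x < length y"
  shows "mul x y \<noteq> [] \<and> last (mul x y) = last y"
proof -
  have "length y \<le> length x + length (mul x y) \<and> (length x < length y \<longrightarrow> last (mul x y) = last y)"
  proof (induction x)
    case (Cons b x)
    then show ?case by (cases "mul x y") (auto split: if_splits)
  qed simp
  with assms show ?thesis by (cases "mul x y") auto
qed

context brw
begin

definition node_set :: "'g field \<Rightarrow> 'g word \<Rightarrow> nat \<times> nat \<times> nat \<times> nat \<Rightarrow> nat \<Rightarrow> nat \<Rightarrow> nat list set \<Rightarrow> bool" where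
  "node_set f w0 t g l Q \<longleftrightarrow> finite Q \<and> inj_on (\<lambda>q. pos q f) Q \<and>
     (\<forall>q\<in>Q. intree q f \<and> length q = g \<and> sh q f \<in> talive t \<and> (\<exists>x\<in>block_words a0 l. pos q f = w0 @ x))"

definition children :: "nat \<times> nat \<times> nat \<times> nat \<Rightarrow> nat \<times> nat \<times> nat \<times> nat \<Rightarrow> nat \<Rightarrow> nat" where
  "children t t' D = nat \<lceil>tprob t' * real (tdeg t ^ D) / 2\<rceil>"

context
  fixes f :: "'g field"
  assumes f: "step_field f"
    and many: "\<And>u t t'. tgood t \<Longrightarrow> tgood t' \<Longrightarrow> \<forall>\<^sub>F D in sequentially. tleaves t D (sh u f) \<noteq> [] \<longrightarrow>
      tprob t' * real (tdeg t ^ D) / 2 \<le> real (card {v \<in> set (tleaves t D (sh u f)). sh (u @ v) f \<in> talive t'})"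
    and ex: "\<And>t. tgood t \<Longrightarrow> \<exists>u. intree u f \<and> sh u f \<in> talive t"
begin

lemma tleaves_tracks: "v \<in> set (tleaves t D (sh q f)) \<Longrightarrow> intree v (sh q f)"
  "v \<in> set (tleaves t D (sh q f)) \<Longrightarrow> pos v (sh q f) \<in> block_words a0 (D * tlen t)"
  "inj_on (\<lambda>v. pos v (sh q f)) (set (tleaves t D (sh q f)))"
  unfolding tleaves_def by (rule tracksD[OF tracks_leaves[OF tracks_tsel] step_field_sh[OF f]]; assumption)+

lemma tsel_length: "v \<in> set (tsel t g) \<Longrightarrow> length v = tgen t"
  using selector_tsel[of t] by (simp add: selector_def)

lemma tleaves_length: "v \<in> set (tleaves t D g) \<Longrightarrow> length v = D * tgen t"
  unfolding tleaves_def by (rule leaves_length_node[OF tsel_length])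

text \<open>There are finitely many nodes, so some depth \<open>D\<close> suits them all. Of the
  good leaves below each node the same number is kept, namely what is guaranteed almost surely,
  which gives the homogeneity required by \<open>cantor_scheme\<close>.\<close>

lemma node_set_extend:
  assumes t: "tgood t" "tgood t'" and w0: "reduced w0" "w0 \<noteq> []" "last w0 = a0" and Q: "node_set f w0 t g l Q"
  obtains D Q' where "D \<ge> n" "node_set f w0 t' (g + D * tgen t) (l + D * tlen t) Q'"
    "\<And>q'. q' \<in> Q' \<Longrightarrow> \<exists>q\<in>Q. \<exists>v\<in>set (tleaves t D (sh q f)). q' = q @ v"
    "\<And>q. q \<in> Q \<Longrightarrow> card {q' \<in> Q'. take g q' = q} = children t t' D"
proof -
  have Qf: "finite Q" and Qi: "inj_on (\<lambda>q. pos q f) Q"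
    using Q by (auto simp: node_set_def)
  have Qq: "intree q f" "length q = g" "sh q f \<in> talive t" "\<exists>x\<in>block_words a0 l. pos q f = w0 @ x" if "q \<in> Q" for q
    using Q that by (auto simp: node_set_def)
  have "\<forall>\<^sub>F D in sequentially. \<forall>q\<in>Q.
      children t t' D \<le> card {v \<in> set (tleaves t D (sh q f)). sh (q @ v) f \<in> talive t'}"
  proof (rule eventually_ball_finite[OF Qf], rule ballI)
    fix q assume "q \<in> Q"
    show "\<forall>\<^sub>F D in sequentially. children t t' D \<le> card {v \<in> set (tleaves t D (sh q f)). sh (q @ v) f \<in> talive t'}"
      using many[OF t, of q]
    proof eventually_elim
      case (elim D)
      have "tleaves t D (sh q f) \<noteq> []" using Qq(3)[OF \<open>q \<in> Q\<close>] unfolding talive_iff by blast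
      with elim show ?case by (simp add: children_def nat_le_iff ceiling_le_iff)
    qed
  qed
  from eventually_happens'[OF sequentially_bot eventually_conj[OF this eventually_ge_at_top[of n]]]
  obtain D where D: "n \<le> D" and
    "\<forall>q\<in>Q. children t t' D \<le> card {v \<in> set (tleaves t D (sh q f)). sh (q @ v) f \<in> talive t'}"
    by blast
  then have "\<forall>q\<in>Q. \<exists>B. B \<subseteq> {v \<in> set (tleaves t D (sh q f)). sh (q @ v) f \<in> talive t'} \<and>
      card B = children t t' D \<and> finite B"
    by (meson obtain_subset_with_card_n)
  from bchoice[OF this] obtain B where "\<forall>q\<in>Q. B q \<subseteq> {v \<in> set (tleaves t D (sh q f)). sh (q @ v) f \<in> talive t'} \<and>
      card (B q) = children t t' D \<and> finite (B q)" ..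
  then have B: "\<And>q. q \<in> Q \<Longrightarrow> B q \<subseteq> {v \<in> set (tleaves t D (sh q f)). sh (q @ v) f \<in> talive t'}"
    "\<And>q. q \<in> Q \<Longrightarrow> card (B q) = children t t' D" "\<And>q. q \<in> Q \<Longrightarrow> finite (B q)" by blast+
  define Q' where "Q' = (\<Union>q\<in>Q. (@) q ` B q)"
  have app: "pos (q @ v) f = pos q f @ pos v (sh q f)" "pos v (sh q f) \<in> block_words a0 (D * tlen t)"
      "intree v (sh q f)" "v \<in> set (tleaves t D (sh q f))" if "q \<in> Q" "v \<in> B q" for q v
  proof -
    show v: "v \<in> set (tleaves t D (sh q f))" using B(1) that by blast
    note tt = tleaves_tracks(1,2)[OF v]
    show "pos v (sh q f) \<in> block_words a0 (D * tlen t)" "intree v (sh q f)" by (rule tt)+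
    show "pos (q @ v) f = pos q f @ pos v (sh q f)"
      using pos_append_block[OF f w0 Qq(1)[OF that(1)] _ _ tt] Qq(4)[OF that(1)] by blast
  qed
  have lenq: "length (pos q f) = length w0 + l" if "q \<in> Q" for q
    using Qq(4)[OF that] by (auto simp: block_words_length)
  show ?thesis
  proof (rule that[OF D])
    show "\<exists>q\<in>Q. \<exists>v\<in>set (tleaves t D (sh q f)). q' = q @ v" if "q' \<in> Q'" for q'
      using that app(4) by (auto simp: Q'_def)
    show "card {q' \<in> Q'. take g q' = q} = children t t' D" if "q \<in> Q" for q
    proof -
      have "{q' \<in> Q'. take g q' = q} = (@) q ` B q" using that Qq(2) by (auto simp: Q'_def)
      then show ?thesis using B(2)[OF that] by (simp add: card_image inj_on_def)
    qed
    show "node_set f w0 t' (g + D * tgen t) (l + D * tlen t) Q'"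
      unfolding node_set_def
    proof (intro conjI ballI)
      show "finite Q'" using Qf B(3) by (auto simp: Q'_def)
      show "inj_on (\<lambda>q. pos q f) Q'"
      proof (rule inj_onI)
        fix x y assume "x \<in> Q'" "y \<in> Q'" and e: "pos x f = pos y f"
        then obtain q v q1 v1 where q: "x = q @ v" "q \<in> Q" "v \<in> B q" "y = q1 @ v1" "q1 \<in> Q" "v1 \<in> B q1"
          by (auto simp: Q'_def)
        have "pos q f @ pos v (sh q f) = pos q1 f @ pos v1 (sh q1 f)"
          using e unfolding q(1,4) app(1)[OF q(2,3)] app(1)[OF q(5,6)] .
        moreover have "length (pos q f) = length (pos q1 f)" by (simp only: lenq[OF q(2)] lenq[OF q(5)])
        ultimately have e': "pos q f = pos q1 f" "pos v (sh q f) = pos v1 (sh q1 f)" by simp_all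
        have "q = q1" by (rule inj_onD[OF Qi e'(1) q(2,5)])
        moreover have "v = v1"
          by (rule inj_onD[OF tleaves_tracks(3) _ app(4)[OF q(2,3)]])
             (use e'(2) app(4)[OF q(5,6)] \<open>q = q1\<close> in simp_all)
        ultimately show "x = y" by (simp add: q)
      qed
      fix q' assume "q' \<in> Q'"
      then obtain q v where q: "q' = q @ v" "q \<in> Q" "v \<in> B q" by (auto simp: Q'_def)
      note a = app[OF q(2,3)]
      show "intree q' f" using a(3) Qq(1)[OF q(2)] by (simp add: q intree_append)
      show "length q' = g + D * tgen t" using Qq(2)[OF q(2)] tleaves_length[OF a(4)] by (simp add: q)
      show "sh q' f \<in> talive t'" using B(1)[OF q(2)] q by blast
      obtain x where x: "x \<in> block_words a0 l" "pos q f = w0 @ x" using Qq(4)[OF q(2)] by blast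
      show "\<exists>x\<in>block_words a0 (l + D * tlen t). pos q' f = w0 @ x"
        using a(1) x block_words_append[OF x(1) a(2)] by (auto simp: q)
    qed
  qed
qed

lemma children_ge: "tprob t' * real (tdeg t ^ D) / 2 \<le> real (children t t' D)"
  unfolding children_def by (rule real_nat_ceiling_ge)

text \<open>The path to the first surviving subtree may end in any letter. Descending through more
  blocks than that path has letters makes the last letter \<open>a0\<close>, and from then on
  nothing cancels.\<close>

lemma ex_start:
  assumes t: "tgood t"
  obtains q where "node_set f (pos q f) t (length q) 0 {q}" "reduced (pos q f)" "pos q f \<noteq> []" "last (pos q f) = a0"
proof -
  obtain u where u: "intree u f" "sh u f \<in> talive t" using ex[OF t] by blast
  from eventually_happens'[OF sequentially_bot eventually_conj[OF many[OF t t, of u] eventually_gt_at_top[of "length (pos u f)"]]]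
  obtain D where D: "length (pos u f) < D" "tleaves t D (sh u f) \<noteq> [] \<longrightarrow>
      tprob t * real (tdeg t ^ D) / 2 \<le> real (card {v \<in> set (tleaves t D (sh u f)). sh (u @ v) f \<in> talive t})"
    by blast
  have "tleaves t D (sh u f) \<noteq> []" using u(2) unfolding talive_iff by blast
  moreover have "tprob t * real (tdeg t ^ D) / 2 > 0" using t by (simp add: tgood_def)
  ultimately have "0 < real (card {v \<in> set (tleaves t D (sh u f)). sh (u @ v) f \<in> talive t})"
    using D(2) by (smt (verit, ccfv_threshold))
  then have "{v \<in> set (tleaves t D (sh u f)). sh (u @ v) f \<in> talive t} \<noteq> {}" by (metis card.empty less_irrefl of_nat_0)
  then obtain v where v: "v \<in> set (tleaves t D (sh u f))" "sh (u @ v) f \<in> talive t" by blast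
  have it: "intree (u @ v) f" using u tleaves_tracks(1)[OF v(1)] by (simp add: intree_append)
  have b: "pos v (sh u f) \<in> block_words a0 (D * tlen t)" by (rule tleaves_tracks(2)[OF v(1)])
  have "D * 1 \<le> D * tlen t" using t by (intro mult_le_mono) (auto simp: tgood_def)
  then have l: "length (pos u f) < length (pos v (sh u f))" using D(1) block_words_length[OF b] by linarith
  have p: "pos (u @ v) f = mul (pos u f) (pos v (sh u f))" by (rule pos_append[OF f it])
  have "last (pos v (sh u f)) = a0" using b l by (auto simp: block_words_def)
  then have "pos (u @ v) f \<noteq> []" "last (pos (u @ v) f) = a0" using last_mul[OF l] p by simp_all
  moreover have "node_set f (pos (u @ v) f) t (length (u @ v)) 0 {u @ v}"
    using it v(2) by (simp add: node_set_def block_words_def)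
  ultimately show ?thesis using that reduced_pos[OF f it] by blast
qed

lemma ex_cantor_set:
  assumes fy: "f = fieldof k y" and \<alpha>: "\<alpha> \<in> rate_sublevel L r" and s: "ereal s < spectrum_value L r \<alpha>"
  shows "limit_set_speed k y \<alpha> \<noteq> {}"
    "0 < s' \<Longrightarrow> s' < s \<Longrightarrow> hausdorff_measure boundary_metric s' (limit_set_speed k y \<alpha>) \<noteq> 0"
proof -
  have "\<exists>t. tgood t \<and> exp (s * real (tlen t)) \<le> real (tdeg t) \<and> \<bar>real (tlen t) / real (tgen t) - \<alpha>\<bar> < 1 / real (Suc j)" for j
    by (rule ex_tgood[OF \<alpha> s]) simp
  then obtain \<tau> where \<tau>: "\<And>j. tgood (\<tau> j)" "\<And>j. exp (s * real (tlen (\<tau> j))) \<le> real (tdeg (\<tau> j))"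
    "\<And>j. \<bar>real (tlen (\<tau> j)) / real (tgen (\<tau> j)) - \<alpha>\<bar> < 1 / real (Suc j)" by metis
  define p where "p j = tprob (\<tau> j)" for j
  define G where "G j = tgen (\<tau> j)" for j
  define M where "M j = tlen (\<tau> j)" for j
  have GM: "G j > 0" "M j > 0" "tdeg (\<tau> j) > 0" "p j > 0" for j using \<tau>(1)[of j] by (auto simp: tgood_def G_def M_def p_def)
  obtain q0 where q0: "node_set f (pos q0 f) (\<tau> 0) (length q0) 0 {q0}"
    "reduced (pos q0 f)" "pos q0 f \<noteq> []" "last (pos q0 f) = a0" using ex_start[OF \<tau>(1)] .
  define w0 where "w0 = pos q0 f"
  \<comment> \<open>The summands ensure, in this order, \<open>D1\<close>, \<open>D2\<close> and the
    condition of \<open>T.measure_pos\<close>; the outer \<open>Suc\<close> makes every depth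
    positive. All of them are known before the depth of stage \<open>j\<close> is chosen. For
    nonemptiness the third summand may be any number.\<close>
  define need where "need j g l = Suc (Suc j * (length w0 + l + g) + Suc j * Suc (G (Suc j)) +
     nat \<lceil>ln (block_tree.loss p (Suc (Suc j)) * exp (s * real (M (Suc j)))) / (s - s')\<rceil>)" for j g l
  define P where "P j st = (case st of (Q, g, l) \<Rightarrow> node_set f w0 (\<tau> j) g l Q \<and> (j = 0 \<longrightarrow> l = 0 \<and> Q \<noteq> {}))" for j st
  define T where "T j st st' D = (case st of (Q, g, l) \<Rightarrow> case st' of (Q', g', l') \<Rightarrow> need j g l \<le> D \<and>
     g' = g + D * G j \<and> l' = l + D * M j \<and>
     (\<forall>q'\<in>Q'. \<exists>q\<in>Q. \<exists>v\<in>set (tleaves (\<tau> j) D (sh q f)). q' = q @ v) \<and>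
     (\<forall>q\<in>Q. card {q' \<in> Q'. take g q' = q} = children (\<tau> j) (\<tau> (Suc j)) D))" for j st st' D
  have "\<exists>F. \<forall>n. P n (F n) \<and> (\<exists>D. T n (F n) (F (Suc n)) D)"
  proof (rule dependent_nat_choice)
    show "\<exists>x. P 0 x" using q0(1) by (intro exI[of _ "({q0}, length q0, 0)"]) (simp add: P_def w0_def)
    fix st n assume "P n st"
    then obtain Q g l where st: "st = (Q, g, l)" "node_set f w0 (\<tau> n) g l Q" by (cases st) (auto simp: P_def)
    obtain D Q' where D: "need n g l \<le> D" "node_set f w0 (\<tau> (Suc n)) (g + D * tgen (\<tau> n)) (l + D * tlen (\<tau> n)) Q'"
      "\<And>q'. q' \<in> Q' \<Longrightarrow> \<exists>q\<in>Q. \<exists>v\<in>set (tleaves (\<tau> n) D (sh q f)). q' = q @ v"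
      "\<And>q. q \<in> Q \<Longrightarrow> card {q' \<in> Q'. take g q' = q} = children (\<tau> n) (\<tau> (Suc n)) D"
      by (rule node_set_extend[OF \<tau>(1)[of n] \<tau>(1)[of "Suc n"] q0(2,3,4)[folded w0_def] st(2)]) (rule that)
    show "\<exists>st'. P (Suc n) st' \<and> (\<exists>D. T n st st' D)"
      by (intro exI[of _ "(Q', g + D * G n, l + D * M n)"] conjI exI[of _ D])
         (use D in \<open>auto simp: P_def T_def st(1) G_def M_def\<close>)
  qed
  then obtain F D where F: "\<And>n. P n (F n)" "\<And>n. T n (F n) (F (Suc n)) (D n)" by metis
  define Q where "Q j = fst (F j)" for j
  define g where "g j = fst (snd (F j))" for j
  define l where "l j = snd (snd (F j))" for j
  have Fj: "F j = (Q j, g j, l j)" for j by (simp add: Q_def g_def l_def)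
  have ns: "node_set f w0 (\<tau> j) (g j) (l j) (Q j)" for j using F(1)[of j] by (simp add: P_def Fj)
  have init: "l 0 = 0" "Q 0 \<noteq> {}" using F(1)[of 0] by (simp_all add: P_def Fj)
  have D: "need j (g j) (l j) \<le> D j" "g (Suc j) = g j + D j * G j" "l (Suc j) = l j + D j * M j"
    "\<And>q'. q' \<in> Q (Suc j) \<Longrightarrow> \<exists>q\<in>Q j. \<exists>v\<in>set (tleaves (\<tau> j) (D j) (sh q f)). q' = q @ v"
    "\<And>q. q \<in> Q j \<Longrightarrow> card {q' \<in> Q (Suc j). take (g j) q' = q} = children (\<tau> j) (\<tau> (Suc j)) (D j)" for j
    using F(2)[of j] by (auto simp: T_def Fj)
  define c where "c j = children (\<tau> j) (\<tau> (Suc j)) (D j)" for j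
  have c_ge: "p (Suc j) * real (tdeg (\<tau> j) ^ D j) / 2 \<le> real (c j)" for j
    unfolding c_def p_def by (rule children_ge)
  interpret T: block_tree f a0 w0 "\<lambda>j. tsel (\<tau> j)" G M "\<lambda>j. tdeg (\<tau> j)" D g l c Q
  proof
    show "step_field f" by (rule f)
    show "reduced w0" "w0 \<noteq> []" "last w0 = a0" using q0 by (simp_all add: w0_def)
    show "tracks a0 (M j) (tsel (\<tau> j))" for j unfolding M_def by (rule tracks_tsel)
    show "length v = G j" if "v \<in> set (tsel (\<tau> j) h)" for j h v unfolding G_def by (rule tsel_length[OF that])
    show "0 < tdeg (\<tau> j)" "0 < G j" "0 < M j" for j using GM by auto
    show "0 < D j" for j using D(1)[of j] by (simp add: need_def)
    show "0 < c j" for j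
    proof -
      have "0 < p (Suc j) * real (tdeg (\<tau> j) ^ D j) / 2" using GM by simp
      then show ?thesis using c_ge[of j] by (metis less_le_trans of_nat_0_less_iff)
    qed
    show "l 0 = 0" "Q 0 \<noteq> {}" by (rule init)+
    show "l (Suc j) = l j + D j * M j" "g (Suc j) = g j + D j * G j" for j by (rule D)+
    show "finite (Q j)" "inj_on (\<lambda>q. pos q f) (Q j)" for j using ns[of j] by (simp_all add: node_set_def)
    show "intree q f" "length q = g j" "\<exists>x\<in>block_words a0 (l j). pos q f = w0 @ x" if "q \<in> Q j" for j q
      using ns[of j] that by (simp_all add: node_set_def)
    show "\<exists>q\<in>Q j. \<exists>v\<in>set (leaves (tdeg (\<tau> j)) (tsel (\<tau> j)) (D j) (sh q f)). q' = q @ v" if "q' \<in> Q (Suc j)" for j q'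
      using D(4)[OF that] by (simp add: tleaves_def)
    show "card {q' \<in> Q (Suc j). take (g j) q' = q} = c j" if "q \<in> Q j" for j q
      using D(5)[OF that] by (simp add: c_def)
  qed
  have sub: "T.limit \<subseteq> limit_set_speed k y \<alpha>"
  proof (rule T.limit_subset_speed[OF _ _ _ _ _ fy])
    show "0 \<le> \<alpha>" "\<alpha> \<le> 1" using \<alpha> by (auto simp: rate_sublevel_def)
    show "\<bar>real (M j) - \<alpha> * real (G j)\<bar> \<le> real (G j) / real (Suc j)" for j
    proof -
      have "real (M j) - \<alpha> * real (G j) = (real (M j) / real (G j) - \<alpha>) * real (G j)"
        using GM(1)[of j] by (simp add: field_simps)
      then have "\<bar>real (M j) - \<alpha> * real (G j)\<bar> = \<bar>real (M j) / real (G j) - \<alpha>\<bar> * real (G j)" by (simp add: abs_mult)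
      also have "\<dots> \<le> 1 / real (Suc j) * real (G j)"
        using \<tau>(3)[of j] unfolding M_def[symmetric] G_def[symmetric] by (intro mult_right_mono) auto
      finally show ?thesis by simp
    qed
    show "Suc j * (T.len j + g j) \<le> D j" "Suc j * Suc (G (Suc j)) \<le> D j" for j
      using D(1)[of j] by (auto simp: need_def T.len_def simp del: mult_Suc)
  qed
  then show "limit_set_speed k y \<alpha> \<noteq> {}" using T.limit_nonempty by blast
  assume s': "0 < s'" "s' < s"
  show "hausdorff_measure boundary_metric s' (limit_set_speed k y \<alpha>) \<noteq> 0"
  proof (rule T.measure_pos[OF _ GM(4) c_ge s' sub])
    show N_ge: "exp (s * real (M j)) \<le> real (tdeg (\<tau> j))" for j
      using \<tau>(2)[of j] by (simp add: M_def)
    fix j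
    let ?K = "T.loss p (Suc (Suc j)) * exp (s * real (M (Suc j)))"
    have "T.loss p (Suc (Suc j)) > 0" by (rule T.loss_pos[OF N_ge GM(4) c_ge])
    then have K: "?K > 0" by simp
    have "ln ?K / (s - s') \<le> real (nat \<lceil>ln ?K / (s - s')\<rceil>)" by (rule real_nat_ceiling_ge)
    also have "\<dots> \<le> real (D j)"
      unfolding of_nat_le_iff using D(1)[of j] unfolding need_def by linarith
    finally have "ln ?K \<le> (s - s') * real (D j)" using s' by (simp add: pos_divide_le_eq mult.commute)
    then show "?K \<le> exp ((s - s') * real (D j))" using K by (metis exp_le_cancel_iff exp_ln)
  qed
qed

end

end

subsection \<open>The field of labels of the branching random walk\<close>

lemma pmf_replicate_pmf:
  "pmf (replicate_pmf k \<mu>) c = (if length c = k then \<Prod>i<length c. pmf \<mu> (c ! i) else 0)"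
proof (induction k arbitrary: c)
  case 0
  then show ?case by (simp add: pmf_return indicator_def)
next
  case (Suc k)
  have eq: "replicate_pmf (Suc k) \<mu> = map_pmf (\<lambda>(x, xs). x # xs) (pair_pmf \<mu> (replicate_pmf k \<mu>))"
    by (simp add: pair_pmf_def map_pmf_def bind_assoc_pmf bind_return_pmf)
  show ?case
  proof (cases c)
    case Nil
    then show ?thesis unfolding pmf_eq_0_set_pmf by (simp add: set_replicate_pmf pmf_eq_0_set_pmf)
  next
    case (Cons x xs)
    have "inj (\<lambda>(x, xs). x # xs :: 'a list)" by (auto intro!: injI)
    from pmf_map_inj'[OF this, of "pair_pmf \<mu> (replicate_pmf k \<mu>)" "(x, xs)"]
    have "pmf (replicate_pmf (Suc k) \<mu>) c = pmf \<mu> x * pmf (replicate_pmf k \<mu>) xs"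
      unfolding eq by (simp add: Cons pmf_pair)
    then show ?thesis by (simp add: Suc Cons prod.lessThan_Suc_shift del: replicate_pmf.simps prod.lessThan_Suc)
  qed
qed

lemma pmf_brlaw: "pmf (brlaw p \<mu>) c = pmf p (length c) * (\<Prod>i<length c. pmf \<mu> (c ! i))"
proof -
  have "pmf (brlaw p \<mu>) c = (\<integral>k. (\<Prod>i<length c. pmf \<mu> (c ! i)) * indicator {length c} k \<partial>measure_pmf p)"
    unfolding brlaw_def pmf_bind by (intro Bochner_Integration.integral_cong) (auto simp: pmf_replicate_pmf)
  then show ?thesis by (simp add: measure_pmf_single)
qed

lemma sets_cylinder:
  assumes "finite J"
  shows "{f. \<forall>u\<in>J. f u = c u} \<in> sets (fieldM \<nu>)"
proof -
  have "{f \<in> space (fieldM \<nu>). f u = c u} \<in> sets (fieldM \<nu>)" for u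
    using measurable_sets[OF measurable_apply[of u \<nu>], of "{c u}"] by (simp add: vimage_def Int_def)
  then have "{f \<in> space (fieldM \<nu>). \<forall>u\<in>J. f u = c u} \<in> sets (fieldM \<nu>)"
    using assms by (intro sets.sets_Collect_finite_All) auto
  then show ?thesis by simp
qed

text \<open>Labels are countable, so an event that restricts finitely many of them is a countable
  disjoint union of events that prescribe these labels exactly.\<close>

lemma fieldM_eqI:
  fixes \<nu> :: "'c::countable pmf"
  assumes N: "sets N = sets (fieldM \<nu>)"
    and eq: "\<And>J c. finite J \<Longrightarrow> emeasure N {f. \<forall>u\<in>J. f u = c u} = (\<Prod>u\<in>J. ennreal (pmf \<nu> (c u)))"
  shows "N = fieldM \<nu>"
proof -
  interpret product_prob_space "\<lambda>_. measure_pmf \<nu>" "UNIV :: nat list set" by unfold_locales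
  show ?thesis
    unfolding fieldM_def
  proof (rule PiM_eq)
    show "sets N = sets (PiM UNIV (\<lambda>_. measure_pmf \<nu>))" using N by (simp add: fieldM_def)
    fix J :: "nat list set" and F :: "nat list \<Rightarrow> 'c set" assume J: "finite J"
    let ?E = "prod_emb UNIV (\<lambda>_. measure_pmf \<nu>) J (\<Pi>\<^sub>E j\<in>J. F j)"
    have E: "?E = (\<Union>c\<in>PiE J F. {f. \<forall>u\<in>J. f u = c u})"
    proof (intro equalityI subsetI)
      fix f assume "f \<in> ?E"
      then have "restrict f J \<in> PiE J F" by (simp add: prod_emb_def)
      then show "f \<in> (\<Union>c\<in>PiE J F. {f. \<forall>u\<in>J. f u = c u})" by (intro UN_I[of "restrict f J"]) auto
    next
      fix f assume "f \<in> (\<Union>c\<in>PiE J F. {f. \<forall>u\<in>J. f u = c u})"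
      then obtain c where "c \<in> PiE J F" "\<forall>u\<in>J. f u = c u" by blast
      then show "f \<in> ?E" by (auto simp: prod_emb_def PiE_iff)
    qed
    have sum: "emeasure N' ?E = (\<integral>\<^sup>+c. emeasure N' {f. \<forall>u\<in>J. f u = c u} \<partial>count_space (PiE J F))"
      if "sets N' = sets (fieldM \<nu>)" for N'
      unfolding E
    proof (rule emeasure_UN_countable)
      show "countable (PiE J F)" using J by (intro countable_PiE) auto
      show "disjoint_family_on (\<lambda>c. {f. \<forall>u\<in>J. f u = c u}) (PiE J F)"
      proof (unfold disjoint_family_on_def, intro ballI impI)
        fix c c' assume c: "c \<in> PiE J F" "c' \<in> PiE J F" "c \<noteq> c'"
        then obtain u where "u \<in> J" "c u \<noteq> c' u" using PiE_ext[OF c(1,2)] by blast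
        then show "{f. \<forall>u\<in>J. f u = c u} \<inter> {f. \<forall>u\<in>J. f u = c' u} = {}" by auto
      qed
    qed (use sets_cylinder[OF J] that in auto)
    have "emeasure (fieldM \<nu>) {f. \<forall>u\<in>J. f u = c u} = (\<Prod>u\<in>J. ennreal (pmf \<nu> (c u)))" for c
      using emeasure_PiM_Collect[OF _ J, of "\<lambda>u. {c u}"]
      by (simp add: fieldM_def[symmetric] emeasure_pmf_single)
    then have "emeasure N ?E = emeasure (fieldM \<nu>) ?E"
      unfolding sum[OF N] sum[OF refl] using eq[OF J] by simp
    also have "\<dots> = (\<Prod>j\<in>J. emeasure (measure_pmf \<nu>) (F j))"
      unfolding fieldM_def by (rule emeasure_PiM_emb[OF _ J]) auto
    finally show "emeasure N ?E = (\<Prod>j\<in>J. emeasure (measure_pmf \<nu>) (F j))" .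
  qed
qed

locale brw_data = prob_space M for M :: "'x measure" +
  fixes p :: "nat pmf" and \<mu> :: "'g::finite word pmf"
    and K :: "nat list \<Rightarrow> 'x \<Rightarrow> nat" and Y :: "nat list \<Rightarrow> 'x \<Rightarrow> 'g word"
  assumes indep: "indep_vars (\<lambda>_. count_space UNIV) (\<lambda>u x. (K u x, Y u x)) UNIV"
    and law: "\<And>u. distr M (count_space UNIV) (\<lambda>x. (K u x, Y u x)) = measure_pmf (pair_pmf p \<mu>)"
begin

definition F :: "'x \<Rightarrow> 'g field" where
  "F x = fieldof (\<lambda>u. K u x) (\<lambda>u. Y u x)"

lemma measurable_pair: "(\<lambda>x. (K u x, Y u x)) \<in> M \<rightarrow>\<^sub>M count_space UNIV"
  using indep by (auto simp: indep_vars_def)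

lemma measurable_F [measurable]: "F \<in> M \<rightarrow>\<^sub>M fieldM \<nu>"
proof (rule measurable_fieldM_I)
  fix u
  have K: "K u \<in> M \<rightarrow>\<^sub>M count_space UNIV" for u
    using measurable_compose[OF measurable_pair, of fst "count_space UNIV" u] by simp
  have Y: "Y u \<in> M \<rightarrow>\<^sub>M count_space UNIV" for u
    using measurable_compose[OF measurable_pair, of snd "count_space UNIV" u] by simp
  have "(\<lambda>x. map (\<lambda>i. Y (u @ [i]) x) [0..<k]) \<in> M \<rightarrow>\<^sub>M count_space UNIV" for k
    by (rule measurable_map_list[OF Y])
  from measurable_compose_countable[OF this K[of u]]
  show "(\<lambda>x. F x u) \<in> M \<rightarrow>\<^sub>M count_space UNIV" by (simp add: F_def fieldof_def)
qed

text \<open>The label of \<open>u\<close> is made of \<open>K u\<close> and of the displacements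
  \<open>Y\<close> of its children, so the pair at a vertex is shared between its own label and that
  of its parent. Prescribing labels restricts each pair to a rectangle, and the two coordinates of a
  pair are independent.\<close>

lemma prob_cylinder:
  assumes J: "finite J" "J \<noteq> {}"
  shows "prob {x \<in> space M. \<forall>u\<in>J. F x u = c u} = (\<Prod>u\<in>J. pmf (brlaw p \<mu>) (c u))"
proof -
  \<comment> \<open>The children whose displacements are prescribed.\<close>
  define J2 where "J2 = (\<lambda>(u, i). u @ [i]) ` (SIGMA u:J. {..<length (c u)})"
  define A where "A v = (if v \<in> J then {length (c v)} else UNIV)" for v
  define B where "B v = (if v \<in> J2 then {c (butlast v) ! last v} else UNIV)" for v
  have fin: "finite (J \<union> J2)" using J by (simp add: J2_def)
  have "{x \<in> space M. \<forall>u\<in>J. F x u = c u} = (\<Inter>v\<in>J \<union> J2. (\<lambda>x. (K v x, Y v x)) -` (A v \<times> B v) \<inter> space M)"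
  proof (intro equalityI subsetI)
    fix x assume x: "x \<in> {x \<in> space M. \<forall>u\<in>J. F x u = c u}"
    have "K v x \<in> A v" for v using x by (auto simp: A_def F_def dest!: bspec[of _ _ v] arg_cong[where f = length])
    moreover have "Y v x \<in> B v" for v
    proof (cases "v \<in> J2")
      case True
      then obtain u i where v: "v = u @ [i]" "u \<in> J" "i < length (c u)" by (auto simp: J2_def)
      then have "F x u ! i = c u ! i" "i < K u x" using x by (auto simp: F_def dest!: bspec[of _ _ u] arg_cong[where f = length])
      then show ?thesis using v by (simp add: F_def nth_fieldof B_def)
    qed (simp add: B_def)
    ultimately show "x \<in> (\<Inter>v\<in>J \<union> J2. (\<lambda>x. (K v x, Y v x)) -` (A v \<times> B v) \<inter> space M)" using x by simp
  next
    fix x assume "x \<in> (\<Inter>v\<in>J \<union> J2. (\<lambda>x. (K v x, Y v x)) -` (A v \<times> B v) \<inter> space M)"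
    from INT_D[OF this] have x: "K v x \<in> A v \<and> Y v x \<in> B v \<and> x \<in> space M" if "v \<in> J \<union> J2" for v
      using that by auto
    have "F x u = c u" if u: "u \<in> J" for u
    proof (rule nth_equalityI)
      show l: "length (F x u) = length (c u)" using x[of u] u by (simp add: F_def A_def)
      fix i assume i: "i < length (F x u)"
      then have "u @ [i] \<in> J2" using u l by (auto simp: J2_def)
      then have "Y (u @ [i]) x = c u ! i" using x[of "u @ [i]"] by (simp add: B_def)
      then show "F x u ! i = c u ! i" using i by (simp add: F_def nth_fieldof)
    qed
    moreover have "x \<in> space M" using x J(2) by auto
    ultimately show "x \<in> {x \<in> space M. \<forall>u\<in>J. F x u = c u}" by simp
  qed
  also have "prob \<dots> = (\<Prod>v\<in>J \<union> J2. prob ((\<lambda>x. (K v x, Y v x)) -` (A v \<times> B v) \<inter> space M))"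
    by (rule indep_varsD[OF indep]) (use fin J in auto)
  also have "\<dots> = (\<Prod>v\<in>J \<union> J2. measure_pmf.prob p (A v) * measure_pmf.prob \<mu> (B v))"
  proof (rule prod.cong[OF refl])
    fix v
    have "prob ((\<lambda>x. (K v x, Y v x)) -` (A v \<times> B v) \<inter> space M) =
        measure (distr M (count_space UNIV) (\<lambda>x. (K v x, Y v x))) (A v \<times> B v)"
      by (rule measure_distr[OF measurable_pair, symmetric]) simp
    then show "prob ((\<lambda>x. (K v x, Y v x)) -` (A v \<times> B v) \<inter> space M) = measure_pmf.prob p (A v) * measure_pmf.prob \<mu> (B v)"
      by (simp add: law measure_pmf_prob_product)
  qed
  also have "\<dots> = (\<Prod>v\<in>J \<union> J2. if v \<in> J then pmf p (length (c v)) else 1) *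
      (\<Prod>v\<in>J \<union> J2. if v \<in> J2 then pmf \<mu> (c (butlast v) ! last v) else 1)"
    unfolding prod.distrib[symmetric] by (intro prod.cong) (auto simp: A_def B_def measure_pmf_single)
  also have "(\<Prod>v\<in>J \<union> J2. if v \<in> J then pmf p (length (c v)) else 1) = (\<Prod>u\<in>J. pmf p (length (c u)))"
    using fin by (simp add: prod.If_cases Int_absorb1 Int_commute)
  also have "(\<Prod>v\<in>J \<union> J2. if v \<in> J2 then pmf \<mu> (c (butlast v) ! last v) else 1) = (\<Prod>v\<in>J2. pmf \<mu> (c (butlast v) ! last v))"
    using fin by (simp add: prod.If_cases Int_absorb1 Int_commute)
  also have "\<dots> = (\<Prod>(u, i)\<in>(SIGMA u:J. {..<length (c u)}). pmf \<mu> (c u ! i))"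
    unfolding J2_def by (subst prod.reindex) (auto simp: inj_on_def intro!: prod.cong)
  also have "\<dots> = (\<Prod>u\<in>J. \<Prod>i<length (c u). pmf \<mu> (c u ! i))"
    using J by (subst prod.Sigma) auto
  finally show ?thesis by (simp add: pmf_brlaw prod.distrib)
qed

lemma distr_F: "distr M (fieldM (brlaw p \<mu>)) F = fieldM (brlaw p \<mu>)"
proof (rule fieldM_eqI)
  fix J :: "nat list set" and c assume J: "finite J"
  show "emeasure (distr M (fieldM (brlaw p \<mu>)) F) {f. \<forall>u\<in>J. f u = c u} = (\<Prod>u\<in>J. ennreal (pmf (brlaw p \<mu>) (c u)))"
  proof (cases "J = {}")
    case True
    interpret D: prob_space "distr M (fieldM (brlaw p \<mu>)) F" by (rule prob_space_distr[OF measurable_F])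
    show ?thesis using True D.emeasure_space_1 by simp
  next
    case False
    have "emeasure (distr M (fieldM (brlaw p \<mu>)) F) {f. \<forall>u\<in>J. f u = c u} = emeasure M (F -` {f. \<forall>u\<in>J. f u = c u} \<inter> space M)"
      by (rule emeasure_distr[OF measurable_F sets_cylinder[OF J]])
    also have "F -` {f. \<forall>u\<in>J. f u = c u} \<inter> space M = {x \<in> space M. \<forall>u\<in>J. F x u = c u}" by auto
    also have "emeasure M \<dots> = (\<Prod>u\<in>J. ennreal (pmf (brlaw p \<mu>) (c u)))"
      unfolding emeasure_eq_measure prob_cylinder[OF J False] by (rule prod_ennreal[symmetric]) simp
    finally show ?thesis .
  qed
qed simp

lemma AE_F: "AE f in fieldM (brlaw p \<mu>). Q f \<Longrightarrow> AE x in M. Q (F x)"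
  using AE_distrD[OF measurable_F[of "brlaw p \<mu>"], where P = Q] unfolding distr_F .

end

subsection \<open>The dimension spectrum\<close>

lemma limit_set_speed_subset: "limit_set_speed k y \<alpha> \<subseteq> limit_set k y"
  by (auto simp: limit_set_speed_def limit_set_def)

lemma AE_impI_const: "(P \<Longrightarrow> AE x in N. Q x) \<Longrightarrow> AE x in N. P \<longrightarrow> Q x"
  by (cases P) auto

context brw
begin

text \<open>All conditions range over rationals, types and vertices, hence over a countable set;
  everything that follows is deterministic for a fixed typical field and arbitrary real
  \<alpha>.\<close>

definition typical :: "'g field \<Rightarrow> bool" where
  "typical f \<longleftrightarrow> step_field f \<and>
    (\<forall>a b \<eta> :: rat. \<eta> > 0 \<longrightarrow> (\<forall>q. of_rat a \<le> q \<longrightarrow> q \<le> of_rat b \<longrightarrow> ereal (ln r + of_rat \<eta>) \<le> L q) \<longrightarrow>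
       (\<forall>\<^sub>F n in sequentially. \<forall>m\<le>n. of_rat a \<le> real (Suc m) / real (Suc n) \<longrightarrow>
          real (Suc m) / real (Suc n) \<le> of_rat b \<longrightarrow> rwords m \<inter> visited n f = {})) \<and>
    (\<forall>a b s1 s :: rat. 0 < a \<longrightarrow> s1 < s \<longrightarrow>
       (\<forall>q. of_rat a \<le> q \<longrightarrow> q \<le> of_rat b \<longrightarrow> ereal (ln r - of_rat s1 * q) \<le> L q) \<longrightarrow>
       (\<Sum>m. ennreal (exp (- of_rat s * real m)) *
          of_nat (card (rwords m \<inter> (\<Union>n\<in>window (of_rat a) (of_rat b) m. visited n f)))) < \<top>) \<and>
    (\<forall>s1 s :: rat. s1 < s \<longrightarrow> (\<forall>q. 0 < q \<longrightarrow> q \<le> 1 \<longrightarrow> ereal (ln r - of_rat s1 * q) \<le> L q) \<longrightarrow>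
       (\<Sum>m. ennreal (exp (- of_rat s * real m)) * of_nat (card (rwords m \<inter> (\<Union>n. visited n f)))) < \<top>) \<and>
    (\<forall>u t t'. tgood t \<longrightarrow> tgood t' \<longrightarrow> (\<forall>\<^sub>F D in sequentially. tleaves t D (sh u f) \<noteq> [] \<longrightarrow>
       tprob t' * real (tdeg t ^ D) / 2 \<le> real (card {v \<in> set (tleaves t D (sh u f)). sh (u @ v) f \<in> talive t'}))) \<and>
    (\<forall>t. tgood t \<longrightarrow> (\<exists>u. intree u f \<and> sh u f \<in> talive t))"

lemma AE_typical: "AE f in \<P>. typical f"
  unfolding typical_def
proof (intro AE_conjI)
  show "AE f in \<P>. step_field f" using AE_good_field by eventually_elim simp
  show "AE f in \<P>. \<forall>a b \<eta> :: rat. \<eta> > 0 \<longrightarrow> (\<forall>q. of_rat a \<le> q \<longrightarrow> q \<le> of_rat b \<longrightarrow> ereal (ln r + of_rat \<eta>) \<le> L q) \<longrightarrow>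
       (\<forall>\<^sub>F n in sequentially. \<forall>m\<le>n. of_rat a \<le> real (Suc m) / real (Suc n) \<longrightarrow>
          real (Suc m) / real (Suc n) \<le> of_rat b \<longrightarrow> rwords m \<inter> visited n f = {})"
    unfolding AE_all_countable
    by (intro allI AE_impI_const AE_no_visits) auto
  show "AE f in \<P>. \<forall>a b s1 s :: rat. 0 < a \<longrightarrow> s1 < s \<longrightarrow>
       (\<forall>q. of_rat a \<le> q \<longrightarrow> q \<le> of_rat b \<longrightarrow> ereal (ln r - of_rat s1 * q) \<le> L q) \<longrightarrow>
       (\<Sum>m. ennreal (exp (- of_rat s * real m)) *
          of_nat (card (rwords m \<inter> (\<Union>n\<in>window (of_rat a) (of_rat b) m. visited n f)))) < \<top>"
    unfolding AE_all_countable
  proof (intro allI AE_impI_const)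
    fix a b s1 s :: rat
    assume "0 < a" "s1 < s" "\<forall>q. of_rat a \<le> q \<longrightarrow> q \<le> of_rat b \<longrightarrow> ereal (ln r - of_rat s1 * q) \<le> L q"
    then show "AE f in \<P>. (\<Sum>m. ennreal (exp (- of_rat s * real m)) *
          of_nat (card (rwords m \<inter> (\<Union>n\<in>window (of_rat a) (of_rat b) m. visited n f)))) < \<top>"
      by (intro AE_window_sum_finite[where ?s1.0 = "of_rat s1"]) (auto simp: of_rat_less)
  qed
  show "AE f in \<P>. \<forall>s1 s :: rat. s1 < s \<longrightarrow> (\<forall>q. 0 < q \<longrightarrow> q \<le> 1 \<longrightarrow> ereal (ln r - of_rat s1 * q) \<le> L q) \<longrightarrow>
       (\<Sum>m. ennreal (exp (- of_rat s * real m)) * of_nat (card (rwords m \<inter> (\<Union>n. visited n f)))) < \<top>"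
    unfolding AE_all_countable
  proof (intro allI AE_impI_const)
    fix s1 s :: rat
    assume "s1 < s" "\<forall>q. 0 < q \<longrightarrow> q \<le> 1 \<longrightarrow> ereal (ln r - of_rat s1 * q) \<le> L q"
    then show "AE f in \<P>. (\<Sum>m. ennreal (exp (- of_rat s * real m)) * of_nat (card (rwords m \<inter> (\<Union>n. visited n f)))) < \<top>"
      by (intro AE_total_sum_finite[where ?s1.0 = "of_rat s1"]) (auto simp: of_rat_less)
  qed
qed (rule AE_many_alive AE_ex_talive)+

lemma rat_between:
  assumes "0 \<le> x" "x < (y :: ereal)"
  obtains s1 s :: rat where "x < ereal (of_rat s1)" "s1 < s" "ereal (of_rat s) < y" "0 < (of_rat s :: real)"
proof -
  obtain u where u: "x < ereal u" "ereal u < y" using ereal_dense2[OF assms(2)] by auto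
  obtain v where v: "x < ereal v" "ereal v < ereal u" using ereal_dense2[OF u(1)] by auto
  obtain s1 where s1: "v < of_rat s1" "of_rat s1 < u" using of_rat_dense[of v u] v by auto
  obtain s where s: "of_rat s1 < (of_rat s :: real)" "of_rat s < u" using of_rat_dense[OF s1(2)] by auto
  have x1: "x < ereal (of_rat s1)" using v(1) s1(1) by (meson ereal_less_eq(3) less_imp_le less_le_trans)
  then have "0 < (of_rat s1 :: real)" using assms(1) by (metis le_less_trans ereal_less(2))
  moreover have "ereal (of_rat s) < y" using u(2) s(2) by (meson ereal_less_eq(3) less_imp_le le_less_trans)
  ultimately show ?thesis using x1 s(1) by (intro that[of s1 s]) (auto simp: of_rat_less)
qed

context
  fixes k :: "nat list \<Rightarrow> nat" and y :: "nat list \<Rightarrow> 'g word"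
  assumes tp: "typical (fieldof k y)"
begin

lemma speed_set_empty:
  assumes "\<alpha> \<in> {0..1}" "\<alpha> \<notin> rate_sublevel L r"
  shows "limit_set_speed k y \<alpha> = {}"
proof -
  have "ereal (ln r) < L \<alpha>" using assms by (auto simp: rate_sublevel_def)
  then obtain a b \<eta> :: rat where ab: "of_rat a < \<alpha>" "\<alpha> < of_rat b" "\<eta> > 0"
    "\<And>q. of_rat a \<le> q \<Longrightarrow> q \<le> of_rat b \<Longrightarrow> ereal (ln r + of_rat \<eta>) \<le> L q"
    by (rule local_bound_supercritical) (rule that)
  show ?thesis
    by (rule limit_set_speed_empty[OF _ ab(1,2)]) (use tp ab in \<open>auto simp: typical_def\<close>)
qed

lemma step_typical: "step_field (fieldof k y)"
  using tp unfolding typical_def by blast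

lemma many_alive:
  assumes "tgood t" "tgood t'"
  shows "\<forall>\<^sub>F D in sequentially. tleaves t D (sh u (fieldof k y)) \<noteq> [] \<longrightarrow> tprob t' * real (tdeg t ^ D) / 2 \<le>
    real (card {v \<in> set (tleaves t D (sh u (fieldof k y))). sh (u @ v) (fieldof k y) \<in> talive t'})"
  using tp assms unfolding typical_def by blast

lemma ex_talive: "tgood t \<Longrightarrow> \<exists>u. intree u (fieldof k y) \<and> sh u (fieldof k y) \<in> talive t"
  using tp unfolding typical_def by blast

text \<open>The spectrum may vanish at \<alpha>, so no positive exponent need lie below it; a
  negative one does, and the Cantor construction then still yields a point.\<close>

lemma speed_set_nonempty:
  assumes "\<alpha> \<in> rate_sublevel L r"
  shows "limit_set_speed k y \<alpha> \<noteq> {}"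
proof (rule ex_cantor_set(1)[OF step_typical many_alive ex_talive refl assms])
  have "ereal (-1) < 0" by simp
  then show "ereal (-1) < spectrum_value L r \<alpha>" using spectrum_value_nonneg[OF assms] by (rule less_le_trans)
qed

lemma spectrum_value_le_dim:
  assumes \<alpha>: "\<alpha> \<in> rate_sublevel L r"
  shows "spectrum_value L r \<alpha> \<le> hausdorff_dim boundary_metric (limit_set_speed k y \<alpha>)"
proof (rule le_hausdorff_dim[OF speed_set_nonempty[OF \<alpha>]])
  fix s' :: real assume s': "0 < s'" "ereal s' < spectrum_value L r \<alpha>"
  then obtain s where s: "ereal s' < ereal s" "ereal s < spectrum_value L r \<alpha>" using ereal_dense2 by blast
  show "hausdorff_measure boundary_metric s' (limit_set_speed k y \<alpha>) \<noteq> 0"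
    by (rule ex_cantor_set(2)[OF step_typical many_alive ex_talive refl \<alpha> s(2) s'(1)]) (use s(1) in auto)
qed

lemma dim_limit_set_le:
  assumes bound: "\<And>q. 0 < q \<Longrightarrow> q \<le> 1 \<Longrightarrow> (ereal (ln r) - L q) / ereal q \<le> v" and v: "0 \<le> v"
  shows "hausdorff_dim boundary_metric (limit_set k y) \<le> v"
proof (rule ccontr)
  assume "\<not> ?thesis"
  then have "v < hausdorff_dim boundary_metric (limit_set k y)" by simp
  then obtain s1 s :: rat where s: "v < ereal (of_rat s1)" "s1 < s"
    "ereal (of_rat s) < hausdorff_dim boundary_metric (limit_set k y)" "0 < (of_rat s :: real)"
    using rat_between[OF v] by metis
  have "ereal (ln r - of_rat s1 * q) \<le> L q" if q: "0 < q" "q \<le> 1" for q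
  proof -
    have "(ereal (ln r) - L q) / ereal q < ereal (of_rat s1)" using bound[OF q] s(1) by (rule le_less_trans)
    then show ?thesis using q(1) L_nonneg[of q] by (cases "L q") (auto simp: field_simps)
  qed
  then have "(\<Sum>m. ennreal (exp (- of_rat s * real m)) * of_nat (card (rwords m \<inter> (\<Union>n. visited n (fieldof k y))))) < \<top>"
    using tp s(2) unfolding typical_def by blast
  from limit_set_measure_0[OF step_typical s(4) this]
  have "hausdorff_dim boundary_metric (limit_set k y) \<le> ereal (of_rat s)"
    using s(4) by (intro hausdorff_dim_le) auto
  then show False using s(3) by simp
qed

text \<open>At \<alpha> = 0 there is no window with positive lower end. But then
  \<open>r = R\<close>, every quotient is a chord slope below the value at 0, and the bound for the
  whole limit set suffices.\<close>

lemma dim_speed_set_le: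
  assumes \<alpha>: "\<alpha> \<in> rate_sublevel L r"
  shows "hausdorff_dim boundary_metric (limit_set_speed k y \<alpha>) \<le> spectrum_value L r \<alpha>"
proof (cases "\<alpha> = 0")
  case True
  have "r = R" using \<alpha> True by (intro zero_rate_sublevel r1 rR) simp
  have "hausdorff_dim boundary_metric (limit_set_speed k y \<alpha>) \<le> hausdorff_dim boundary_metric (limit_set k y)"
    by (rule hausdorff_dim_mono[OF limit_set_speed_subset])
  also have "\<dots> \<le> spectrum_value L r \<alpha>"
  proof (rule dim_limit_set_le)
    show "(ereal (ln r) - L q) / ereal q \<le> spectrum_value L r \<alpha>" if "0 < q" "q \<le> 1" for q
      using that unfolding True spectrum_value_0
      by (intro SUP_upper2[of q]) (auto simp: slope_def L_0 \<open>r = R\<close>)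
    show "0 \<le> spectrum_value L r \<alpha>" by (rule spectrum_value_nonneg[OF \<alpha>])
  qed
  finally show ?thesis .
next
  case False
  then have pos: "\<alpha> > 0" using \<alpha> by (auto simp: rate_sublevel_def)
  show ?thesis
  proof (rule ccontr)
    assume "\<not> ?thesis"
    then have "spectrum_value L r \<alpha> < hausdorff_dim boundary_metric (limit_set_speed k y \<alpha>)" by simp
    then obtain s1 s :: rat where s: "spectrum_value L r \<alpha> < ereal (of_rat s1)" "s1 < s"
      "ereal (of_rat s) < hausdorff_dim boundary_metric (limit_set_speed k y \<alpha>)" "0 < (of_rat s :: real)"
      using rat_between[OF spectrum_value_nonneg[OF \<alpha>]] by metis
    obtain a b :: rat where ab: "0 < a" "of_rat a < \<alpha>" "\<alpha> < of_rat b"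
      "\<And>q. of_rat a \<le> q \<Longrightarrow> q \<le> of_rat b \<Longrightarrow> ereal (ln r - of_rat s1 * q) \<le> L q"
      by (rule local_bound[OF \<alpha> pos s(1)]) (rule that)
    have "(\<Sum>m. ennreal (exp (- of_rat s * real m)) *
        of_nat (card (rwords m \<inter> (\<Union>n\<in>window (of_rat a) (of_rat b) m. visited n (fieldof k y))))) < \<top>"
      using tp s(2) ab(1,4) unfolding typical_def by blast
    from limit_set_speed_measure_0[OF step_typical s(4) ab(2,3) this]
    have "hausdorff_dim boundary_metric (limit_set_speed k y \<alpha>) \<le> ereal (of_rat s)"
      using s(4) by (intro hausdorff_dim_le) auto
    then show False using s(3) by simp
  qed
qed

lemma dim_speed_set:
  "\<alpha> \<in> rate_sublevel L r \<Longrightarrow>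
     hausdorff_dim boundary_metric (limit_set_speed k y \<alpha>) = spectrum_value L r \<alpha>"
  by (intro antisym dim_speed_set_le spectrum_value_le_dim)

lemma dim_limit_set_maximum:
  "is_maximum (hausdorff_dim boundary_metric (limit_set k y)) (spectrum_value L r) (rate_sublevel L r)"
proof -
  obtain \<alpha> where \<alpha>: "\<alpha> \<in> rate_sublevel L r"
    "\<And>q. 0 < q \<Longrightarrow> q \<le> 1 \<Longrightarrow> (ereal (ln r) - L q) / ereal q \<le> spectrum_value L r \<alpha>"
    "\<And>\<beta>. \<beta> \<in> rate_sublevel L r \<Longrightarrow> spectrum_value L r \<beta> \<le> spectrum_value L r \<alpha>"
    by (rule spectrum_value_max[OF r1 rR]) (rule that)
  have "hausdorff_dim boundary_metric (limit_set k y) = spectrum_value L r \<alpha>"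
  proof (rule antisym)
    show "hausdorff_dim boundary_metric (limit_set k y) \<le> spectrum_value L r \<alpha>"
      by (rule dim_limit_set_le[OF \<alpha>(2) spectrum_value_nonneg[OF \<alpha>(1)]])
    show "spectrum_value L r \<alpha> \<le> hausdorff_dim boundary_metric (limit_set k y)"
      unfolding dim_speed_set[OF \<alpha>(1), symmetric] by (rule hausdorff_dim_mono[OF limit_set_speed_subset])
  qed
  then show ?thesis using \<alpha> by (auto simp: is_maximum_def)
qed

lemma dim_limit_set_maximum_dim:
  "is_maximum (hausdorff_dim boundary_metric (limit_set k y))
     (\<lambda>\<alpha>. hausdorff_dim boundary_metric (limit_set_speed k y \<alpha>)) (rate_sublevel L r)"
  using dim_limit_set_maximum dim_speed_set by (auto simp: is_maximum_def image_iff)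

end

end

theorem theorem1p1:
  fixes \<mu> :: "'g::finite word pmf"
    and P :: "'w measure" and Z :: "nat \<Rightarrow> 'w \<Rightarrow> 'g word"
    and R :: real and L :: "real \<Rightarrow> ereal"
    and M :: "'x measure" and p :: "nat pmf" and r :: real
    and K :: "nat list \<Rightarrow> 'x \<Rightarrow> nat" and Y :: "nat list \<Rightarrow> 'x \<Rightarrow> 'g word"
  assumes "CARD('g) \<ge> 2"
    and "step_law \<mu>"
    and "random_walk P \<mu> Z"
    and "spectral_radius P Z = ereal (1 / R)"
    and "ldp_rate_function P Z L"
    and "pmf p 0 = 0"
    and "\<exists>s>0. summable (\<lambda>k. exp (s * real k) * pmf p k)"
    and "r = measure_pmf.expectation p real"
    and "1 < r" and "r \<le> R"
    and "branching_random_walk M p \<mu> K Y"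
  shows "(AE x in M. \<forall>\<alpha>\<in>{0..1}.
            (limit_set_speed (\<lambda>u. K u x) (\<lambda>u. Y u x) \<alpha> \<noteq> {} \<longleftrightarrow> \<alpha> \<in> rate_sublevel L r) \<and>
            (\<alpha> \<in> rate_sublevel L r \<longrightarrow>
               hausdorff_dim boundary_metric (limit_set_speed (\<lambda>u. K u x) (\<lambda>u. Y u x) \<alpha>)
                 = spectrum_value L r \<alpha>)) \<and>
         (AE x in M.
            is_maximum (hausdorff_dim boundary_metric (limit_set (\<lambda>u. K u x) (\<lambda>u. Y u x)))
              (spectrum_value L r) (rate_sublevel L r) \<and>
            is_maximum (hausdorff_dim boundary_metric (limit_set (\<lambda>u. K u x) (\<lambda>u. Y u x)))
              (\<lambda>\<alpha>. hausdorff_dim boundary_metric (limit_set_speed (\<lambda>u. K u x) (\<lambda>u. Y u x) \<alpha>))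
              (rate_sublevel L r))"
proof -
  have "1 < R" using assms(9,10) by linarith
  then interpret brw \<mu> P Z R L p r using assms by unfold_locales
  interpret X: brw_data M p \<mu> K Y
    using assms(11) unfolding branching_random_walk_def brw_data_def brw_data_axioms_def by blast
  have tp: "AE x in M. typical (fieldof (\<lambda>u. K u x) (\<lambda>u. Y u x))"
    using X.AE_F[OF AE_typical] by (simp add: X.F_def)
  show ?thesis
  proof (intro conjI)
    show "AE x in M. \<forall>\<alpha>\<in>{0..1}.
            (limit_set_speed (\<lambda>u. K u x) (\<lambda>u. Y u x) \<alpha> \<noteq> {} \<longleftrightarrow> \<alpha> \<in> rate_sublevel L r) \<and>
            (\<alpha> \<in> rate_sublevel L r \<longrightarrow>
               hausdorff_dim boundary_metric (limit_set_speed (\<lambda>u. K u x) (\<lambda>u. Y u x) \<alpha>)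
                 = spectrum_value L r \<alpha>)"
      using tp
    proof eventually_elim
      case (elim x)
      show ?case using speed_set_empty[OF elim] speed_set_nonempty[OF elim] dim_speed_set[OF elim] by blast
    qed
    show "AE x in M.
            is_maximum (hausdorff_dim boundary_metric (limit_set (\<lambda>u. K u x) (\<lambda>u. Y u x)))
              (spectrum_value L r) (rate_sublevel L r) \<and>
            is_maximum (hausdorff_dim boundary_metric (limit_set (\<lambda>u. K u x) (\<lambda>u. Y u x)))
              (\<lambda>\<alpha>. hausdorff_dim boundary_metric (limit_set_speed (\<lambda>u. K u x) (\<lambda>u. Y u x) \<alpha>))
              (rate_sublevel L r)"
      using tp by eventually_elim (use dim_limit_set_maximum dim_limit_set_maximum_dim in blast)
  qed
qed

end
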